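(* Let $N\ge1$ be an integer and let $\theta=\arg\nu$. (i) Suppose $-\frac{\pi}{2}<\theta<\frac{3\pi}{2}$, and put $s(\theta)=1$ if $0\le\theta\le\pi$ and $s(\theta)=|\sec\theta|$ otherwise. Then $$\left|R_N^{(H')}(\nu)\right|\le\frac{d_N(\nu)}{\sqrt3\pi}s(\theta)\ \text{ if }N\equiv0\bmod3;\qquad\left|R_N^{(H')}(\nu)\right|\le\frac{d_N(\nu)+d_{N+1}(\nu)}{\sqrt3\pi}s(\theta)\ \text{ if }N\equiv1\bmod3;$$ $$\left|R_N^{(H')}(\nu)\right|\le\frac{d_{N+1}(\nu)}{\sqrt3\pi}s(\theta)\ \text{ if }N\equiv2\bmod3.$$ (ii) Suppose $-\pi<\theta<0$ or $\pi<\theta<2\pi$. Let $\varphi^\ast$ and $\varphi^{\ast\ast}$ be the unique solutions in the interval $I_\theta$ of $$\sin(\theta-2\varphi^\ast)=\frac{2N-1}{2N+5}\sin\theta,\qquad\sin(\theta-2\varphi^{\ast\ast})=\frac{2N+1}{2N+7}\sin\theta .$$ Then $$\left|R_N^{(H')}(\nu)\right|\le\frac{|\sec(\theta-\varphi^\ast)|}{\cos^{\frac{2N+2}{3}}\varphi^\ast}\frac{d_N(\nu)}{\sqrt3\pi}\quad\text{if }N\equiv0\bmod3;$$ $$\left|R_N^{(H')}(\nu)\right|\le\frac{|\sec(\theta-\varphi^\ast)|}{\cos^{\frac{2N+2}{3}}\varphi^\ast}\frac{d_N(\nu)}{\sqrt3\pi}+\frac{|\sec(\theta-\varphi^{\ast\ast})|}{\cos^{\frac{2N+4}{3}}\varphi^{\ast\ast}}\frac{d_{N+1}(\nu)}{\sqrt3\pi}\quad\text{if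 }N\equiv1\bmod3;$$ $$\left|R_N^{(H')}(\nu)\right|\le\frac{|\sec(\theta-\varphi^{\ast\ast})|}{\cos^{\frac{2N+4}{3}}\varphi^{\ast\ast}}\frac{d_{N+1}(\nu)}{\sqrt3\pi}\quad\text{if }N\equiv2\bmod3.$$ (iii) Suppose $\pi<\theta\le\frac{3\pi}{2}$ or $-\frac{\pi}{2}\le\theta<0$. Then $$\left|R_N^{(H')}(\nu)\right|\le\sqrt{\tfrac e3\left(2N+\tfrac72\right)}\frac{d_N(\nu)}{\sqrt3\pi}\quad\text{if }N\equiv0\bmod3;$$ $$\left|R_N^{(H')}(\nu)\right|\le\sqrt{\tfrac e3\left(2N+\tfrac72\right)}\frac{d_N(\nu)}{\sqrt3\pi}+\sqrt{\tfrac e3\left(2N+\tfrac{11}2\right)}\frac{d_{N+1}(\nu)}{\sqrt3\pi}\quad\text{if }N\equiv1\bmod3;$$ $$\left|R_N^{(H')}(\nu)\right|\le\sqrt{\tfrac e3\left(2N+\tfrac{11}2\right)}\frac{d_{N+1}(\nu)}{\sqrt3\pi}\quad\text{if }N\equiv2\bmod3.$$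
   Context: $\nu\ne0$ is regarded as a point of the Riemann surface of the logarithm, $\nu^{1/3}=|\nu|^{1/3}e^{i\theta/3}$. $H_\nu^{(1)\prime}(\nu)$ denotes the derivative of the Hankel function $H^{(1)}_\nu(z)$ with respect to $z$ evaluated at $z=\nu$, continued analytically in $\nu$ from $\nu>0$. The remainder $R_N^{(H')}(\nu)$ is defined by $$H_\nu^{(1)\prime}(\nu)=-\frac{2}{3\pi}\sum_{n=0}^{N-1}6^{\frac{2n+2}{3}}D_{2n+1}(0)e^{\frac{2(2n+2)\pi i}{3}}\sin\left(\frac{(2n+2)\pi}{3}\right)\frac{\Gamma\left(\frac{2n+2}{3}\right)}{\nu^{\frac{2n+2}{3}}}+R_N^{(H')}(\nu),$$ where $D_n(0)=\frac{1}{n!}\left[\frac{d^n}{dt^n}\left(\sinh t\left(\frac16\frac{t^3}{\sinh t-t}\right)^{\frac{n+1}{3}}\right)\right]_{t=0}$ (branch of the power equal to $1$ at $t=0$). Notation: $$d_n(\nu)=6^{\frac{2n+2}{3}}|D_{2n+1}(0)|\frac{\Gamma\left(\frac{2n+2}{3}\right)}{|\nu|^{\frac{2n+2}{3}}}.$$ The interval $I_\theta$ is: $\left(-\frac{3\pi}{2}+\theta,\frac{\pi}{2}\right)$ if $\frac{3\pi}{2}\le\theta<2\pi$; $(0,-\pi+\theta)$ if $\pi<\theta<\frac{3\pi}{2}$; $\left(-\frac{\pi}{2},\frac{\pi}{2}+\theta\right)$ if $-\pi<\theta\le-\frac{\pi}{2}$; $(\theta,0)$ if $-\frac{\pi}{2}<\theta<0$.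 *)

theory Defs
  imports "HOL-Complex_Analysis.Complex_Analysis"
begin

text \<open>Bessel and Hankel functions of complex order, principal branch in \<open>z\<close>. Using the entire
  function \<open>rGamma\<close> (reciprocal Gamma) covers the orders at which Gamma has poles. At integer
  orders the second solution is the limit in the order.\<close>

definition besselJ :: "complex \<Rightarrow> complex \<Rightarrow> complex" where
  "besselJ \<nu> z = (z / 2) powr \<nu> *
     (\<Sum>k. (- 1) ^ k * (z / 2) ^ (2 * k) * rGamma (\<nu> + of_nat k + 1) / fact k)"

definition besselY :: "complex \<Rightarrow> complex \<Rightarrow> complex" where
  "besselY \<nu> z =
     (let q = (\<lambda>\<mu>. (besselJ \<mu> z * cos (\<mu> * of_real pi) - besselJ (- \<mu>) z) / sin (\<mu> * of_real pi))
      in if \<nu> \<in> \<int> then Lim (at \<nu>) q else q \<nu>)"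

definition hankel1 :: "complex \<Rightarrow> complex \<Rightarrow> complex" where
  "hankel1 \<nu> z = besselJ \<nu> z + \<i> * besselY \<nu> z"

text \<open>A point \<open>\<nu>\<close> of the Riemann surface of the logarithm is given by its modulus \<open>r > 0\<close> and its
  argument \<open>\<theta> \<in> \<real>\<close>; the global holomorphic coordinate is \<open>log \<nu> = ln r + \<i> \<theta>\<close>, ranging over the
  whole complex plane. In particular \<open>rs_power r \<theta> p\<close> is \<open>\<nu>\<close> to the power \<open>p\<close>.\<close>

definition rs_power :: "real \<Rightarrow> real \<Rightarrow> real \<Rightarrow> complex" where
  "rs_power r \<theta> p = of_real (r powr p) * exp (\<i> * of_real (p * \<theta>))"

text \<open>The analytic continuation to the Riemann surface, in the coordinate \<open>log \<nu>\<close>, of the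
  \<open>z\<close>-derivative of \<open>hankel1 \<nu> z\<close> at \<open>z = \<nu>\<close>, \<open>\<nu> > 0\<close>. There is at most one such entire function by
  the identity theorem.\<close>

definition hankel1_deriv_diag_log :: "complex \<Rightarrow> complex" where
  "hankel1_deriv_diag_log =
     (THE F. F holomorphic_on UNIV \<and>
        (\<forall>x::real. 0 < x \<longrightarrow>
           F (of_real (ln x)) = deriv (hankel1 (of_real x)) (of_real x)))"

definition hankel1_deriv_diag :: "real \<Rightarrow> real \<Rightarrow> complex" where
  "hankel1_deriv_diag r \<theta> = hankel1_deriv_diag_log (Complex (ln r) \<theta>)"

text \<open>The removable singularity at \<open>t = 0\<close> is filled in; near \<open>0\<close> the base of the power is close
  to \<open>1\<close>, so the principal \<open>powr\<close> is the branch that equals \<open>1\<close> at \<open>t = 0\<close>.\<close>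

definition coeffD :: "nat \<Rightarrow> complex" where
  "coeffD n =
     (deriv ^^ n)
       (\<lambda>t. sinh t *
          (if t = 0 then 1 else 1 / 6 * (t ^ 3 / (sinh t - t))) powr ((of_nat n + 1) / 3)) 0
     / fact n"

definition hankel_remainder :: "nat \<Rightarrow> real \<Rightarrow> real \<Rightarrow> complex" where
  "hankel_remainder N r \<theta> =
     hankel1_deriv_diag r \<theta> -
     (- (2 / (3 * of_real pi)) *
        (\<Sum>n<N. of_real (6 powr ((2 * real n + 2) / 3)) * coeffD (2 * n + 1)
           * exp (2 * (2 * of_nat n + 2) * of_real pi * \<i> / 3)
           * of_real (sin ((2 * real n + 2) * pi / 3))
           * (of_real (Gamma ((2 * real n + 2) / 3))
              / rs_power r \<theta> ((2 * real n + 2) / 3))))"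

definition dterm :: "nat \<Rightarrow> real \<Rightarrow> real" where
  "dterm n r =
     6 powr ((2 * real n + 2) / 3) * cmod (coeffD (2 * n + 1))
     * (Gamma ((2 * real n + 2) / 3) / r powr ((2 * real n + 2) / 3))"

definition sfactor :: "real \<Rightarrow> real" where
  "sfactor \<theta> = (if 0 \<le> \<theta> \<and> \<theta> \<le> pi then 1 else \<bar>1 / cos \<theta>\<bar>)"

definition phi_interval :: "real \<Rightarrow> real set" where
  "phi_interval \<theta> =
     (if 3 * pi / 2 \<le> \<theta> \<and> \<theta> < 2 * pi then {- (3 * pi / 2) + \<theta> <..< pi / 2}
      else if pi < \<theta> \<and> \<theta> < 3 * pi / 2 then {0 <..< - pi + \<theta>}
      else if - pi < \<theta> \<and> \<theta> \<le> - (pi / 2) then {- (pi / 2) <..< pi / 2 + \<theta>}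
      else if - (pi / 2) < \<theta> \<and> \<theta> < 0 then {\<theta> <..< 0}
      else {})"

definition is_phi :: "real \<Rightarrow> real \<Rightarrow> real \<Rightarrow> bool" where
  "is_phi c \<theta> \<phi> \<longleftrightarrow> \<phi> \<in> phi_interval \<theta> \<and> sin (\<theta> - 2 * \<phi>) = c * sin \<theta>"

definition phi_factor :: "real \<Rightarrow> real \<Rightarrow> real \<Rightarrow> real" where
  "phi_factor p \<theta> \<phi> = \<bar>1 / cos (\<theta> - \<phi>)\<bar> / cos \<phi> powr p"

end

theory Submission
  imports Defs "HOL-Real_Asymp.Real_Asymp"
begin

text \<open>
  Put \<open>w\<^sup>3 = 6 (sinh t - t)\<close>, with \<open>w\<close> asymptotic to \<open>t\<close> at \<open>0\<close>. On the imaginary ray \<open>\<nu> = \<i> \<tau>\<close> the integral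
  of \<open>sinh t exp (\<i> \<tau> (sinh t - t))\<close> that represents \<open>H\<^sub>\<nu>' (\<nu>)\<close> can be moved to the steepest descent curve
  through \<open>0\<close>, where \<open>w = exp (\<plusminus> \<i> \<pi> / 6) z\<close> with \<open>z > 0\<close>. The numbers \<open>D\<^sub>2\<^sub>n\<^sub>+\<^sub>1\<close> are the Taylor coefficients of
  \<open>sinh t dt/dw\<close>. Deforming Cauchy's formula for them to the curve through \<open>2 \<pi> \<i>\<close>, on which \<open>w = \<i> v\<close> with
  \<open>v > 0\<close>, shows that, up to sign, they are moments of a positive measure. Hence
  \<open>sinh t dt/dw\<close> is a Stieltjes function of \<open>w\<^sup>2\<close>, and the remainder becomes a combination of integrals of
  \<open>exp (- \<lambda> z\<^sup>3 / 6) z\<^sup>m\<^sup>-\<^sup>1 / (1 + \<zeta> + \<zeta>\<^sup>2)\<close> with \<open>\<zeta> = z\<^sup>2 / v\<^sup>2\<close> and \<open>\<lambda> = - \<i> \<nu>\<close>. Rotating the path of integration in \<open>\<lambda> z\<^sup>3\<close> by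
  an angle \<open>\<phi>\<close> continues this to the Riemann surface, and a lower bound of \<open>|1 + \<zeta> + \<zeta>\<^sup>2|\<close> on a ray gives all the estimates.
\<close>

section \<open>Holomorphic parameter integrals and Bessel series\<close>

text \<open>On the imaginary ray the order is not an integer, so the quotient defining Y can be used
  as it stands, and the Bessel series is evaluated at the positive number -nu^2 / 4; this reduces
  the contour integral to Macdonald integrals, which Wronskians identify with Bessel series. The
  continuation, however, is defined from nu > 0, where integer orders occur, so an entire function
  of log nu is first built across these removable singularities. The terms with d_N and d_(N+1)
  carry sin (pi (N + 1) / 3) and sin (pi N / 3), each 0 or +-sqrt 3 / 2: hence the three cases
  modulo 3. The zeros of 1 + zeta + zeta^2 at arg zeta = +-2 pi / 3 lie at distance pi in arg
  (lambda z^3); with |phi| < pi / 2 this allows -pi < theta < 2 pi. Rotation costs |sec (theta -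
  phi)| / cos^p phi with p = (2 N + 2) / 3 or (2 N + 4) / 3, and its stationary points satisfy sin
  (theta - 2 phi) = (p - 1) / (p + 1) * sin theta: these are the fractions in (ii). Part (i) is phi
  = 0; part (iii) takes phi = 0 or, up to sign, the angle that is optimal at the end of its
  range.\<close>

lemma absolutely_integrable_on_dominated:
  fixes f :: "real \<Rightarrow> 'a::euclidean_space"
  assumes "S \<in> sets lebesgue" "continuous_on S f" "g integrable_on S" "\<And>x. x \<in> S \<Longrightarrow> norm (f x) \<le> g x"
  shows "f absolutely_integrable_on S"
proof -
  have "f \<in> borel_measurable (lebesgue_on S)"
    using assms(1,2) by (rule continuous_imp_measurable_on_sets_lebesgue[rotated])
  then have "f integrable_on S"
    using measurable_bounded_by_integrable_imp_integrable assms by blast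
  then show ?thesis
    using absolutely_integrable_integrable_bound assms(3,4) by blast
qed

text \<open>Cauchy's estimate on small discs turns the bound \<open>g\<close> for the integrand into
  a bound for its derivative, hence for the difference quotients, and dominated convergence applies.
  Only the integrand itself has to be dominated.\<close>

lemma integral_param_has_field_derivative:
  fixes f :: "complex \<Rightarrow> 'a::euclidean_space \<Rightarrow> complex"
  assumes U: "open U" and hol: "\<And>x. x \<in> S \<Longrightarrow> (\<lambda>z. f z x) holomorphic_on U"
    and int: "\<And>z. z \<in> U \<Longrightarrow> f z integrable_on S"
    and e: "0 < e" and g: "g integrable_on S"
    and dom: "\<And>w x. w \<in> ball z0 e \<Longrightarrow> w \<in> U \<Longrightarrow> x \<in> S \<Longrightarrow> norm (f w x) \<le> g x"
    and z0: "z0 \<in> U"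
  shows "((\<lambda>z. integral S (f z)) has_field_derivative integral S (\<lambda>x. deriv (\<lambda>z. f z x) z0)) (at z0)"
proof -
  obtain e1 where e1: "e1 > 0" "ball z0 e1 \<subseteq> U" using U z0 openE by blast
  define d where "d = min e e1 / 2"
  have d: "d > 0" "ball z0 (2*d) \<subseteq> U" "ball z0 (2*d) \<subseteq> ball z0 e" using e e1 by (auto simp: d_def)
  have dq: "norm ((f w x - f z0 x) / (w - z0)) \<le> 2 * g x / d"
    if w: "w \<in> ball z0 (d/2)" "w \<noteq> z0" and x: "x \<in> S" for w x
  proof -
    have "norm (f w x - f z0 x) \<le> (2 * g x / d) * norm (w - z0)"
    proof (rule field_differentiable_bound)
      show "convex (ball z0 (d/2))" by simp
      show "((\<lambda>z. f z x) has_field_derivative deriv (\<lambda>z. f z x) y) (at y within ball z0 (d/2))"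
        if "y \<in> ball z0 (d/2)" for y
      proof -
        have "y \<in> U" using that d by auto
        then show ?thesis using hol[OF x] U holomorphic_derivI by blast
      qed
      show "norm (deriv (\<lambda>z. f z x) y) \<le> 2 * g x / d" if y: "y \<in> ball z0 (d/2)" for y
      proof -
        have sub: "cball y (d/2) \<subseteq> ball z0 (2*d)"
        proof
          fix z assume "z \<in> cball y (d/2)"
          then show "z \<in> ball z0 (2*d)" using y dist_triangle[of z0 z y] d(1)
            by (auto simp: dist_commute)
        qed
        have "norm ((deriv ^^ 1) (\<lambda>z. f z x) y) \<le> fact 1 * g x / (d/2)^1"
        proof (rule Cauchy_inequality)
          show "(\<lambda>z. f z x) holomorphic_on ball y (d/2)"
            using hol[OF x] sub d by (meson ball_subset_cball holomorphic_on_subset order_trans)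
          show "continuous_on (cball y (d/2)) (\<lambda>z. f z x)"
            using hol[OF x] sub d by (meson holomorphic_on_imp_continuous_on holomorphic_on_subset order_trans)
          show "norm (f z x) \<le> g x" if "cmod (y - z) = d/2" for z
          proof -
            have "z \<in> cball y (d/2)" using that by (simp add: dist_norm)
            then have "z \<in> ball z0 (2*d)" using sub by blast
            then show ?thesis using dom d x by blast
          qed
        qed (use d in auto)
        then show ?thesis by (simp add: field_simps)
      qed
      show "w \<in> ball z0 (d/2)" "z0 \<in> ball z0 (d/2)" using w d by auto
    qed
    then show ?thesis using w by (simp add: norm_divide pos_divide_le_eq)
  qed
  show ?thesis
    unfolding has_field_derivative_iff tendsto_at_iff_sequentially o_def
  proof (intro allI impI)
    fix X :: "nat \<Rightarrow> complex"
    assume X: "\<forall>i. X i \<in> UNIV - {z0}" and lim: "X \<longlonglongrightarrow> z0"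
    then have "eventually (\<lambda>i. X i \<in> ball z0 (d/2)) sequentially"
      using d by (metis centre_in_ball half_gt_zero open_ball topological_tendstoD)
    \<comment> \<open>Dominated convergence asks for the bound at every index, so the sequence is
      shifted into the disc; \<open>LIMSEQ_offset\<close> undoes the shift at the end.\<close>
    then obtain N where N: "\<And>i. X (i + N) \<in> ball z0 (d/2)" by (metis eventually_sequentially le_add2)
    define Y where "Y = (\<lambda>i. X (i + N))"
    have Y: "Y i \<in> ball z0 (d/2)" "Y i \<noteq> z0" "Y i \<in> U" for i
      using N[of i] X d by (auto simp: Y_def subset_eq)
    have Yl: "Y \<longlonglongrightarrow> z0" unfolding Y_def using lim by (rule LIMSEQ_ignore_initial_segment)
    have "(\<lambda>i. integral S (\<lambda>x. (f (Y i) x - f z0 x) / (Y i - z0))) \<longlonglongrightarrow> integral S (\<lambda>x. deriv (\<lambda>z. f z x) z0)"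
    proof (rule dominated_convergence(2))
      show "(\<lambda>x. (f (Y i) x - f z0 x) / (Y i - z0)) integrable_on S" for i
        using int[OF Y(3)] int[OF z0] by (intro integrable_on_divide integrable_diff)
      show "(\<lambda>x. 2 * g x / d) integrable_on S" using g
        by (intro integrable_on_divide integrable_on_mult_right)
      show "norm ((f (Y i) x - f z0 x) / (Y i - z0)) \<le> 2 * g x / d" if "x \<in> S" for i x
        using dq Y that by blast
      show "(\<lambda>i. (f (Y i) x - f z0 x) / (Y i - z0)) \<longlonglongrightarrow> deriv (\<lambda>z. f z x) z0" if "x \<in> S" for x
      proof -
        have "((\<lambda>z. f z x) has_field_derivative deriv (\<lambda>z. f z x) z0) (at z0)"
          using hol[OF that] U z0 holomorphic_derivI by blast
        then show ?thesis
          unfolding has_field_derivative_iff tendsto_at_iff_sequentially o_def using Y Yl by auto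
      qed
    qed
    note lim_int = this
    have quot: "integral S (\<lambda>x. (f (Y i) x - f z0 x) / (Y i - z0))
        = (integral S (f (Y i)) - integral S (f z0)) / (Y i - z0)" for i
      using integral_diff[OF int[OF Y(3)[of i]] int[OF z0]] by simp
    have "(\<lambda>i. (integral S (f (X (i+N))) - integral S (f z0)) / (X (i+N) - z0)) \<longlonglongrightarrow> integral S (\<lambda>x. deriv (\<lambda>z. f z x) z0)"
      using lim_int unfolding quot unfolding Y_def .
    then show "(\<lambda>i. (integral S (f (X i)) - integral S (f z0)) / (X i - z0)) \<longlonglongrightarrow> integral S (\<lambda>x. deriv (\<lambda>z. f z x) z0)"
      by (rule LIMSEQ_offset)
  qed
qed

lemma holomorphic_on_integral_param:
  fixes f :: "complex \<Rightarrow> real \<Rightarrow> complex"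
  assumes U: "open U" and S: "S \<in> sets lebesgue"
    and hol: "\<And>x. x \<in> S \<Longrightarrow> (\<lambda>z. f z x) holomorphic_on U"
    and cont: "\<And>z. z \<in> U \<Longrightarrow> continuous_on S (f z)"
    and dom: "\<And>z. z \<in> U \<Longrightarrow> \<exists>e>0. \<exists>g. g integrable_on S \<and> (\<forall>w\<in>ball z e \<inter> U. \<forall>x\<in>S. norm (f w x) \<le> g x)"
  shows "(\<lambda>z. integral S (f z)) holomorphic_on U"
proof -
  have int: "f z integrable_on S" if z: "z \<in> U" for z
  proof -
    obtain e g where "e > 0" "g integrable_on S" "\<forall>w\<in>ball z e \<inter> U. \<forall>x\<in>S. norm (f w x) \<le> g x"
      using dom[OF z] by blast
    then show ?thesis
      using absolutely_integrable_on_dominated[OF S cont[OF z], of g] z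
        set_lebesgue_integral_eq_integral(1) by auto
  qed
  have "\<exists>D. ((\<lambda>z. integral S (f z)) has_field_derivative D) (at z)" if z: "z \<in> U" for z
  proof -
    obtain e g where "e > 0" "g integrable_on S" "\<forall>w\<in>ball z e \<inter> U. \<forall>x\<in>S. norm (f w x) \<le> g x"
      using dom[OF z] by blast
    then show ?thesis
      using integral_param_has_field_derivative[OF U hol int, of e g z] z by blast
  qed
  then show ?thesis unfolding holomorphic_on_open[OF U] by blast
qed

text \<open>Near a zero \<open>a\<close> of \<open>g\<close> both functions are divided by z - a; as
  the zero of \<open>g\<close> is simple, the divided denominator does not vanish near
  \<open>a\<close>. The filled-in value is the one given by de l'Hospital's rule.\<close>

lemma holomorphic_on_removable_quotient:
  assumes S: "open S" and f: "f holomorphic_on S" and g: "g holomorphic_on S"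
    and z: "\<And>z. z \<in> S \<Longrightarrow> g z = 0 \<Longrightarrow> f z = 0 \<and> deriv g z \<noteq> 0"
  shows "(\<lambda>z. if g z = 0 then deriv f z / deriv g z else f z / g z) holomorphic_on S"
proof -
  let ?q = "\<lambda>z. if g z = 0 then deriv f z / deriv g z else f z / g z"
  have "\<exists>D. (?q has_field_derivative D) (at a)" if a: "a \<in> S" for a
  proof (cases "g a = 0")
    case True
    define F where "F = (\<lambda>z. if z = a then deriv f a else (f z - f a)/(z-a))"
    define G where "G = (\<lambda>z. if z = a then deriv g a else (g z - g a)/(z-a))"
    have FG: "F holomorphic_on S" "G holomorphic_on S"
      unfolding F_def G_def using f g S by (auto intro: pole_lemma_open)
    have Ga: "G a \<noteq> 0" using z[OF a True] by (simp add: G_def)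
    have "isCont G a"
      using holomorphic_on_imp_continuous_on[OF FG(2)] continuous_on_eq_continuous_at[OF S] a by blast
    then obtain e where e: "e > 0" "\<And>y. dist a y < e \<Longrightarrow> G y \<noteq> 0"
      using Ga continuous_at_avoid by blast
    define T where "T = ball a e"
    have T: "open T" "a \<in> T" "\<And>z. z \<in> T \<Longrightarrow> G z \<noteq> 0" using e by (auto simp: T_def)
    have 1: "(\<lambda>z. F z / G z) holomorphic_on (S \<inter> T)"
      using FG T by (intro holomorphic_on_divide) (auto intro: holomorphic_on_subset)
    have "?q holomorphic_on (S \<inter> T)"
    proof (rule holomorphic_transform[OF 1])
      fix y assume y: "y \<in> S \<inter> T"
      show "F y / G y = ?q y"
        using T(3)[of y] y z[OF a True] True by (cases "y = a") (auto simp: F_def G_def)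
    qed
    then show ?thesis using a T S holomorphic_derivI[of ?q "S \<inter> T" a] by auto
  next
    case False
    have 1: "(\<lambda>z. f z / g z) holomorphic_on (S \<inter> g -` (-{0}))"
      using f g by (intro holomorphic_on_divide) (auto intro: holomorphic_on_subset)
    have o: "open (S \<inter> g -` (-{0}))"
      using g S by (intro continuous_open_preimage holomorphic_on_imp_continuous_on) auto
    have "?q holomorphic_on (S \<inter> g -` (-{0}))"
      by (rule holomorphic_transform[OF 1]) auto
    then show ?thesis using o a False holomorphic_derivI[of ?q "S \<inter> g -` (-{0})" a] by auto
  qed
  then show ?thesis unfolding holomorphic_on_open[OF S] by blast
qed

text \<open>The Bessel-Clifford function: \<open>besselJ \<mu> z\<close> is (z / 2)^\<mu> times its
  value at -z^2 / 4. It is entire in both arguments, so all branch questions sit in the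
  power.\<close>

definition besselS :: "complex \<Rightarrow> complex \<Rightarrow> complex" where
  "besselS \<mu> a = (\<Sum>k. a ^ k * rGamma (\<mu> + of_nat k + 1) / fact k)"

text \<open>For k beyond \<open>m\<close> the factor \<mu> + k + 1 has modulus at least 1, so the
  recurrence of \<open>rGamma\<close> can only decrease the modulus; the earlier arguments lie in
  one compact disc.\<close>

lemma rGamma_shift_bounded:
  obtains C where "C > 0" "\<And>\<mu> k. cmod \<mu> \<le> R \<Longrightarrow> cmod (rGamma (\<mu> + of_nat k + 1)) \<le> C"
proof -
  define m where "m = nat \<lceil>R\<rceil> + 1"
  have "compact (rGamma ` cball (0::complex) (R + m + 1))"
    by (intro compact_continuous_image continuous_intros) auto
  then obtain C where C: "C > 0" "\<And>z. z \<in> cball (0::complex) (R + m + 1) \<Longrightarrow> cmod (rGamma z) \<le> C"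
    by (metis bounded_pos compact_imp_bounded image_eqI)
  have "cmod (rGamma (\<mu> + of_nat k + 1)) \<le> C" if mu: "cmod \<mu> \<le> R" for \<mu> k
  proof (induction k)
    case 0
    have "cmod (\<mu> + 1) \<le> R + m + 1" using mu norm_triangle_ineq[of \<mu> 1] by simp
    then show ?case using C(2)[of "\<mu> + 1"] by simp
  next
    case (Suc k)
    show ?case
    proof (cases "Suc k \<le> m")
      case True
      have "cmod (\<mu> + of_nat (Suc k) + 1) \<le> cmod \<mu> + cmod (of_nat (Suc k) + 1)"
        by (metis add.assoc norm_triangle_ineq)
      also have "cmod (of_nat (Suc k) + 1) = real (Suc k) + 1"
        by (metis norm_of_nat of_nat_Suc add.commute)
      finally show ?thesis using C(2) mu True by simp
    next
      case False
      have "1 \<le> real (k + 1) - R" using False unfolding m_def by linarith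
      also have "\<dots> \<le> cmod (\<mu> + of_nat k + 1)"
      proof -
        have "real (k + 1) = cmod (of_nat (k+1))" by (simp only: norm_of_nat)
        also have "\<dots> \<le> cmod (\<mu> + of_nat k + 1) + cmod \<mu>"
          using norm_triangle_ineq4[of "\<mu> + of_nat k + 1" \<mu>] by (simp add: algebra_simps)
        finally show ?thesis using mu by simp
      qed
      finally have 1: "1 \<le> cmod (\<mu> + of_nat k + 1)" .
      have "(\<mu> + of_nat k + 1) * rGamma (\<mu> + of_nat k + 1 + 1) = rGamma (\<mu> + of_nat k + 1)"
        by (rule rGamma_plus1)
      then have "cmod (\<mu> + of_nat k + 1) * cmod (rGamma (\<mu> + of_nat (Suc k) + 1)) = cmod (rGamma (\<mu> + of_nat k + 1))"
        by (metis norm_mult add.assoc add.commute of_nat_Suc)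
      moreover have "1 * cmod (rGamma (\<mu> + of_nat (Suc k) + 1)) \<le> cmod (\<mu> + of_nat k + 1) * cmod (rGamma (\<mu> + of_nat (Suc k) + 1))"
        by (intro mult_right_mono 1) auto
      ultimately show ?thesis using Suc.IH by linarith
    qed
  qed
  then show ?thesis using that C(1) by blast
qed

lemma summable_exp_terms: "summable (\<lambda>k. C * (A ^ k / fact k) :: real)"
  using summable_exp[of A] by (simp add: divide_inverse mult.commute summable_mult)

lemma besselS_term_le:
  assumes "cmod (rGamma (\<mu> + of_nat k + 1)) \<le> C" "cmod a \<le> A"
  shows "cmod (a ^ k * rGamma (\<mu> + of_nat k + 1) / fact k) \<le> C * (A ^ k / fact k)"
proof -
  have "cmod (a ^ k * rGamma (\<mu> + of_nat k + 1)) \<le> A ^ k * C"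
    unfolding norm_mult norm_power using assms order_trans[OF norm_ge_zero assms(2)]
    by (intro mult_mono power_mono zero_le_power) auto
  then show ?thesis by (simp add: norm_divide divide_right_mono mult.commute)
qed

lemma summable_besselS: "summable (\<lambda>k. (a::complex) ^ k * rGamma (\<mu> + of_nat k + 1) / fact k)"
proof -
  obtain C where "C > 0" "\<And>\<mu>' k. cmod \<mu>' \<le> cmod \<mu> \<Longrightarrow> cmod (rGamma (\<mu>' + of_nat k + 1)) \<le> C"
    using rGamma_shift_bounded[of "cmod \<mu>"] by blast
  then have "norm (a ^ k * rGamma (\<mu> + of_nat k + 1) / fact k) \<le> C * (cmod a ^ k / fact k)" for k
    by (intro besselS_term_le) auto
  then show ?thesis by (rule summable_comparison_test'[OF summable_exp_terms, of 0])
qed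

lemma besselS_uniform_limit:
  assumes "\<And>x. x \<in> X \<Longrightarrow> cmod (m x) \<le> R" "\<And>x. x \<in> X \<Longrightarrow> cmod (a x) \<le> A"
  shows "uniform_limit X (\<lambda>n x. \<Sum>k<n. a x ^ k * rGamma (m x + of_nat k + 1) / fact k)
           (\<lambda>x. besselS (m x) (a x)) sequentially"
proof -
  obtain C where "C > 0" "\<And>\<mu>' k. cmod \<mu>' \<le> R \<Longrightarrow> cmod (rGamma (\<mu>' + of_nat k + 1)) \<le> C"
    using rGamma_shift_bounded[of R] by blast
  then show ?thesis unfolding besselS_def
    using assms by (intro Weierstrass_m_test[OF besselS_term_le summable_exp_terms]) auto
qed

lemma holomorphic_on_besselS [holomorphic_intros]:
  assumes m: "m holomorphic_on U" and a: "a holomorphic_on U" and "open U"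
  shows "(\<lambda>z. besselS (m z) (a z)) holomorphic_on U"
proof (rule holomorphic_uniform_sequence[OF \<open>open U\<close>])
  show "(\<lambda>z. \<Sum>k<n. a z ^ k * rGamma (m z + of_nat k + 1) / fact k) holomorphic_on U" for n
    using m a by (intro holomorphic_intros) auto
  fix x assume "x \<in> U"
  then obtain d where d: "d > 0" "cball x d \<subseteq> U" using \<open>open U\<close> open_contains_cball by blast
  have "compact (m ` cball x d)" "compact (a ` cball x d)"
    using m a d by (auto intro!: compact_continuous_image holomorphic_on_imp_continuous_on intro: holomorphic_on_subset)
  then obtain R A where "\<And>z. z \<in> cball x d \<Longrightarrow> cmod (m z) \<le> R" "\<And>z. z \<in> cball x d \<Longrightarrow> cmod (a z) \<le> A"
    by (metis bounded_pos compact_imp_bounded image_eqI)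
  then show "\<exists>d>0. cball x d \<subseteq> U \<and> uniform_limit (cball x d)
       (\<lambda>n z. \<Sum>k<n. a z ^ k * rGamma (m z + of_nat k + 1) / fact k) (\<lambda>z. besselS (m z) (a z)) sequentially"
    using d besselS_uniform_limit by blast
qed

lemma continuous_on_besselS_pair: "continuous_on UNIV (\<lambda>p. besselS (fst p) (snd p))"
proof -
  have "continuous_on (ball 0 r) (\<lambda>p. besselS (fst p) (snd p))" for r
  proof (rule uniform_limit_theorem)
    show "\<forall>\<^sub>F n in sequentially. continuous_on (ball 0 r)
            (\<lambda>p::complex\<times>complex. \<Sum>k<n. snd p ^ k * rGamma (fst p + of_nat k + 1) / fact k)"
      by (intro always_eventually allI continuous_intros continuous_on_compose2[OF continuous_on_rGamma[of UNIV]]) auto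
    show "uniform_limit (ball 0 r) (\<lambda>n p::complex\<times>complex. \<Sum>k<n. snd p ^ k * rGamma (fst p + of_nat k + 1) / fact k)
       (\<lambda>p. besselS (fst p) (snd p)) sequentially"
    proof (rule besselS_uniform_limit)
      fix p :: "complex \<times> complex" assume "p \<in> ball 0 r"
      then have "norm p \<le> r" by (simp add: dist_norm)
      then show "cmod (fst p) \<le> r" "cmod (snd p) \<le> r"
        using norm_fst_le[of "fst p" "snd p"] norm_snd_le[of "snd p" "fst p"] by auto
    qed
  qed simp
  note c = this
  have "isCont (\<lambda>p. besselS (fst p) (snd p)) p" for p
    using c[of "norm p + 1"] continuous_on_eq_continuous_at[OF open_ball] by force
  then show ?thesis by (simp add: continuous_at_imp_continuous_on)
qed

lemma continuous_on_besselS [continuous_intros]: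
  assumes "continuous_on X m" "continuous_on X a"
  shows "continuous_on X (\<lambda>x. besselS (m x) (a x))"
  using continuous_on_compose2[OF continuous_on_besselS_pair continuous_on_Pair[OF assms]] by simp

lemma besselS_has_field_derivative:
  "(besselS \<mu> has_field_derivative besselS (\<mu> + 1) a) (at a)"
proof -
  define c where "c = (\<lambda>k. rGamma (\<mu> + of_nat k + 1) / fact k)"
  have s: "summable (\<lambda>k. c k * y ^ k)" for y
    using summable_besselS[of y \<mu>] by (simp add: c_def mult.commute)
  have "((\<lambda>x. \<Sum>k. c k * x ^ k) has_field_derivative (\<Sum>k. diffs c k * a ^ k)) (at a)"
    using s by (rule termdiffs_strong_converges_everywhere)
  moreover have "(\<lambda>x. \<Sum>k. c k * x ^ k) = besselS \<mu>"
    by (simp add: fun_eq_iff besselS_def c_def mult.commute)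
  moreover have "diffs c k * a ^ k = a ^ k * rGamma (\<mu> + 1 + of_nat k + 1) / fact k" for k
    by (simp add: diffs_def c_def field_simps del: of_nat_Suc) (simp add: algebra_simps)
  ultimately show ?thesis by (simp add: besselS_def)
qed

declare besselS_has_field_derivative [THEN DERIV_chain2, derivative_intros]

lemma besselS_0: "besselS \<mu> 0 = rGamma (\<mu> + 1)"
  unfolding besselS_def by (subst suminf_finite[of "{0}"]) auto

text \<open>The first n coefficients vanish because \<open>rGamma\<close> is zero at the
  non-positive integers; this is the source of J_(-n) = (-1)^n J_n.\<close>

lemma besselS_minus_nat: "besselS (- of_nat n) a = a ^ n * besselS (of_nat n) a"
proof -
  have "besselS (- of_nat n) a = (\<Sum>k. a ^ (k+n) * rGamma (- of_nat n + of_nat (k+n) + 1) / fact (k+n))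
         + (\<Sum>k<n. a ^ k * rGamma (- of_nat n + of_nat k + 1) / fact k)"
    unfolding besselS_def by (rule suminf_split_initial_segment[OF summable_besselS])
  also have "(\<Sum>k<n. a ^ k * rGamma (- of_nat n + of_nat k + 1) / fact k) = 0"
  proof (rule sum.neutral, rule ballI)
    fix k assume "k \<in> {..<n}"
    then have "- of_nat n + of_nat k + 1 = (- of_nat (n - k - 1) :: complex)"
      by (simp add: of_nat_diff algebra_simps)
    then show "a ^ k * rGamma (- of_nat n + of_nat k + 1) / fact k = 0"
      using rGamma_eq_zero_iff[of "- of_nat (n - k - 1) :: complex"] by simp
  qed
  also have "(\<lambda>k. a ^ (k+n) * rGamma (- of_nat n + of_nat (k+n) + 1) / fact (k+n))
      = (\<lambda>k. a ^ n * (a ^ k * rGamma (of_nat n + of_nat k + 1) / fact k))"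
  proof
    fix k
    have 1: "rGamma (of_nat m + 1 :: complex) = 1 / fact m" for m
      by (simp add: rGamma_inverse_Gamma Gamma_fact inverse_eq_divide add.commute)
    show "a ^ (k+n) * rGamma (- of_nat n + of_nat (k+n) + 1) / fact (k+n)
        = a ^ n * (a ^ k * rGamma (of_nat n + of_nat k + 1) / fact k)"
      using 1[of k] 1[of "n+k"] by (simp add: power_add field_simps add.commute)
  qed
  finally show ?thesis unfolding besselS_def suminf_mult[OF summable_besselS] by simp
qed

section \<open>The diagonal Hankel function in the coordinate log z\<close>

text \<open>Joint continuity bounds the integrand by a constant on a closed disc times the interval,
  which is the local domination required above.\<close>

lemma integral_param_interval:
  fixes f :: "complex \<Rightarrow> real \<Rightarrow> complex"
  assumes U: "open U" and cont: "continuous_on (U \<times> {a..b}) (\<lambda>(z, t). f z t)"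
    and hol: "\<And>t. t \<in> {a..b} \<Longrightarrow> (\<lambda>z. f z t) holomorphic_on U"
  shows "(\<lambda>z. integral {a..b} (f z)) holomorphic_on U"
    and "z0 \<in> U \<Longrightarrow> ((\<lambda>z. integral {a..b} (f z)) has_field_derivative
           integral {a..b} (\<lambda>t. deriv (\<lambda>z. f z t) z0)) (at z0)"
proof -
  have c1: "continuous_on {a..b} (f z)" if "z \<in> U" for z
  proof -
    have "continuous_on {a..b} (\<lambda>t. (\<lambda>(z, t). f z t) (z, t))"
      by (rule continuous_on_compose2[OF cont]) (use that in \<open>auto intro!: continuous_intros\<close>)
    then show ?thesis by simp
  qed
  have dom: "\<exists>e>0. \<exists>g. g integrable_on {a..b} \<and> (\<forall>w\<in>ball z e \<inter> U. \<forall>x\<in>{a..b}. norm (f w x) \<le> g x)"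
    if z: "z \<in> U" for z
  proof -
    obtain e where e: "e > 0" "cball z e \<subseteq> U" using U z open_contains_cball by blast
    have "compact ((\<lambda>(z, t). f z t) ` (cball z e \<times> {a..b}))"
      using e(2) by (intro compact_continuous_image continuous_on_subset[OF cont] compact_Times) auto
    from compact_imp_bounded[OF this]
    obtain B where B: "\<forall>y \<in> (\<lambda>(z, t). f z t) ` (cball z e \<times> {a..b}). norm y \<le> B"
      unfolding bounded_iff ..
    have "\<forall>w\<in>ball z e \<inter> U. \<forall>x\<in>{a..b}. norm (f w x) \<le> B"
    proof (intro ballI)
      fix w x assume "w \<in> ball z e \<inter> U" "x \<in> {a..b}"
      then have "(\<lambda>(z, t). f z t) (w, x) \<in> (\<lambda>(z, t). f z t) ` (cball z e \<times> {a..b})"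
        by (intro imageI) auto
      then show "norm (f w x) \<le> B" using B by auto
    qed
    then show ?thesis using e(1) by (intro exI[of _ e] conjI exI[of _ "\<lambda>_. B"]) (auto intro: integrable_const_ivl)
  qed
  show "(\<lambda>z. integral {a..b} (f z)) holomorphic_on U"
    using hol c1 dom by (intro holomorphic_on_integral_param U) auto
  assume z0: "z0 \<in> U"
  obtain e g where eg: "e > 0" "g integrable_on {a..b}" "\<forall>w\<in>ball z0 e \<inter> U. \<forall>x\<in>{a..b}. norm (f w x) \<le> g x"
    using dom[OF z0] by blast
  show "((\<lambda>z. integral {a..b} (f z)) has_field_derivative
           integral {a..b} (\<lambda>t. deriv (\<lambda>z. f z t) z0)) (at z0)"
    by (rule integral_param_has_field_derivative[OF U hol _ eg(1,2)])
       (use eg(3) z0 c1 in \<open>auto intro: integrable_continuous_real\<close>)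
qed

text \<open>Cauchy's formula as an ordinary integral over [0, 1]. Applied in the order, it expresses
  values at an integer order through orders on a circle that avoids the integers.\<close>

lemma Cauchy_integral_interval:
  assumes f: "f holomorphic_on UNIV" and w: "cmod (w - z) < r"
  shows "f w = integral {0..1} (\<lambda>t. f (circlepath z r t) * (circlepath z r t - z) / (circlepath z r t - w))"
proof -
  have "((\<lambda>u. f u/(u-w)) has_contour_integral (2 * of_real pi * \<i> * f w)) (circlepath z r)"
    using f w by (intro Cauchy_integral_circlepath_simple) (auto intro: holomorphic_on_subset)
  then have "((\<lambda>t. f (circlepath z r t) / (circlepath z r t - w) * (2 * pi * \<i> * r * exp(2 * of_real pi * \<i> * t)))
      has_integral (2 * of_real pi * \<i> * f w)) {0..1}"
    unfolding has_contour_integral vector_derivative_circlepath .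
  then have "((\<lambda>t. f (circlepath z r t) / (circlepath z r t - w) * (2 * pi * \<i> * r * exp(2 * of_real pi * \<i> * t)) / (2 * pi * \<i>))
      has_integral (2 * of_real pi * \<i> * f w) / (2 * pi * \<i>)) {0..1}"
    by (rule has_integral_divide)
  then have "((\<lambda>t. f (circlepath z r t) * (circlepath z r t - z) / (circlepath z r t - w)) has_integral f w) {0..1}"
  proof (rule has_integral_eq_rhs[OF has_integral_eq[rotated]])
    fix t :: real
    have eq: "2 * pi * \<i> * r * exp(2 * of_real pi * \<i> * t) / (2 * pi * \<i>) = circlepath z r t - z"
      by (simp add: circlepath)
    show "f (circlepath z r t) / (circlepath z r t - w) * (2 * pi * \<i> * r * exp(2 * of_real pi * \<i> * t)) / (2 * pi * \<i>)
      = f (circlepath z r t) * (circlepath z r t - z) / (circlepath z r t - w)"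
      unfolding times_divide_eq_right[symmetric] eq by (simp add: circlepath)
  qed simp
  then show ?thesis by (simp add: integral_unique)
qed

text \<open>J in the coordinate l = log z: the power becomes an exponential, so the function is
  entire in order and argument. \<open>besselJLd\<close> is its derivative in l.\<close>

definition besselJL :: "complex \<Rightarrow> complex \<Rightarrow> complex" where
  "besselJL \<mu> l = exp (\<mu> * (l - of_real (ln 2))) * besselS \<mu> (- exp (2 * l) / 4)"

definition besselJLd :: "complex \<Rightarrow> complex \<Rightarrow> complex" where
  "besselJLd \<mu> l = exp (\<mu> * (l - of_real (ln 2))) *
     (\<mu> * besselS \<mu> (- exp (2 * l) / 4) - exp (2 * l) / 2 * besselS (\<mu> + 1) (- exp (2 * l) / 4))"

lemma besselJL_has_field_derivative [derivative_intros]: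
  "(besselJL \<mu> has_field_derivative besselJLd \<mu> l) (at l)"
  unfolding besselJL_def besselJLd_def
  by (rule derivative_eq_intros refl | simp)+ (simp add: algebra_simps)

lemma besselJ_eq_besselJL:
  assumes "Re z > 0"
  shows "besselJ \<mu> z = besselJL \<mu> (Ln z)"
proof -
  have "z \<noteq> 0" using assms by auto
  have "(z / 2) powr \<mu> = exp (\<mu> * (Ln z - of_real (ln 2)))"
    using \<open>z \<noteq> 0\<close> Ln_divide_of_real[of 2 z] by (simp add: powr_def)
  moreover have "exp (2 * Ln z) = z\<^sup>2"
    using \<open>z \<noteq> 0\<close> by (metis exp_Ln exp_double)
  moreover have "(- 1) ^ k * (z / 2) ^ (2 * k) = (- z\<^sup>2 / 4) ^ k" for k
  proof -
    have "(z / 2) ^ (2 * k) = (z\<^sup>2 / 4) ^ k" by (simp add: power_mult power_divide)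
    then show ?thesis using power_minus[of "z\<^sup>2 / 4" k] by simp
  qed
  ultimately show ?thesis by (simp add: besselJ_def besselJL_def besselS_def)
qed

lemma complex_sin_mult_pi_eq_0: "sin (\<mu> * complex_of_real pi) = 0 \<longleftrightarrow> \<mu> \<in> \<int>"
proof
  assume "sin (\<mu> * of_real pi) = 0"
  then obtain n :: int where "\<mu> * of_real pi = of_real (n * pi)"
    using sin_eq_0 by blast
  then have "\<mu> = of_int n" by simp
  then show "\<mu> \<in> \<int>" by simp
next
  assume "\<mu> \<in> \<int>"
  then obtain n where "\<mu> = of_int n" by (elim Ints_cases)
  then have "\<mu> * of_real pi = of_real (of_int n * pi)" by simp
  then show "sin (\<mu> * of_real pi) = 0" using sin_eq_0 by blast
qed

text \<open>Makes the numerator of the quotient for Y vanish at every integer order, so that the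
  poles of 1 / sin (\<pi> \<mu>) are removable.\<close>

lemma besselJL_minus_Ints:
  assumes "\<mu> \<in> \<int>"
  shows "besselJL (- \<mu>) l = cos (\<mu> * of_real pi) * besselJL \<mu> l"
proof -
  have nat: "besselJL (- of_nat n) l = (-1) ^ n * besselJL (of_nat n) l" for n
  proof -
    have "exp (- of_nat n * (l - of_real (ln 2))) = exp (of_nat n * (l - of_real (ln 2))) / exp (of_nat n * (2 * (l - of_real (ln 2))))"
    proof -
      have "- of_nat n * (l - of_real (ln 2)) = of_nat n * (l - of_real (ln 2)) - of_nat n * (2 * (l - of_real (ln 2)))"
        by (simp add: algebra_simps)
      then show ?thesis by (simp only: exp_diff)
    qed
    moreover have "exp (2 * of_real (ln 2) :: complex) = of_real 4"
      unfolding exp_double by (simp add: exp_of_real)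
    then have "exp (of_nat n * (2 * (l - of_real (ln 2)))) = (exp (2 * l) / 4) ^ n"
      unfolding exp_of_nat_mult by (simp add: right_diff_distrib exp_diff)
    moreover have "(- exp (2 * l) / 4) ^ n = (-1) ^ n * (exp (2 * l) / 4) ^ n"
      by (metis minus_divide_left power_minus)
    ultimately show ?thesis by (simp add: besselJL_def besselS_minus_nat)
  qed
  have cosn: "cos (of_nat n * of_real pi) = (-1 :: complex) ^ n" for n
  proof -
    have "cos (of_nat n * of_real pi) = complex_of_real (cos (n * pi))"
      using cos_of_real[of "n * pi", where 'a = complex] by simp
    then show ?thesis by simp
  qed
  obtain k where k: "\<mu> = of_int k" using assms by (elim Ints_cases)
  show ?thesis
  proof (cases k rule: int_cases2)
    case (nonneg n)
    then show ?thesis using nat[of n] cosn[of n] k by simp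
  next
    case (nonpos n)
    have "(-1 :: complex) ^ n * (-1) ^ n = 1" by (simp flip: power_mult_distrib)
    then show ?thesis using nat[of n] cosn[of n] k nonpos
      by (simp add: mult.assoc[symmetric])
  qed
qed

lemma besselJLd_minus_Ints:
  assumes "\<mu> \<in> \<int>"
  shows "besselJLd (- \<mu>) l = cos (\<mu> * of_real pi) * besselJLd \<mu> l"
proof -
  have "((\<lambda>l. cos (\<mu> * of_real pi) * besselJL \<mu> l) has_field_derivative cos (\<mu> * of_real pi) * besselJLd \<mu> l) (at l)"
    by (rule DERIV_cmult[OF besselJL_has_field_derivative])
  moreover have "(\<lambda>l. cos (\<mu> * of_real pi) * besselJL \<mu> l) = besselJL (- \<mu>)"
    using besselJL_minus_Ints[OF assms] by auto
  ultimately have "(besselJL (- \<mu>) has_field_derivative cos (\<mu> * of_real pi) * besselJLd \<mu> l) (at l)"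
    by simp
  then show ?thesis using besselJL_has_field_derivative DERIV_unique by blast
qed

lemma holomorphic_besselJL_order: "(\<lambda>\<mu>. besselJL \<mu> l) holomorphic_on UNIV"
  "(\<lambda>\<mu>. besselJL (- \<mu>) l) holomorphic_on UNIV"
  "(\<lambda>\<mu>. besselJLd \<mu> l) holomorphic_on UNIV" "(\<lambda>\<mu>. besselJLd (- \<mu>) l) holomorphic_on UNIV"
  unfolding besselJL_def besselJLd_def by (intro holomorphic_intros open_UNIV)+

text \<open>The quotient of \<open>f\<close> by \<open>sin (\<pi> \<mu>)\<close> with the removable singularities at the integers filled in.\<close>

definition fill_quot :: "(complex \<Rightarrow> complex) \<Rightarrow> complex \<Rightarrow> complex" where
  "fill_quot f \<mu> = (if sin (\<mu> * of_real pi) = 0 then deriv f \<mu> / deriv (\<lambda>\<mu>. sin (\<mu> * of_real pi)) \<mu>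
     else f \<mu> / sin (\<mu> * of_real pi))"

lemma holomorphic_fill_quot:
  assumes "f holomorphic_on UNIV" "\<And>\<mu>. \<mu> \<in> \<int> \<Longrightarrow> f \<mu> = 0"
  shows "fill_quot f holomorphic_on UNIV"
proof -
  have "((\<lambda>\<mu>. sin (\<mu> * complex_of_real pi)) has_field_derivative cos (\<mu> * of_real pi) * of_real pi) (at \<mu>)" for \<mu>
    by (auto intro!: derivative_eq_intros)
  then have d: "deriv (\<lambda>\<mu>. sin (\<mu> * complex_of_real pi)) \<mu> = cos (\<mu> * of_real pi) * of_real pi" for \<mu>
    by (rule DERIV_imp_deriv)
  have "cos (\<mu> * complex_of_real pi) \<noteq> 0" if "sin (\<mu> * complex_of_real pi) = 0" for \<mu>
    using that sin_cos_squared_add[of "\<mu> * complex_of_real pi"] by auto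
  then have "(\<lambda>\<mu>. if sin (\<mu> * of_real pi) = 0 then deriv f \<mu> / deriv (\<lambda>\<mu>. sin (\<mu> * of_real pi)) \<mu>
     else f \<mu> / sin (\<mu> * of_real pi)) holomorphic_on UNIV"
    using assms by (intro holomorphic_on_removable_quotient holomorphic_intros)
       (auto simp: complex_sin_mult_pi_eq_0 d)
  then show ?thesis unfolding fill_quot_def[abs_def] .
qed

section \<open>The second solution and the Hankel function on the diagonal\<close>

definition besselYL :: "complex \<Rightarrow> complex \<Rightarrow> complex" where
  "besselYL \<mu> l = fill_quot (\<lambda>\<mu>. besselJL \<mu> l * cos (\<mu> * of_real pi) - besselJL (- \<mu>) l) \<mu>"

definition besselYLd :: "complex \<Rightarrow> complex \<Rightarrow> complex" where
  "besselYLd \<mu> l = fill_quot (\<lambda>\<mu>. besselJLd \<mu> l * cos (\<mu> * of_real pi) - besselJLd (- \<mu>) l) \<mu>"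

lemma besselYL_nonint:
  assumes "\<mu> \<notin> \<int>"
  shows "besselYL \<mu> l = (besselJL \<mu> l * cos (\<mu> * of_real pi) - besselJL (- \<mu>) l) / sin (\<mu> * of_real pi)"
    "besselYLd \<mu> l = (besselJLd \<mu> l * cos (\<mu> * of_real pi) - besselJLd (- \<mu>) l) / sin (\<mu> * of_real pi)"
  using assms by (auto simp: besselYL_def besselYLd_def fill_quot_def complex_sin_mult_pi_eq_0)

lemma holomorphic_besselYL_order:
  "(\<lambda>\<mu>. besselYL \<mu> l) holomorphic_on UNIV" "(\<lambda>\<mu>. besselYLd \<mu> l) holomorphic_on UNIV"
  unfolding besselYL_def besselYLd_def
  by (rule holomorphic_fill_quot; (intro holomorphic_intros holomorphic_besselJL_order)?;
      simp add: besselJL_minus_Ints besselJLd_minus_Ints)+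

text \<open>At an integer order the limit in the definition of \<open>besselY\<close> is the value
  of the filled-in quotient, which is continuous in the order; the unit disc around the order
  contains no other integer, so the two quotients agree there.\<close>

lemma besselY_eq_besselYL:
  assumes "Re z > 0"
  shows "besselY \<mu> z = besselYL \<mu> (Ln z)"
proof (cases "\<mu> \<in> \<int>")
  case False
  then show ?thesis using assms by (simp add: besselY_def besselYL_nonint besselJ_eq_besselJL)
next
  case True
  have "isCont (\<lambda>\<mu>. besselYL \<mu> (Ln z)) \<mu>"
    using holomorphic_on_imp_continuous_on[OF holomorphic_besselYL_order(1)]
    by (simp add: continuous_on_eq_continuous_at)
  then have "((\<lambda>\<mu>. besselYL \<mu> (Ln z)) \<longlongrightarrow> besselYL \<mu> (Ln z)) (at \<mu>)" by (simp add: isCont_def)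
  moreover have "eventually (\<lambda>m. m \<in> ball \<mu> 1 - {\<mu>}) (at \<mu>)"
    by (intro eventually_at_in_open) auto
  then have "eventually (\<lambda>m. besselYL m (Ln z) =
     (besselJ m z * cos (m * of_real pi) - besselJ (- m) z) / sin (m * of_real pi)) (at \<mu>)"
  proof eventually_elim
    case (elim m)
    have "m \<notin> \<int>"
    proof
      assume "m \<in> \<int>"
      then have "m - \<mu> \<in> \<int>" using True by auto
      then obtain k where k: "m - \<mu> = of_int k" by (elim Ints_cases)
      then have "k \<noteq> 0" using elim by auto
      then have "norm (m - \<mu>) \<ge> 1" unfolding k by simp
      then show False using elim by (auto simp: dist_norm norm_minus_commute)
    qed
    then show ?case using assms by (simp add: besselYL_nonint besselJ_eq_besselJL)
  qed
  ultimately have "((\<lambda>m. (besselJ m z * cos (m * of_real pi) - besselJ (- m) z) / sin (m * of_real pi)) \<longlongrightarrow> besselYL \<mu> (Ln z)) (at \<mu>)"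
    by (rule Lim_transform_eventually)
  then show ?thesis using True by (simp add: besselY_def tendsto_Lim Let_def)
qed

lemma circle_half_nonint:
  assumes "n \<in> \<int>" "cmod (u - n) = 1/2"
  shows "u \<notin> (\<int> :: complex set)"
proof
  assume "u \<in> \<int>"
  then have "u - n \<in> \<int>" using assms by auto
  then obtain k where "u - n = of_int k" by (elim Ints_cases)
  then have "cmod (u - n) = \<bar>of_int k\<bar>" by simp
  then have "2 * \<bar>k\<bar> = 1" using assms(2) by linarith
  then show False by presburger
qed

lemma cmod_circlepath: "r \<ge> 0 \<Longrightarrow> cmod (circlepath z r t - z) = r"
  by (simp add: circlepath norm_mult norm_exp_eq_Re)

lemma continuous_on_circlepath [continuous_intros]:
  "continuous_on A g \<Longrightarrow> continuous_on A (\<lambda>x. circlepath z r (g x))"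
  unfolding circlepath by (intro continuous_intros)

lemma continuous_on_besselYL_circle:
  assumes n: "n \<in> \<int>"
  shows "continuous_on A (\<lambda>(l, t). besselYL (circlepath n (1/2) t) l)"
    "continuous_on A (\<lambda>(l, t). besselYLd (circlepath n (1/2) t) l)"
proof -
  have ni: "circlepath n (1/2) t \<notin> \<int>" for t
    using circle_half_nonint[OF n] cmod_circlepath by simp
  show "continuous_on A (\<lambda>(l, t). besselYL (circlepath n (1/2) t) l)"
    "continuous_on A (\<lambda>(l, t). besselYLd (circlepath n (1/2) t) l)"
    unfolding split_def besselYL_nonint[OF ni] besselJL_def besselJLd_def
    using ni by (intro continuous_intros; simp add: complex_sin_mult_pi_eq_0)+
qed

text \<open>Away from integers this is the quotient rule. At an integer order both sides are mean
  values over the circle of radius 1/2 in the order, where the first case applies, and one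
  differentiates under the integral.\<close>

lemma besselYL_has_field_derivative [derivative_intros]:
  "(besselYL \<mu> has_field_derivative besselYLd \<mu> l) (at l)"
proof -
  have ni: "(besselYL \<mu> has_field_derivative besselYLd \<mu> l) (at l)" if "\<mu> \<notin> \<int>" for \<mu> l
    unfolding besselYL_nonint[OF that, abs_def] using that
    by (auto intro!: derivative_eq_intros simp: complex_sin_mult_pi_eq_0 field_simps)
  show ?thesis
  proof (cases "\<mu> \<in> \<int>")
    case True
    have u: "circlepath \<mu> (1/2) t \<notin> \<int>" "circlepath \<mu> (1/2) t \<noteq> \<mu>" for t
      using circle_half_nonint[OF True] cmod_circlepath[of "1/2" \<mu> t] by auto
    have *: "f \<mu> = integral {0..1} (\<lambda>t. f (circlepath \<mu> (1/2) t))" if "f holomorphic_on UNIV" for f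
      using Cauchy_integral_interval[OF that, of \<mu> \<mu> "1/2"] u by simp
    have "((\<lambda>l. integral {0..1} (\<lambda>t. besselYL (circlepath \<mu> (1/2) t) l)) has_field_derivative
           integral {0..1} (\<lambda>t. deriv (\<lambda>l. besselYL (circlepath \<mu> (1/2) t) l) l)) (at l)"
    proof (rule integral_param_interval(2))
      show "besselYL (circlepath \<mu> (1/2) t) holomorphic_on UNIV" for t
        using ni[OF u(1)] by (auto simp: holomorphic_on_open)
    qed (use continuous_on_besselYL_circle(1)[OF True] in auto)
    also have "(\<lambda>l. integral {0..1} (\<lambda>t. besselYL (circlepath \<mu> (1/2) t) l)) = besselYL \<mu>"
      using *[OF holomorphic_besselYL_order(1)] by auto
    also have "integral {0..1} (\<lambda>t. deriv (\<lambda>l. besselYL (circlepath \<mu> (1/2) t) l) l)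
       = integral {0..1} (\<lambda>t. besselYLd (circlepath \<mu> (1/2) t) l)"
      by (intro integral_cong DERIV_imp_deriv ni u)
    also have "\<dots> = besselYLd \<mu> l" using *[OF holomorphic_besselYL_order(2)] by auto
    finally show ?thesis .
  qed (rule ni)
qed

text \<open>Order and argument are both exp l; the division by exp l converts the derivative in log
  z into the derivative in z.\<close>

definition hankelF :: "complex \<Rightarrow> complex" where
  "hankelF l = (besselJLd (exp l) l + \<i> * besselYLd (exp l) l) / exp l"

lemma deriv_hankel1_diag:
  fixes x :: real
  assumes "x > 0"
  shows "deriv (hankel1 (of_real x)) (of_real x) = hankelF (of_real (ln x))"
proof -
  have "((\<lambda>z. besselJL x (Ln z) + \<i> * besselYL x (Ln z)) has_field_derivative
       (besselJLd x (Ln x) + \<i> * besselYLd x (Ln x)) / x) (at (complex_of_real x))"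
    using assms
    by (auto intro!: derivative_eq_intros DERIV_chain2[OF besselJL_has_field_derivative]
        DERIV_chain2[OF besselYL_has_field_derivative] simp: field_simps)
  moreover have "open {z. Re z > 0}" by (rule open_halfspace_Re_gt)
  ultimately have "(hankel1 x has_field_derivative
       (besselJLd x (Ln x) + \<i> * besselYLd x (Ln x)) / x) (at (complex_of_real x))"
    by (rule has_field_derivative_transform_within_open)
       (use assms in \<open>auto simp: hankel1_def besselJ_eq_besselJL besselY_eq_besselYL\<close>)
  then have "deriv (hankel1 x) x = (besselJLd x (Ln x) + \<i> * besselYLd x (Ln x)) / x"
    by (rule DERIV_imp_deriv)
  also have "\<dots> = hankelF (of_real (ln x))"
    using assms by (simp add: hankelF_def Ln_of_real exp_of_real)
  finally show ?thesis .
qed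

text \<open>The difficulty is that the order exp l crosses integers as l moves. Near such an l the
  value at order exp l is written by Cauchy's formula over a fixed circle of non-integer orders,
  where the dependence on l is explicit.\<close>

lemma holomorphic_hankelF: "hankelF holomorphic_on UNIV"
proof -
  have J: "(\<lambda>l. besselJLd (exp l) l) holomorphic_on A" "(\<lambda>l. besselJLd (- exp l) l) holomorphic_on A"
    if "open A" for A
    unfolding besselJLd_def using that by (intro holomorphic_intros; simp)+
  have "\<exists>U. open U \<and> l \<in> U \<and> (\<lambda>l. besselYLd (exp l) l) holomorphic_on U" for l
  proof (cases "exp l \<in> \<int>")
    case False
    define U where "U = (\<lambda>l. exp l) -` (- \<int> :: complex set)"
    have U: "open U" unfolding U_def
      by (intro continuous_open_vimage) (auto intro!: continuous_intros closed_Ints)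
    have "(\<lambda>l. (besselJLd (exp l) l * cos (exp l * of_real pi) - besselJLd (- exp l) l) / sin (exp l * of_real pi)) holomorphic_on U"
      using J[OF U] by (intro holomorphic_intros) (auto simp: U_def complex_sin_mult_pi_eq_0)
    then have "(\<lambda>l. besselYLd (exp l) l) holomorphic_on U"
      by (rule holomorphic_transform) (simp add: U_def besselYL_nonint)
    then show ?thesis using U False by (auto simp: U_def)
  next
    case True
    define n where "n = exp l"
    define U where "U = (\<lambda>l. exp l) -` (ball n (1/2))"
    have U: "open U" unfolding U_def
      by (intro continuous_open_vimage) (auto intro!: continuous_intros)
    have n: "n \<in> \<int>" using True by (simp add: n_def)
    have d: "circlepath n (1/2) t - exp l \<noteq> 0" if "l \<in> U" for l t
      using that cmod_circlepath[of "1/2" n t] by (auto simp: U_def dist_norm norm_minus_commute)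
    have "(\<lambda>l. integral {0..1} (\<lambda>t. besselYLd (circlepath n (1/2) t) l * (circlepath n (1/2) t - n)
              / (circlepath n (1/2) t - exp l))) holomorphic_on U"
    proof (rule integral_param_interval(1)[OF U])
      have "continuous_on (U \<times> {0..1}) (\<lambda>p. besselYLd (circlepath n (1/2) (snd p)) (fst p))"
        using continuous_on_besselYL_circle(2)[OF n] by (simp add: split_def)
      then show "continuous_on (U \<times> {0..1}) (\<lambda>(l, t). besselYLd (circlepath n (1/2) t) l * (circlepath n (1/2) t - n)
              / (circlepath n (1/2) t - exp l))"
        unfolding split_def using d by (intro continuous_intros) auto
    next
      fix t :: real
      have "circlepath n (1/2) t \<notin> \<int>" using circle_half_nonint[OF n] cmod_circlepath by simp
      then have "(\<lambda>l. besselYLd (circlepath n (1/2) t) l) holomorphic_on U"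
        using U by (simp add: besselYL_nonint besselJLd_def)
           (intro holomorphic_intros; simp add: complex_sin_mult_pi_eq_0)
      then show "(\<lambda>l. besselYLd (circlepath n (1/2) t) l * (circlepath n (1/2) t - n)
              / (circlepath n (1/2) t - exp l)) holomorphic_on U"
        using d by (intro holomorphic_intros)
    qed
    then have "(\<lambda>l. besselYLd (exp l) l) holomorphic_on U"
    proof (rule holomorphic_transform)
      fix l assume "l \<in> U"
      then have "cmod (exp l - n) < 1/2" by (auto simp: U_def dist_norm norm_minus_commute)
      from Cauchy_integral_interval[OF holomorphic_besselYL_order(2) this]
      show "integral {0..1} (\<lambda>t. besselYLd (circlepath n (1/2) t) l * (circlepath n (1/2) t - n)
              / (circlepath n (1/2) t - exp l)) = besselYLd (exp l) l" by simp
    qed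
    then show ?thesis using U by (auto simp: U_def n_def)
  qed
  then have "\<exists>D. ((\<lambda>l. besselYLd (exp l) l) has_field_derivative D) (at l)" for l
    by (metis holomorphic_derivI)
  then have "(\<lambda>l. besselYLd (exp l) l) holomorphic_on UNIV"
    unfolding holomorphic_on_open[OF open_UNIV] by blast
  then show ?thesis unfolding hankelF_def[abs_def] using J[OF open_UNIV] by (intro holomorphic_intros) auto
qed

lemma entire_eqI_real:
  assumes "F holomorphic_on UNIV" "G holomorphic_on UNIV" "\<And>x::real. F (of_real x) = G (of_real x)"
  shows "F = G"
proof
  fix z
  have "F z - G z = 0"
  proof (rule analytic_continuation[of "\<lambda>z. F z - G z" UNIV "range complex_of_real" 0])
    show "(0::complex) islimpt range complex_of_real"
      unfolding islimpt_approachable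
    proof (intro allI impI)
      fix e :: real assume "e > 0"
      then show "\<exists>x'\<in>range complex_of_real. x' \<noteq> 0 \<and> dist x' 0 < e"
        by (intro bexI[OF _ rangeI[of complex_of_real "e/2"]]) auto
    qed
  qed (use assms in \<open>auto intro: holomorphic_intros\<close>)
  then show "F z = G z" by simp
qed

lemma hankel1_deriv_diag_log_eq: "hankel1_deriv_diag_log = hankelF"
  unfolding hankel1_deriv_diag_log_def
proof (rule the_equality)
  show "hankelF holomorphic_on UNIV \<and> (\<forall>x>0. hankelF (of_real (ln x)) = deriv (hankel1 (of_real x)) (of_real x))"
    using holomorphic_hankelF deriv_hankel1_diag by simp
next
  fix F assume F: "F holomorphic_on UNIV \<and> (\<forall>x>0. F (of_real (ln x)) = deriv (hankel1 (of_real x)) (of_real x))"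
  show "F = hankelF"
  proof (rule entire_eqI_real)
    fix y :: real
    have "exp y > 0" by simp
    then show "F (of_real y) = hankelF (of_real y)"
      using F deriv_hankel1_diag[of "exp y"] by (metis ln_exp)
  qed (use F holomorphic_hankelF in auto)
qed

section \<open>The steepest descent curves\<close>

text \<open>Truncations of \<open>f\<close> are dominated by its norm. Stated for sequences of end
  points, the conclusion leaves the behaviour of F at both ends to be examined by the
  caller.\<close>

lemma integral_FTC_half_line:
  fixes f F :: "real \<Rightarrow> 'a::euclidean_space"
  assumes f: "f absolutely_integrable_on {0<..}"
    and F: "\<And>x. x > 0 \<Longrightarrow> (F has_vector_derivative f x) (at x)"
    and p: "\<And>n. p n > 0" "\<And>n. p n \<le> q n" "p \<longlonglongrightarrow> 0" and q: "filterlim q at_top sequentially"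
  shows "(\<lambda>n. F (q n) - F (p n)) \<longlonglongrightarrow> integral {0<..} f"
proof -
  have eq: "((\<lambda>x. if x \<in> {p n..q n} then f x else 0) has_integral (F (q n) - F (p n))) {0<..}" for n
  proof -
    have "(f has_integral (F (q n) - F (p n))) {p n..q n}"
    proof (rule fundamental_theorem_of_calculus[OF p(2)])
      fix x assume "x \<in> {p n..q n}"
      then have "x > 0" using p(1)[of n] by simp
      then show "(F has_vector_derivative f x) (at x within {p n..q n})"
        using F has_vector_derivative_at_within by blast
    qed
    moreover have "{p n..q n} \<subseteq> {0<..}" using p(1)[of n] by auto
    ultimately show ?thesis by (subst has_integral_restrict)
  qed
  have "(\<lambda>n. integral {0<..} (\<lambda>x. if x \<in> {p n..q n} then f x else 0)) \<longlonglongrightarrow> integral {0<..} f"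
  proof (rule dominated_convergence(2)[where h = "\<lambda>x. norm (f x)"])
    show "(\<lambda>x. if x \<in> {p n..q n} then f x else 0) integrable_on {0<..}" for n using eq by blast
    show "(\<lambda>x. norm (f x)) integrable_on {0<..}" using f by (simp add: absolutely_integrable_on_def)
    show "(\<lambda>n. if x \<in> {p n..q n} then f x else 0) \<longlonglongrightarrow> f x" if "x \<in> {0<..}" for x
    proof (rule tendsto_eventually)
      have "eventually (\<lambda>n. p n < x) sequentially" using p(3) that by (auto intro: order_tendstoD)
      moreover have "eventually (\<lambda>n. q n > x) sequentially" using q by (simp add: filterlim_at_top_dense)
      ultimately show "eventually (\<lambda>n. (if x \<in> {p n..q n} then f x else 0) = f x) sequentially"
        by eventually_elim auto
    qed
  qed auto
  then show ?thesis unfolding integral_unique[OF eq] .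
qed

text \<open>\<open>(x, cangle x)\<close>, for \<open>x > 0\<close>, is half of the steepest descent curve of \<open>sinh t - t\<close> through \<open>0\<close>; there
  \<open>sinh t - t = \<i> height x\<close>, and \<open>Kmass\<close> is the imaginary part of \<open>cosh t\<close>.\<close>

definition cangle :: "real \<Rightarrow> real" where "cangle x = arccos (x / sinh x)"
definition Kmass :: "real \<Rightarrow> real" where "Kmass x = sqrt ((sinh x)\<^sup>2 - x\<^sup>2)"
text \<open>The derivative of \<open>Kmass\<close>. As \<open>Kmass\<close> is the imaginary part of
  cosh t on the curve, this is the density of the imaginary part of sinh t dt; its sign makes the
  moments positive.\<close>

definition Kdens :: "real \<Rightarrow> real" where "Kdens x = (sinh x * cosh x - x) / Kmass x"
definition height :: "real \<Rightarrow> real" where "height x = cosh x * Kmass x / sinh x - cangle x"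
definition height' :: "real \<Rightarrow> real" where "height' x = (cosh x - x / sinh x)\<^sup>2 / Kmass x"

lemma sinh_gt_self:
  assumes "x > (0::real)"
  shows "sinh x > x"
proof -
  have "sinh 0 - 0 < sinh x - x"
  proof (rule DERIV_pos_imp_increasing_open[OF assms])
    fix y :: real assume "0 < y" "y < x"
    then have "cosh y > 1" using cosh_real_ge_1[of y] cosh_real_one_iff[of y] by linarith
    then show "\<exists>d. ((\<lambda>x. sinh x - x) has_real_derivative d) (at y) \<and> d > 0"
      by (intro exI[of _ "cosh y - 1"]) (auto intro!: derivative_eq_intros)
  qed (intro continuous_intros)
  then show ?thesis by simp
qed

context
  fixes x :: real
  assumes x: "x > 0"
begin

lemma sinh_ratio: "0 < x / sinh x" "x / sinh x < 1"
  using sinh_gt_self[OF x] x by (auto simp: divide_less_eq)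

lemma Kmass_pos: "Kmass x > 0"
  using sinh_gt_self[OF x] x by (simp add: Kmass_def power_strict_mono)

lemma Kmass_sq: "(Kmass x)\<^sup>2 = (sinh x)\<^sup>2 - x\<^sup>2"
  using sinh_gt_self[OF x] x by (simp add: Kmass_def power_mono)

lemma cos_cangle: "cos (cangle x) = x / sinh x"
  using sinh_ratio by (simp add: cangle_def)

lemma sin_cangle: "sin (cangle x) = Kmass x / sinh x"
proof -
  have "sin (cangle x) = sqrt (1 - (x / sinh x)\<^sup>2)"
    using sinh_ratio by (simp add: cangle_def sin_arccos)
  also have "1 - (x / sinh x)\<^sup>2 = ((sinh x)\<^sup>2 - x\<^sup>2) / (sinh x)\<^sup>2"
    using x by (simp add: field_simps)
  also have "sqrt \<dots> = Kmass x / sinh x"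
    using x by (simp add: Kmass_def real_sqrt_divide)
  finally show ?thesis .
qed

lemma cangle_bounds: "0 < cangle x" "cangle x < pi / 2"
proof -
  show "0 < cangle x" unfolding cangle_def using sinh_ratio arccos_less_arccos[of "x / sinh x" 1] by simp
  show "cangle x < pi / 2" unfolding cangle_def using sinh_ratio arccos_less_arccos[of 0 "x / sinh x"] by simp
qed

lemma cangle_deriv:
  "(cangle has_real_derivative (x * cosh x - sinh x) / (sinh x * Kmass x)) (at x)"
proof -
  have "(cangle has_real_derivative inverse (- sqrt (1 - (x / sinh x)\<^sup>2)) * ((sinh x - x * cosh x) / (sinh x)\<^sup>2)) (at x)"
    unfolding cangle_def[abs_def] using sinh_ratio x
    by (auto intro!: derivative_eq_intros simp: power2_eq_square field_simps)
  also have "sqrt (1 - (x / sinh x)\<^sup>2) = Kmass x / sinh x"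
    using sin_cangle sinh_ratio by (simp add: cangle_def sin_arccos)
  also have "inverse (- (Kmass x / sinh x)) * ((sinh x - x * cosh x) / (sinh x)\<^sup>2) = (x * cosh x - sinh x) / (sinh x * Kmass x)"
    using x Kmass_pos by (simp add: field_simps power2_eq_square)
  finally show ?thesis .
qed

lemma Kmass_deriv: "(Kmass has_real_derivative Kdens x) (at x)"
proof -
  have pos: "(sinh x)\<^sup>2 - x\<^sup>2 > 0" using Kmass_pos Kmass_sq by (metis zero_less_power)
  have "((\<lambda>x. sqrt ((sinh x)\<^sup>2 - x\<^sup>2)) has_real_derivative (inverse (sqrt ((sinh x)\<^sup>2 - x\<^sup>2)) / 2 * (2 * sinh x * cosh x - 2 * x))) (at x)"
    using pos by (auto intro!: derivative_eq_intros)
  moreover have "inverse r / 2 * (2 * a * b - 2 * c) = (a * b - c) / r" for r a b c :: real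
    by (cases "r = 0") (simp_all add: field_simps)
  ultimately show ?thesis unfolding Kmass_def[abs_def] Kdens_def[abs_def] by metis
qed

text \<open>With cosh^2 = sinh^2 + 1 and the formula for \<open>Kmass\<close> squared, the numerator
  collapses to the square of sinh x cosh x - x, from which the monotonicity of \<open>height\<close>
  is visible.\<close>

lemma height_deriv: "(height has_real_derivative height' x) (at x)"
proof -
  have "(height has_real_derivative ((sinh x * Kmass x + cosh x * Kdens x) * sinh x - cosh x * Kmass x * cosh x) / (sinh x * sinh x)
      - (x * cosh x - sinh x) / (sinh x * Kmass x)) (at x)"
    unfolding height_def[abs_def] using x
    by (auto intro!: derivative_eq_intros Kmass_deriv cangle_deriv simp: algebra_simps)
  moreover have "((sinh x * Kmass x + cosh x * Kdens x) * sinh x - cosh x * Kmass x * cosh x) / (sinh x * sinh x)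
      - (x * cosh x - sinh x) / (sinh x * Kmass x) = height' x"
  proof -
    let ?S = "sinh x" and ?C = "cosh x" and ?K = "Kmass x"
    have nz: "?S \<noteq> 0" "?K \<noteq> 0" using x Kmass_pos by auto
    have K2: "?K * ?K = ?S * ?S - x * x" using Kmass_sq by (simp add: power2_eq_square)
    have C2: "?C * ?C = ?S * ?S + 1" using cosh_square_eq[of x] by (simp add: power2_eq_square)
    have "((?S * ?K + ?C * Kdens x) * ?S - ?C * ?K * ?C) / (?S * ?S) - (x * ?C - ?S) / (?S * ?K)
       = ((?S * (?K * ?K) + ?C * (?S * ?C - x)) * ?S - (?C * ?C) * (?K * ?K) - (x * ?C - ?S) * ?S) / (?S * ?S * ?K)"
      using nz by (simp add: Kdens_def divide_simps)
    also have "(?S * (?K * ?K) + ?C * (?S * ?C - x)) * ?S - (?C * ?C) * (?K * ?K) - (x * ?C - ?S) * ?S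
      = (?S * ?C - x) * (?S * ?C - x)"
    proof -
      have "(?S * (?K * ?K) + ?C * (?S * ?C - x)) * ?S - (?C * ?C) * (?K * ?K) - (x * ?C - ?S) * ?S
        - (?S * ?C - x) * (?S * ?C - x) = (?S*?S - ?C*?C) * (?K * ?K) + ?S * ?S - x * x"
        by (simp add: algebra_simps)
      also have "\<dots> = 0" unfolding K2 C2 by (simp add: algebra_simps)
      finally show ?thesis by simp
    qed
    also have "(?S * ?C - x) * (?S * ?C - x) / (?S * ?S * ?K) = height' x"
      unfolding height'_def using nz by (simp add: power2_eq_square divide_simps) (simp add: algebra_simps)
    finally show ?thesis .
  qed
  ultimately show ?thesis by simp
qed

lemma height'_pos: "height' x > 0"
proof -
  have "cosh x - x / sinh x > 0" using sinh_ratio cosh_real_ge_1[of x] by linarith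
  then show ?thesis using Kmass_pos by (simp add: height'_def)
qed

lemma Kdens_nonneg: "Kdens x \<ge> 0"
proof -
  have "x \<le> sinh x * cosh x"
    using sinh_gt_self[OF x] cosh_real_ge_1[of x] x mult_mono[of x "sinh x" 1 "cosh x"] by simp
  then show ?thesis using Kmass_pos by (simp add: Kdens_def)
qed

text \<open>Trades the exponent for \<open>Kmass\<close>, whose derivative is the density
  \<open>Kdens\<close>; the resulting dominating functions have explicit primitives.\<close>

lemma height_ge: "height x \<ge> Kmass x - pi / 2"
proof -
  have "Kmass x * 1 \<le> Kmass x * (cosh x / sinh x)"
    using Kmass_pos sinh_le_cosh_real[of x] x by (intro mult_left_mono) auto
  then show ?thesis using cangle_bounds by (simp add: height_def mult.commute)
qed

end

lemma continuous_on_curve: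
  "continuous_on {0<..} cangle" "continuous_on {0<..} Kmass" "continuous_on {0<..} Kdens"
  "continuous_on {0<..} height" "continuous_on {0<..} height'"
proof -
  show "continuous_on {0<..} cangle" "continuous_on {0<..} height"
    by (rule DERIV_continuous_on, rule has_field_derivative_at_within, rule cangle_deriv height_deriv, simp)+
  show K: "continuous_on {0<..} Kmass" unfolding Kmass_def by (intro continuous_intros)
  show "continuous_on {0<..} Kdens" "continuous_on {0<..} height'"
    unfolding Kdens_def height'_def
    by (intro continuous_intros K; use Kmass_pos in force)+
qed

lemma Kmass_limits: "(Kmass \<longlongrightarrow> 0) (at_right 0)" "filterlim Kmass at_top at_top"
proof -
  have "(Kmass \<longlongrightarrow> Kmass 0) (at_right 0)"
    unfolding Kmass_def by (intro tendsto_intros)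
  then show "(Kmass \<longlongrightarrow> 0) (at_right 0)" by (simp add: Kmass_def)
  show "filterlim Kmass at_top at_top" unfolding Kmass_def sinh_field_def by real_asymp
qed

lemma cangle_limit: "(cangle \<longlongrightarrow> 0) (at_right 0)"
proof -
  have "((\<lambda>x::real. x / sinh x) \<longlongrightarrow> 1) (at_right 0)" unfolding sinh_field_def by real_asymp
  moreover have "eventually (\<lambda>x::real. x / sinh x \<in> {-1..1}) (at_right 0)"
    using eventually_at_right_less[of 0]
  proof eventually_elim
    case (elim x)
    have "- 1 \<le> x / sinh x" using sinh_ratio(1)[OF elim] by linarith
    then show ?case using sinh_ratio(2)[OF elim] by simp
  qed
  ultimately have "((\<lambda>x::real. arccos (x / sinh x)) \<longlongrightarrow> arccos 1) (at_right 0)"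
    using continuous_on_tendsto_compose[OF continuous_on_arccos', of "\<lambda>x. x / sinh x" 1 "at_right 0"]
    by simp
  then show ?thesis by (simp add: cangle_def[abs_def])
qed

lemma height_limits: "(height \<longlongrightarrow> 0) (at_right 0)" "filterlim height at_top at_top"
proof -
  have "((\<lambda>x. cosh x * sin (cangle x) - cangle x) \<longlongrightarrow> cosh 0 * sin 0 - 0) (at_right 0)"
    by (intro tendsto_intros cangle_limit)
  moreover have "eventually (\<lambda>x. cosh x * sin (cangle x) - cangle x = height x) (at_right 0)"
    using eventually_at_right_less[of 0] by eventually_elim (simp add: sin_cangle height_def)
  ultimately show "(height \<longlongrightarrow> 0) (at_right 0)" using Lim_transform_eventually by fastforce
  have "filterlim (\<lambda>x. - (pi/2) + Kmass x) at_top at_top"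
    using Kmass_limits(2) by (intro filterlim_tendsto_add_at_top[OF tendsto_const])
  moreover have "eventually (\<lambda>x. - (pi/2) + Kmass x \<le> height x) at_top"
    using eventually_gt_at_top[of 0] by eventually_elim (use height_ge in force)
  ultimately show "filterlim height at_top at_top" by (rule filterlim_at_top_mono)
qed

lemma height_strict_mono: "0 < x \<Longrightarrow> x < y \<Longrightarrow> height x < height y"
  by (rule DERIV_pos_imp_increasing[of x y height])
    (auto intro!: exI[of _ "height' _"] height_deriv height'_pos)

lemma height_pos: assumes "0 < x" shows "height x > 0"
proof -
  have "height y \<le> height (x/2)" if "0 < y" "y < x/2" for y using height_strict_mono that by (meson less_imp_le)
  then have "eventually (\<lambda>y. height y \<le> height (x/2)) (at_right 0)"
    using assms by (intro eventually_at_rightI[of 0 "x/2"]) auto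
  then have "0 \<le> height (x/2)" using height_limits(1) by (intro tendsto_upperbound) auto
  then show ?thesis using height_strict_mono[of "x/2" x] assms by simp
qed

lemma height_image: "height ` {0<..} = {0<..}"
proof (intro equalityI subsetI)
  fix y :: real assume y: "y \<in> {0<..}"
  have "eventually (\<lambda>x. height x < y) (at_right 0)" using height_limits(1) y by (auto intro: order_tendstoD)
  then obtain b where b: "b > 0" "\<And>x. 0 < x \<Longrightarrow> x < b \<Longrightarrow> height x < y"
    unfolding eventually_at_right_field by auto
  have "eventually (\<lambda>x. height x > y \<and> x > b) at_top"
    using height_limits(2) eventually_gt_at_top[of b] by (simp add: eventually_conj filterlim_at_top_dense)
  then obtain c where c: "height c > y" "c > b" using eventually_happens by fastforce
  have "\<exists>x. b/2 \<le> x \<and> x \<le> c \<and> height x = y"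
    using b(1) b(2)[of "b/2"] c
    by (intro IVT') (auto intro: continuous_on_subset[OF continuous_on_curve(4)])
  then show "y \<in> height ` {0<..}" using b(1) by force
qed (use height_pos in auto)

lemma cosh_sinh_Complex:
  "cosh (Complex a b) = Complex (cosh a * cos b) (sinh a * sin b)"
  "sinh (Complex a b) = Complex (sinh a * cos b) (cosh a * sin b)"
proof -
  have "Complex a b = of_real a + \<i> * of_real b" by (simp add: complex_eq_iff)
  moreover have "cosh (\<i> * of_real b) = of_real (cos b)" "sinh (\<i> * of_real b) = \<i> * of_real (sin b)"
    by (simp_all add: complex_eq_iff Re_exp Im_exp cosh_field_def sinh_field_def)
  moreover have "cosh (of_real a :: complex) = of_real (cosh a)" "sinh (of_real a :: complex) = of_real (sinh a)"
    by (simp_all add: complex_eq_iff Re_exp Im_exp cosh_field_def sinh_field_def)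
  ultimately show "cosh (Complex a b) = Complex (cosh a * cos b) (sinh a * sin b)"
    "sinh (Complex a b) = Complex (sinh a * cos b) (cosh a * sin b)"
    by (simp_all only: cosh_add sinh_add) (simp_all add: complex_eq_iff)
qed

definition sm :: "complex \<Rightarrow> complex" where "sm t = sinh t - t"

lemma sm_has_field_derivative [derivative_intros]: "(sm has_field_derivative (cosh t - 1)) (at t within A)"
  unfolding sm_def[abs_def] by (auto intro!: derivative_eq_intros)

text \<open>The two halves (\<open>e = \<plusminus>1\<close>) of the curves through \<open>0\<close> and through \<open>2 \<pi> \<i>\<close>.\<close>

definition tC :: "real \<Rightarrow> real \<Rightarrow> complex" where "tC e x = Complex (e * x) (cangle x)"
definition tU :: "real \<Rightarrow> real \<Rightarrow> complex" where "tU e x = Complex (e * x) (2 * pi - cangle x)"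

lemma sm_curve:
  assumes "x > 0" "e = 1 \<or> e = - 1"
  shows "sm (tC e x) = \<i> * height x" "sm (tU e x) = - \<i> * (height x + 2 * pi)"
    "cosh (tC e x) = Complex (cosh x * (x / sinh x)) (e * Kmass x)"
    "cosh (tU e x) = Complex (cosh x * (x / sinh x)) (- e * Kmass x)"
  using assms
  by (auto simp: sm_def tC_def tU_def cosh_sinh_Complex cos_cangle sin_cangle complex_eq_iff height_def
     cos_diff sin_diff)

lemma curve_has_vector_derivative:
  assumes "x > 0"
  shows "(tC e has_vector_derivative Complex e ((x * cosh x - sinh x) / (sinh x * Kmass x))) (at x)"
    "(tU e has_vector_derivative Complex e (- ((x * cosh x - sinh x) / (sinh x * Kmass x)))) (at x)"
  unfolding has_vector_derivative_complex_iff tC_def tU_def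
  using cangle_deriv[OF assms] by (auto intro!: derivative_eq_intros)

section \<open>Macdonald-type integrals\<close>

lemma integrable_exp_powr:
  assumes "p > (0::real)"
  shows "(\<lambda>y. exp (- y) * y powr (p - 1)) integrable_on {0<..}"
proof -
  have "(\<lambda>t. norm (complex_of_real t powr (of_real p - 1) / of_real (exp t))) integrable_on {0<..}"
    using absolutely_integrable_Gamma_integral'[of "of_real p"] assms
    by (simp add: absolutely_integrable_on_def)
  then show ?thesis
  proof (rule integrable_eq)
    fix t :: real assume "t \<in> {0<..}"
    then show "norm (complex_of_real t powr (of_real p - 1) / of_real (exp t)) = exp (- t) * t powr (p - 1)"
      by (simp add: norm_divide norm_mult norm_inverse norm_powr_real_powr exp_minus divide_inverse mult.commute)
  qed
qed

text \<open>The integral over y > 0 is 2 a^((c+1)/2) times the Macdonald function K of order c + 1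
  at 2 sqrt a.\<close>

definition macI :: "complex \<Rightarrow> complex \<Rightarrow> real \<Rightarrow> complex" where
  "macI c a y = exp (- of_real y - a / of_real y) * of_real y powr c"

definition mac :: "complex \<Rightarrow> complex \<Rightarrow> complex" where
  "mac c a = integral {0<..} (macI c a)"

lemma norm_macI: "y > 0 \<Longrightarrow> norm (macI c a y) = exp (- y) * exp (- Re a / y) * y powr Re c"
  by (simp add: macI_def norm_mult norm_powr_real_powr Re_divide_of_real flip: exp_add)

text \<open>The factor exp (- \<delta> / y) outweighs any power at 0: u <= exp u with u = \<delta> /
  (n y), raised to the power n > |Re c|, leaves an integrable Gamma integrand. The bound is uniform
  in Re a >= \<delta>, as differentiation in \<open>a\<close> requires.\<close>

lemma macI_dominated:
  assumes "\<delta> > 0"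
  obtains g where "g integrable_on {0<..}" "\<And>a y. Re a \<ge> \<delta> \<Longrightarrow> y > 0 \<Longrightarrow> norm (macI c a y) \<le> g y"
proof -
  define n where "n = nat \<lceil>\<bar>Re c\<bar>\<rceil> + 1"
  define g where "g = (\<lambda>y. (n / \<delta>) ^ n * (exp (- y) * y powr ((Re c + n + 1) - 1)))"
  have n: "n > 0" "Re c + n + 1 > 0" unfolding n_def by linarith+
  have "g integrable_on {0<..}"
    unfolding g_def by (intro integrable_on_mult_right integrable_exp_powr n)
  moreover have "norm (macI c a y) \<le> g y" if a: "Re a \<ge> \<delta>" and y: "y > 0" for a y
  proof -
    have "(\<delta> / y / n) ^ n \<le> exp (\<delta> / y / n) ^ n"
    proof (rule power_mono)
      show "\<delta> / y / n \<le> exp (\<delta> / y / n)"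
        using exp_ge_add_one_self[of "\<delta> / y / n"] by linarith
    qed (use assms y in auto)
    also have "\<dots> = exp (\<delta> / y)" unfolding exp_of_nat_mult[symmetric] using n by simp
    finally have "inverse (exp (\<delta> / y)) \<le> inverse ((\<delta> / y / n) ^ n)"
      using assms y n by (intro le_imp_inverse_le) auto
    also have "\<dots> = (n / \<delta>) ^ n * y ^ n"
      using assms y n by (simp add: field_simps)
    finally have 1: "exp (- \<delta> / y) \<le> (n / \<delta>) ^ n * y ^ n" by (simp add: exp_minus)
    have "exp (- Re a / y) \<le> exp (- \<delta> / y)" using a y by (simp add: divide_right_mono)
    then have "norm (macI c a y) \<le> exp (- y) * ((n / \<delta>) ^ n * y ^ n) * y powr Re c"
      unfolding norm_macI[OF y] using order_trans[OF _ 1] by (intro mult_right_mono mult_left_mono) auto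
    also have "y powr (Re c + n + 1 - 1) = y ^ n * y powr Re c" using y by (simp add: powr_add powr_realpow)
    then have "exp (- y) * ((n / \<delta>) ^ n * y ^ n) * y powr Re c = g y" by (simp add: g_def)
    finally show ?thesis .
  qed
  ultimately show ?thesis using that by blast
qed

lemma continuous_on_macI: "continuous_on {0<..} (macI c a)"
proof -
  have "continuous_on {0<..} (\<lambda>y::real. exp (- of_real y - a / of_real y) * exp (c * of_real (ln y)))"
    by (intro continuous_intros) auto
  then show ?thesis
    by (rule continuous_on_eq) (simp add: macI_def powr_def Ln_of_real)
qed

lemma macI_absolutely_integrable:
  assumes "Re a > 0"
  shows "macI c a absolutely_integrable_on {0<..}"
proof -
  obtain g where "g integrable_on {0<..}" "\<And>a' y. Re a' \<ge> Re a \<Longrightarrow> y > 0 \<Longrightarrow> norm (macI c a' y) \<le> g y"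
    using macI_dominated[OF assms] by blast
  then show ?thesis by (intro absolutely_integrable_on_dominated[of _ _ g] continuous_on_macI) auto
qed

lemmas macI_integrable = macI_absolutely_integrable[THEN set_lebesgue_integral_eq_integral(1)]

lemma mac_has_field_derivative:
  assumes a: "Re a > 0"
  shows "(mac c has_field_derivative - mac (c - 1) a) (at a)"
proof -
  obtain g where g: "g integrable_on {0<..}" "\<And>a' y. Re a' \<ge> Re a / 2 \<Longrightarrow> y > 0 \<Longrightarrow> norm (macI c a' y) \<le> g y"
    using macI_dominated[of "Re a / 2"] a by auto
  have d: "((\<lambda>a. macI c a y) has_field_derivative - macI (c - 1) a y) (at a)" if "y > 0" for y a
    unfolding macI_def using that by (auto intro!: derivative_eq_intros simp: powr_diff)
  have "((\<lambda>a. integral {0<..} (macI c a)) has_field_derivative integral {0<..} (\<lambda>y. deriv (\<lambda>a. macI c a y) a)) (at a)"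
  proof (rule integral_param_has_field_derivative[where e = "Re a / 2" and g = g])
    show "open {a. Re a > 0}" by (rule open_halfspace_Re_gt)
    show "(\<lambda>z. macI c z x) holomorphic_on {a. 0 < Re a}" if "x \<in> {0<..}" for x
      unfolding macI_def using that by (intro holomorphic_intros) auto
    show "norm (macI c w x) \<le> g x" if "w \<in> ball a (Re a / 2)" "x \<in> {0<..}" for w x
    proof -
      have "Re (a - w) < Re a / 2" using that complex_Re_le_cmod[of "a - w"] by (auto simp: dist_norm)
      then have "Re w \<ge> Re a / 2" by simp
      then show ?thesis using g that by auto
    qed
  qed (use a g macI_integrable in auto)
  also have "integral {0<..} (\<lambda>y. deriv (\<lambda>a. macI c a y) a) = integral {0<..} (\<lambda>y. - macI (c - 1) a y)"
    by (intro integral_cong DERIV_imp_deriv d) auto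
  also have "\<dots> = - mac (c - 1) a" by (simp add: mac_def)
  finally show ?thesis by (simp add: mac_def[abs_def])
qed

text \<open>The combination of the three integrands is the derivative of
  \<open>macI (- \<mu>) a\<close>. Since Re \<mu> = 0 the power has modulus 1, and the exponentials
  kill both boundary terms.\<close>

lemma mac_parts:
  assumes a: "Re a > 0" and mu: "Re \<mu> = 0"
  shows "a * mac (- \<mu> - 2) a = \<mu> * mac (- \<mu> - 1) a + mac (- \<mu>) a"
proof -
  define f where "f = (\<lambda>y. a * macI (- \<mu> - 2) a y - \<mu> * macI (- \<mu> - 1) a y - macI (- \<mu>) a y)"
  have d: "(macI (- \<mu>) a has_vector_derivative f y) (at y)" if y: "y > 0" for y
  proof -
    have "((\<lambda>z. exp (- z - a / z) * z powr (- \<mu>)) has_field_derivative f y) (at (of_real y))"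
      unfolding f_def macI_def using y
      by (auto intro!: derivative_eq_intros simp: complex_nonpos_Reals_iff powr_diff power2_eq_square field_simps)
    then show ?thesis unfolding macI_def[abs_def]
      using has_vector_derivative_real_field by blast
  qed
  have f: "f absolutely_integrable_on {0<..}"
    unfolding f_def using macI_absolutely_integrable[OF a]
    by (intro set_integral_diff(1) set_integrable_mult_right) auto
  have n: "norm (macI (- \<mu>) a y) = exp (- y) * exp (- Re a / y)" if "y > 0" for y
    using norm_macI[OF that] that mu by simp
  have "(\<lambda>n. macI (- \<mu>) a (real (Suc n)) - macI (- \<mu>) a (inverse (real (Suc n)))) \<longlonglongrightarrow> integral {0<..} f"
  proof (rule integral_FTC_half_line[OF f d])
    show "inverse (real (Suc n)) \<le> real (Suc n)" for n
      using inverse_le_1_iff[of "real (Suc n)"] by simp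
    show "(\<lambda>n. inverse (real (Suc n))) \<longlonglongrightarrow> 0" by (rule LIMSEQ_inverse_real_of_nat)
    show "filterlim (\<lambda>n. real (Suc n)) at_top sequentially" by real_asymp
  qed auto
  moreover have "(\<lambda>n. macI (- \<mu>) a (real (Suc n)) - macI (- \<mu>) a (inverse (real (Suc n)))) \<longlonglongrightarrow> 0 - 0"
  proof (intro tendsto_diff)
    show "(\<lambda>n. macI (- \<mu>) a (real (Suc n))) \<longlonglongrightarrow> 0"
    proof (rule Lim_null_comparison[OF always_eventually])
      show "\<forall>k. norm (macI (- \<mu>) a (real (Suc k))) \<le> exp (- real (Suc k)) * 1"
        using a by (intro allI) (subst n; (intro mult_left_mono)?; simp)
      show "(\<lambda>k. exp (- real (Suc k)) * 1) \<longlonglongrightarrow> 0" by real_asymp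
    qed
    show "(\<lambda>n. macI (- \<mu>) a (inverse (real (Suc n)))) \<longlonglongrightarrow> 0"
    proof (rule Lim_null_comparison[OF always_eventually])
      show "\<forall>k. norm (macI (- \<mu>) a (inverse (real (Suc k)))) \<le> 1 * exp (- Re a * real (Suc k))"
      proof
        fix k
        have "exp (- inverse (real (Suc k))) \<le> 1" by simp
        moreover have "- Re a / inverse (real (Suc k)) = - Re a * real (Suc k)" by (simp add: divide_inverse)
        ultimately show "norm (macI (- \<mu>) a (inverse (real (Suc k)))) \<le> 1 * exp (- Re a * real (Suc k))"
          by (subst n) (auto intro!: mult_right_mono)
      qed
      show "(\<lambda>k. 1 * exp (- Re a * real (Suc k))) \<longlonglongrightarrow> 0" using a by real_asymp
    qed
  qed
  ultimately have "integral {0<..} f = 0" using LIMSEQ_unique by fastforce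
  moreover have "integral {0<..} f = a * mac (- \<mu> - 2) a - \<mu> * mac (- \<mu> - 1) a - mac (- \<mu>) a"
  proof -
    have i: "(\<lambda>y. c * macI c' a y) integrable_on {0<..}" for c c'
      by (intro integrable_on_mult_right macI_integrable a)
    show ?thesis unfolding f_def mac_def
      by (simp add: integral_diff[OF integrable_diff[OF i i] macI_integrable[OF a]] integral_diff[OF i i])
  qed
  ultimately show ?thesis by (simp add: algebra_simps)
qed

text \<open>Substitution y -> a / y. In terms of Macdonald functions this is the symmetry K_(-s) =
  K_s.\<close>

lemma mac_reflect:
  assumes a: "a > (0::real)"
  shows "of_real a powr (c + 1) * mac (- c - 2) (of_real a) = mac c (of_real a)"
proof -
  have img: "(\<lambda>v. a / v) ` {0<..} = {0::real<..}"
  proof (intro equalityI subsetI)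
    fix y :: real assume "y \<in> {0<..}"
    then show "y \<in> (\<lambda>v. a / v) ` {0<..}" using a by (intro image_eqI[of _ _ "a / y"]) auto
  qed (use a in auto)
  have "(\<lambda>x. \<bar>- a / x\<^sup>2\<bar> *\<^sub>R macI (- c - 2) a (a / x)) absolutely_integrable_on {0<..} \<and>
        integral {0<..} (\<lambda>x. \<bar>- a / x\<^sup>2\<bar> *\<^sub>R macI (- c - 2) a (a / x)) = mac (- c - 2) a
       \<longleftrightarrow> macI (- c - 2) a absolutely_integrable_on ((\<lambda>v. a / v) ` {0<..}) \<and>
           integral ((\<lambda>v. a / v) ` {0<..}) (macI (- c - 2) a) = mac (- c - 2) a"
  proof (rule has_absolute_integral_change_of_variables_real)
    show "((\<lambda>v. a / v) has_real_derivative - a / x\<^sup>2) (at x within {0<..})" if "x \<in> {0<..}" for x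
      using that by (auto intro!: derivative_eq_intros simp: power2_eq_square)
    show "inj_on (\<lambda>v. a / v) {0<..}" using a by (auto simp: inj_on_def)
  qed auto
  then have "integral {0<..} (\<lambda>x. \<bar>- a / x\<^sup>2\<bar> *\<^sub>R macI (- c - 2) a (a / x)) = mac (- c - 2) a"
    using macI_absolutely_integrable[of a] a by (simp add: img mac_def)
  also have "integral {0<..} (\<lambda>x. \<bar>- a / x\<^sup>2\<bar> *\<^sub>R macI (- c - 2) a (a / x))
     = integral {0<..} (\<lambda>x. of_real a powr (- c - 1) * macI c a x)"
  proof (rule integral_cong)
    fix x :: real assume x: "x \<in> {0<..}"
    have p: "of_real (a / x) powr (- c - 2) = of_real a powr (- c - 1) * of_real x powr c * (of_real x)\<^sup>2 / complex_of_real a"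
    proof -
      have "of_real (a / x) powr (- c - 2) = of_real a powr (- c - 2) * of_real (inverse x) powr (- c - 2)"
        using x a by (simp add: powr_times_real divide_inverse del: of_real_inverse)
      also have "of_real a powr (- c - 2) = of_real a powr (- c - 1) / complex_of_real a"
        using a by (simp add: powr_diff power2_eq_square)
      also have "of_real (inverse x) powr (- c - 2) = of_real x powr (c + 2)"
        using x by (simp add: powr_def Ln_of_real ln_inverse del: of_real_inverse) (simp add: algebra_simps)
      also have "\<dots> = of_real x powr c * (of_real x)\<^sup>2" using x by (simp add: powr_add)
      finally show ?thesis by simp
    qed
    have e: "exp (- of_real (a / x) - of_real a / of_real (a / x)) = exp (- of_real x - of_real a / complex_of_real x)"
    proof -
      have q: "of_real a / of_real (a / x) = complex_of_real x" using x a by simp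
      show ?thesis unfolding q unfolding of_real_divide by (rule arg_cong[of _ _ exp], rule minus_diff_commute)
    qed
    show "\<bar>- a / x\<^sup>2\<bar> *\<^sub>R macI (- c - 2) a (a / x) = of_real a powr (- c - 1) * macI c a x"
      unfolding macI_def e p using x a by (simp add: scaleR_conv_of_real field_simps)
  qed
  also have "\<dots> = of_real a powr (- c - 1) * mac c a" by (simp add: mac_def)
  finally have "mac (- c - 2) a = of_real a powr (- c - 1) * mac c a" by simp
  then have "of_real a powr (c + 1) * mac (- c - 2) (of_real a) = (of_real a powr (c + 1) * of_real a powr (- c - 1)) * mac c a"
    by (simp add: mult.assoc)
  also have "of_real a powr (c + 1) * of_real a powr (- c - 1) = (1::complex)"
    using a by (simp flip: powr_add)
  finally show ?thesis by simp
qed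

text \<open>Supplies the values at a -> 0 by which the constant Wronskians are identified.\<close>

lemma mac_tendsto_Gamma:
  assumes "Re c > - 1"
  shows "(\<lambda>n. mac c (of_real (inverse (real (Suc n))))) \<longlonglongrightarrow> Gamma (c + 1)"
proof -
  have "(\<lambda>n. integral {0<..} (macI c (of_real (inverse (real (Suc n)))))) \<longlonglongrightarrow> integral {0<..} (\<lambda>t. of_real t powr (c + 1 - 1) / of_real (exp t))"
  proof (rule dominated_convergence(2))
    show "macI c (of_real (inverse (real (Suc k)))) integrable_on {0<..}" for k by (rule macI_integrable) simp
    show "(\<lambda>y. exp (- y) * y powr (Re c + 1 - 1)) integrable_on {0<..}" using assms by (intro integrable_exp_powr) auto
    show "norm (macI c (of_real (inverse (real (Suc k)))) x) \<le> exp (- x) * x powr (Re c + 1 - 1)" if "x \<in> {0<..}" for k x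
      using that by (simp add: norm_macI mult_left_le_one_le mult_right_le_one_le mult.assoc)
    show "(\<lambda>k. macI c (of_real (inverse (real (Suc k)))) x) \<longlonglongrightarrow> of_real x powr (c + 1 - 1) / of_real (exp x)" if "x \<in> {0<..}" for x
    proof -
      have "(\<lambda>k. exp (- of_real x - of_real (inverse (real (Suc k))) / of_real x) * of_real x powr c) \<longlonglongrightarrow> exp (- of_real x - of_real 0 / of_real x) * of_real x powr c"
        by (intro tendsto_intros LIMSEQ_inverse_real_of_nat) (use that in auto)
      then show ?thesis unfolding macI_def by (simp add: exp_minus divide_inverse mult.commute exp_of_real)
    qed
  qed
  also have "integral {0<..} (\<lambda>t. of_real t powr (c + 1 - 1) / of_real (exp t)) = Gamma (c + 1)"
    using assms by (intro integral_unique Gamma_integral_complex') auto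
  finally show ?thesis by (simp add: mac_def)
qed

section \<open>Macdonald integrals as Bessel series, by Wronskians\<close>

lemma besselS_recurrence: "besselS (\<mu> - 1) a = \<mu> * besselS \<mu> a + a * besselS (\<mu> + 1) a"
proof -
  have s: "summable (\<lambda>k. a ^ k * (\<mu> * rGamma (\<mu> + of_nat k + 1)) / fact k)"
    using summable_mult[OF summable_besselS[of a \<mu>], of \<mu>] by (simp add: mult_ac)
  have t: "(\<lambda>k. a ^ k * rGamma ((\<mu> - 1) + of_nat k + 1) / fact k) =
     (\<lambda>k. a ^ k * (\<mu> * rGamma (\<mu> + of_nat k + 1)) / fact k + a ^ k * (of_nat k * rGamma (\<mu> + of_nat k + 1)) / fact k)"
  proof
    fix k
    have "rGamma ((\<mu> - 1) + of_nat k + 1) = (\<mu> + of_nat k) * rGamma (\<mu> + of_nat k + 1)"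
      using rGamma_plus1[of "\<mu> + of_nat k"] by simp
    then show "a ^ k * rGamma ((\<mu> - 1) + of_nat k + 1) / fact k = a ^ k * (\<mu> * rGamma (\<mu> + of_nat k + 1)) / fact k + a ^ k * (of_nat k * rGamma (\<mu> + of_nat k + 1)) / fact k"
      by (simp add: algebra_simps add_divide_distrib)
  qed
  have r: "a ^ Suc k * (of_nat (Suc k) * rGamma (\<mu> + of_nat (Suc k) + 1)) / fact (Suc k)
     = a * (a ^ k * rGamma (\<mu> + 1 + of_nat k + 1) / fact k)" for k
    by (simp add: field_simps del: of_nat_Suc) (simp add: algebra_simps)
  have s2: "summable (\<lambda>k. a ^ k * (of_nat k * rGamma (\<mu> + of_nat k + 1)) / fact k)"
    by (subst summable_Suc_iff[symmetric], subst r, intro summable_mult summable_besselS)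
  have "besselS (\<mu> - 1) a = (\<Sum>k. a ^ k * (\<mu> * rGamma (\<mu> + of_nat k + 1)) / fact k) + (\<Sum>k. a ^ k * (of_nat k * rGamma (\<mu> + of_nat k + 1)) / fact k)"
    unfolding besselS_def t by (rule suminf_add[OF s s2, symmetric])
  also have "(\<Sum>k. a ^ k * (\<mu> * rGamma (\<mu> + of_nat k + 1)) / fact k) = \<mu> * besselS \<mu> a"
    unfolding besselS_def suminf_mult[OF summable_besselS, symmetric] by (simp add: mult_ac)
  also have "(\<Sum>k. a ^ k * (of_nat k * rGamma (\<mu> + of_nat k + 1)) / fact k) = a * besselS (\<mu> + 1) a"
    using suminf_split_head[OF s2] r suminf_mult[OF summable_besselS[of a "\<mu> + 1"], of a] by (simp add: besselS_def)
  finally show ?thesis .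
qed

text \<open>The recurrence makes the derivative in \<open>a\<close> zero; at a = 0 only the leading
  coefficients survive, and the reflection formula for Gamma evaluates them.\<close>

lemma besselS_wronskian:
  "besselS (\<mu> - 1) a * besselS (- \<mu>) a - a * besselS \<mu> a * besselS (1 - \<mu>) a = sin (\<mu> * of_real pi) / of_real pi"
proof -
  define W where "W = (\<lambda>a. besselS (\<mu> - 1) a * besselS (- \<mu>) a - a * besselS \<mu> a * besselS (1 - \<mu>) a)"
  have "(W has_field_derivative 0) (at a)" for a
  proof -
    have "(W has_field_derivative (besselS \<mu> a * besselS (- \<mu>) a + besselS (1 - \<mu>) a * besselS (\<mu> - 1) a
       - ((besselS \<mu> a + besselS (\<mu> + 1) a * a) * besselS (1 - \<mu>) a + besselS (2 - \<mu>) a * (a * besselS \<mu> a)))) (at a)"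
      unfolding W_def by (auto intro!: derivative_eq_intros simp: algebra_simps)
    also have "(besselS \<mu> a * besselS (- \<mu>) a + besselS (1 - \<mu>) a * besselS (\<mu> - 1) a
       - ((besselS \<mu> a + besselS (\<mu> + 1) a * a) * besselS (1 - \<mu>) a + besselS (2 - \<mu>) a * (a * besselS \<mu> a))) = 0"
    proof -
      have r1: "besselS (- \<mu>) a = (1 - \<mu>) * besselS (1 - \<mu>) a + a * besselS (2 - \<mu>) a"
        using besselS_recurrence[of "1 - \<mu>" a] by simp
      show ?thesis unfolding r1 besselS_recurrence[of \<mu> a] by (simp add: algebra_simps)
    qed
    finally show ?thesis .
  qed
  then have "W a = W 0"
    using has_field_derivative_zero_constant[of UNIV W] by force
  also have "W 0 = rGamma \<mu> * rGamma (1 - \<mu>)"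
    by (simp add: W_def besselS_0 mult.commute)
  finally show ?thesis by (simp add: W_def rGamma_reflection_complex mult.commute)
qed

lemma constant_of_DERIV_zero_halfplane:
  assumes "\<And>a. Re a > 0 \<Longrightarrow> (f has_field_derivative 0) (at a)" "Re a > 0"
    and "(\<lambda>n. f (of_real (inverse (real (Suc n))))) \<longlonglongrightarrow> L"
  shows "f a = L"
proof -
  have "\<exists>c. \<forall>x\<in>{a. Re a > 0}. f x = c"
    using assms(1) by (intro has_field_derivative_zero_constant convex_halfspace_Re_gt) (auto intro: has_field_derivative_at_within)
  then obtain c where c: "\<And>x. Re x > 0 \<Longrightarrow> f x = c" by auto
  then have "f (of_real (inverse (real (Suc n)))) = c" for n by (intro c) simp
  then have "L = c" using assms(3) LIMSEQ_unique tendsto_const by (metis (no_types, lifting) LIMSEQ_const_iff ext)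
  then show ?thesis using c assms(2) by simp
qed

context
  fixes \<mu> :: complex
  assumes mu: "Re \<mu> = 0" "\<mu> \<noteq> 0"
begin

lemma mac_deriv_order:
  assumes "Re a > 0"
  shows "(mac (- \<mu> - 1) has_field_derivative - (\<mu> * mac (- \<mu> - 1) a + mac (- \<mu>) a) / a) (at a)"
    "(mac (- \<mu>) has_field_derivative - mac (- \<mu> - 1) a) (at a)"
proof -
  have "a \<noteq> 0" using assms by auto
  then have "mac (- \<mu> - 2) a = (\<mu> * mac (- \<mu> - 1) a + mac (- \<mu>) a) / a"
    using mac_parts[OF assms mu(1)] by (simp add: field_simps)
  moreover have "- \<mu> - 1 - 1 = - \<mu> - 2" by simp
  ultimately show "(mac (- \<mu> - 1) has_field_derivative - (\<mu> * mac (- \<mu> - 1) a + mac (- \<mu>) a) / a) (at a)"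
    using mac_has_field_derivative[OF assms, of "- \<mu> - 1"] by (simp only: minus_divide_left)
  show "(mac (- \<mu>) has_field_derivative - mac (- \<mu> - 1) a) (at a)"
    by (rule mac_has_field_derivative[OF assms])
qed

lemma besselS_limit: "(\<lambda>n. besselS c (of_real (inverse (real (Suc n))))) \<longlonglongrightarrow> rGamma (c + 1)"
proof -
  have "(\<lambda>n. besselS c (of_real (inverse (real (Suc n))))) \<longlonglongrightarrow> besselS c (of_real 0)"
    by (rule isCont_tendsto_compose[OF DERIV_isCont[OF besselS_has_field_derivative]])
       (intro tendsto_of_real LIMSEQ_inverse_real_of_nat)
  then show ?thesis by (simp add: besselS_0)
qed

lemma rGamma_Gamma_mu: "rGamma (1 + \<mu>) * Gamma (1 + \<mu>) = 1" "rGamma (1 - \<mu>) * Gamma (1 - \<mu>) = 1"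
proof -
  have "Gamma z \<noteq> 0" if "Re z = 1" for z :: complex
    using that by (auto simp: Gamma_eq_zero_iff elim!: nonpos_Ints_cases)
  then show "rGamma (1 + \<mu>) * Gamma (1 + \<mu>) = 1" "rGamma (1 - \<mu>) * Gamma (1 - \<mu>) = 1"
    using mu by (simp_all add: rGamma_inverse_Gamma)
qed

text \<open>The index - \<mu> - 1 has real part -1, just outside the Gamma limit. Integration by
  parts expresses it through the indices - \<mu> - 2 and - \<mu>, and reflection carries - \<mu> - 2
  to \<mu>, where the Gamma limit applies.\<close>

lemma mac_small:
  "(\<lambda>n. of_real (inverse (real (Suc n))) * mac (- \<mu> - 1) (of_real (inverse (real (Suc n))))) \<longlonglongrightarrow> 0"
proof -
  define a where "a = (\<lambda>n. inverse (real (Suc n)))"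
  have a: "a n > 0" for n by (simp add: a_def)
  have al: "a \<longlonglongrightarrow> 0" unfolding a_def by (rule LIMSEQ_inverse_real_of_nat)
  have eq: "of_real (a n) * mac (- \<mu> - 1) (of_real (a n)) =
      (of_real (a n) powr (- \<mu>) * (of_real (a n) * mac \<mu> (of_real (a n))) - of_real (a n) * mac (- \<mu>) (of_real (a n))) / \<mu>" for n
  proof -
    have an: "complex_of_real (a n) \<noteq> 0" using a[of n] by simp
    have "of_real (a n) powr (- \<mu>) * mac \<mu> (of_real (a n)) = of_real (a n) powr (- \<mu>) * of_real (a n) powr (\<mu> + 1) * mac (- \<mu> - 2) (of_real (a n))"
      using mac_reflect[OF a[of n], of \<mu>] by simp
    also have "of_real (a n) powr (- \<mu>) * of_real (a n) powr (\<mu> + 1) = of_real (a n)"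
      using an by (simp flip: powr_add)
    also have "of_real (a n) * mac (- \<mu> - 2) (of_real (a n)) = \<mu> * mac (- \<mu> - 1) (of_real (a n)) + mac (- \<mu>) (of_real (a n))"
      using mac_parts[OF _ mu(1)] a by simp
    finally show ?thesis using mu(2) by (simp add: field_simps)
  qed
  have z: "(\<lambda>n. of_real (a n) * mac c (of_real (a n))) \<longlonglongrightarrow> 0" if "Re c = 0" for c
    using tendsto_mult[OF tendsto_of_real[OF al] mac_tendsto_Gamma[of c]] that by (simp add: a_def)
  have "(\<lambda>n. of_real (a n) powr (- \<mu>) * (of_real (a n) * mac \<mu> (of_real (a n)))) \<longlonglongrightarrow> 0"
  proof (rule Lim_null_comparison[OF always_eventually])
    show "\<forall>n. norm (of_real (a n) powr (- \<mu>) * (of_real (a n) * mac \<mu> (of_real (a n)))) \<le> norm (of_real (a n) * mac \<mu> (of_real (a n)))"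
      using a mu by (simp add: norm_mult norm_powr_real_powr less_imp_le)
    show "(\<lambda>n. norm (of_real (a n) * mac \<mu> (of_real (a n)))) \<longlonglongrightarrow> 0"
      using z mu tendsto_norm_zero by blast
  qed
  then have "(\<lambda>n. (of_real (a n) powr (- \<mu>) * (of_real (a n) * mac \<mu> (of_real (a n))) - of_real (a n) * mac (- \<mu>) (of_real (a n))) / \<mu>) \<longlonglongrightarrow> (0 - 0) / \<mu>"
    using z mu by (intro tendsto_intros) auto
  then show ?thesis unfolding eq[symmetric] by (simp add: a_def)
qed

text \<open>Both left sides, the first after multiplication by a^\<mu>, have derivative 0 by the
  recurrences. The constants are read off at a -> 0; the terms with index - \<mu> - 1 disappear
  there by \<open>mac_small\<close>.\<close>

lemma mac_besselS_wronskians: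
  assumes a: "Re a > 0"
  shows "mac (- \<mu> - 1) a * besselS (\<mu> - 1) a + mac (- \<mu>) a * besselS \<mu> a = a powr (- \<mu>)"
    "a * mac (- \<mu> - 1) a * besselS (1 - \<mu>) a + mac (- \<mu>) a * besselS (- \<mu>) a = 1"
proof -
  define C1 where "C1 = (\<lambda>a. a powr \<mu> * (mac (- \<mu> - 1) a * besselS (\<mu> - 1) a + mac (- \<mu>) a * besselS \<mu> a))"
  define C2 where "C2 = (\<lambda>a. a * mac (- \<mu> - 1) a * besselS (1 - \<mu>) a + mac (- \<mu>) a * besselS (- \<mu>) a)"
  define r where "r = (\<lambda>n. inverse (real (Suc n)))"
  have r: "r n > 0" for n by (simp add: r_def)
  have "C1 a = 1"
  proof (rule constant_of_DERIV_zero_halfplane[OF _ a])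
    fix a :: complex assume a: "Re a > 0"
    then have a0: "a \<noteq> 0" "a \<notin> \<real>\<^sub>\<le>\<^sub>0" by (auto simp: complex_nonpos_Reals_iff)
    let ?k = "mac (- \<mu> - 1) a" and ?q = "mac (- \<mu>) a"
    have "(C1 has_field_derivative (\<mu> * a powr (\<mu> - 1)) * (?k * besselS (\<mu> - 1) a + ?q * besselS \<mu> a)
       + a powr \<mu> * (- (\<mu> * ?k + ?q) / a * besselS (\<mu> - 1) a + ?k * besselS \<mu> a - ?k * besselS \<mu> a + ?q * besselS (\<mu> + 1) a)) (at a)"
      unfolding C1_def
      by (rule derivative_eq_intros mac_deriv_order a has_field_derivative_powr a0 refl | simp)+
    also have "a powr (\<mu> - 1) = a powr \<mu> / a" using a0 by (simp add: powr_diff)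
    also have "(\<mu> * (a powr \<mu> / a)) * (?k * besselS (\<mu> - 1) a + ?q * besselS \<mu> a)
       + a powr \<mu> * (- (\<mu> * ?k + ?q) / a * besselS (\<mu> - 1) a + ?k * besselS \<mu> a - ?k * besselS \<mu> a + ?q * besselS (\<mu> + 1) a)
       = a powr \<mu> * ?q / a * (\<mu> * besselS \<mu> a + a * besselS (\<mu> + 1) a - besselS (\<mu> - 1) a)"
      using a0 by (simp add: field_simps)
    also have "\<dots> = 0" using besselS_recurrence[of \<mu> a] by simp
    finally show "(C1 has_field_derivative 0) (at a)" .
  next
    have eq: "C1 (of_real (r n)) = mac \<mu> (of_real (r n)) * besselS \<mu> (of_real (r n))
        + of_real (r n) powr \<mu> * (of_real (r n) * mac (- \<mu> - 1) (of_real (r n))) * besselS (\<mu> + 1) (of_real (r n))" for n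
    proof -
      have rn: "complex_of_real (r n) \<noteq> 0" using r[of n] by simp
      have "C1 (of_real (r n)) = of_real (r n) powr \<mu> * (\<mu> * mac (- \<mu> - 1) (of_real (r n)) + mac (- \<mu>) (of_real (r n))) * besselS \<mu> (of_real (r n))
        + of_real (r n) powr \<mu> * (of_real (r n) * mac (- \<mu> - 1) (of_real (r n))) * besselS (\<mu> + 1) (of_real (r n))"
        unfolding C1_def besselS_recurrence[of \<mu>] by (simp add: algebra_simps)
      also have "\<mu> * mac (- \<mu> - 1) (of_real (r n)) + mac (- \<mu>) (of_real (r n)) = of_real (r n) * mac (- \<mu> - 2) (of_real (r n))"
        using mac_parts[OF _ mu(1), of "of_real (r n)"] r by simp
      also have "of_real (r n) powr \<mu> * (of_real (r n) * mac (- \<mu> - 2) (of_real (r n))) = of_real (r n) powr (\<mu> + 1) * mac (- \<mu> - 2) (of_real (r n))"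
        using rn by (simp add: powr_add)
      also have "\<dots> = mac \<mu> (of_real (r n))" by (rule mac_reflect[OF r])
      finally show ?thesis .
    qed
    have "(\<lambda>n. of_real (r n) powr \<mu> * (of_real (r n) * mac (- \<mu> - 1) (of_real (r n)))) \<longlonglongrightarrow> 0"
    proof (rule Lim_null_comparison[OF always_eventually])
      show "\<forall>n. norm (of_real (r n) powr \<mu> * (of_real (r n) * mac (- \<mu> - 1) (of_real (r n)))) \<le> norm (of_real (r n) * mac (- \<mu> - 1) (of_real (r n)))"
        using r mu by (simp add: norm_mult norm_powr_real_powr less_imp_le)
      show "(\<lambda>n. norm (of_real (r n) * mac (- \<mu> - 1) (of_real (r n)))) \<longlonglongrightarrow> 0"
        using mac_small tendsto_norm_zero unfolding r_def by blast
    qed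
    then have "(\<lambda>n. C1 (of_real (r n))) \<longlonglongrightarrow> Gamma (\<mu> + 1) * rGamma (\<mu> + 1) + 0 * rGamma (\<mu> + 1 + 1)"
      unfolding eq using mac_tendsto_Gamma[of \<mu>] besselS_limit[of \<mu>] besselS_limit[of "\<mu> + 1"] mu
      by (intro tendsto_intros) (simp_all add: r_def)
    then show "(\<lambda>n. C1 (of_real (inverse (real (Suc n))))) \<longlonglongrightarrow> 1"
      using rGamma_Gamma_mu by (simp add: r_def ac_simps)
  qed
  moreover have "a \<noteq> 0" using a by auto
  then have "a powr (- \<mu>) * a powr \<mu> = 1" by (simp flip: powr_add)
  then have "a powr (- \<mu>) * C1 a = mac (- \<mu> - 1) a * besselS (\<mu> - 1) a + mac (- \<mu>) a * besselS \<mu> a"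
    unfolding C1_def mult.assoc[symmetric] by simp
  ultimately show "mac (- \<mu> - 1) a * besselS (\<mu> - 1) a + mac (- \<mu>) a * besselS \<mu> a = a powr (- \<mu>)"
    by simp
  have "C2 a = 1"
  proof (rule constant_of_DERIV_zero_halfplane[OF _ a])
    fix a :: complex assume a: "Re a > 0"
    then have a0: "a \<noteq> 0" by auto
    let ?k = "mac (- \<mu> - 1) a" and ?q = "mac (- \<mu>) a"
    have "(C2 has_field_derivative (?k + a * (- (\<mu> * ?k + ?q) / a)) * besselS (1 - \<mu>) a + a * ?k * besselS (2 - \<mu>) a
       - ?k * besselS (- \<mu>) a + ?q * besselS (1 - \<mu>) a) (at a)"
      unfolding C2_def
      by (rule derivative_eq_intros mac_deriv_order a refl | simp)+
    also have "(?k + a * (- (\<mu> * ?k + ?q) / a)) * besselS (1 - \<mu>) a + a * ?k * besselS (2 - \<mu>) a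
       - ?k * besselS (- \<mu>) a + ?q * besselS (1 - \<mu>) a = ?k * ((1 - \<mu>) * besselS (1 - \<mu>) a + a * besselS (1 - \<mu> + 1) a - besselS (1 - \<mu> - 1) a)"
    proof -
      have "a * (- (\<mu> * ?k + ?q) / a) = - (\<mu> * ?k + ?q)" using a0 by simp
      then show ?thesis by (simp only:) (simp add: algebra_simps)
    qed
    also have "\<dots> = 0" using besselS_recurrence[of "1 - \<mu>" a] by simp
    finally show "(C2 has_field_derivative 0) (at a)" .
  next
    have "(\<lambda>n. C2 (of_real (inverse (real (Suc n))))) \<longlonglongrightarrow> 0 * rGamma (1 - \<mu> + 1) + Gamma (- \<mu> + 1) * rGamma (- \<mu> + 1)"
      unfolding C2_def using mac_tendsto_Gamma[of "- \<mu>"] mu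
      by (intro tendsto_intros mac_small besselS_limit) simp
    then show "(\<lambda>n. C2 (of_real (inverse (real (Suc n))))) \<longlonglongrightarrow> 1"
      using rGamma_Gamma_mu by (simp add: ac_simps)
  qed
  then show "a * mac (- \<mu> - 1) a * besselS (1 - \<mu>) a + mac (- \<mu>) a * besselS (- \<mu>) a = 1"
    by (simp add: C2_def)
qed

text \<open>The two Wronskians form a linear system for the two integrals; this is Cramer's rule,
  with \<open>besselS_wronskian\<close> as the determinant.\<close>

lemma mac_eq_besselS:
  assumes a: "Re a > 0"
  shows "mac (- \<mu> - 1) a * sin (\<mu> * of_real pi) = of_real pi * (a powr (- \<mu>) * besselS (- \<mu>) a - besselS \<mu> a)"
    "mac (- \<mu>) a * sin (\<mu> * of_real pi) = of_real pi * (besselS (\<mu> - 1) a - a powr (- \<mu>) * a * besselS (1 - \<mu>) a)"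
proof -
  let ?k = "mac (- \<mu> - 1) a" and ?q = "mac (- \<mu>) a"
  note w = mac_besselS_wronskians[OF a]
  have s: "sin (\<mu> * of_real pi) = of_real pi * (besselS (\<mu> - 1) a * besselS (- \<mu>) a - a * besselS \<mu> a * besselS (1 - \<mu>) a)"
    using besselS_wronskian[of \<mu> a] by simp
  have "?k * (besselS (\<mu> - 1) a * besselS (- \<mu>) a - a * besselS \<mu> a * besselS (1 - \<mu>) a)
     = (?k * besselS (\<mu> - 1) a + ?q * besselS \<mu> a) * besselS (- \<mu>) a
       - (a * ?k * besselS (1 - \<mu>) a + ?q * besselS (- \<mu>) a) * besselS \<mu> a"
    by (simp add: algebra_simps)
  also have "\<dots> = a powr (- \<mu>) * besselS (- \<mu>) a - 1 * besselS \<mu> a"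
    by (simp only: w)
  finally have "a powr (- \<mu>) * besselS (- \<mu>) a - 1 * besselS \<mu> a = ?k * (besselS (\<mu> - 1) a * besselS (- \<mu>) a - a * besselS \<mu> a * besselS (1 - \<mu>) a)" ..
  then show "?k * sin (\<mu> * of_real pi) = of_real pi * (a powr (- \<mu>) * besselS (- \<mu>) a - besselS \<mu> a)"
    unfolding s by simp
  have "?q * (besselS (\<mu> - 1) a * besselS (- \<mu>) a - a * besselS \<mu> a * besselS (1 - \<mu>) a)
     = (a * ?k * besselS (1 - \<mu>) a + ?q * besselS (- \<mu>) a) * besselS (\<mu> - 1) a
       - (?k * besselS (\<mu> - 1) a + ?q * besselS \<mu> a) * (a * besselS (1 - \<mu>) a)"
    by (simp add: algebra_simps)
  also have "\<dots> = 1 * besselS (\<mu> - 1) a - a powr (- \<mu>) * (a * besselS (1 - \<mu>) a)"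
    by (simp only: w)
  finally have "1 * besselS (\<mu> - 1) a - a powr (- \<mu>) * (a * besselS (1 - \<mu>) a) = ?q * (besselS (\<mu> - 1) a * besselS (- \<mu>) a - a * besselS \<mu> a * besselS (1 - \<mu>) a)" ..
  then show "?q * sin (\<mu> * of_real pi) = of_real pi * (besselS (\<mu> - 1) a - a powr (- \<mu>) * a * besselS (1 - \<mu>) a)"
    unfolding s by (simp add: mult.assoc)
qed

end

section \<open>The Hankel function on the imaginary ray\<close>

lemma exp_Complex_half_pi: "b > 0 \<Longrightarrow> exp (Complex (ln b) (pi / 2)) = \<i> * of_real b"
  by (simp add: complex_eq_iff Re_exp Im_exp)

text \<open>For l = log (i \<tau>) the argument - exp (2 l) / 4 of the series is the positive number
  b^2, and the order i \<tau> is not an integer. The quotient for Y then combines with J into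
  exactly the two expressions of \<open>mac_eq_besselS\<close>, and sin (\<pi> \<mu>)
  cancels.\<close>

lemma hankelF_imaginary:
  fixes \<tau> :: real
  assumes tau: "\<tau> > 0"
  defines "\<mu> \<equiv> \<i> * of_real \<tau>" and "b \<equiv> \<tau> / 2"
  shows "hankelF (Complex (ln \<tau>) (pi / 2)) = \<i> / of_real pi * of_real (exp (pi * \<tau> / 2)) * of_real b powr \<mu> *
     (mac (- \<mu> - 1) (of_real (b\<^sup>2)) - \<i> / of_real b * mac (- \<mu>) (of_real (b\<^sup>2)))"
proof -
  define l where "l = Complex (ln \<tau>) (pi / 2)"
  define a :: complex where "a = of_real (b\<^sup>2)"
  define P :: complex where "P = of_real (exp (pi * \<tau> / 2))"
  define bp bm where "bp = of_real b powr \<mu>" and "bm = of_real b powr (- \<mu>)"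
  define s where "s = sin (\<mu> * of_real pi)"
  have b: "b > 0" using tau by (simp add: b_def)
  have mu: "Re \<mu> = 0" "\<mu> \<noteq> 0" using tau by (auto simp: \<mu>_def)
  have a: "Re a > 0" "a = - \<mu>\<^sup>2 / 4" using b by (auto simp: a_def \<mu>_def b_def power_mult_distrib power_divide)
  have bb: "bp * bm = 1" unfolding bp_def bm_def using b by (simp flip: powr_add)
  have el: "exp l = \<mu>" unfolding l_def \<mu>_def by (rule exp_Complex_half_pi[OF tau])
  have e2l: "exp (2 * l) = \<mu>\<^sup>2" by (simp add: exp_double el)
  have ni: "\<mu> \<notin> \<int>" using tau by (auto simp: \<mu>_def complex_eq_iff elim!: Ints_cases)
  have s0: "s \<noteq> 0" using ni by (simp add: s_def complex_sin_mult_pi_eq_0)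
  have lb: "l - of_real (ln 2) = of_real (ln b) + \<i> * of_real (pi / 2)"
    using tau by (simp add: l_def b_def complex_eq_iff ln_div)
  have bp: "bp = exp (\<mu> * of_real (ln b))" and bm: "bm = exp (- \<mu> * of_real (ln b))"
    using b by (simp_all add: bp_def bm_def powr_def Ln_of_real)
  have P: "P = exp (- \<mu> * (\<i> * of_real (pi / 2)))"
    by (simp add: P_def \<mu>_def flip: exp_of_real) (simp add: mult_ac)
  have E: "exp (- \<i> * (\<mu> * of_real pi)) * exp (\<mu> * (l - of_real (ln 2))) = P * bp"
    unfolding lb bp P by (simp add: algebra_simps flip: exp_add)
  have E': "exp (- \<mu> * (l - of_real (ln 2))) = P * bm"
    unfolding lb bm P by (simp add: algebra_simps flip: exp_add)
  have aa: "bp * a powr (- \<mu>) = bm"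
  proof -
    have "a powr (- \<mu>) = bm * bm"
      unfolding a_def bm_def power2_eq_square of_real_mult using b by (intro powr_times_real) auto
    then show ?thesis using bb by (simp add: mult.assoc[symmetric])
  qed
  have ex: "cos (\<mu> * of_real pi) - \<i> * s = exp (- \<i> * (\<mu> * of_real pi))"
    using exp_Euler[of "- (\<mu> * of_real pi)"] by (simp add: s_def)
  have a4: "- exp (2 * l) / 4 = a" by (simp add: e2l a)
  have "hankelF l = (besselJLd \<mu> l + \<i> * ((besselJLd \<mu> l * cos (\<mu> * of_real pi) - besselJLd (- \<mu>) l) / s)) / \<mu>"
    unfolding hankelF_def el besselYL_nonint[OF ni] s_def ..
  also have "\<dots> = \<i> * ((cos (\<mu> * of_real pi) - \<i> * s) * besselJLd \<mu> l - besselJLd (- \<mu>) l) / (\<mu> * s)"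
    using s0 mu by (simp add: field_simps)
  also have "(cos (\<mu> * of_real pi) - \<i> * s) * besselJLd \<mu> l = P * bp * (\<mu> * besselS \<mu> a - \<mu>\<^sup>2 / 2 * besselS (\<mu> + 1) a)"
    unfolding ex besselJLd_def a4 unfolding e2l mult.assoc[symmetric] E[unfolded mult.assoc[symmetric]] ..
  also have "besselJLd (- \<mu>) l = P * bm * (- \<mu> * besselS (- \<mu>) a - \<mu>\<^sup>2 / 2 * besselS (1 - \<mu>) a)"
    unfolding besselJLd_def a4 unfolding e2l E' by simp
  also have "\<i> * (P * bp * (\<mu> * besselS \<mu> a - \<mu>\<^sup>2 / 2 * besselS (\<mu> + 1) a)
       - P * bm * (- \<mu> * besselS (- \<mu>) a - \<mu>\<^sup>2 / 2 * besselS (1 - \<mu>) a)) / (\<mu> * s)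
     = \<i> * P * (bp * (besselS \<mu> a - \<mu> / 2 * besselS (\<mu> + 1) a) + bm * (besselS (- \<mu>) a + \<mu> / 2 * besselS (1 - \<mu>) a)) / s"
    using mu s0 by (simp add: field_simps power2_eq_square)
  also have "bp * (besselS \<mu> a - \<mu> / 2 * besselS (\<mu> + 1) a) + bm * (besselS (- \<mu>) a + \<mu> / 2 * besselS (1 - \<mu>) a)
    = bp / of_real pi * (mac (- \<mu> - 1) a * s - \<i> / of_real b * (mac (- \<mu>) a * s))"
  proof -
    have m1: "\<i> / of_real b * \<mu> = - 2" and m2: "\<i> / of_real b * a = \<mu> / 2"
      using b by (simp_all add: \<mu>_def b_def a_def field_simps power2_eq_square)
    have "bp * (a powr (- \<mu>) * besselS (- \<mu>) a - besselS \<mu> a - \<i> / of_real b * (besselS (\<mu> - 1) a - a powr (- \<mu>) * a * besselS (1 - \<mu>) a))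
      = (bp * a powr (- \<mu>)) * besselS (- \<mu>) a - bp * besselS \<mu> a - bp * (\<i> / of_real b * \<mu>) * besselS \<mu> a
         - bp * (\<i> / of_real b * a) * besselS (\<mu> + 1) a + (bp * a powr (- \<mu>)) * (\<i> / of_real b * a) * besselS (1 - \<mu>) a"
      unfolding besselS_recurrence[of \<mu>] by (simp add: algebra_simps)
    also have "\<dots> = bp * (besselS \<mu> a - \<mu> / 2 * besselS (\<mu> + 1) a) + bm * (besselS (- \<mu>) a + \<mu> / 2 * besselS (1 - \<mu>) a)"
      unfolding aa m1 m2 by (simp add: algebra_simps)
    finally have fin: "bp * (a powr (- \<mu>) * besselS (- \<mu>) a - besselS \<mu> a - \<i> / of_real b * (besselS (\<mu> - 1) a - a powr (- \<mu>) * a * besselS (1 - \<mu>) a))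
      = bp * (besselS \<mu> a - \<mu> / 2 * besselS (\<mu> + 1) a) + bm * (besselS (- \<mu>) a + \<mu> / 2 * besselS (1 - \<mu>) a)" .
    have gen: "bp / of_real pi * (of_real pi * U - w * (of_real pi * V)) = bp * (U - w * V)" for U V w
      by (simp add: field_simps)
    show ?thesis unfolding s_def mac_eq_besselS[OF mu a(1)] gen fin ..
  qed
  also have "\<i> * P * (bp / of_real pi * (mac (- \<mu> - 1) a * s - \<i> / of_real b * (mac (- \<mu>) a * s))) / s
    = \<i> / of_real pi * P * bp * (mac (- \<mu> - 1) a - \<i> / of_real b * mac (- \<mu>) a)"
    using s0 b by (simp add: field_simps)
  finally show ?thesis by (simp only: l_def P_def bp_def a_def)
qed

section \<open>Deformation to the steepest descent curve\<close>

lemma absolutely_integrable_FTC_nonneg: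
  fixes f F :: "real \<Rightarrow> real"
  assumes "continuous_on {0<..} f" "\<And>x. x > 0 \<Longrightarrow> f x \<ge> 0" "\<And>x. x > 0 \<Longrightarrow> (F has_real_derivative f x) (at x)"
    "(F \<longlongrightarrow> A) (at_right 0)" "(F \<longlongrightarrow> B) at_top"
  shows "f absolutely_integrable_on {0<..}"
proof -
  have "set_integrable lborel (einterval (ereal 0) \<infinity>) f"
  proof (rule interval_integral_FTC_nonneg(1))
    show "isCont f x" if "ereal 0 < ereal x" for x
      using assms(1) that by (simp add: continuous_on_eq_continuous_at)
    show "((F \<circ> real_of_ereal) \<longlongrightarrow> A) (at_right (ereal 0))" "((F \<circ> real_of_ereal) \<longlongrightarrow> B) (at_left \<infinity>)"
      using assms by (auto simp: ereal_tendsto_simps)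
  qed (use assms in auto)
  moreover have "einterval (ereal 0) \<infinity> = {0<..}" by (auto simp: einterval_def)
  ultimately have "f integrable_on {0<..}" using set_borel_integral_eq_integral(1) by fastforce
  then show ?thesis using assms(2) by (intro nonnegative_absolutely_integrable_1) auto
qed

lemma Kdens_exp_integrable:
  assumes "\<tau> > 0"
  shows "(\<lambda>x. exp (- \<tau> * height x) * Kdens x) absolutely_integrable_on {0<..}"
proof (rule absolutely_integrable_on_dominated)
  have "(\<lambda>x. Kdens x * exp (- \<tau> * (Kmass x - pi / 2))) absolutely_integrable_on {0<..}"
  proof (rule absolutely_integrable_FTC_nonneg)
    show "continuous_on {0<..} (\<lambda>x. Kdens x * exp (- \<tau> * (Kmass x - pi / 2)))"
      by (intro continuous_intros continuous_on_curve)
    show "((\<lambda>x. - exp (- \<tau> * (Kmass x - pi / 2)) / \<tau>) has_real_derivative Kdens x * exp (- \<tau> * (Kmass x - pi / 2))) (at x)" if "x > 0" for x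
      using assms by (auto intro!: derivative_eq_intros Kmass_deriv[OF that])
    show "((\<lambda>x. - exp (- \<tau> * (Kmass x - pi / 2)) / \<tau>) \<longlongrightarrow> - exp (- \<tau> * (0 - pi / 2)) / \<tau>) (at_right 0)"
      using assms by (intro tendsto_intros Kmass_limits) auto
    have "filterlim (\<lambda>x. - (pi / 2) + Kmass x) at_top at_top"
      using Kmass_limits(2) by (intro filterlim_tendsto_add_at_top[OF tendsto_const])
    moreover have "((\<lambda>y. - exp (- \<tau> * y) / \<tau>) \<longlongrightarrow> 0) at_top" using assms by real_asymp
    ultimately show "((\<lambda>x. - exp (- \<tau> * (Kmass x - pi / 2)) / \<tau>) \<longlongrightarrow> 0) at_top"
      by (auto dest: filterlim_compose simp: algebra_simps)
  qed (use Kdens_nonneg in auto)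
  then show "(\<lambda>x. Kdens x * exp (- \<tau> * (Kmass x - pi / 2))) integrable_on {0<..}"
    by (rule set_lebesgue_integral_eq_integral(1))
  show "norm (exp (- \<tau> * height x) * Kdens x) \<le> Kdens x * exp (- \<tau> * (Kmass x - pi / 2))" if "x \<in> {0<..}" for x
    using that height_ge[of x] Kdens_nonneg[of x] assms
    by (simp add: mult.commute[of "Kdens x"] mult_right_mono)
qed (auto intro!: continuous_intros continuous_on_curve)

lemma norm_sinh_le: "norm (sinh t) \<le> cosh (Re t)"
proof -
  have "norm (sinh t) \<le> (norm (exp t) + norm (exp (- t))) / 2"
    unfolding sinh_field_def using norm_triangle_ineq4[of "exp t" "exp (- t)"] by (simp add: norm_divide)
  then show ?thesis by (simp add: cosh_field_def)
qed

lemma tC_tendsto_0: "(tC e \<longlongrightarrow> 0) (at_right 0)"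
proof -
  have "((\<lambda>x. Complex (e * x) (cangle x)) \<longlongrightarrow> Complex (e * 0) 0) (at_right 0)"
    by (intro tendsto_intros cangle_limit)
  then show ?thesis by (simp add: tC_def[abs_def] flip: zero_complex.code)
qed

context
  fixes \<tau> :: real and A B :: "complex \<Rightarrow> complex"
  assumes tau: "\<tau> > 0"
    and A: "\<And>t. (A has_field_derivative (exp t - 1) * exp (\<i> * \<tau> * sm t)) (at t)"
  defines "B \<equiv> \<lambda>t. A t - exp (\<i> * \<tau> * sm t) / (\<i> * \<tau>)"
begin

text \<open>A and B differ by a primitive of (cosh t - 1) times the exponential, which is exact. On
  the line Im t = \<pi> / 2 the integrand of A, with exp t - 1 in place of sinh t, produces only the
  indices - \<mu> and - \<mu> - 1 that are known; on the curve B is used.\<close>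

lemma B_deriv: "(B has_field_derivative sinh t * exp (\<i> * \<tau> * sm t)) (at t)"
proof -
  have "(B has_field_derivative (exp t - 1) * exp (\<i> * \<tau> * sm t) - (\<i> * \<tau> * (cosh t - 1) * exp (\<i> * \<tau> * sm t)) / (\<i> * \<tau>)) (at t)"
    unfolding B_def using tau by (auto intro!: derivative_eq_intros A)
  also have "(exp t - 1) * exp (\<i> * \<tau> * sm t) - (\<i> * \<tau> * (cosh t - 1) * exp (\<i> * \<tau> * sm t)) / (\<i> * \<tau>)
     = (exp t - cosh t) * exp (\<i> * \<tau> * sm t)"
    using tau by (simp add: field_simps)
  also have "exp t - cosh t = sinh t" using sinh_plus_cosh[of t] by (simp add: algebra_simps)
  finally show ?thesis .
qed

text \<open>Substitution t = ln (y / b) + i \<pi> / 2: there i \<tau> (sinh t - t) equals - y - b^2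
  / y + \<pi> \<tau> / 2 - \<mu> ln (y / b), the exponent of the Macdonald integrand.\<close>

lemma line_integral_limit:
  "(\<lambda>n. A (Complex (real (Suc n)) (pi / 2)) - A (Complex (- real (Suc n)) (pi / 2))) \<longlonglongrightarrow>
     of_real pi * \<i> * hankelF (Complex (ln \<tau>) (pi / 2))"
proof -
  define b where "b = \<tau> / 2"
  define \<mu> where "\<mu> = \<i> * complex_of_real \<tau>"
  define a :: complex where "a = of_real (b\<^sup>2)"
  define Q where "Q = of_real (exp (pi * \<tau> / 2)) * of_real b powr \<mu>"
  have b: "b > 0" using tau by (simp add: b_def)
  define f where "f = (\<lambda>y. - Q * (macI (- \<mu> - 1) a y - \<i> / of_real b * macI (- \<mu>) a y))"
  have a: "Re a > 0" using b by (simp add: a_def)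
  have d: "((\<lambda>y. A (Complex (ln (y / b)) (pi / 2))) has_vector_derivative f y) (at y)" if y: "y > 0" for y
  proof -
    define t where "t = Complex (ln (y / b)) (pi / 2)"
    have "((\<lambda>y. Complex (ln (y / b)) (pi / 2)) has_vector_derivative Complex (1 / y) 0) (at y)"
      unfolding has_vector_derivative_complex_iff using y b
      by (auto intro!: derivative_eq_intros)
    from field_vector_diff_chain_at[OF this, of A] A[of t]
    have "((\<lambda>y. A (Complex (ln (y / b)) (pi / 2))) has_vector_derivative Complex (1 / y) 0 * ((exp t - 1) * exp (\<i> * \<tau> * sm t))) (at y)"
      unfolding t_def o_def by blast
    moreover have "Complex (1 / y) 0 * ((exp t - 1) * exp (\<i> * \<tau> * sm t)) = f y"
    proof -
      have e1: "exp t = \<i> * of_real (y / b)" unfolding t_def using y b by (intro exp_Complex_half_pi) simp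
      have e2: "exp (- t) = - \<i> * of_real (b / y)" using e1 y b by (simp add: exp_minus field_simps)
      have sm: "sm t = \<i> * of_real ((y / b + b / y) / 2) - t"
        unfolding sm_def sinh_field_def e1 e2 using y b by (simp add: field_simps)
      have t: "t = of_real (ln (y / b)) + \<i> * of_real (pi / 2)" by (simp add: t_def complex_eq_iff)
      have "\<i> * \<tau> * sm t = (- of_real y - a / of_real y) + of_real (pi * \<tau> / 2) - \<mu> * of_real (ln (y / b))"
        unfolding sm unfolding t \<mu>_def a_def using y b
        by (simp add: b_def field_simps power2_eq_square)
      then have "\<i> * \<tau> * sm t = (- of_real y - a / of_real y) + of_real (pi * \<tau> / 2) + (- \<mu> * of_real (ln (y / b)))"
        by simp
      then have "exp (\<i> * \<tau> * sm t) = exp (- of_real y - a / of_real y) * of_real (exp (pi * \<tau> / 2)) * exp (- \<mu> * of_real (ln (y / b)))"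
        by (simp only: exp_add exp_of_real)
      also have "exp (- \<mu> * of_real (ln (y / b))) = of_real b powr \<mu> * of_real y powr (- \<mu>)"
        using y b by (simp add: powr_def Ln_of_real ln_div algebra_simps flip: exp_add)
      finally have e3: "exp (\<i> * \<tau> * sm t) = Q * macI (- \<mu>) a y"
        by (simp add: Q_def macI_def)
      have e4: "macI (- \<mu> - 1) a y = macI (- \<mu>) a y / of_real y"
        using y by (simp add: macI_def powr_diff)
      have e5: "Complex (1 / y) 0 = 1 / of_real y" by (simp add: complex_eq_iff)
      show ?thesis unfolding e3 f_def e4 e1 e5 using y b by (simp add: field_simps)
    qed
    ultimately show ?thesis by simp
  qed
  have f: "f absolutely_integrable_on {0<..}"
    unfolding f_def using macI_absolutely_integrable[OF a]
    by (intro set_integrable_mult_right set_integral_diff(1)) auto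
  have "(\<lambda>n. A (Complex (ln (b * exp (real (Suc n)) / b)) (pi / 2)) - A (Complex (ln (b * exp (- real (Suc n)) / b)) (pi / 2))) \<longlonglongrightarrow> integral {0<..} f"
  proof (rule integral_FTC_half_line[OF f d])
    show "b * exp (- real (Suc n)) > 0" for n using b by simp
    show "b * exp (- real (Suc n)) \<le> b * exp (real (Suc n))" for n using b by simp
    show "(\<lambda>n. b * exp (- real (Suc n))) \<longlonglongrightarrow> 0" using b by real_asymp
    show "filterlim (\<lambda>n. b * exp (real (Suc n))) at_top sequentially" using b by real_asymp
  qed
  moreover have "integral {0<..} f = - Q * (mac (- \<mu> - 1) a - \<i> / of_real b * mac (- \<mu>) a)"
  proof -
    have i: "(\<lambda>y. c * macI c' a y) integrable_on {0<..}" for c c'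
      by (intro integrable_on_mult_right macI_integrable a)
    show ?thesis unfolding f_def mac_def
      by (simp only: integral_mult_right integral_diff[OF macI_integrable[OF a] i])
  qed
  moreover have "of_real pi * \<i> * hankelF (Complex (ln \<tau>) (pi / 2)) = - Q * (mac (- \<mu> - 1) a - \<i> / of_real b * mac (- \<mu>) a)"
    unfolding hankelF_imaginary[OF tau, folded \<mu>_def b_def] a_def Q_def by (simp add: field_simps)
  ultimately show ?thesis using b by simp
qed

text \<open>Between the curve and the line at abscissa +-X the sine increases with the ordinate, so
  Im (sinh t - t) is at least \<open>Kmass X - pi / 2\<close> all along the segment. The summand 1 /
  \<tau> comes from the exact term separating A from B.\<close>

lemma vertical_bounds:
  assumes X: "X > 0" and e: "e = 1 \<or> e = - 1"
  shows "norm (B (tC e X) - A (Complex (e * X) (pi / 2))) \<le> (pi / 2 + 1 / \<tau>) * (cosh X * exp (- \<tau> * (Kmass X - pi / 2)))"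
proof -
  define M where "M = cosh X * exp (- \<tau> * (Kmass X - pi / 2))"
  have nexp: "norm (exp (\<i> * \<tau> * sm (Complex (e * X) y))) \<le> exp (- \<tau> * (Kmass X - pi / 2))"
    if y: "cangle X \<le> y" "y \<le> pi / 2" for y
  proof -
    have "Im (sm (Complex (e * X) y)) = cosh X * sin y - y"
      using e by (auto simp: sm_def cosh_sinh_Complex)
    moreover have "sin (cangle X) \<le> sin y" using cangle_bounds[OF X] y by (intro sin_monotone_2pi_le) auto
    then have "cosh X * sin (cangle X) \<le> cosh X * sin y" by (intro mult_left_mono) auto
    moreover have "Kmass X \<le> cosh X * sin (cangle X)"
      using height_ge[OF X] Kmass_pos[OF X] sinh_le_cosh_real[of X] X unfolding sin_cangle[OF X]
      by (simp add: field_simps)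
    ultimately have "Im (sm (Complex (e * X) y)) \<ge> Kmass X - pi / 2" using y by linarith
    then have "\<tau> * Im (sm (Complex (e * X) y)) \<ge> \<tau> * (Kmass X - pi / 2)" using tau by (intro mult_left_mono) auto
    then show ?thesis by (simp add: algebra_simps)
  qed
  have "norm (B (tC e X) - B (Complex (e * X) (pi / 2))) \<le> M * norm (tC e X - Complex (e * X) (pi / 2))"
  proof (rule field_differentiable_bound)
    show "convex (closed_segment (tC e X) (Complex (e * X) (pi / 2)))" by simp
    fix t assume t: "t \<in> closed_segment (tC e X) (Complex (e * X) (pi / 2))"
    show "(B has_field_derivative sinh t * exp (\<i> * \<tau> * sm t)) (at t within closed_segment (tC e X) (Complex (e * X) (pi / 2)))"
      using B_deriv by (rule has_field_derivative_at_within)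
    obtain v where v: "0 \<le> v" "v \<le> 1" "t = (1 - v) *\<^sub>R tC e X + v *\<^sub>R Complex (e * X) (pi / 2)"
      using t by (auto simp: closed_segment_def)
    have t2: "t = Complex (e * X) ((1 - v) * cangle X + v * (pi / 2))"
      using v by (simp add: tC_def complex_eq_iff algebra_simps)
    have "cangle X \<le> (1 - v) * cangle X + v * (pi / 2)" "(1 - v) * cangle X + v * (pi / 2) \<le> pi / 2"
      using cangle_bounds[OF X] v mult_left_mono[of "cangle X" "pi / 2" v] mult_left_mono[of "cangle X" "pi / 2" "1 - v"]
      by (auto simp: algebra_simps)
    from nexp[OF this] have "norm (exp (\<i> * \<tau> * sm t)) \<le> exp (- \<tau> * (Kmass X - pi / 2))" unfolding t2 .
    moreover have "norm (sinh t) \<le> cosh X" using norm_sinh_le[of t] e unfolding t2 by auto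
    ultimately show "norm (sinh t * exp (\<i> * \<tau> * sm t)) \<le> M"
      unfolding norm_mult M_def by (intro mult_mono) auto
  qed auto
  also have "norm (tC e X - Complex (e * X) (pi / 2)) = pi / 2 - cangle X"
    using cangle_bounds[OF X] by (simp add: tC_def cmod_def)
  also have "M * (pi / 2 - cangle X) \<le> M * (pi / 2)"
    using cangle_bounds[OF X] by (intro mult_left_mono) (auto simp: M_def)
  finally have 1: "norm (B (tC e X) - B (Complex (e * X) (pi / 2))) \<le> M * (pi / 2)" .
  have "norm (B (Complex (e * X) (pi / 2)) - A (Complex (e * X) (pi / 2))) = norm (exp (\<i> * \<tau> * sm (Complex (e * X) (pi / 2)))) / \<tau>"
    using tau by (simp add: B_def norm_divide norm_mult)
  also have "\<dots> \<le> exp (- \<tau> * (Kmass X - pi / 2)) / \<tau>"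
    using nexp[of "pi / 2"] cangle_bounds[OF X] tau by (intro divide_right_mono) auto
  also have "\<dots> \<le> M / \<tau>"
    using tau cosh_real_ge_1[of X] by (intro divide_right_mono) (auto simp: M_def)
  finally have "norm (B (tC e X) - A (Complex (e * X) (pi / 2))) \<le> M * (pi / 2) + M / \<tau>"
    using 1 norm_triangle_ineq[of "B (tC e X) - B (Complex (e * X) (pi / 2))" "B (Complex (e * X) (pi / 2)) - A (Complex (e * X) (pi / 2))"]
    by simp
  then show ?thesis by (simp add: M_def algebra_simps)
qed

text \<open>The two halves are mirror images in the imaginary axis. In the difference the real parts
  of sinh t dt cancel and twice the imaginary part remains.\<close>

lemma curve_integral_limit:
  "(\<lambda>n. B (tC 1 (real (Suc n))) - B (tC (- 1) (real (Suc n)))) \<longlonglongrightarrow>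
     2 * \<i> * of_real (integral {0<..} (\<lambda>x. exp (- \<tau> * height x) * Kdens x))"
proof -
  define f where "f = (\<lambda>x. 2 * \<i> * complex_of_real (exp (- \<tau> * height x) * Kdens x))"
  define G where "G = (\<lambda>x. B (tC 1 x) - B (tC (- 1) x))"
  note i = Kdens_exp_integrable[OF tau]
  have d: "(G has_vector_derivative f x) (at x)" if x: "x > 0" for x
  proof -
    let ?c = "(x * cosh x - sinh x) / (sinh x * Kmass x)"
    have B': "((\<lambda>x. B (tC e x)) has_vector_derivative Complex e ?c * (sinh (tC e x) * exp (- \<tau> * height x))) (at x)"
      if e: "e = 1 \<or> e = -1" for e
    proof -
      have "((B \<circ> tC e) has_vector_derivative Complex e ?c * (sinh (tC e x) * exp (\<i> * \<tau> * sm (tC e x)))) (at x)"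
        by (rule field_vector_diff_chain_at[OF curve_has_vector_derivative(1)[OF x] B_deriv])
      then show ?thesis unfolding sm_curve(1)[OF x e] o_def by (simp add: exp_of_real[symmetric] algebra_simps)
    qed
    have C': "((\<lambda>x. cosh (tC e x)) has_vector_derivative Complex e ?c * sinh (tC e x)) (at x)" for e
    proof -
      have "((cosh \<circ> tC e) has_vector_derivative Complex e ?c * sinh (tC e x)) (at x)"
        by (rule field_vector_diff_chain_at[OF curve_has_vector_derivative(1)[OF x]]) (auto intro!: derivative_eq_intros)
      then show ?thesis by (simp add: o_def)
    qed
    \<comment> \<open>The combination of the two sinh terms is not expanded: it is the derivative of
      a difference of cosh values, which on the curve equals 2 i \<open>Kmass\<close>.\<close>
    have "((\<lambda>x. cosh (tC 1 x) - cosh (tC (-1) x)) has_vector_derivative (Complex 1 ?c * sinh (tC 1 x) - Complex (-1) ?c * sinh (tC (-1) x))) (at x)"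
      by (intro has_vector_derivative_diff C')
    moreover have "((\<lambda>x. cosh (tC 1 x) - cosh (tC (-1) x)) has_vector_derivative Complex 0 (2 * Kdens x)) (at x)"
    proof (rule has_vector_derivative_transform_within_open[of _ _ _ "{0<..}"])
      show "((\<lambda>x. Complex 0 (2 * Kmass x)) has_vector_derivative Complex 0 (2 * Kdens x)) (at x)"
        unfolding has_vector_derivative_complex_iff using Kmass_deriv[OF x] by (auto intro!: derivative_eq_intros)
    qed (use x sm_curve(3) in \<open>auto simp: complex_eq_iff\<close>)
    ultimately have eq: "Complex 1 ?c * sinh (tC 1 x) - Complex (-1) ?c * sinh (tC (-1) x) = Complex 0 (2 * Kdens x)"
      by (rule vector_derivative_unique_at)
    have "(G has_vector_derivative (Complex 1 ?c * (sinh (tC 1 x) * exp (- \<tau> * height x)) - Complex (-1) ?c * (sinh (tC (-1) x) * exp (- \<tau> * height x)))) (at x)"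
      unfolding G_def by (intro has_vector_derivative_diff B') auto
    also have "(Complex 1 ?c * (sinh (tC 1 x) * exp (- \<tau> * height x)) - Complex (-1) ?c * (sinh (tC (-1) x) * exp (- \<tau> * height x)))
       = (Complex 1 ?c * sinh (tC 1 x) - Complex (-1) ?c * sinh (tC (-1) x)) * exp (- \<tau> * height x)"
      by (simp only: left_diff_distrib mult.assoc)
    also have "\<dots> = f x" unfolding eq f_def by (simp add: complex_eq_iff)
    finally show ?thesis .
  qed
  have f: "f absolutely_integrable_on {0<..}"
    unfolding f_def using absolutely_integrable_linear[OF i bounded_linear_of_real]
    by (intro set_integrable_mult_right) (simp add: o_def)
  have "(\<lambda>n. G (real (Suc n)) - G (inverse (real (Suc n)))) \<longlonglongrightarrow> integral {0<..} f"
  proof (rule integral_FTC_half_line[OF f d])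
    show "inverse (real (Suc n)) \<le> real (Suc n)" for n
      using inverse_le_1_iff[of "real (Suc n)"] by simp
    show "(\<lambda>n. inverse (real (Suc n))) \<longlonglongrightarrow> 0" by (rule LIMSEQ_inverse_real_of_nat)
    show "filterlim (\<lambda>n. real (Suc n)) at_top sequentially" by real_asymp
  qed auto
  moreover have "(\<lambda>n. G (inverse (real (Suc n)))) \<longlonglongrightarrow> 0"
  proof -
    have "filterlim (\<lambda>n. inverse (real (Suc n))) (at_right 0) sequentially" by real_asymp
    then have "(\<lambda>n. tC e (inverse (real (Suc n)))) \<longlonglongrightarrow> 0" for e
      using filterlim_compose[OF tC_tendsto_0] by blast
    then have "(\<lambda>n. B (tC e (inverse (real (Suc n))))) \<longlonglongrightarrow> B 0" for e
      using isCont_tendsto_compose[OF DERIV_isCont[OF B_deriv]] by blast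
    then have "(\<lambda>n. G (inverse (real (Suc n)))) \<longlonglongrightarrow> B 0 - B 0"
      unfolding G_def by (intro tendsto_diff)
    then show ?thesis by simp
  qed
  ultimately have "(\<lambda>n. (G (real (Suc n)) - G (inverse (real (Suc n)))) + G (inverse (real (Suc n)))) \<longlonglongrightarrow> integral {0<..} f + 0"
    by (rule tendsto_add)
  moreover have "integral {0<..} f = 2 * \<i> * of_real (integral {0<..} (\<lambda>x. exp (- \<tau> * height x) * Kdens x))"
    unfolding f_def integral_mult_right
    using integral_linear[OF set_lebesgue_integral_eq_integral(1)[OF i], of complex_of_real]
    by (simp only: o_def bounded_linear_of_real)
  ultimately show ?thesis by (simp add: G_def)
qed

lemma hankelF_curve_aux:
  "hankelF (Complex (ln \<tau>) (pi / 2)) = of_real (2 / pi * integral {0<..} (\<lambda>x. exp (- \<tau> * height x) * Kdens x))"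
proof -
  define I where "I = complex_of_real (integral {0<..} (\<lambda>x. exp (- \<tau> * height x) * Kdens x))"
  define M where "M = (\<lambda>n. (pi / 2 + 1 / \<tau>) * (cosh (real (Suc n)) * exp (- \<tau> * (Kmass (real (Suc n)) - pi / 2))))"
  have "M \<longlonglongrightarrow> 0"
    unfolding M_def cosh_field_def Kmass_def sinh_field_def using tau by real_asymp
  then have lim: "(\<lambda>n. B (tC e (real (Suc n))) - A (Complex (e * real (Suc n)) (pi / 2))) \<longlonglongrightarrow> 0" if "e = 1 \<or> e = -1" for e
    by (rule Lim_null_comparison[rotated])
       (use vertical_bounds[OF _ that] in \<open>auto simp: M_def\<close>)
  have "(\<lambda>n. (B (tC 1 (real (Suc n))) - A (Complex (1 * real (Suc n)) (pi / 2))) - (B (tC (-1) (real (Suc n))) - A (Complex (-1 * real (Suc n)) (pi / 2)))) \<longlonglongrightarrow> 0 - 0"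
    by (rule tendsto_diff[OF lim lim]) simp_all
  with line_integral_limit have "(\<lambda>n. (A (Complex (real (Suc n)) (pi / 2)) - A (Complex (- real (Suc n)) (pi / 2)))
     + ((B (tC 1 (real (Suc n))) - A (Complex (1 * real (Suc n)) (pi / 2))) - (B (tC (-1) (real (Suc n))) - A (Complex (-1 * real (Suc n)) (pi / 2)))))
      \<longlonglongrightarrow> of_real pi * \<i> * hankelF (Complex (ln \<tau>) (pi / 2)) + (0 - 0)"
    by (rule tendsto_add)
  then have "(\<lambda>n. B (tC 1 (real (Suc n))) - B (tC (- 1) (real (Suc n)))) \<longlonglongrightarrow> of_real pi * \<i> * hankelF (Complex (ln \<tau>) (pi / 2))"
    by (simp add: algebra_simps)
  then have "of_real pi * \<i> * hankelF (Complex (ln \<tau>) (pi / 2)) = 2 * \<i> * I"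
    using curve_integral_limit LIMSEQ_unique unfolding I_def by blast
  then have "hankelF (Complex (ln \<tau>) (pi / 2)) = 2 * I / of_real pi" by (simp add: field_simps)
  then show ?thesis by (simp add: I_def)
qed

end

theorem hankelF_curve:
  assumes "\<tau> > 0"
  shows "hankelF (Complex (ln \<tau>) (pi / 2)) = of_real (2 / pi * integral {0<..} (\<lambda>x. exp (- \<tau> * height x) * Kdens x))"
proof -
  have "(\<lambda>t. (exp t - 1) * exp (\<i> * \<tau> * sm t)) holomorphic_on UNIV"
    unfolding sm_def sinh_field_def by (intro holomorphic_intros) auto
  then obtain A where "\<And>t. (A has_field_derivative (exp t - 1) * exp (\<i> * \<tau> * sm t)) (at t within UNIV)"
    using holomorphic_convex_primitive'[of UNIV] by auto
  then show ?thesis using hankelF_curve_aux[OF assms, of A] by simp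
qed

section \<open>A uniformising cube root\<close>

lemma Taylor_remainder_holomorphic:
  fixes f :: "complex \<Rightarrow> complex"
  assumes S: "open S" "0 \<in> S" and f: "f holomorphic_on S"
  obtains g where "g holomorphic_on S"
    "\<And>t. t \<in> S \<Longrightarrow> f t = (\<Sum>j<m. (deriv ^^ j) f 0 / fact j * t ^ j) + t ^ m * g t"
    "g 0 = (deriv ^^ m) f 0 / fact m"
proof -
  \<comment> \<open>Strengthened by all Taylor coefficients of the quotient, so that the induction
    can divide by t once more.\<close>
  have "\<exists>g. g holomorphic_on S \<and> (\<forall>t\<in>S. f t = (\<Sum>j<m. (deriv ^^ j) f 0 / fact j * t ^ j) + t ^ m * g t)
    \<and> (\<forall>k. (deriv ^^ k) g 0 / fact k = (deriv ^^ (m + k)) f 0 / fact (m + k))"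
  proof (induction m)
    case 0
    then show ?case using f by (intro exI[of _ f]) auto
  next
    case (Suc m)
    then obtain g where g: "g holomorphic_on S" "\<And>t. t \<in> S \<Longrightarrow> f t = (\<Sum>j<m. (deriv ^^ j) f 0 / fact j * t ^ j) + t ^ m * g t"
      "\<And>k. (deriv ^^ k) g 0 / fact k = (deriv ^^ (m + k)) f 0 / fact (m + k)" by auto
    define h where "h = (\<lambda>t. if t = 0 then deriv g 0 else (g t - g 0) / (t - 0))"
    have h: "h holomorphic_on S" unfolding h_def by (rule pole_lemma_open[OF g(1) S(1)])
    have gh: "g t = g 0 + t * h t" for t by (simp add: h_def)
    have "g has_fps_expansion fps_expansion g 0" "h has_fps_expansion fps_expansion h 0"
      using g(1) h S by (auto intro!: has_fps_expansion_fps_expansion)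
    then have "(\<lambda>t. g 0 + t * h t) has_fps_expansion fps_const (g 0) + fps_X * fps_expansion h 0"
      by (intro fps_expansion_intros)
    moreover have "(\<lambda>t. g 0 + t * h t) = g" by (intro ext gh[symmetric])
    ultimately have gX: "g has_fps_expansion fps_const (g 0) + fps_X * fps_expansion h 0" by simp
    have "(deriv ^^ k) h 0 / fact k = (deriv ^^ (Suc k)) g 0 / fact (Suc k)" for k
      using fps_nth_fps_expansion[OF gX, of "Suc k"] by (simp add: fps_expansion_def)
    then have "(deriv ^^ k) h 0 / fact k = (deriv ^^ (Suc m + k)) f 0 / fact (Suc m + k)" for k
      using g(3)[of "Suc k"] by simp
    moreover have "f t = (\<Sum>j<Suc m. (deriv ^^ j) f 0 / fact j * t ^ j) + t ^ Suc m * h t" if "t \<in> S" for t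
      using g(2)[OF that] g(3)[of 0] gh[of t] by (simp add: algebra_simps)
    ultimately show ?case using h by blast
  qed
  then obtain g where "g holomorphic_on S" "\<forall>t\<in>S. f t = (\<Sum>j<m. (deriv ^^ j) f 0 / fact j * t ^ j) + t ^ m * g t"
    "\<forall>k. (deriv ^^ k) g 0 / fact k = (deriv ^^ (m + k)) f 0 / fact (m + k)" by blast
  then show ?thesis using that[of g] by (auto dest: spec[of _ 0])
qed

section \<open>A single-valued logarithm of (w / t)^3 on a strip\<close>

definition gq :: "complex \<Rightarrow> complex" where "gq t = (if t = 0 then 1 else 6 * sm t / t ^ 3)"

text \<open>The strip has to contain 2 \<pi> i and the curve through it in its interior, yet no zero
  of \<open>sm\<close> except 0; the margin 1/2 beyond 2 \<pi> is small enough for the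
  latter.\<close>

definition Str :: "complex set" where "Str = {t. \<bar>Im t\<bar> < 2 * pi + 1 / 2}"

lemma Str_props: "open Str" "convex Str" "connected Str" "0 \<in> Str" "t \<in> Str \<Longrightarrow> - t \<in> Str"
proof -
  have eq: "Str = {t. Im t < 2 * pi + 1 / 2} \<inter> {t. Im t > - (2 * pi + 1 / 2)}" by (auto simp: Str_def)
  show "open Str" unfolding eq by (intro open_Int open_halfspace_Im_lt open_halfspace_Im_gt)
  show c: "convex Str" unfolding eq by (intro convex_Int convex_halfspace_Im_lt convex_halfspace_Im_gt)
  show "connected Str" by (rule convex_connected[OF c])
  have "0 < 2 * pi + 1 / 2" using pi_gt_zero by linarith
  then show "0 \<in> Str" "t \<in> Str \<Longrightarrow> - t \<in> Str" by (auto simp: Str_def)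
qed

lemma holomorphic_sm: "sm holomorphic_on S"
  unfolding sm_def[abs_def] sinh_field_def by (intro holomorphic_intros) auto

lemma holomorphic_gq: "gq holomorphic_on UNIV"
proof -
  have d1: "deriv sm = (\<lambda>t. cosh t - 1)"
    by (intro ext DERIV_imp_deriv sm_has_field_derivative)
  have d2: "deriv (\<lambda>t::complex. cosh t - 1) = sinh"
    by (intro ext DERIV_imp_deriv) (auto intro!: derivative_eq_intros)
  have d3: "deriv (sinh :: complex \<Rightarrow> complex) = cosh"
    by (intro ext DERIV_imp_deriv) (auto intro!: derivative_eq_intros)
  obtain g where g: "g holomorphic_on UNIV"
    "\<And>t. sm t = (\<Sum>j<3. (deriv ^^ j) sm 0 / fact j * t ^ j) + t ^ 3 * g t"
    "g 0 = (deriv ^^ 3) sm 0 / fact 3"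
    using Taylor_remainder_holomorphic[of UNIV sm 3] holomorphic_sm by auto
  have "sm t = t ^ 3 * g t" for t
    using g(2)[of t] by (simp add: numeral_3_eq_3 d1 d2 sm_def)
  moreover have "g 0 = 1 / 6" using g(3) by (simp add: numeral_3_eq_3 d1 d2 d3)
  ultimately have "gq t = 6 * g t" for t by (cases "t = 0") (simp_all add: gq_def mult.commute)
  then have gqe: "gq = (\<lambda>t. 6 * g t)" by (rule ext)
  show ?thesis unfolding gqe by (intro holomorphic_intros g(1))
qed

lemma cosh_ge_quadratic: "cosh x \<ge> 1 + x\<^sup>2 / 2" for x :: real
proof -
  have "\<bar>x / 2\<bar> \<le> \<bar>sinh (x / 2)\<bar>"
  proof (cases "x = 0")
    case False
    then show ?thesis using sinh_gt_self[of "x / 2"] sinh_gt_self[of "- x / 2"]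
      by (cases "x > 0") (auto simp: abs_if)
  qed auto
  then have "(x / 2)\<^sup>2 \<le> (sinh (x / 2))\<^sup>2" by (rule abs_le_square_iff[THEN iffD1])
  moreover have "cosh x = 1 + 2 * (sinh (x / 2))\<^sup>2"
    using cosh_double[of "x / 2"] cosh_square_eq[of "x / 2"] by simp
  ultimately show ?thesis by (simp add: power_divide)
qed

lemma sin_less_self:
  assumes "x > (0::real)"
  shows "sin x < x"
proof (cases "x > 1")
  case False
  have "0 - sin 0 < x - sin x"
  proof (rule DERIV_pos_imp_increasing_open[OF assms])
    fix y :: real assume "0 < y" "y < x"
    then have "cos y < 1" using False cos_monotone_0_pi[of 0 y] pi_gt3 by simp
    then show "\<exists>d. ((\<lambda>x. x - sin x) has_real_derivative d) (at y) \<and> d > 0"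
      by (intro exI[of _ "1 - cos y"]) (auto intro!: derivative_eq_intros)
  qed (intro continuous_intros)
  then show ?thesis by simp
qed (use sin_le_one[of x] in linarith)

text \<open>Off the axes the equations force sin y > 0 and cos y > 0, so y lies in the first
  quadrant modulo 2 \<pi>. For y < \<pi> / 2 the point would be on the curve with
  \<open>height\<close> 0; only the thin layer above 2 \<pi> needs numbers.\<close>

lemma sm_nonzero_aux:
  fixes x y :: real
  assumes x: "x \<ge> 0" and y: "0 \<le> y" "y < 2 * pi + 1 / 2" and xy: "(x, y) \<noteq> (0, 0)"
    and eq: "sinh x * cos y = x" "cosh x * sin y = y"
  shows False
proof (cases "x = 0 \<or> y = 0")
  case True
  then show False
  proof
    assume "x = 0"
    then have "sin y = y" "y > 0" using eq xy y by auto
    then show False using sin_less_self[of y] by simp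
  next
    assume "y = 0"
    then show False using eq xy x sinh_gt_self[of x] by auto
  qed
next
  case False
  then have x0: "x > 0" and y0: "y > 0" using x y by auto
  have c: "cos y = x / sinh x" using eq x0 by (simp add: field_simps)
  then have cpos: "cos y > 0" using x0 by simp
  have "sin y = y / cosh x" using eq by (simp add: field_simps)
  then have spos: "sin y > 0" using y0 by simp
  consider "y < pi / 2" | "pi / 2 \<le> y" "y \<le> pi" | "pi < y" "y \<le> 2 * pi" | "2 * pi < y" by linarith
  then show False
  proof cases
    case 1
    then have "y = cangle x" using c y0 arccos_cos[of y] by (simp add: cangle_def)
    then have "height x = 0" using eq(2) sin_cangle[OF x0] by (simp add: height_def)
    then show False using height_pos[OF x0] by simp
  next
    case 2
    then show False using cpos cos_monotone_0_pi_le[of "pi / 2" y] by simp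
  next
    case 3
    then show False using spos sin_le_zero[of y] by (cases "y = 2 * pi") auto
  next
    case 4
    \<comment> \<open>Here cos z >= cos (\<pi> / 3) gives sinh x <= 2 x, while sin z < 1/2 and y > 6
      give cosh x > 12. The quadratic lower bound for cosh forces x <= 4, so cosh x <= 2 x + 1 <= 9,
      a contradiction.\<close>
    define z where "z = y - 2 * pi"
    have z: "0 < z" "z < 1 / 2" using 4 y by (auto simp: z_def)
    have cz: "cos z = cos y" "sin z = sin y" by (simp_all add: z_def cos_diff sin_diff)
    have "cos z \<ge> cos (pi / 3)" using z pi_gt3 by (intro cos_monotone_0_pi_le) auto
    then have "x / sinh x \<ge> 1 / 2" using c cz by (simp add: cos_60)
    then have s2: "sinh x \<le> 2 * x" using x0 by (simp add: field_simps)
    have "sin z < 1 / 2" using sin_less_self[of z] z by simp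
    then have "cosh x * (1 / 2) > cosh x * sin y" using cz by (intro mult_strict_left_mono) auto
    then have c12: "cosh x > 12" using eq 4 pi_gt3 by simp
    have "exp (- x) \<le> 1" using x0 by simp
    then have "cosh x \<le> sinh x + 1" using cosh_minus_sinh[of x] by linarith
    then have "cosh x \<le> 2 * x + 1" "1 + x\<^sup>2 / 2 \<le> 2 * x + 1" using s2 cosh_ge_quadratic[of x] by linarith+
    then have "x * x \<le> 4 * x" by (simp add: power2_eq_square)
    then have "x \<le> 4" using x0 by simp
    then show False using \<open>cosh x \<le> 2 * x + 1\<close> c12 by simp
  qed
qed

lemma sm_nonzero:
  assumes "t \<in> Str" "t \<noteq> 0"
  shows "sm t \<noteq> 0"
proof
  assume z: "sm t = 0"
  define x y where "x = Re t" and "y = Im t"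
  have t: "t = Complex x y" by (simp add: x_def y_def)
  have eq: "sinh x * cos y = x" "cosh x * sin y = y"
    using z unfolding t sm_def cosh_sinh_Complex by (auto simp: complex_eq_iff)
  show False
  proof (rule sm_nonzero_aux[of "\<bar>x\<bar>" "\<bar>y\<bar>"])
    show "\<bar>y\<bar> < 2 * pi + 1 / 2" using assms by (simp add: Str_def y_def)
    show "(\<bar>x\<bar>, \<bar>y\<bar>) \<noteq> (0, 0)" using assms t by (auto simp: complex_eq_iff)
    show "sinh \<bar>x\<bar> * cos \<bar>y\<bar> = \<bar>x\<bar>" "cosh \<bar>x\<bar> * sin \<bar>y\<bar> = \<bar>y\<bar>"
      using eq by (auto simp: abs_if)
  qed auto
qed

text \<open>The branch of the logarithm of \<open>gq\<close> that vanishes at \<open>0\<close>; \<open>gq\<close> has no zeros in the strip.\<close>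

definition lgq :: "complex \<Rightarrow> complex" where
  "lgq = (SOME h. h holomorphic_on Str \<and> (\<forall>t\<in>Str. exp (h t) = gq t) \<and> h 0 = 0)"

lemma lgq: "lgq holomorphic_on Str" "t \<in> Str \<Longrightarrow> exp (lgq t) = gq t" "lgq 0 = 0"
proof -
  have nz: "gq t \<noteq> 0" if "t \<in> Str" for t using sm_nonzero[OF that] by (simp add: gq_def)
  obtain h where h: "h holomorphic_on Str" "\<And>t. t \<in> Str \<Longrightarrow> exp (h t) = gq t"
    using holomorphic_logarithm_exists[of Str gq 0] Str_props nz holomorphic_gq
    by (metis holomorphic_on_subset subset_UNIV)
  have "exp (h 0) = 1" using h(2)[of 0] Str_props by (simp add: gq_def)
  then have "(\<lambda>t. h t - h 0) holomorphic_on Str \<and> (\<forall>t\<in>Str. exp (h t - h 0) = gq t) \<and> h 0 - h 0 = 0"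
    using h by (auto intro!: holomorphic_intros simp: exp_diff)
  then have "\<exists>h. h holomorphic_on Str \<and> (\<forall>t\<in>Str. exp (h t) = gq t) \<and> h 0 = 0"
    by (intro exI[of _ "\<lambda>t. h t - h 0"])
  from someI_ex[OF this, folded lgq_def]
  show "lgq holomorphic_on Str" "t \<in> Str \<Longrightarrow> exp (lgq t) = gq t" "lgq 0 = 0" by auto
qed

lemma sm_minus: "sm (- t) = - sm t" by (simp add: sm_def)

lemma lgq_minus:
  assumes "t \<in> Str"
  shows "lgq (- t) = lgq t"
proof -
  define d where "d = (\<lambda>t. lgq (- t) - lgq t)"
  have "uminus holomorphic_on Str" by (intro holomorphic_intros)
  moreover have "lgq holomorphic_on uminus ` Str"
    using lgq(1) Str_props(5) by (auto intro: holomorphic_on_subset)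
  ultimately have "(\<lambda>t. lgq (- t)) holomorphic_on Str"
    using holomorphic_on_compose[of uminus Str lgq] by (simp add: o_def)
  then have d: "d holomorphic_on Str" unfolding d_def using lgq(1) by (intro holomorphic_intros)
  have e: "exp (d t) = 1" if "t \<in> Str" for t
  proof -
    have "gq (- t) = gq t" by (simp add: gq_def sm_minus)
    moreover have "gq t \<noteq> 0" using lgq(2)[OF that] by (metis exp_not_eq_zero)
    ultimately show ?thesis using lgq(2)[OF that] lgq(2)[OF Str_props(5)[OF that]]
      by (simp add: d_def exp_diff)
  qed
  have "(d has_field_derivative 0) (at t)" if t: "t \<in> Str" for t
  proof -
    have D: "(d has_field_derivative deriv d t) (at t)" using d t Str_props(1) holomorphic_derivI by blast
    then have "((\<lambda>t. exp (d t)) has_field_derivative exp (d t) * deriv d t) (at t)"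
      by (auto intro!: derivative_eq_intros)
    moreover have "((\<lambda>t. exp (d t)) has_field_derivative 0) (at t)"
      by (rule has_field_derivative_transform_within_open[of "\<lambda>_. 1" _ _ Str]) (use t e Str_props in auto)
    ultimately have "exp (d t) * deriv d t = 0" using DERIV_unique by blast
    then show ?thesis using D by simp
  qed
  then have "\<exists>c. \<forall>t\<in>Str. d t = c"
    using Str_props(2) by (intro has_field_derivative_zero_constant) (auto intro: has_field_derivative_at_within)
  then have "d t = d 0" using assms Str_props(4) by auto
  then show ?thesis by (simp add: d_def)
qed

text \<open>On this segment \<open>gq\<close> is positive, so the imaginary part of its logarithm is
  a continuous function with values in 2 \<pi> Z that vanishes at 0. It fixes the branch of w at 2
  \<pi> i.\<close>

lemma lgq_imaginary_real:
  assumes "0 \<le> y" "y \<le> 2 * pi"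
  shows "Im (lgq (\<i> * of_real y)) = 0"
proof -
  define th where "th = (\<lambda>y. Im (lgq (\<i> * of_real y)))"
  have S: "\<i> * of_real y \<in> Str" if "y \<in> {0..2*pi}" for y using that by (auto simp: Str_def)
  have cont: "continuous_on {0..2*pi} th"
    unfolding th_def using S
    by (intro continuous_intros continuous_on_compose2[OF holomorphic_on_imp_continuous_on[OF lgq(1)]]) auto
  have int: "th y / (2 * pi) \<in> \<int>" if y: "y \<in> {0..2*pi}" for y
  proof -
    have "\<exists>r>0. gq (\<i> * of_real y) = of_real r"
    proof (cases "y = 0")
      case False
      then have "y > 0" using y by auto
      have "sm (\<i> * of_real y) = \<i> * of_real (sin y - y)"
        using cosh_sinh_Complex(2)[of 0 y] by (simp add: sm_def complex_eq_iff Complex_eq)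
      moreover have "(\<i> * of_real y) ^ 3 = - \<i> * of_real (y ^ 3)"
        by (simp add: power_mult_distrib power3_eq_cube[of \<i>])
      ultimately have "gq (\<i> * of_real y) = 6 * (\<i> * of_real (sin y - y)) / (- \<i> * of_real (y ^ 3))"
        using False unfolding gq_def by simp
      also have "\<dots> = 6 * (- of_real (sin y - y)) / of_real (y ^ 3)"
      proof -
        have "6 * (\<i> * z) / (- \<i> * w) = 6 * (- z) / w" for z w :: complex
          by (cases "w = 0") (simp_all add: field_simps)
        then show ?thesis .
      qed
      also have "\<dots> = of_real (6 * (- (sin y - y)) / y ^ 3)"
        by (simp only: of_real_divide of_real_mult of_real_minus of_real_numeral)
      also have "6 * (- (sin y - y)) / y ^ 3 = 6 * (y - sin y) / y ^ 3" by simp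
      finally have "gq (\<i> * of_real y) = of_real (6 * (y - sin y) / y ^ 3)" .
      moreover have "6 * (y - sin y) / y ^ 3 > 0" using sin_less_self[of y] \<open>y > 0\<close> by simp
      ultimately show ?thesis by blast
    qed (auto simp: gq_def)
    then obtain r where r: "r > 0" "exp (lgq (\<i> * of_real y)) = of_real r" using lgq(2)[OF S[OF y]] by auto
    then have "exp (lgq (\<i> * of_real y)) = exp (of_real (ln r))" by (simp add: exp_of_real)
    then obtain n :: int where "lgq (\<i> * of_real y) = of_real (ln r) + (of_int (2 * n) * pi) * \<i>"
      using exp_eq by blast
    then have "th y = 2 * n * pi" by (simp add: th_def)
    then show ?thesis by simp
  qed
  have "(\<lambda>y. th y / (2 * pi)) constant_on {0..2*pi}"
  proof (rule continuous_discrete_range_constant)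
    show "continuous_on {0..2*pi} (\<lambda>y. th y / (2 * pi))" using cont by (intro continuous_intros) auto
    fix x assume x: "x \<in> {0..2*pi}"
    show "\<exists>e>0. \<forall>y. y \<in> {0..2*pi} \<and> th y / (2*pi) \<noteq> th x / (2*pi) \<longrightarrow> e \<le> norm (th y / (2*pi) - th x / (2*pi))"
    proof (intro exI[of _ 1] conjI allI impI)
      fix y assume y: "y \<in> {0..2*pi} \<and> th y / (2*pi) \<noteq> th x / (2*pi)"
      then have "th y / (2*pi) - th x / (2*pi) \<in> \<int>" "th y / (2*pi) - th x / (2*pi) \<noteq> 0"
        using int x by (auto intro!: Ints_diff)
      from Ints_nonzero_abs_ge1[OF this]
      show "1 \<le> norm (th y / (2*pi) - th x / (2*pi))" unfolding real_norm_def .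
    qed simp
  qed simp
  then obtain c where c: "\<And>y. y \<in> {0..2*pi} \<Longrightarrow> th y / (2 * pi) = c"
    unfolding constant_on_def by auto
  have "th y / (2 * pi) = th 0 / (2 * pi)" using c[of y] c[of 0] assms pi_ge_zero by simp
  then show ?thesis using lgq(3) by (simp add: th_def)
qed

definition wq :: "complex \<Rightarrow> complex" where "wq t = t * exp (lgq t / 3)"

lemma holomorphic_wq: "wq holomorphic_on Str"
  unfolding wq_def using lgq(1) by (intro holomorphic_intros) auto

lemma wq_cube: "t \<in> Str \<Longrightarrow> wq t ^ 3 = 6 * sm t"
proof -
  assume "t \<in> Str"
  then have "exp (lgq t / 3) ^ 3 = gq t" using lgq(2) by (simp flip: exp_of_nat_mult)
  then show ?thesis by (simp add: wq_def power_mult_distrib gq_def sm_def)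
qed

lemma wq_minus: "t \<in> Str \<Longrightarrow> wq (- t) = - wq t"
  by (simp add: wq_def lgq_minus)

lemma wq_eq_0_iff: "wq t = 0 \<longleftrightarrow> t = 0" by (simp add: wq_def)

text \<open>The values of \<open>w\<close> on the two curves, up to the factors \<open>\<i>\<close> and \<open>exp (\<i> \<pi> / 6)\<close>.\<close>

definition vv :: "real \<Rightarrow> real" where "vv x = (6 * (height x + 2 * pi)) powr (1 / 3)"
definition zz :: "real \<Rightarrow> real" where "zz x = (6 * height x) powr (1 / 3)"

lemma vv_zz:
  assumes "x > 0"
  shows "vv x > 0" "zz x > 0" "vv x ^ 3 = 6 * (height x + 2 * pi)" "zz x ^ 3 = 6 * height x"
proof -
  have h: "6 * height x > 0" "6 * (height x + 2 * pi) > 0"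
    using height_pos[OF assms] pi_gt3 by (simp_all add: add_pos_pos)
  then show "vv x > 0" "zz x > 0" by (auto simp: vv_def zz_def)
  have "(a powr (1 / 3)) ^ 3 = a" if "a > 0" for a :: real
    using that powr_realpow[of "a powr (1/3)" 3] by (simp add: powr_powr)
  from this[OF h(1)] this[OF h(2)]
  show "vv x ^ 3 = 6 * (height x + 2 * pi)" "zz x ^ 3 = 6 * height x"
    by (simp_all only: vv_def zz_def)
qed

lemma continuous_on_vv: "continuous_on {0<..} vv" and continuous_on_zz: "continuous_on {0<..} zz"
proof -
  have "6 * height x \<noteq> 0" "6 * (height x + 2 * pi) \<noteq> 0" if "x > 0" for x
    using height_pos[OF that] add_pos_pos[OF height_pos[OF that], of "2 * pi"] by auto
  then show "continuous_on {0<..} vv" "continuous_on {0<..} zz"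
    unfolding vv_def[abs_def] zz_def[abs_def]
    by (intro continuous_intros continuous_on_curve; auto)+
qed

lemma curve_in_Str:
  assumes "x > 0"
  shows "tC e x \<in> Str" "tU e x \<in> Str"
  using cangle_bounds[OF assms] pi_gt_zero by (auto simp: Str_def tC_def tU_def)

lemma continuous_on_tC: "continuous_on {0<..} (tC e)" and continuous_on_tU: "continuous_on {0<..} (tU e)"
  unfolding tC_def tU_def
  by (rule continuous_on_Complex; intro continuous_on_mult continuous_on_diff continuous_on_const continuous_on_id continuous_on_curve(1))+

lemma continuous_on_wq_curve:
  "continuous_on {0<..} (\<lambda>x. wq (tC e x))" "continuous_on {0<..} (\<lambda>x. wq (tU e x))"
proof -
  note w = holomorphic_on_imp_continuous_on[OF holomorphic_wq]
  show "continuous_on {0<..} (\<lambda>x. wq (tC e x))"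
    by (rule continuous_on_compose2[OF w continuous_on_tC]) (auto simp: curve_in_Str)
  show "continuous_on {0<..} (\<lambda>x. wq (tU e x))"
    by (rule continuous_on_compose2[OF w continuous_on_tU]) (auto simp: curve_in_Str)
qed

lemma vv_zz_nz: "x > 0 \<Longrightarrow> vv x \<noteq> 0" "x > 0 \<Longrightarrow> zz x \<noteq> 0"
  using vv_zz(1)[of x] vv_zz(2)[of x] by auto

text \<open>Knowing w^3 on a curve determines w up to a cube root of unity, which is constant by
  continuity and so can be found at one end of the curve.\<close>

lemma cube_root_unity_constant:
  fixes \<rho> :: "real \<Rightarrow> complex"
  assumes c: "continuous_on {0<..} \<rho>" and 3: "\<And>x. x > 0 \<Longrightarrow> \<rho> x ^ 3 = 1"
  obtains c where "c ^ 3 = 1" "\<And>x. x > 0 \<Longrightarrow> \<rho> x = c"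
proof -
  have "finite (\<rho> ` {0<..})"
    by (rule finite_subset[OF _ finite_roots_unity[of 3]]) (use 3 in auto)
  then have "\<rho> constant_on {0<..}"
    by (intro continuous_finite_range_constant[OF _ c]) (simp add: connected_Ioi)
  then show ?thesis using that 3 unfolding constant_on_def by (metis greaterThan_iff zero_less_one)
qed

text \<open>As x -> 0 the point tends to 2 \<pi> i, where the logarithm is real and w is therefore i
  times a positive number. The root of unity is the positive number \<open>a\<close>, hence
  1.\<close>

lemma wq_upper:
  assumes x: "x > 0" and e: "e = 1 \<or> e = - 1"
  shows "wq (tU e x) = \<i> * vv x"
proof -
  define \<rho> where "\<rho> = (\<lambda>x. wq (tU e x) / (\<i> * vv x))"
  have "\<rho> x ^ 3 = 1" if "x > 0" for x
  proof -
    have "complex_of_real (vv x) ^ 3 = of_real (6 * (height x + 2 * pi))"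
      using vv_zz(3)[OF that] by (metis of_real_power)
    moreover have "6 * (height x + 2 * pi) \<noteq> 0"
      using add_pos_pos[OF height_pos[OF that], of "2 * pi"] by auto
    then have "complex_of_real (6 * (height x + 2 * pi)) \<noteq> 0" by (metis of_real_eq_0_iff)
    moreover have "wq (tU e x) ^ 3 = - \<i> * of_real (6 * (height x + 2 * pi))"
      unfolding wq_cube[OF curve_in_Str(2)[OF that]] sm_curve(2)[OF that e] by (simp add: algebra_simps)
    ultimately show ?thesis
      unfolding \<rho>_def power_divide power_mult_distrib
      by (simp del: of_real_mult of_real_add add: power3_eq_cube[of \<i>])
  qed
  moreover have "continuous_on {0<..} \<rho>"
    unfolding \<rho>_def
    by (intro continuous_intros continuous_on_vv continuous_on_wq_curve) (auto simp: vv_zz_nz)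
  ultimately obtain c where c: "c ^ 3 = 1" "\<And>x. x > 0 \<Longrightarrow> \<rho> x = c"
    using cube_root_unity_constant by blast
  define a where "a = 2 * pi * exp (Re (lgq (2 * pi * \<i>)) / 3) / (6 * (0 + 2 * pi)) powr (1 / 3)"
  have "(tU e \<longlongrightarrow> Complex (e * 0) (2 * pi - 0)) (at_right 0)"
    unfolding tU_def[abs_def] by (intro tendsto_intros cangle_limit)
  then have "((\<lambda>x. wq (tU e x)) \<longlongrightarrow> wq (Complex (e * 0) (2 * pi - 0))) (at_right 0)"
  proof (rule isCont_tendsto_compose[rotated])
    have "Complex (e * 0) (2 * pi - 0) \<in> Str" using pi_gt_zero by (auto simp: Str_def)
    then show "isCont wq (Complex (e * 0) (2 * pi - 0))"
      using holomorphic_on_imp_continuous_on[OF holomorphic_wq] continuous_on_eq_continuous_at[OF Str_props(1)] by blast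
  qed
  moreover have "(vv \<longlongrightarrow> (6 * (0 + 2 * pi)) powr (1 / 3)) (at_right 0)"
    unfolding vv_def[abs_def] by (intro tendsto_intros height_limits) auto
  ultimately have "(\<rho> \<longlongrightarrow> wq (Complex (e * 0) (2 * pi - 0)) / (\<i> * of_real ((6 * (0 + 2 * pi)) powr (1 / 3)))) (at_right 0)"
    unfolding \<rho>_def by (intro tendsto_intros) auto
  moreover have "wq (Complex (e * 0) (2 * pi - 0)) / (\<i> * of_real ((6 * (0 + 2 * pi)) powr (1 / 3))) = of_real a"
  proof -
    have eq: "Complex (e * 0) (2 * pi - 0) = \<i> * of_real (2 * pi)" by (simp add: complex_eq_iff)
    have "lgq (\<i> * of_real (2 * pi)) = of_real (Re (lgq (2 * pi * \<i>)))"
      using lgq_imaginary_real[of "2 * pi"] by (simp add: complex_eq_iff mult.commute)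
    then show ?thesis unfolding eq wq_def a_def by (simp add: exp_of_real[symmetric])
  qed
  moreover have "(\<rho> \<longlongrightarrow> c) (at_right 0)"
    by (rule tendsto_eventually, rule eventually_mono[OF eventually_at_right_less]) (use c in auto)
  ultimately have "c = of_real a"
    using tendsto_unique[OF trivial_limit_at_right_real] by simp
  moreover have "a > 0" by (simp add: a_def)
  ultimately have "a ^ 3 = 1 ^ 3" using c(1) by (metis of_real_eq_1_iff of_real_power power_one)
  then have "a = 1" using \<open>a > 0\<close> by (intro power_eq_imp_eq_base[of a 3 1]) auto
  then have "\<rho> x = 1" using c(2)[OF x] \<open>c = of_real a\<close> by simp
  then show ?thesis using vv_zz(1)[OF x] by (simp add: \<rho>_def field_simps)
qed

text \<open>The cube roots of i are - i and +-sqrt 3 / 2 + i / 2; each inequality excludes one wrong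
  root and leaves room for the crude estimate by which it will be verified.\<close>

lemma cube_root_i:
  fixes d :: complex
  assumes "d ^ 3 = \<i>" "Re d > - (1 / 2)" "Im d > - (1 / 2)"
  shows "d = Complex (sqrt 3 / 2) (1 / 2)"
proof -
  have "(d + \<i>) * ((d - \<i> / 2)\<^sup>2 - of_real ((sqrt 3 / 2)\<^sup>2)) = d ^ 3 - \<i>"
    by (simp add: power2_eq_square power3_eq_cube algebra_simps flip: of_real_mult)
  then have "d + \<i> = 0 \<or> (d - \<i> / 2)\<^sup>2 - (of_real (sqrt 3 / 2))\<^sup>2 = 0" using assms(1) by simp
  moreover have "d + \<i> \<noteq> 0" using assms(3) by (auto simp: complex_eq_iff)
  ultimately have "(d - \<i> / 2 - of_real (sqrt 3 / 2)) * (d - \<i> / 2 + of_real (sqrt 3 / 2)) = 0"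
    by (simp add: power2_eq_square algebra_simps)
  moreover have "d - \<i> / 2 + of_real (sqrt 3 / 2) \<noteq> 0"
  proof
    assume "d - \<i> / 2 + of_real (sqrt 3 / 2) = 0"
    then have "Re d = - sqrt 3 / 2" by (simp add: complex_eq_iff)
    moreover have "sqrt 3 > 1" by simp
    ultimately show False using assms(2) by linarith
  qed
  ultimately have "d - \<i> / 2 - of_real (sqrt 3 / 2) = 0" by simp
  then show ?thesis by (simp add: complex_eq_iff)
qed

text \<open>At the end t = 0 numerator and denominator both vanish, so the root of unity is found
  from a nearby point: there w is close to t relative to |t|, and t lies in the first
  quadrant.\<close>

lemma wq_lower:
  assumes x: "x > 0"
  shows "wq (tC 1 x) = Complex (sqrt 3 / 2) (1 / 2) * zz x"
proof -
  define \<rho> where "\<rho> = (\<lambda>x. wq (tC 1 x) / (Complex (sqrt 3 / 2) (1 / 2) * zz x))"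
  have k0: "Complex (sqrt 3 / 2) (1 / 2) \<noteq> 0" by (simp add: complex_eq_iff)
  have k3: "Complex (sqrt 3 / 2) (1 / 2) ^ 3 = \<i>"
    by (simp add: power3_eq_cube complex_eq_iff algebra_simps)
  have w3: "wq (tC 1 x) ^ 3 = \<i> * of_real (zz x) ^ 3" if "x > 0" for x
  proof -
    have "complex_of_real (zz x) ^ 3 = of_real (6 * height x)"
      using vv_zz(4)[OF that] by (metis of_real_power)
    then show ?thesis using wq_cube[OF curve_in_Str(1)[OF that]] sm_curve(1)[OF that, of 1] by simp
  qed
  have "\<rho> x ^ 3 = 1" if "x > 0" for x
    using w3[OF that] vv_zz(2)[OF that] by (simp add: \<rho>_def power_divide power_mult_distrib k3)
  moreover have "continuous_on {0<..} \<rho>"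
    unfolding \<rho>_def
    by (intro continuous_intros continuous_on_zz continuous_on_wq_curve) (auto simp: vv_zz_nz k0)
  ultimately obtain c where c: "c ^ 3 = 1" "\<And>x. x > 0 \<Longrightarrow> \<rho> x = c"
    using cube_root_unity_constant by blast
  have "isCont (\<lambda>t. exp (lgq t / 3)) 0"
    using holomorphic_on_imp_continuous_on[OF lgq(1)] continuous_on_eq_continuous_at[OF Str_props(1)] Str_props(4)
    by (intro continuous_intros) auto
  then have "((\<lambda>x. exp (lgq (tC 1 x) / 3)) \<longlongrightarrow> exp (lgq 0 / 3)) (at_right 0)"
    by (rule isCont_tendsto_compose[OF _ tC_tendsto_0])
  \<comment> \<open>With 1/4 one gets |t| <= 4 |w| / 3 and thus |w - t| <= |w| / 3 < |w| / 2, as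
    \<open>cube_root_i\<close> demands.\<close>
  then have "eventually (\<lambda>x. dist (exp (lgq (tC 1 x) / 3)) 1 < 1 / 4) (at_right 0)"
    using lgq(3) by (intro tendstoD) auto
  then have "eventually (\<lambda>x. dist (exp (lgq (tC 1 x) / 3)) 1 < 1 / 4 \<and> x > 0) (at_right 0)"
    using eventually_at_right_less[of 0] by (rule eventually_conj)
  then obtain y where y: "dist (exp (lgq (tC 1 y) / 3)) 1 < 1 / 4" "y > 0"
    using eventually_happens trivial_limit_at_right_real by blast
  define t where "t = tC 1 y"
  define d where "d = c * Complex (sqrt 3 / 2) (1 / 2)"
  have wd: "wq t = d * zz y"
    using c(2)[OF y(2)] vv_zz(2)[OF y(2)] k0 by (simp add: \<rho>_def t_def d_def field_simps)
  have nd: "d ^ 3 = \<i>" using c(1) k3 by (simp add: d_def power_mult_distrib)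
  then have "norm d ^ 3 = 1 ^ 3" by (metis norm_ii norm_power power_one)
  then have nd1: "norm d = 1" using power_eq_imp_eq_base[of "norm d" 3 1] by simp
  have tpos: "Re t > 0" "Im t > 0" using y cangle_bounds[OF y(2)] by (auto simp: t_def tC_def)
  have "wq t - t = t * (exp (lgq t / 3) - 1)" by (simp add: wq_def algebra_simps)
  then have "norm (wq t - t) = norm t * dist (exp (lgq t / 3)) 1" by (simp add: norm_mult dist_norm)
  also have "\<dots> \<le> norm t * (1 / 4)" using y(1) by (intro mult_left_mono) (auto simp: t_def)
  finally have 1: "norm (wq t - t) \<le> norm t / 4" by simp
  have nw: "norm (wq t) = zz y" using wd nd1 vv_zz(2)[OF y(2)] by (simp add: norm_mult)
  have "norm t \<le> norm (wq t) + norm (wq t - t)" using norm_triangle_ineq4[of "wq t" "wq t - t"] by simp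
  then have "norm (wq t - t) \<le> zz y / 3" using 1 nw by simp
  moreover have "Re (t - wq t) \<le> norm (wq t - t)" "Im (t - wq t) \<le> norm (wq t - t)"
    using abs_Re_le_cmod[of "t - wq t"] abs_Im_le_cmod[of "t - wq t"]
    unfolding norm_minus_commute[of t "wq t"] by linarith+
  ultimately have "- Re (wq t) < zz y / 2" "- Im (wq t) < zz y / 2"
    using tpos vv_zz(2)[OF y(2)] by auto
  then have "- (1 / 2) * zz y < Re d * zz y" "- (1 / 2) * zz y < Im d * zz y"
    by (simp_all add: wd)
  then have "Re d > - (1 / 2)" "Im d > - (1 / 2)"
    using vv_zz(2)[OF y(2)] mult_less_cancel_right_pos by blast+
  from cube_root_i[OF nd this] have "c * Complex (sqrt 3 / 2) (1 / 2) = 1 * Complex (sqrt 3 / 2) (1 / 2)" by (simp add: d_def)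
  then have "c = 1" using k0 mult_right_cancel by blast
  then show ?thesis using c(2)[OF x] vv_zz(2)[OF x] k0 by (simp add: \<rho>_def field_simps)
qed

section \<open>The coefficients as moments\<close>

definition Mass :: "nat \<Rightarrow> real" where "Mass k = integral {0<..} (\<lambda>x. Kdens x / vv x ^ k)"

text \<open>The exponent 4/3 exceeds 1, so (1 + Kmass)^(-4/3) is integrable against d Kmass; this is
  what makes the moments from k = 4 on finite.\<close>

lemma vv_ge:
  assumes "x > 0"
  shows "vv x \<ge> 1" "vv x ^ 4 \<ge> (1 + Kmass x) powr (4 / 3)"
proof -
  define a where "a = 6 * (height x + 2 * pi)"
  have a: "a \<ge> 1 + Kmass x" "Kmass x > 0"
    using height_ge[OF assms] Kmass_pos[OF assms] pi_gt3 unfolding a_def distrib_left by linarith+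
  have v: "vv x = a powr (1 / 3)" by (simp add: vv_def a_def)
  show "vv x \<ge> 1" unfolding v using a by (intro ge_one_powr_ge_zero) auto
  have "vv x ^ 4 = a powr (4 / 3)"
    unfolding v using a powr_realpow[of "a powr (1/3)" 4] by (simp add: powr_powr)
  also have "\<dots> \<ge> (1 + Kmass x) powr (4 / 3)" using a by (intro powr_mono2) auto
  finally show "vv x ^ 4 \<ge> (1 + Kmass x) powr (4 / 3)" .
qed

lemma Kdens_vv_integrable:
  assumes "k \<ge> 4"
  shows "(\<lambda>x. Kdens x / vv x ^ k) absolutely_integrable_on {0<..}"
proof (rule absolutely_integrable_on_dominated)
  have "(\<lambda>x. Kdens x / (1 + Kmass x) powr (4 / 3)) absolutely_integrable_on {0<..}"
  proof (rule absolutely_integrable_FTC_nonneg)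
    have nz: "1 + Kmass x \<noteq> 0" "1 + Kmass x > 0" if "x > 0" for x using Kmass_pos[OF that] by linarith+
    show "continuous_on {0<..} (\<lambda>x. Kdens x / (1 + Kmass x) powr (4 / 3))"
      by (intro continuous_intros continuous_on_curve) (auto simp: nz)
    show "((\<lambda>x. - 3 * (1 + Kmass x) powr (- (1 / 3))) has_real_derivative Kdens x / (1 + Kmass x) powr (4 / 3)) (at x)" if x: "x > 0" for x
    proof -
      have "((\<lambda>x. - 3 * (1 + Kmass x) powr (- (1 / 3))) has_real_derivative - 3 * (- (1 / 3) * (1 + Kmass x) powr (- (1 / 3) - 1) * Kdens x)) (at x)"
        using nz[OF x] by (auto intro!: derivative_eq_intros Kmass_deriv[OF x])
      moreover have "- (1 / 3) - 1 = - (4 / 3 :: real)" by simp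
      then have "(1 + Kmass x) powr (- (1 / 3) - 1) = inverse ((1 + Kmass x) powr (4 / 3))"
        by (simp only: powr_minus)
      then have "- 3 * (- (1 / 3) * (1 + Kmass x) powr (- (1 / 3) - 1) * Kdens x) = Kdens x / (1 + Kmass x) powr (4 / 3)"
        by (simp only: divide_inverse) simp
      ultimately show ?thesis by simp
    qed
    show "((\<lambda>x. - 3 * (1 + Kmass x) powr (- (1 / 3))) \<longlongrightarrow> - 3 * (1 + 0) powr (- (1 / 3))) (at_right 0)"
      by (intro tendsto_intros Kmass_limits) auto
    have "((\<lambda>y. - 3 * (1 + y) powr (- (1 / 3))) \<longlongrightarrow> (0::real)) at_top" by real_asymp
    from filterlim_compose[OF this Kmass_limits(2)]
    show "((\<lambda>x. - 3 * (1 + Kmass x) powr (- (1 / 3))) \<longlongrightarrow> 0) at_top" .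
  qed (use Kdens_nonneg in auto)
  then show "(\<lambda>x. Kdens x / (1 + Kmass x) powr (4 / 3)) integrable_on {0<..}"
    by (rule set_lebesgue_integral_eq_integral(1))
  show "continuous_on {0<..} (\<lambda>x. Kdens x / vv x ^ k)"
    by (intro continuous_intros continuous_on_curve continuous_on_vv) (auto simp: vv_zz_nz)
  show "norm (Kdens x / vv x ^ k) \<le> Kdens x / (1 + Kmass x) powr (4 / 3)" if x: "x \<in> {0<..}" for x
  proof -
    have "vv x ^ k \<ge> vv x ^ 4" using vv_ge[of x] x assms by (intro power_increasing) auto
    then have "vv x ^ k \<ge> (1 + Kmass x) powr (4 / 3)" using vv_ge(2)[of x] x by simp
    moreover have "(1 + Kmass x) powr (4 / 3) > 0" using Kmass_pos[of x] x by simp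
    moreover have "vv x ^ k > 0" using vv_zz(1) x by simp
    ultimately show ?thesis using Kdens_nonneg[of x] x
      by (simp add: divide_left_mono)
  qed
qed auto

text \<open>Holds for every k: if the integral does not exist, its default value is 0.\<close>

lemma Mass_nonneg: "Mass k \<ge> 0"
proof (cases "(\<lambda>x. Kdens x / vv x ^ k) integrable_on {0<..}")
  case True
  then show ?thesis unfolding Mass_def
    by (rule integral_nonneg) (auto intro!: divide_nonneg_nonneg Kdens_nonneg zero_le_power less_imp_le[OF vv_zz(1)])
qed (simp add: Mass_def not_integrable_integral)

text \<open>This is sinh t * (t / w)^(m+1), so \<open>fD m t / t ^ (m + 1)\<close> is sinh t /
  w^(m+1) and its residue is the coefficient \<open>coeffD m\<close>.\<close>

definition fD :: "nat \<Rightarrow> complex \<Rightarrow> complex" where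
  "fD m t = sinh t * exp ((of_nat m + 1) / 3 * - lgq t)"

lemma holomorphic_fD: "fD m holomorphic_on Str"
  unfolding fD_def sinh_field_def using lgq(1) by (intro holomorphic_intros) auto

text \<open>Near 0 the imaginary part of \<open>lgq\<close> stays below 1 < \<pi>, so the principal
  power agrees with the one built from \<open>lgq\<close>; the derivatives see only this
  neighbourhood.\<close>

lemma coeffD_eq: "coeffD m = (deriv ^^ m) (fD m) 0 / fact m"
proof -
  have "isCont lgq 0"
    using holomorphic_on_imp_continuous_on[OF lgq(1)] continuous_on_eq_continuous_at[OF Str_props(1)] Str_props(4) by blast
  then have "eventually (\<lambda>t. dist (lgq t) (lgq 0) < 1) (at 0)" unfolding isCont_def by (intro tendstoD) auto
  then have "eventually (\<lambda>t. dist (lgq t) (lgq 0) < 1) (nhds 0)"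
    unfolding eventually_at_filter
  proof eventually_elim
    case (elim t)
    then show ?case by (cases "t = 0") auto
  qed
  moreover have "eventually (\<lambda>t. t \<in> Str) (nhds (0::complex))"
    using Str_props(1,4) by (rule eventually_nhds_in_open)
  ultimately have "eventually (\<lambda>t. sinh t * (if t = 0 then 1 else 1 / 6 * (t ^ 3 / (sinh t - t))) powr ((of_nat m + 1) / 3) = fD m t) (nhds 0)"
  proof eventually_elim
    case (elim t)
    have "(if t = 0 then 1 else 1 / 6 * (t ^ 3 / (sinh t - t))) = inverse (gq t)"
      by (simp add: gq_def sm_def field_simps)
    also have "\<dots> = exp (- lgq t)" using lgq(2)[OF elim(2)] by (simp add: exp_minus)
    finally have b: "(if t = 0 then 1 else 1 / 6 * (t ^ 3 / (sinh t - t))) = exp (- lgq t)" .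
    have "\<bar>Im (lgq t)\<bar> < 1" using elim(1) abs_Im_le_cmod[of "lgq t"] by (simp add: lgq(3) dist_norm)
    then have "Ln (exp (- lgq t)) = - lgq t" using pi_gt3 by (intro Ln_exp) auto
    then show ?case unfolding b fD_def powr_def by simp
  qed
  then show ?thesis unfolding coeffD_def by (simp add: higher_deriv_cong_ev)
qed

lemma coeffD_1: "coeffD 1 = 1"
proof -
  have "(lgq has_field_derivative deriv lgq 0) (at 0)" using lgq(1) Str_props holomorphic_derivI by blast
  then have "(fD 1 has_field_derivative 1) (at 0)"
    unfolding fD_def by (auto intro!: derivative_eq_intros simp: lgq(3))
  then show ?thesis unfolding coeffD_eq by (simp add: DERIV_imp_deriv)
qed

lemma norm_sinh_ge: "norm (sinh t) \<ge> sinh \<bar>Re t\<bar>"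
proof -
  have "\<bar>norm (exp t) - norm (exp (- t))\<bar> \<le> norm (exp t - exp (- t))" by (rule norm_triangle_ineq3)
  then have "\<bar>exp (Re t) - exp (- Re t)\<bar> / 2 \<le> norm (sinh t)" by (simp add: sinh_field_def norm_divide)
  moreover have "sinh \<bar>Re t\<bar> \<le> \<bar>exp (Re t) - exp (- Re t)\<bar> / 2" by (cases "Re t \<ge> 0") (simp_all add: sinh_field_def abs_if)
  ultimately show ?thesis by linarith
qed

context
  fixes n :: nat
  assumes n: "n \<ge> 1"
begin

definition aD :: "complex \<Rightarrow> complex" where "aD t = sinh t / wq t ^ (2 * n + 2)"

text \<open>Once the residue term is removed, a Laurent part plus a holomorphic function has a
  single-valued primitive on the punctured strip. It is even because \<open>aD\<close> is odd: Q t -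
  Q (- t) is constant there and changes sign with t.\<close>

lemma aD_primitive:
  obtains Q where "\<And>t. t \<in> Str - {0} \<Longrightarrow> (Q has_field_derivative aD t - coeffD (2 * n + 1) / t) (at t)"
    "\<And>t. t \<in> Str - {0} \<Longrightarrow> Q (- t) = Q t"
proof -
  define m where "m = 2 * n + 1"
  define c where "c = (\<lambda>j. (deriv ^^ j) (fD m) 0 / fact j)"
  obtain g where g: "g holomorphic_on Str" "\<And>t. t \<in> Str \<Longrightarrow> fD m t = (\<Sum>j<Suc m. c j * t ^ j) + t ^ Suc m * g t"
    using Taylor_remainder_holomorphic[OF Str_props(1,4) holomorphic_fD[of m], of "Suc m"] unfolding c_def by metis
  have cm: "c m = coeffD m" by (simp add: c_def coeffD_eq)
  obtain G where G: "\<And>t. t \<in> Str \<Longrightarrow> (G has_field_derivative g t) (at t within Str)"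
    using holomorphic_convex_primitive'[OF Str_props(2,1) g(1)] by blast
  have G': "(G has_field_derivative g t) (at t)" if "t \<in> Str" for t
    using G[OF that] at_within_open[OF that Str_props(1)] by simp
  \<comment> \<open>Termwise primitive of the Laurent part. The index j = m is left out: it is the
    term \<open>coeffD m / t\<close>.\<close>
  define Q where "Q = (\<lambda>t. (\<Sum>j<m. - (c j / of_nat (m - j)) * inverse t ^ (m - j)) + G t)"
  have aDf: "aD t = fD m t / t ^ Suc m" for t
  proof -
    have E: "exp ((of_nat m + 1) / 3 * - lgq t) = inverse (exp (lgq t / 3) ^ Suc m)"
    proof -
      have e: "(of_nat m + 1) / 3 * - lgq t = - (of_nat (Suc m) * (lgq t / 3))" by simp
      show ?thesis by (simp only: e exp_minus exp_of_nat_mult)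
    qed
    have m2: "2 * n + 2 = Suc m" by (simp add: m_def)
    show ?thesis unfolding aD_def fD_def m2 wq_def power_mult_distrib E
      by (simp only: divide_inverse inverse_mult_distrib mult_ac)
  qed
  have QD: "(Q has_field_derivative aD t - coeffD m / t) (at t)" if t: "t \<in> Str - {0}" for t
  proof -
    have t0: "t \<noteq> 0" using t by auto
    have ID: "((\<lambda>t. inverse t ^ k) has_field_derivative - of_nat k * inverse t ^ Suc k) (at t)" for k
    proof -
      have "((\<lambda>t. inverse t ^ k) has_field_derivative of_nat k * (- (inverse t ^ Suc (Suc 0)) * inverse t ^ (k - Suc 0))) (at t)"
        by (rule DERIV_power[OF DERIV_inverse[OF t0]])
      moreover have "of_nat k * (- (inverse t ^ Suc (Suc 0)) * inverse t ^ (k - Suc 0)) = - of_nat k * inverse t ^ Suc k"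
        by (cases k) (simp_all add: algebra_simps)
      ultimately show ?thesis by (simp only:)
    qed
    have "(Q has_field_derivative (\<Sum>j<m. - (c j / of_nat (m - j)) * (- of_nat (m - j) * inverse t ^ Suc (m - j))) + g t) (at t)"
      unfolding Q_def by (intro DERIV_add DERIV_sum DERIV_cmult G' ID) (use t in auto)
    moreover have "(\<Sum>j<m. - (c j / of_nat (m - j)) * (- of_nat (m - j) * inverse t ^ Suc (m - j))) = (\<Sum>j<m. c j * t ^ j / t ^ Suc m)"
    proof (rule sum.cong[OF refl])
      fix j assume j: "j \<in> {..<m}"
      have "t ^ Suc m = t ^ j * t ^ Suc (m - j)" using j by (simp flip: power_add)
      then have e1: "t ^ j / t ^ Suc m = inverse t ^ Suc (m - j)" using t0 by (simp add: field_simps)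
      show "- (c j / of_nat (m - j)) * (- of_nat (m - j) * inverse t ^ Suc (m - j)) = c j * t ^ j / t ^ Suc m"
      proof -
        have "- (x / a) * (- a * y) = x * y" if "a \<noteq> 0" for x a y :: complex using that by simp
        moreover have "of_nat (m - j) \<noteq> (0::complex)" using j by (simp del: of_nat_diff)
        ultimately show ?thesis unfolding times_divide_eq_right[symmetric] e1 by blast
      qed
    qed
    moreover have "aD t - coeffD m / t = (\<Sum>j<m. c j * t ^ j / t ^ Suc m) + g t"
    proof -
      have "fD m t = (\<Sum>j<m. c j * t ^ j) + coeffD m * t ^ m + t ^ Suc m * g t" using g(2)[of t] t cm by simp
      then have "aD t = (\<Sum>j<m. c j * t ^ j) / t ^ Suc m + coeffD m * t ^ m / t ^ Suc m + t ^ Suc m * g t / t ^ Suc m"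
        unfolding aDf by (simp only: add_divide_distrib)
      then show ?thesis using t0 by (simp add: sum_divide_distrib)
    qed
    ultimately show ?thesis by simp
  qed
  have odd: "aD (- t) = - aD t" if "t \<in> Str" for t
    using wq_minus[OF that] by (simp add: aD_def)
  have con: "connected (Str - {0})" using Str_props by (intro connected_open_delete) auto
  have "((\<lambda>t. Q t - Q (- t)) has_field_derivative 0) (at t)" if t: "t \<in> Str - {0}" for t
  proof -
    have t': "- t \<in> Str - {0}" using t Str_props(5) by auto
    have "((\<lambda>t. Q (- t)) has_field_derivative (aD (- t) - coeffD m / (- t)) * (- 1)) (at t)"
      by (rule DERIV_chain2[where f = Q and g = uminus, OF QD[OF t']]) (auto intro!: derivative_eq_intros)
    then have "((\<lambda>t. Q t - Q (- t)) has_field_derivative (aD t - coeffD m / t) - (aD (- t) - coeffD m / (- t)) * (- 1)) (at t)"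
      by (intro DERIV_diff QD t)
    then show ?thesis using odd t by simp
  qed
  note D0 = this
  have "(\<lambda>t. Q t - Q (- t)) constant_on (Str - {0})"
  proof (rule DERIV_zero_connected_constant_on[OF con _ finite.emptyI])
    show "open (Str - {0})" using Str_props(1) by auto
    show "continuous_on (Str - {0}) (\<lambda>t. Q t - Q (- t))"
      by (rule DERIV_continuous_on, rule has_field_derivative_at_within, rule D0)
  qed (use D0 in auto)
  then obtain k where k: "\<And>t. t \<in> Str - {0} \<Longrightarrow> Q t - Q (- t) = k"
    unfolding constant_on_def by auto
  have "Q (- t) = Q t" if t: "t \<in> Str - {0}" for t
  proof -
    have "- t \<in> Str - {0}" using t Str_props(5) by auto
    from k[OF this] k[OF t] have "k = - k" by (simp add: algebra_simps)
    then have "k = 0" by simp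
    then show ?thesis using k[OF t] by simp
  qed
  then show ?thesis using that QD unfolding m_def by blast
qed

text \<open>On vertical segments |w|^3 = 6 |sinh t - t| is at least 6 (sinh X - X - 2 \<pi>) >= 1,
  and 2 n + 2 >= 4 allows the exponent to be lowered to 4.\<close>

lemma aD_bound:
  assumes X: "X > 0" and S: "6 * (sinh X - X - 2 * pi) \<ge> 1" and y: "\<bar>y\<bar> \<le> 2 * pi" and e: "e = 1 \<or> e = - 1"
  shows "norm (aD (Complex (e * X) y)) \<le> cosh X / (6 * (sinh X - X - 2 * pi)) powr (4 / 3)"
proof -
  define t where "t = Complex (e * X) y"
  define s where "s = 6 * (sinh X - X - 2 * pi)"
  have Re: "\<bar>Re t\<bar> = X" using e X by (auto simp: t_def)
  have "t \<in> Str" using y by (auto simp: t_def Str_def)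
  then have "norm (wq t) ^ 3 = 6 * norm (sm t)" using wq_cube by (metis norm_mult norm_numeral norm_power)
  moreover have "norm (sm t) \<ge> norm (sinh t) - norm t" unfolding sm_def by (rule norm_triangle_ineq2)
  moreover have "norm t \<le> \<bar>Re t\<bar> + \<bar>Im t\<bar>" by (rule cmod_le)
  moreover have "norm (sinh t) \<ge> sinh X" using norm_sinh_ge[of t] Re by simp
  moreover have "\<bar>Re t\<bar> + \<bar>Im t\<bar> \<le> X + 2 * pi" using y Re by (simp add: t_def)
  ultimately have "norm (wq t) ^ 3 \<ge> s" unfolding s_def by argo
  then have w3: "norm (wq t) ^ 3 \<ge> s" "s \<ge> 1" using S by (auto simp: s_def)
  have w1: "norm (wq t) \<ge> 1"
  proof (rule ccontr)
    assume "\<not> norm (wq t) \<ge> 1"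
    then have "norm (wq t) ^ 3 < 1" using power_strict_mono[of "norm (wq t)" 1 3] by simp
    then show False using w3 by simp
  qed
  have "s powr (4 / 3) \<le> (norm (wq t) ^ 3) powr (4 / 3)" using w3 by (intro powr_mono2) auto
  also have "\<dots> = norm (wq t) ^ 4"
  proof -
    have A: "(r ^ 3) powr (4 / 3) = r ^ 4" if "r > 0" for r :: real
    proof -
      have "(r ^ 3) powr (4 / 3) = (r powr real 3) powr (4 / 3)" using that by (subst powr_realpow) auto
      also have "\<dots> = r powr real 4" unfolding powr_powr by simp
      also have "\<dots> = r ^ 4" using that by (rule powr_realpow)
      finally show ?thesis .
    qed
    show ?thesis by (rule A[OF less_le_trans[OF zero_less_one w1]])
  qed
  also have "\<dots> \<le> norm (wq t) ^ (2 * n + 2)" using w1 n by (intro power_increasing) auto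
  finally have den: "s powr (4 / 3) \<le> norm (wq t) ^ (2 * n + 2)" .
  have "norm (aD t) = norm (sinh t) / norm (wq t) ^ (2 * n + 2)" by (simp only: aD_def norm_divide norm_power)
  also have "\<dots> \<le> cosh X / s powr (4 / 3)"
    using den norm_sinh_le[of t] w3 Re cosh_real_abs[of "Re t"] by (intro frac_le) auto
  finally show ?thesis by (simp add: t_def s_def)
qed

text \<open>The primitive P is followed from X up to the curve, through 2 \<pi> i and down to - X.
  Between the end points Q cancels by evenness and the logarithms differ by i \<pi>; on the curve w
  = i v, so i^(2n+2) gives the sign and the two halves give 2 i \<open>Kdens\<close>.\<close>

theorem coeffD_eq_Mass: "coeffD (2 * n + 1) = of_real ((- 1) ^ (n + 1) * (2 / pi) * Mass (2 * n + 2))"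
proof -
  define c where "c = coeffD (2 * n + 1)"
  obtain Q where Q: "\<And>t. t \<in> Str - {0} \<Longrightarrow> (Q has_field_derivative aD t - c / t) (at t)"
    "\<And>t. t \<in> Str - {0} \<Longrightarrow> Q (- t) = Q t" using aD_primitive unfolding c_def by blast
  \<comment> \<open>This logarithm has its cut on the negative imaginary axis, below the whole
    path.\<close>
  define P where "P = (\<lambda>t. Q t + c * Ln (- \<i> * t))"
  have PD: "(P has_field_derivative aD t) (at t)" if t: "t \<in> Str" "Im t > 0 \<or> Re t \<noteq> 0" for t
  proof -
    have t0: "t \<noteq> 0" using t by auto
    have "- \<i> * t \<notin> \<real>\<^sub>\<le>\<^sub>0" using t by (auto simp: complex_nonpos_Reals_iff)
    then have "((\<lambda>t. c * Ln (- \<i> * t)) has_field_derivative c / t) (at t)"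
      using t0 by (auto intro!: derivative_eq_intros simp: field_simps)
    then have "(P has_field_derivative (aD t - c / t) + c / t) (at t)"
      unfolding P_def using t t0 by (intro DERIV_add Q) auto
    then show ?thesis by simp
  qed
  define G where "G = (\<lambda>x. P (tU (- 1) x) - P (tU 1 x))"
  define f where "f = (\<lambda>x. 2 * \<i> * (- 1) ^ (n + 1) * complex_of_real (Kdens x / vv x ^ (2 * n + 2)))"
  have iv: "(\<i> * complex_of_real v) ^ (2 * n + 2) = (- 1) ^ (n + 1) * of_real (v ^ (2 * n + 2))" for v
  proof -
    have "2 * n + 2 = 2 * (n + 1)" by simp
    then have "\<i> ^ (2 * n + 2) = (- 1) ^ (n + 1)" by (simp only: power_mult power2_i)
    then show ?thesis by (simp only: power_mult_distrib of_real_power)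
  qed
  have d: "(G has_vector_derivative f x) (at x)" if x: "x > 0" for x
  proof -
    let ?c = "- ((x * cosh x - sinh x) / (sinh x * Kmass x))"
    have P': "((\<lambda>x. P (tU e x)) has_vector_derivative Complex e ?c * (sinh (tU e x) / (\<i> * vv x) ^ (2 * n + 2))) (at x)"
      if e: "e = 1 \<or> e = -1" for e
    proof -
      have "Re (tU e x) \<noteq> 0" using e x by (auto simp: tU_def)
      then have "((P \<circ> tU e) has_vector_derivative Complex e ?c * aD (tU e x)) (at x)"
        by (intro field_vector_diff_chain_at[OF curve_has_vector_derivative(2)[OF x]] PD curve_in_Str x) auto
      then show ?thesis unfolding aD_def wq_upper[OF x e] o_def .
    qed
    have C': "((\<lambda>x. cosh (tU e x)) has_vector_derivative Complex e ?c * sinh (tU e x)) (at x)" for e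
    proof -
      have "((cosh \<circ> tU e) has_vector_derivative Complex e ?c * sinh (tU e x)) (at x)"
        by (rule field_vector_diff_chain_at[OF curve_has_vector_derivative(2)[OF x]]) (auto intro!: derivative_eq_intros)
      then show ?thesis by (simp add: o_def)
    qed
    have "((\<lambda>x. cosh (tU (-1) x) - cosh (tU 1 x)) has_vector_derivative (Complex (-1) ?c * sinh (tU (-1) x) - Complex 1 ?c * sinh (tU 1 x))) (at x)"
      by (intro has_vector_derivative_diff C')
    moreover have "((\<lambda>x. cosh (tU (-1) x) - cosh (tU 1 x)) has_vector_derivative Complex 0 (2 * Kdens x)) (at x)"
    proof (rule has_vector_derivative_transform_within_open[of _ _ _ "{0<..}"])
      show "((\<lambda>x. Complex 0 (2 * Kmass x)) has_vector_derivative Complex 0 (2 * Kdens x)) (at x)"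
        unfolding has_vector_derivative_complex_iff using Kmass_deriv[OF x] by (auto intro!: derivative_eq_intros)
    qed (use x sm_curve(4) in \<open>auto simp: complex_eq_iff\<close>)
    ultimately have eq: "Complex (-1) ?c * sinh (tU (-1) x) - Complex 1 ?c * sinh (tU 1 x) = Complex 0 (2 * Kdens x)"
      by (rule vector_derivative_unique_at)
    have "(G has_vector_derivative (Complex (-1) ?c * (sinh (tU (-1) x) / (\<i> * vv x) ^ (2 * n + 2)) - Complex 1 ?c * (sinh (tU 1 x) / (\<i> * vv x) ^ (2 * n + 2)))) (at x)"
      unfolding G_def by (intro has_vector_derivative_diff P') auto
    also have "(Complex (-1) ?c * (sinh (tU (-1) x) / (\<i> * vv x) ^ (2 * n + 2)) - Complex 1 ?c * (sinh (tU 1 x) / (\<i> * vv x) ^ (2 * n + 2)))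
       = (Complex (-1) ?c * sinh (tU (-1) x) - Complex 1 ?c * sinh (tU 1 x)) / (\<i> * vv x) ^ (2 * n + 2)"
      by (simp only: times_divide_eq_right diff_divide_distrib)
    also have "\<dots> = Complex 0 (2 * Kdens x) / ((- 1) ^ (n + 1) * of_real (vv x ^ (2 * n + 2)))" unfolding eq iv ..
    also have "\<dots> = f x"
    proof -
      have "Complex 0 (2 * Kdens x) = 2 * \<i> * of_real (Kdens x)" by (simp add: complex_eq_iff)
      moreover have "a / ((- 1) ^ k * b) = (- 1) ^ k * (a / b)" for a b :: complex and k :: nat
        by (cases "even k") auto
      ultimately show ?thesis unfolding f_def by (simp del: power_Suc)
    qed
    finally show ?thesis .
  qed
  have i: "(\<lambda>x. Kdens x / vv x ^ (2 * n + 2)) absolutely_integrable_on {0<..}"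
    using n by (intro Kdens_vv_integrable) auto
  have f: "f absolutely_integrable_on {0<..}"
    unfolding f_def using absolutely_integrable_linear[OF i bounded_linear_of_real]
    by (intro set_integrable_mult_right) (simp only: o_def)
  have "(\<lambda>k. G (real (Suc k)) - G (inverse (real (Suc k)))) \<longlonglongrightarrow> integral {0<..} f"
  proof (rule integral_FTC_half_line[OF f d])
    show "inverse (real (Suc n)) \<le> real (Suc n)" for n
      using inverse_le_1_iff[of "real (Suc n)"] by simp
    show "(\<lambda>n. inverse (real (Suc n))) \<longlonglongrightarrow> 0" by (rule LIMSEQ_inverse_real_of_nat)
    show "filterlim (\<lambda>n. real (Suc n)) at_top sequentially" by real_asymp
  qed auto
  moreover have "(\<lambda>k. G (inverse (real (Suc k)))) \<longlonglongrightarrow> 0"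
  proof -
    have fl: "filterlim (\<lambda>n. inverse (real (Suc n))) (at_right 0) sequentially" by real_asymp
    have "(\<lambda>k. P (tU e (inverse (real (Suc k))))) \<longlonglongrightarrow> P (Complex (e * 0) (2 * pi - 0))" for e
    proof (rule isCont_tendsto_compose[where g = P])
      have "(tU e \<longlongrightarrow> Complex (e * 0) (2 * pi - 0)) (at_right 0)"
        unfolding tU_def[abs_def] by (intro tendsto_intros cangle_limit)
      then show "(\<lambda>k. tU e (inverse (real (Suc k)))) \<longlonglongrightarrow> Complex (e * 0) (2 * pi - 0)"
        using fl by (rule filterlim_compose)
      show "isCont P (Complex (e * 0) (2 * pi - 0))"
        by (rule DERIV_isCont[OF PD]) (use pi_gt_zero in \<open>auto simp: Str_def\<close>)
    qed
    from tendsto_diff[OF this[of "-1"] this[of 1]] show ?thesis by (simp add: G_def)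
  qed
  ultimately have "(\<lambda>k. (G (real (Suc k)) - G (inverse (real (Suc k)))) + G (inverse (real (Suc k)))) \<longlonglongrightarrow> integral {0<..} f + 0"
    by (rule tendsto_add)
  then have lim1: "(\<lambda>k. G (real (Suc k))) \<longlonglongrightarrow> integral {0<..} f" by simp
  \<comment> \<open>Decays like exp (- X / 3), so the vertical segments of fixed length contribute
    nothing in the limit.\<close>
  define M where "M = (\<lambda>X. cosh X / (6 * (sinh X - X - 2 * pi)) powr (4 / 3))"
  have V: "norm (P (tU e X) - P (Complex (e * X) 0)) \<le> M X * (2 * pi)"
    if X: "X > 0" and S: "6 * (sinh X - X - 2 * pi) \<ge> 1" and e: "e = 1 \<or> e = - 1" for X e
  proof -
    have "norm (P (tU e X) - P (Complex (e * X) 0)) \<le> M X * norm (tU e X - Complex (e * X) 0)"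
    proof (rule field_differentiable_bound)
      show "convex (closed_segment (tU e X) (Complex (e * X) 0))" by simp
      fix t assume "t \<in> closed_segment (tU e X) (Complex (e * X) 0)"
      then obtain v where v: "0 \<le> v" "v \<le> 1" "t = (1 - v) *\<^sub>R tU e X + v *\<^sub>R Complex (e * X) 0"
        by (auto simp: closed_segment_def)
      define y where "y = (1 - v) * (2 * pi - cangle X)"
      have t: "t = Complex (e * X) y" using v by (simp add: tU_def y_def complex_eq_iff algebra_simps)
      have "0 \<le> y" using v cangle_bounds[OF X] by (simp add: y_def)
      moreover have "y \<le> 1 * (2 * pi)" unfolding y_def using v cangle_bounds[OF X] by (intro mult_mono) auto
      ultimately have y: "\<bar>y\<bar> \<le> 2 * pi" by simp
      show "norm (aD t) \<le> M X" unfolding t M_def by (rule aD_bound[OF X S y e])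
      have "t \<in> Str" "Re t \<noteq> 0" using y e X by (auto simp: t Str_def)
      then show "(P has_field_derivative aD t) (at t within closed_segment (tU e X) (Complex (e * X) 0))"
        using PD has_field_derivative_at_within by blast
    qed auto
    also have "norm (tU e X - Complex (e * X) 0) = 2 * pi - cangle X"
      using cangle_bounds[OF X] by (simp add: tU_def cmod_def)
    also have "M X * (2 * pi - cangle X) \<le> M X * (2 * pi)"
      using cangle_bounds[OF X] by (intro mult_left_mono) (auto simp: M_def)
    finally show ?thesis .
  qed
  have Ml: "(\<lambda>k. M (real (Suc k)) * (2 * pi)) \<longlonglongrightarrow> 0"
    unfolding M_def cosh_field_def sinh_field_def by real_asymp
  have "eventually (\<lambda>k. 6 * (sinh (real (Suc k)) - real (Suc k) - 2 * pi) \<ge> 1) sequentially"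
    unfolding sinh_field_def by real_asymp
  then have ev: "eventually (\<lambda>k. norm (P (tU e (real (Suc k))) - P (Complex (e * real (Suc k)) 0)) \<le> M (real (Suc k)) * (2 * pi)) sequentially"
    if e: "e = 1 \<or> e = - 1" for e
    by eventually_elim (intro V e; simp)
  have Vl: "(\<lambda>k. P (tU e (real (Suc k))) - P (Complex (e * real (Suc k)) 0)) \<longlonglongrightarrow> 0" if "e = 1 \<or> e = - 1" for e
    by (rule Lim_null_comparison[OF ev[OF that] Ml])
  have PX: "P (Complex (- 1 * X) 0) - P (Complex (1 * X) 0) = c * (\<i> * pi)" if X: "X > 0" for X
  proof -
    have e: "Complex (- 1 * X) 0 = - complex_of_real X" "Complex (1 * X) 0 = complex_of_real X" by (auto simp: complex_eq_iff)
    have "of_real X \<in> Str - {0}" using X pi_gt_zero by (auto simp: Str_def add_pos_pos)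
    then have q: "Q (- of_real X) = Q (of_real X)" by (rule Q(2))
    have L: "Ln (- \<i> * - of_real X) = of_real (ln X) + \<i> * pi / 2"
      "Ln (- \<i> * of_real X) = of_real (ln X) - \<i> * pi / 2"
      using X pi_gt3 by (intro Ln_unique; simp add: complex_eq_iff Re_exp Im_exp del: Ln_times_of_real)+
    show ?thesis unfolding e P_def L q by (simp add: algebra_simps)
  qed
  have "(\<lambda>k. (P (tU (- 1) (real (Suc k))) - P (Complex (- 1 * real (Suc k)) 0)) - (P (tU 1 (real (Suc k))) - P (Complex (1 * real (Suc k)) 0)) + c * (\<i> * pi)) \<longlonglongrightarrow> 0 - 0 + c * (\<i> * pi)"
    by (rule tendsto_add[OF tendsto_diff[OF Vl Vl] tendsto_const]) auto
  moreover have "(P (tU (- 1) (real (Suc k))) - P (Complex (- 1 * real (Suc k)) 0)) - (P (tU 1 (real (Suc k))) - P (Complex (1 * real (Suc k)) 0)) + c * (\<i> * pi) = G (real (Suc k))" for k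
    using PX[of "real (Suc k)"] by (simp add: G_def algebra_simps)
  ultimately have "(\<lambda>k. G (real (Suc k))) \<longlonglongrightarrow> c * (\<i> * pi)" by simp
  then have "c * (\<i> * pi) = integral {0<..} f" using lim1 LIMSEQ_unique by blast
  also have "\<dots> = 2 * \<i> * (- 1) ^ (n + 1) * of_real (Mass (2 * n + 2))"
    unfolding f_def Mass_def integral_mult_right
    using integral_linear[OF set_lebesgue_integral_eq_integral(1)[OF i], of complex_of_real]
    by (simp only: o_def bounded_linear_of_real)
  finally have "\<i> * (c * pi) = \<i> * (2 * (- 1) ^ (n + 1) * of_real (Mass (2 * n + 2)))" by (simp only: mult_ac)
  then have "c * pi = 2 * (- 1) ^ (n + 1) * of_real (Mass (2 * n + 2))"
    using mult_cancel_left[of \<i>] complex_i_not_zero by blast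
  then have "c = (- 1) ^ (n + 1) * (2 / complex_of_real pi) * of_real (Mass (2 * n + 2))"
    by (simp add: field_simps)
  then show ?thesis by (simp add: c_def)
qed

end

section \<open>The integrand in the uniformising variable\<close>

text \<open>The integrand of \<open>ker\<close> has its poles at w^2 = - vv^2 with vv >= 1, hence
  w^2 is kept off the half-line from - 1 to the left.\<close>

definition Wdom :: "complex set" where "Wdom = {w. Im (w\<^sup>2) \<noteq> 0 \<or> Re (w\<^sup>2) > - 1}"

lemma open_Wdom: "open Wdom"
  unfolding Wdom_def
  by (intro open_Collect_disj open_Collect_neq open_Collect_less continuous_intros)

text \<open>For V large compared with s the term V dominates; for the remaining V the distance from
  - V to s is bounded below. A bound linear in V, uniform near s, is what the dominating function in
  \<open>kerI_local_bound\<close> requires.\<close>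

lemma real_plus_lower_bound:
  assumes "Im s \<noteq> 0 \<or> Re s > - 1"
  obtains d \<epsilon> where "d > 0" "\<epsilon> > 0" "\<And>s' V. dist s s' < d \<Longrightarrow> V \<ge> 1 \<Longrightarrow> norm (of_real V + s') \<ge> \<epsilon> * V"
proof -
  define d0 where "d0 = (if Im s \<noteq> 0 then \<bar>Im s\<bar> else 1 + Re s)"
  have d0: "d0 > 0" using assms by (auto simp: d0_def)
  have lb: "norm (of_real V + s) \<ge> d0" if "V \<ge> 1" for V
  proof (cases "Im s = 0")
    case True
    have "Re (of_real V + s) \<ge> d0" using that True by (simp add: d0_def)
    then show ?thesis using complex_Re_le_cmod[of "of_real V + s"] by linarith
  next
    case False
    then show ?thesis using abs_Im_le_cmod[of "of_real V + s"] by (simp add: d0_def)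
  qed
  define R where "R = norm s + d0 / 2"
  define \<epsilon> where "\<epsilon> = min (1 / 2) (d0 / (4 * R))"
  have R: "R > 0" using d0 by (simp add: R_def add_nonneg_pos)
  have "norm (of_real V + s') \<ge> \<epsilon> * V" if s': "dist s s' < d0 / 2" and V: "V \<ge> 1" for s' V
  proof (cases "V \<ge> 2 * R")
    case True
    have "norm s' \<le> norm s + dist s s'" by (metis dist_norm norm_minus_commute norm_triangle_sub add.commute)
    then have "norm s' \<le> V / 2" using True s' by (simp add: R_def)
    moreover have "norm (of_real V :: complex) \<le> norm (of_real V + s') + norm s'"
      using norm_triangle_ineq4[of "of_real V + s'" s'] by simp
    ultimately have "V / 2 \<le> norm (of_real V + s')" using V by simp
    moreover have "\<epsilon> * V \<le> 1 / 2 * V" using V by (intro mult_right_mono) (auto simp: \<epsilon>_def)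
    ultimately show ?thesis by simp
  next
    case False
    have "norm (of_real V + s) \<le> norm (of_real V + s') + dist s s'"
      using norm_triangle_ineq[of "of_real V + s'" "s - s'"] by (simp add: dist_norm)
    then have "d0 / 2 \<le> norm (of_real V + s')" using lb[OF V] s' by simp
    moreover have "\<epsilon> * V \<le> (d0 / (4 * R)) * (2 * R)" using False V d0 R by (intro mult_mono) (auto simp: \<epsilon>_def)
    then have "\<epsilon> * V \<le> d0 / 2" using R by (simp add: field_simps)
    ultimately show ?thesis by simp
  qed
  moreover have "\<epsilon> > 0" using d0 R by (simp add: \<epsilon>_def)
  ultimately show ?thesis using that[of "d0 / 2" \<epsilon>] d0 by simp
qed

definition kerI :: "nat \<Rightarrow> complex \<Rightarrow> real \<Rightarrow> complex" where
  "kerI k w x = of_real (Kdens x / vv x ^ k) / (of_real ((vv x)\<^sup>2) + w\<^sup>2)"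

lemma kerI_local_bound:
  assumes w: "w \<in> Wdom" and k: "k \<ge> 2"
  obtains e g where "e > 0" "g integrable_on {0<..}" "\<And>w' x. w' \<in> ball w e \<Longrightarrow> x > 0 \<Longrightarrow> norm (kerI k w' x) \<le> g x"
proof -
  obtain d \<epsilon> where d: "d > 0" "\<epsilon> > 0" "\<And>s' V. dist (w\<^sup>2) s' < d \<Longrightarrow> V \<ge> 1 \<Longrightarrow> norm (of_real V + s') \<ge> \<epsilon> * V"
    using real_plus_lower_bound[of "w\<^sup>2"] w unfolding Wdom_def by blast
  have "isCont (\<lambda>w::complex. w\<^sup>2) w" by (intro continuous_intros)
  then obtain e where e: "e > 0" "\<And>w'. dist w' w < e \<Longrightarrow> dist (w'\<^sup>2) (w\<^sup>2) < d"
    using d(1) unfolding continuous_at_eps_delta by blast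
  define g where "g = (\<lambda>x. (1 / \<epsilon>) * (Kdens x / vv x ^ (k + 2)))"
  have gi: "g integrable_on {0<..}"
    unfolding g_def using Kdens_vv_integrable[of "k + 2"] k
    by (intro integrable_on_mult_right set_lebesgue_integral_eq_integral(1)) auto
  have gb: "norm (kerI k w' x) \<le> g x" if w': "w' \<in> ball w e" and x: "x > 0" for w' x
  proof -
    have v: "vv x \<ge> 1" "vv x > 0" using vv_ge(1)[OF x] by auto
    have "dist (w\<^sup>2) (w'\<^sup>2) < d" using e(2)[of w'] w' by (simp add: dist_commute)
    moreover have "(vv x)\<^sup>2 \<ge> 1" using v by (simp add: one_le_power)
    ultimately have "norm (of_real ((vv x)\<^sup>2) + w'\<^sup>2) \<ge> \<epsilon> * (vv x)\<^sup>2" by (rule d(3))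
    then have "Kdens x / vv x ^ k / norm (of_real ((vv x)\<^sup>2) + w'\<^sup>2) \<le> Kdens x / vv x ^ k / (\<epsilon> * (vv x)\<^sup>2)"
    proof (rule divide_left_mono)
      have "0 < \<epsilon> * (vv x)\<^sup>2" using d(2) v by simp
      then show "0 < norm (of_real ((vv x)\<^sup>2) + w'\<^sup>2) * (\<epsilon> * (vv x)\<^sup>2)"
        using \<open>norm (of_real ((vv x)\<^sup>2) + w'\<^sup>2) \<ge> \<epsilon> * (vv x)\<^sup>2\<close> mult_pos_pos less_le_trans by blast
    qed (use Kdens_nonneg[OF x] v in simp_all)
    also have "\<dots> = g x" by (simp only: g_def power_add divide_divide_eq_left times_divide_eq_right times_divide_eq_left mult_1 mult.assoc mult.commute[of \<epsilon>])
    finally show ?thesis unfolding kerI_def norm_divide norm_of_real using Kdens_nonneg[OF x] v by simp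
  qed
  show ?thesis by (rule that[OF e(1) gi gb])
qed

lemma kerI_denom_nz:
  assumes "w \<in> Wdom" "x > 0"
  shows "of_real ((vv x)\<^sup>2) + w\<^sup>2 \<noteq> 0"
proof
  assume "of_real ((vv x)\<^sup>2) + w\<^sup>2 = 0"
  then have "w\<^sup>2 = of_real (- ((vv x)\<^sup>2))" by (simp add: eq_neg_iff_add_eq_0 add.commute)
  moreover have "(vv x)\<^sup>2 \<ge> 1" using vv_ge(1)[OF assms(2)] by (simp add: one_le_power)
  ultimately show False using assms(1) by (simp add: Wdom_def del: of_real_power)
qed

lemma continuous_on_kerI: "w \<in> Wdom \<Longrightarrow> continuous_on {0<..} (kerI k w)"
  unfolding kerI_def
  by (intro continuous_intros continuous_on_curve continuous_on_vv) (auto simp: vv_zz_nz kerI_denom_nz simp del: of_real_power)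

lemma kerI_integrable:
  assumes "w \<in> Wdom" "k \<ge> 2"
  shows "kerI k w absolutely_integrable_on {0<..}"
proof -
  obtain e g where "e > 0" "g integrable_on {0<..}" "\<And>w' x. w' \<in> ball w e \<Longrightarrow> x > 0 \<Longrightarrow> norm (kerI k w' x) \<le> g x"
    using kerI_local_bound[OF assms] by metis
  then show ?thesis
    by (intro absolutely_integrable_on_dominated[of _ _ g] continuous_on_kerI assms) auto
qed

definition ker :: "nat \<Rightarrow> complex \<Rightarrow> complex" where "ker k w = integral {0<..} (kerI k w)"

lemma holomorphic_ker:
  assumes k: "k \<ge> 2"
  shows "ker k holomorphic_on Wdom"
  unfolding ker_def[abs_def]
proof (rule holomorphic_on_integral_param[OF open_Wdom])
  show "(\<lambda>w. kerI k w x) holomorphic_on Wdom" if "x \<in> {0<..}" for x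
    unfolding kerI_def using kerI_denom_nz that by (intro holomorphic_intros) (auto simp del: of_real_power)
  show "\<exists>e>0. \<exists>g. g integrable_on {0<..} \<and> (\<forall>w'\<in>ball w e \<inter> Wdom. \<forall>x\<in>{0<..}. norm (kerI k w' x) \<le> g x)" if "w \<in> Wdom" for w
    using kerI_local_bound[OF that k] by (metis IntD1 greaterThan_iff)
qed (use continuous_on_kerI in auto)

text \<open>From 1 / (V + W) = 1 / V - W / (V (V + W)): each step splits off one moment of the
  measure.\<close>

lemma ker_step:
  assumes w: "w \<in> Wdom" and k: "k \<ge> 2"
  shows "ker k w = of_real (Mass (k + 2)) - w\<^sup>2 * ker (k + 2) w"
proof -
  have k4: "4 \<le> k + 2" using k by simp
  have i1: "(\<lambda>x. complex_of_real (Kdens x / vv x ^ (k + 2))) integrable_on {0<..}"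
    by (rule set_lebesgue_integral_eq_integral(1)[OF absolutely_integrable_linear[OF Kdens_vv_integrable[OF k4] bounded_linear_of_real], unfolded o_def])
  have ir: "(\<lambda>x. Kdens x / vv x ^ (k + 2)) integrable_on {0<..}"
    by (rule set_lebesgue_integral_eq_integral(1)[OF Kdens_vv_integrable[OF k4]])
  have "integral {0<..} (complex_of_real \<circ> (\<lambda>x. Kdens x / vv x ^ (k + 2))) = of_real (integral {0<..} (\<lambda>x. Kdens x / vv x ^ (k + 2)))"
    by (rule integral_linear[OF ir bounded_linear_of_real])
  then have iM: "integral {0<..} (\<lambda>x. complex_of_real (Kdens x / vv x ^ (k + 2))) = of_real (Mass (k + 2))"
    by (simp only: o_def Mass_def)
  have i2: "kerI (k + 2) w integrable_on {0<..}"
    using kerI_integrable[OF w, of "k + 2"] set_lebesgue_integral_eq_integral(1) by auto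
  have "ker k w = integral {0<..} (\<lambda>x. complex_of_real (Kdens x / vv x ^ (k + 2)) - w\<^sup>2 * kerI (k + 2) w x)"
    unfolding ker_def
  proof (rule integral_cong)
    fix x :: real assume "x \<in> {0<..}"
    then have x: "x > 0" by simp
    define V W where "V = complex_of_real ((vv x)\<^sup>2)" and "W = w\<^sup>2"
    have nz: "V + W \<noteq> 0" "V \<noteq> 0" using kerI_denom_nz[OF w x] vv_zz_nz(1)[OF x] by (auto simp: V_def W_def)
    have h1: "A / (V + W) = A / V - W * (A / V / (V + W))" for A
    proof -
      have "A / V = A / V / (V + W) * (V + W)" using nz(1) by simp
      also have "\<dots> = A / V / (V + W) * V + W * (A / V / (V + W))" by (simp only: distrib_left mult.commute[of W])
      also have "A / V / (V + W) * V = A / (V + W)" using nz(2) by simp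
      finally show ?thesis by (simp only: eq_diff_eq)
    qed
    have h2: "complex_of_real (Kdens x / vv x ^ (k + 2)) = of_real (Kdens x / vv x ^ k) / V"
      unfolding V_def of_real_divide[symmetric] power_add divide_divide_eq_left ..
    show "kerI k w x = complex_of_real (Kdens x / vv x ^ (k + 2)) - w\<^sup>2 * kerI (k + 2) w x"
      unfolding kerI_def V_def[symmetric] W_def[symmetric] h2 by (rule h1)
  qed
  also have "\<dots> = integral {0<..} (\<lambda>x. complex_of_real (Kdens x / vv x ^ (k + 2))) - w\<^sup>2 * ker (k + 2) w"
    using integral_diff[OF i1 integrable_on_mult_right[OF i2]] by (simp add: ker_def)
  finally show ?thesis unfolding iM .
qed

text \<open>\<open>Ghat w\<close> continues \<open>sinh t dt/dw\<close> as a function of \<open>w\<close>.\<close>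

definition Ghat :: "complex \<Rightarrow> complex" where "Ghat w = w + of_real (2 / pi) * w ^ 3 * ker 2 w"

text \<open>Iteration of \<open>ker_step\<close>, with the moments replaced by coefficients through
  \<open>coeffD_eq_Mass\<close>. The moment formula holds for n >= 1, which is why the term n = 0
  stands separately as w in \<open>Ghat\<close>.\<close>

lemma Ghat_expansion:
  assumes w: "w \<in> Wdom" and N: "N \<ge> 1"
  shows "Ghat w = (\<Sum>n<N. coeffD (2 * n + 1) * w ^ (2 * n + 1)) + (- 1) ^ (N + 1) * of_real (2 / pi) * w ^ (2 * N + 1) * ker (2 * N) w"
  using N
proof (induction N rule: dec_induct)
  case base
  show ?case using coeffD_1 by (simp add: Ghat_def numeral_3_eq_3)
next
  case (step N)
  have c: "coeffD (2 * N + 1) = (- 1) ^ (N + 1) * of_real (2 / pi) * of_real (Mass (2 * N + 2))"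
    using coeffD_eq_Mass[OF step(1)] by simp
  have k: "ker (2 * N) w = of_real (Mass (2 * N + 2)) - w\<^sup>2 * ker (2 * Suc N) w"
    using ker_step[OF w, of "2 * N"] step(1) by simp
  show ?case unfolding step.IH k sum.lessThan_Suc c
    by (simp add: algebra_simps power2_eq_square)
qed

section \<open>Identification of the integrand with its Stieltjes continuation\<close>

definition OmE :: "complex set" where "OmE = {t \<in> Str. wq t \<in> Wdom}"
definition errE :: "complex \<Rightarrow> complex" where "errE t = sinh t - Ghat (wq t) * deriv wq t"

lemma OmE_props: "open OmE" "0 \<in> OmE" "OmE \<subseteq> Str"
proof -
  have "OmE = Str \<inter> wq -` Wdom" by (auto simp: OmE_def)
  then show "open OmE"
    using continuous_open_preimage[OF holomorphic_on_imp_continuous_on[OF holomorphic_wq] Str_props(1) open_Wdom] by simp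
  show "0 \<in> OmE" "OmE \<subseteq> Str" using Str_props by (auto simp: OmE_def wq_def Wdom_def)
qed

lemma holomorphic_Ghat: "Ghat holomorphic_on Wdom"
  unfolding Ghat_def[abs_def] by (intro holomorphic_intros holomorphic_ker) auto

lemma holomorphic_comp_wq:
  assumes "f holomorphic_on Wdom"
  shows "(\<lambda>t. f (wq t)) holomorphic_on OmE"
proof -
  have "wq holomorphic_on OmE" using holomorphic_wq OmE_props(3) by (rule holomorphic_on_subset)
  moreover have "f holomorphic_on wq ` OmE" using assms by (rule holomorphic_on_subset) (auto simp: OmE_def)
  ultimately show ?thesis using holomorphic_on_compose[of wq OmE f] by (simp add: o_def)
qed

lemma holomorphic_deriv_wq: "deriv wq holomorphic_on Str"
  using holomorphic_deriv[OF holomorphic_wq Str_props(1)] .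

lemma holomorphic_errE: "errE holomorphic_on OmE"
proof -
  have "(\<lambda>t::complex. sinh t) holomorphic_on OmE"
    unfolding sinh_field_def by (intro holomorphic_intros) auto
  then show ?thesis unfolding errE_def[abs_def]
    by (rule holomorphic_on_diff[OF _ holomorphic_on_mult[OF
        holomorphic_comp_wq[OF holomorphic_Ghat] holomorphic_on_subset[OF holomorphic_deriv_wq OmE_props(3)]]])
qed

lemma wq_deriv: "t \<in> Str \<Longrightarrow> (wq has_field_derivative deriv wq t) (at t)"
  using holomorphic_wq Str_props(1) holomorphic_derivI by blast

lemma deriv_wq_minus:
  assumes "t \<in> Str"
  shows "deriv wq (- t) = deriv wq t"
proof -
  have "((\<lambda>t. wq (- t)) has_field_derivative deriv wq (- t) * (- 1)) (at t)"
    by (rule DERIV_chain2[where f = wq and g = uminus, OF wq_deriv[OF Str_props(5)[OF assms]]]) (auto intro!: derivative_eq_intros)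
  moreover have "((\<lambda>t. wq (- t)) has_field_derivative - deriv wq t) (at t)"
    by (rule has_field_derivative_transform_within_open[OF DERIV_minus[OF wq_deriv[OF assms]] Str_props(1) assms])
       (simp add: wq_minus)
  ultimately show ?thesis using DERIV_unique by fastforce
qed

lemma errE_minus:
  assumes "t \<in> OmE"
  shows "errE (- t) = - errE t"
proof -
  have "t \<in> Str" using assms OmE_props by auto
  have "kerI 2 (- w) = kerI 2 w" for w by (simp add: kerI_def fun_eq_iff)
  then have "Ghat (- w) = - Ghat w" for w by (simp add: Ghat_def ker_def)
  then show ?thesis using wq_minus[OF \<open>t \<in> Str\<close>] deriv_wq_minus[OF \<open>t \<in> Str\<close>] by (simp add: errE_def)
qed

lemma DERIV_inverse_power:
  fixes f :: "complex \<Rightarrow> complex"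
  assumes f: "(f has_field_derivative D) (at t)" "f t \<noteq> 0"
  shows "((\<lambda>t. inverse (f t) ^ k) has_field_derivative - of_nat k * inverse (f t) ^ Suc k * D) (at t)"
proof -
  have "((\<lambda>t. inverse (f t) ^ k) has_field_derivative of_nat k * (- (inverse (f t) * D * inverse (f t)) * inverse (f t) ^ (k - Suc 0))) (at t)"
    by (rule DERIV_power[OF DERIV_inverse'[OF f]])
  moreover have "of_nat k * (- (inverse (f t) * D * inverse (f t)) * inverse (f t) ^ (k - Suc 0)) = - of_nat k * inverse (f t) ^ Suc k * D"
    by (cases k) (simp_all add: algebra_simps)
  ultimately show ?thesis by (simp only:)
qed

text \<open>Invariance of the residue under the change of variable \<open>w = wq t\<close>.\<close>

lemma wq_power_contour_integral:
  assumes r: "r > 0" "cball 0 r \<subseteq> Str"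
  shows "((\<lambda>t. wq t ^ k * deriv wq t / wq t ^ Suc m) has_contour_integral (if k = m then 2 * pi * \<i> else 0)) (circlepath 0 r)"
proof -
  have S: "path_image (circlepath 0 r) \<subseteq> Str - {0}" using r by (auto simp: subset_eq dist_norm)
  have prim: "(f' has_contour_integral 0) (circlepath 0 r)"
    if "\<And>t. t \<in> Str - {0} \<Longrightarrow> (f has_field_derivative f' t) (at t)" for f f'
  proof (rule Cauchy_theorem_primitive[of "Str - {0}" f f', OF _ _ S])
    fix t assume "t \<in> Str - {0}"
    then show "(f has_field_derivative f' t) (at t within Str - {0})" by (rule has_field_derivative_at_within[OF that])
  qed simp_all
  consider "k = m" | "k < m" | "k > m" by linarith
  then show ?thesis
  proof cases
    \<comment> \<open>The form dw / w is dt / t plus a third of d \<open>lgq\<close>; only dt / t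
      has a non-zero integral. In the other two cases a power of w is a primitive.\<close>
    case 1
    have "((\<lambda>t. 1 / (t - 0)) has_contour_integral 2 * pi * \<i>) (circlepath 0 r)"
      using Cauchy_integral_circlepath_simple[of "\<lambda>_. 1" 0 r 0] r by simp
    moreover have "((\<lambda>t. deriv lgq t / 3) has_contour_integral 0) (circlepath 0 r)"
    proof (rule prim)
      fix t assume "t \<in> Str - {0}"
      then have "(lgq has_field_derivative deriv lgq t) (at t)" using lgq(1) Str_props(1) holomorphic_derivI by blast
      then show "((\<lambda>t. lgq t / 3) has_field_derivative deriv lgq t / 3) (at t)" by (rule DERIV_cdivide)
    qed
    ultimately have "((\<lambda>t. 1 / (t - 0) + deriv lgq t / 3) has_contour_integral 2 * pi * \<i> + 0) (circlepath 0 r)"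
      by (rule has_contour_integral_add)
    then have "((\<lambda>t. wq t ^ k * deriv wq t / wq t ^ Suc m) has_contour_integral 2 * pi * \<i> + 0) (circlepath 0 r)"
    proof (rule has_contour_integral_eq)
      fix t assume "t \<in> path_image (circlepath 0 r)"
      then have t: "t \<in> Str" "t \<noteq> 0" using S by auto
      have "(lgq has_field_derivative deriv lgq t) (at t)" using t lgq(1) Str_props(1) holomorphic_derivI by blast
      then have "(wq has_field_derivative exp (lgq t / 3) + t * (exp (lgq t / 3) * (deriv lgq t / 3))) (at t)"
        unfolding wq_def by (auto intro!: derivative_eq_intros)
      then have "deriv wq t = exp (lgq t / 3) + t * (exp (lgq t / 3) * (deriv lgq t / 3))" by (rule DERIV_imp_deriv)
      then have "deriv wq t / wq t = 1 / t + deriv lgq t / 3" using t by (simp add: wq_def field_simps)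
      then show "1 / (t - 0) + deriv lgq t / 3 = wq t ^ k * deriv wq t / wq t ^ Suc m"
        using 1 t wq_eq_0_iff[of t] by (simp add: field_simps)
    qed
    then show ?thesis using 1 by simp
  next
    case 2
    have "((\<lambda>t. wq t ^ k * deriv wq t / wq t ^ Suc m) has_contour_integral 0) (circlepath 0 r)"
    proof (rule prim)
      fix t assume t: "t \<in> Str - {0}"
      then have w0: "wq t \<noteq> 0" by (simp add: wq_eq_0_iff)
      have m: "wq t ^ Suc m = wq t ^ k * wq t ^ Suc (m - k)" using 2 by (simp flip: power_add)
      have "((\<lambda>t. - (1 / of_nat (m - k)) * inverse (wq t) ^ (m - k)) has_field_derivative
          - (1 / of_nat (m - k)) * (- of_nat (m - k) * inverse (wq t) ^ Suc (m - k) * deriv wq t)) (at t)"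
        by (intro DERIV_cmult DERIV_inverse_power wq_deriv w0) (use t in auto)
      also have "- (1 / of_nat (m - k)) * (- of_nat (m - k) * inverse (wq t) ^ Suc (m - k) * deriv wq t) = wq t ^ k * deriv wq t / wq t ^ Suc m"
      proof -
        have "- (1 / a) * (- a * y * z) = y * z" if "a \<noteq> 0" for a y z :: complex using that by simp
        moreover have "of_nat (m - k) \<noteq> (0::complex)" using 2 by (simp del: of_nat_diff)
        ultimately have "- (1 / of_nat (m - k)) * (- of_nat (m - k) * inverse (wq t) ^ Suc (m - k) * deriv wq t) = inverse (wq t) ^ Suc (m - k) * deriv wq t" by blast
        also have "\<dots> = wq t ^ k * deriv wq t / wq t ^ Suc m"         proof -
          have "(wq t ^ k * deriv wq t) / (wq t ^ k * wq t ^ Suc (m - k)) = deriv wq t / wq t ^ Suc (m - k)"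
            by (rule mult_divide_mult_cancel_left) (use w0 in simp)
          then show ?thesis unfolding m power_inverse divide_inverse by (simp only: mult.commute)
        qed
        finally show ?thesis .
      qed
      finally show "((\<lambda>t. - (1 / of_nat (m - k)) * inverse (wq t) ^ (m - k)) has_field_derivative wq t ^ k * deriv wq t / wq t ^ Suc m) (at t)" .
    qed
    then show ?thesis using 2 by simp
  next
    case 3
    have "((\<lambda>t. wq t ^ k * deriv wq t / wq t ^ Suc m) has_contour_integral 0) (circlepath 0 r)"
    proof (rule prim)
      fix t assume t: "t \<in> Str - {0}"
      then have w0: "wq t \<noteq> 0" by (simp add: wq_eq_0_iff)
      define j where "j = k - Suc m"
      have k: "k = j + Suc m" using 3 by (simp add: j_def)
      have "((\<lambda>t. (1 / of_nat (Suc j)) * wq t ^ Suc j) has_field_derivative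
          (1 / of_nat (Suc j)) * (of_nat (Suc j) * (deriv wq t * wq t ^ (Suc j - Suc 0)))) (at t)"
        by (intro DERIV_cmult DERIV_power wq_deriv) (use t in auto)
      also have "(1 / of_nat (Suc j)) * (of_nat (Suc j) * (deriv wq t * wq t ^ (Suc j - Suc 0))) = wq t ^ k * deriv wq t / wq t ^ Suc m"
      proof -
        have "wq t ^ k = wq t ^ j * wq t ^ Suc m" by (simp only: k power_add)
        then show ?thesis using w0 by (simp del: of_nat_Suc)
      qed
      finally show "((\<lambda>t. (1 / of_nat (Suc j)) * wq t ^ Suc j) has_field_derivative wq t ^ k * deriv wq t / wq t ^ Suc m) (at t)" .
    qed
    then show ?thesis using 3 by simp
  qed
qed

lemma fD_contour_integral:
  assumes r: "r > 0" "cball 0 r \<subseteq> Str"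
  shows "((\<lambda>t. sinh t / wq t ^ Suc m) has_contour_integral 2 * pi * \<i> * coeffD m) (circlepath 0 r)"
proof -
  have "((\<lambda>t. fD m t / (t - 0) ^ Suc m) has_contour_integral ((2 * pi * \<i>) / fact m * (deriv ^^ m) (fD m) 0)) (circlepath 0 r)"
  proof (rule Cauchy_has_contour_integral_higher_derivative_circlepath)
    show "continuous_on (cball 0 r) (fD m)"
      using holomorphic_on_subset[OF holomorphic_fD r(2)] by (rule holomorphic_on_imp_continuous_on)
    show "fD m holomorphic_on ball 0 r"
      using holomorphic_on_subset[OF holomorphic_fD r(2)] ball_subset_cball by (rule holomorphic_on_subset)
  qed (use r in auto)
  moreover have "fD m t / (t - 0) ^ Suc m = sinh t / wq t ^ Suc m" for t
  proof -
    have "(of_nat m + 1) / 3 * - lgq t = - (of_nat (Suc m) * (lgq t / 3))" by simp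
    then have "exp ((of_nat m + 1) / 3 * - lgq t) = inverse (exp (lgq t / 3) ^ Suc m)"
      by (simp only: exp_minus exp_of_nat_mult)
    then show ?thesis unfolding fD_def wq_def power_mult_distrib
      by (simp only: divide_inverse inverse_mult_distrib mult_ac diff_zero)
  qed
  ultimately show ?thesis by (simp add: coeffD_eq)
qed

text \<open>In the odd case, both \<open>coeffD m\<close> and the coefficient of the expansion of \<open>Ghat\<close> are residues of the same
  contour integral.\<close>

lemma errE_derivs_zero: "(deriv ^^ m) errE 0 = 0"
proof (induction m rule: less_induct)
  case (less m)
  obtain g where g: "g holomorphic_on OmE" "\<And>t. t \<in> OmE \<Longrightarrow> errE t = (\<Sum>j<m. (deriv ^^ j) errE 0 / fact j * t ^ j) + t ^ m * g t"
    "g 0 = (deriv ^^ m) errE 0 / fact m"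
    using Taylor_remainder_holomorphic[OF OmE_props(1,2) holomorphic_errE, of m] by blast
  have Eg: "errE t = t ^ m * g t" if "t \<in> OmE" for t using g(2)[OF that] less by simp
  obtain e where e: "e > 0" "ball 0 e \<subseteq> OmE" using OmE_props open_contains_ball by blast
  define r where "r = e / 2"
  have r: "r > 0" "cball 0 r \<subseteq> OmE" using e by (auto simp: r_def subset_eq)
  have rS: "cball 0 r \<subseteq> Str" using r OmE_props by auto
  have "g 0 = 0"
  proof (cases "even m")
    \<comment> \<open>Dividing the odd function \<open>errE\<close> by an even power of t leaves an
      odd function, which vanishes at 0.\<close>
    case True
    have ng: "g (- t) = - g t" if t: "t \<in> OmE - {0}" for t
    proof -
      have "- t \<in> OmE"
      proof -
        have "t \<in> Str" "wq t \<in> Wdom" using t by (auto simp: OmE_def)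
        then show ?thesis using wq_minus Str_props(5) by (simp add: OmE_def Wdom_def)
      qed
      then have "(- t) ^ m * g (- t) = - (t ^ m * g t)" using errE_minus[of t] Eg[of t] Eg[of "- t"] t by simp
      then have "t ^ m * g (- t) = t ^ m * - g t" using True by simp
      moreover have "t ^ m \<noteq> 0" using t by simp
      ultimately show ?thesis by (metis mult_left_cancel)
    qed
    have c: "isCont g 0" using holomorphic_on_imp_continuous_on[OF g(1)] OmE_props continuous_on_eq_continuous_at by blast
    have "((\<lambda>t. g (- t)) \<longlongrightarrow> g 0) (at 0)"
      by (rule isCont_tendsto_compose[OF c]) (auto intro!: tendsto_eq_intros)
    moreover have "eventually (\<lambda>t. t \<in> OmE - {0}) (at 0)"
      by (intro eventually_at_in_open OmE_props)
    then have "eventually (\<lambda>t. g (- t) = - g t) (at 0)" by eventually_elim (rule ng)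
    ultimately have "((\<lambda>t. - g t) \<longlongrightarrow> g 0) (at 0)" by (rule Lim_transform_eventually)
    moreover have "((\<lambda>t. - g t) \<longlongrightarrow> - g 0) (at 0)" using c unfolding isCont_def by (rule tendsto_minus)
    ultimately have "g 0 = - g 0" using tendsto_unique[OF trivial_limit_at] by blast
    then show ?thesis by simp
  next
    case False
    then obtain n0 where m: "m = 2 * n0 + 1" by (metis oddE)
    \<comment> \<open>The expansion then contains the power m = 2 n0 + 1 as its last term, and its
      remainder still has the factor w left after division by w^(m+1), so it contributes no
      residue.\<close>
    define N where "N = n0 + 1"
    define R where "R = (\<lambda>w. (- 1) ^ (N + 1) * of_real (2 / pi) * w * ker (2 * N) w)"
    have "(\<lambda>t. R (wq t) * deriv wq t) holomorphic_on OmE"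
      unfolding R_def
      by (intro holomorphic_intros holomorphic_comp_wq[of "\<lambda>w. (- 1) ^ (N + 1) * of_real (2 / pi) * w * ker (2 * N) w"]
          holomorphic_ker holomorphic_on_subset[OF holomorphic_deriv_wq OmE_props(3)]) (auto simp: N_def)
    then have cR: "((\<lambda>t. R (wq t) * deriv wq t) has_contour_integral 0) (circlepath 0 r)"
    proof -
      have "(\<lambda>t. R (wq t) * deriv wq t) holomorphic_on ball 0 e"
        by (rule holomorphic_on_subset[OF \<open>(\<lambda>t. R (wq t) * deriv wq t) holomorphic_on OmE\<close> e(2)])
      then show ?thesis by (rule Cauchy_theorem_disc_simple) (use e(1) in \<open>auto simp: r_def\<close>)
    qed
    have "((\<lambda>t. sinh t / wq t ^ Suc m - ((\<Sum>n<N. coeffD (2 * n + 1) * (wq t ^ (2 * n + 1) * deriv wq t / wq t ^ Suc m)) + R (wq t) * deriv wq t))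
       has_contour_integral 2 * pi * \<i> * coeffD m - ((\<Sum>n<N. coeffD (2 * n + 1) * (if 2 * n + 1 = m then 2 * pi * \<i> else 0)) + 0)) (circlepath 0 r)"
      by (rule has_contour_integral_diff[OF fD_contour_integral[OF r(1) rS] has_contour_integral_add[OF
            has_contour_integral_sum[OF finite_lessThan has_contour_integral_lmul[OF wq_power_contour_integral[OF r(1) rS]]] cR]])
    also have "(\<Sum>n<N. coeffD (2 * n + 1) * (if 2 * n + 1 = m then 2 * pi * \<i> else 0)) = (\<Sum>n<N. if n = n0 then coeffD m * (2 * pi * \<i>) else 0)"
      by (intro sum.cong) (auto simp: m)
    also have "\<dots> = coeffD m * (2 * pi * \<i>)" by (simp add: N_def)
    finally have "((\<lambda>t. sinh t / wq t ^ Suc m - ((\<Sum>n<N. coeffD (2 * n + 1) * (wq t ^ (2 * n + 1) * deriv wq t / wq t ^ Suc m)) + R (wq t) * deriv wq t))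
       has_contour_integral 0) (circlepath 0 r)" by (simp add: mult_ac)
    then have "((\<lambda>t. g t * inverse (exp (lgq t / 3)) ^ Suc m / (t - 0)) has_contour_integral 0) (circlepath 0 r)"
    proof (rule has_contour_integral_eq)
      fix t assume "t \<in> path_image (circlepath 0 r)"
      then have t: "t \<in> OmE" "t \<noteq> 0" using r by (auto simp: subset_eq dist_norm)
      then have wd: "wq t \<in> Wdom" by (simp add: OmE_def)
      have w0: "wq t \<noteq> 0" using t by (simp add: wq_eq_0_iff)
      have m2: "2 * N + 1 = Suc m + 1" by (simp add: m N_def)
      have "Ghat (wq t) = (\<Sum>n<N. coeffD (2 * n + 1) * wq t ^ (2 * n + 1)) + wq t ^ Suc m * R (wq t)"
      proof -
        have N1: "N \<ge> 1" by (simp add: N_def)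
        have "wq t ^ (2 * N + 1) = wq t ^ Suc m * wq t" by (simp only: m2 power_add power_one_right)
        then show ?thesis unfolding Ghat_expansion[OF wd N1] R_def by (simp only: mult_ac)
      qed
      then have "errE t / wq t ^ Suc m = sinh t / wq t ^ Suc m - ((\<Sum>n<N. coeffD (2 * n + 1) * wq t ^ (2 * n + 1)) * deriv wq t / wq t ^ Suc m + R (wq t) * deriv wq t)"
      proof -
        have "(s - (S + W * R) * d) / W = s / W - (S * d / W + R * d)" if "W \<noteq> 0" for s S W R d :: complex
          using that by (simp add: field_simps)
        moreover have "wq t ^ Suc m \<noteq> 0" using w0 by (simp del: power_Suc)
        ultimately show ?thesis using \<open>Ghat (wq t) = _\<close> by (simp only: errE_def)
      qed
      also have "(\<Sum>n<N. coeffD (2 * n + 1) * wq t ^ (2 * n + 1)) * deriv wq t / wq t ^ Suc m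
         = (\<Sum>n<N. coeffD (2 * n + 1) * (wq t ^ (2 * n + 1) * deriv wq t / wq t ^ Suc m))"
        unfolding sum_distrib_right sum_divide_distrib by (intro sum.cong) (simp_all add: mult_ac del: power_Suc)
      finally have "sinh t / wq t ^ Suc m - ((\<Sum>n<N. coeffD (2 * n + 1) * (wq t ^ (2 * n + 1) * deriv wq t / wq t ^ Suc m)) + R (wq t) * deriv wq t)
         = errE t / wq t ^ Suc m" by simp
      also have "\<dots> = g t * inverse (exp (lgq t / 3)) ^ Suc m / (t - 0)"
        unfolding Eg[OF t(1)] wq_def power_mult_distrib using t(2) by (simp add: field_simps power_inverse)
      finally show "sinh t / wq t ^ Suc m - ((\<Sum>n<N. coeffD (2 * n + 1) * (wq t ^ (2 * n + 1) * deriv wq t / wq t ^ Suc m)) + R (wq t) * deriv wq t)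
        = g t * inverse (exp (lgq t / 3)) ^ Suc m / (t - 0)" .
    qed
    moreover have "((\<lambda>t. g t * inverse (exp (lgq t / 3)) ^ Suc m / (t - 0)) has_contour_integral
        2 * of_real pi * \<i> * (g 0 * inverse (exp (lgq 0 / 3)) ^ Suc m)) (circlepath 0 r)"
    proof (rule Cauchy_integral_circlepath_simple)
      have "g holomorphic_on cball 0 r" "lgq holomorphic_on cball 0 r"
        using g(1) lgq(1) r rS by (auto intro: holomorphic_on_subset)
      then show "(\<lambda>t. g t * inverse (exp (lgq t / 3)) ^ Suc m) holomorphic_on cball 0 r"
        by (intro holomorphic_intros) auto
    qed (use r in auto)
    ultimately have "2 * of_real pi * \<i> * (g 0 * inverse (exp (lgq 0 / 3)) ^ Suc m) = 0"
      using has_contour_integral_unique by blast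
    then show ?thesis by simp
  qed
  then show ?case using g(3) by simp
qed

abbreviation kap :: complex where "kap \<equiv> Complex (sqrt 3 / 2) (1 / 2)"

lemma kap_powers: "kap\<^sup>2 = Complex (1 / 2) (sqrt 3 / 2)" "(cnj kap)\<^sup>2 = Complex (1 / 2) (- sqrt 3 / 2)" "norm kap = 1"
  "kap = cis (pi / 6)" "cnj kap = cis (- (pi / 6))"
proof -
  show "kap\<^sup>2 = Complex (1 / 2) (sqrt 3 / 2)" "(cnj kap)\<^sup>2 = Complex (1 / 2) (- sqrt 3 / 2)"
    by (simp_all add: complex_eq_iff power2_eq_square)
  show k: "kap = cis (pi / 6)" by (simp add: complex_eq_iff cos_30 sin_30)
  show "norm kap = 1" unfolding k by simp
  show "cnj kap = cis (- (pi / 6))" unfolding k by (simp add: cis_cnj)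
qed

lemma kap_mult_mem_Wdom:
  assumes "z > 0"
  shows "kap * of_real z \<in> Wdom" "cnj kap * of_real z \<in> Wdom"
proof -
  have "(kap * of_real z)\<^sup>2 = Complex (1 / 2) (sqrt 3 / 2) * of_real (z\<^sup>2)"
    "(cnj kap * of_real z)\<^sup>2 = Complex (1 / 2) (- sqrt 3 / 2) * of_real (z\<^sup>2)"
    by (simp_all only: power_mult_distrib kap_powers(1,2) of_real_power)
  then show "kap * of_real z \<in> Wdom" "cnj kap * of_real z \<in> Wdom"
    using assms unfolding Wdom_def by (simp_all del: of_real_power)
qed

text \<open>All derivatives of \<open>errE\<close> vanish at 0, and the curve together with its end
  point 0 is connected inside \<open>OmE\<close>; so \<open>errE\<close> vanishes on the whole
  component.\<close>

lemma errE_curve: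
  assumes x: "x > 0"
  shows "errE (tC 1 x) = 0"
proof -
  let ?T = "tC 1 ` {0<..}"
  define C where "C = connected_component_set OmE 0"
  have "?T \<subseteq> OmE"
  proof
    fix t assume "t \<in> ?T"
    then obtain y where y: "y > 0" "t = tC 1 y" by auto
    show "t \<in> OmE" using curve_in_Str(1)[OF y(1)] kap_mult_mem_Wdom(1)[OF vv_zz(2)[OF y(1)]]
      by (simp add: OmE_def y(2) wq_lower[OF y(1)])
  qed
  moreover have "0 \<in> closure ?T"
  proof (rule Lim_in_closed_set[OF closed_closure _ _ tC_tendsto_0])
    show "eventually (\<lambda>x. tC 1 x \<in> closure ?T) (at_right 0)"
      using eventually_at_right_less[of 0] by eventually_elim (auto intro: subsetD[OF closure_subset])
  qed simp
  moreover have "connected ?T" by (intro connected_continuous_image continuous_on_tC convex_connected) auto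
  ultimately have "connected (insert 0 ?T)" "insert 0 ?T \<subseteq> OmE"
    using connected_intermediate_closure[of ?T "insert 0 ?T"] closure_subset[of ?T] OmE_props(2) by auto
  then have "insert 0 ?T \<subseteq> C" unfolding C_def by (intro connected_component_maximal) auto
  moreover have "errE holomorphic_on C"
    using holomorphic_errE connected_component_subset[of OmE 0] unfolding C_def by (rule holomorphic_on_subset)
  ultimately show ?thesis using x
    by (intro holomorphic_fun_eq_0_on_connected[of errE C 0])
       (auto simp: C_def open_connected_component OmE_props errE_derivs_zero)
qed

section \<open>The integral on the imaginary ray in the variable z\<close>

definition zzd :: "real \<Rightarrow> real" where "zzd x = 1 / 3 * (6 * height x) powr (1 / 3 - 1) * (6 * height' x)"

lemma zz_deriv:
  assumes "x > 0"
  shows "(zz has_real_derivative zzd x) (at x)" "zzd x > 0"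
proof -
  have h: "6 * height x > 0" using height_pos[OF assms] by simp
  show "(zz has_real_derivative zzd x) (at x)" unfolding zz_def[abs_def] zzd_def
    by (rule DERIV_chain2[where f = "\<lambda>y. y powr (1 / 3)" and g = "\<lambda>x. 6 * height x",
          OF has_real_derivative_powr[OF h] DERIV_cmult[OF height_deriv[OF assms]]])
  show "zzd x > 0" using h height'_pos[OF assms] by (simp add: zzd_def)
qed

lemma zz_image: "zz ` {0<..} = {0<..}"
proof -
  have "y \<in> zz ` {0<..}" if y: "y > 0" for y
  proof -
    have "y ^ 3 / 6 \<in> height ` {0<..}" using y by (simp add: height_image)
    then obtain x where x: "x > 0" "y ^ 3 / 6 = height x" by auto
    have "zz x ^ 3 = y ^ 3" using vv_zz(4)[OF x(1)] x(2) by simp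
    then have "zz x = y" using power_eq_imp_eq_base[of "zz x" 3 y] y vv_zz(2)[OF x(1)] by simp
    then show ?thesis using x(1) by blast
  qed
  then show ?thesis using vv_zz(2) by auto
qed

lemma zz_inj: "inj_on zz {0<..}"
proof (rule linorder_inj_onI)
  fix x y :: real assume "x < y" "x \<in> {0<..}" "y \<in> {0<..}"
  then have "zz x ^ 3 \<noteq> zz y ^ 3" using height_strict_mono[of x y] vv_zz(4) by simp
  then show "zz x \<noteq> zz y" by auto
qed auto

definition Qf :: "real \<Rightarrow> real" where "Qf z = Im (kap * Ghat (kap * of_real z))"

text \<open>Along the curve sinh t dt = \<open>Ghat\<close> w dw with w = kap z. The imaginary part
  of the left side is d \<open>Kmass\<close>, that of the right side is \<open>Qf\<close> z
  dz.\<close>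

lemma Kdens_eq_Qf:
  assumes x: "x > 0"
  shows "Kdens x = zzd x * Qf (zz x)"
proof -
  define c' where "c' = Complex 1 ((x * cosh x - sinh x) / (sinh x * Kmass x))"
  have tC': "(tC 1 has_vector_derivative c') (at x)" unfolding c'_def by (rule curve_has_vector_derivative(1)[OF x])
  have "((cosh \<circ> tC 1) has_vector_derivative c' * sinh (tC 1 x)) (at x)"
    by (rule field_vector_diff_chain_at[OF tC']) (auto intro!: derivative_eq_intros)
  then have "((\<lambda>x. Im ((cosh \<circ> tC 1) x)) has_vector_derivative Im (c' * sinh (tC 1 x))) (at x)"
    by (rule bounded_linear.has_vector_derivative[OF bounded_linear_Im])
  moreover have "Im ((cosh \<circ> tC 1) y) = Kmass y" if "y \<in> {0<..}" for y
    using sm_curve(3)[of y 1] that by simp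
  ultimately have "(Kmass has_vector_derivative Im (c' * sinh (tC 1 x))) (at x)"
    using has_vector_derivative_transform_within_open[of "\<lambda>x. Im ((cosh \<circ> tC 1) x)" _ x "{0<..}" Kmass] x by simp
  moreover have "(Kmass has_vector_derivative Kdens x) (at x)"
    using Kmass_deriv[OF x] by (simp add: has_real_derivative_iff_has_vector_derivative)
  ultimately have K: "Kdens x = Im (c' * sinh (tC 1 x))" using vector_derivative_unique_at by blast
  have "((wq \<circ> tC 1) has_vector_derivative c' * deriv wq (tC 1 x)) (at x)"
    using field_vector_diff_chain_at[OF tC' wq_deriv[OF curve_in_Str(1)[OF x]]] .
  then have "((\<lambda>x. kap * of_real (zz x)) has_vector_derivative c' * deriv wq (tC 1 x)) (at x)"
    using has_vector_derivative_transform_within_open[of "wq \<circ> tC 1" _ x "{0<..}" "\<lambda>x. kap * of_real (zz x)"] x wq_lower by simp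
  moreover have "((\<lambda>x. kap * of_real (zz x)) has_vector_derivative kap * of_real (zzd x)) (at x)"
    using has_vector_derivative_mult_right[OF has_vector_derivative_of_real[OF zz_deriv(1)[OF x]]] .
  ultimately have W: "c' * deriv wq (tC 1 x) = kap * of_real (zzd x)" using vector_derivative_unique_at by blast
  have "sinh (tC 1 x) = Ghat (kap * of_real (zz x)) * deriv wq (tC 1 x)"
    using errE_curve[OF x] wq_lower[OF x] by (simp add: errE_def)
  then have "c' * sinh (tC 1 x) = Ghat (kap * of_real (zz x)) * (c' * deriv wq (tC 1 x))" by simp
  also have "\<dots> = (kap * Ghat (kap * of_real (zz x))) * of_real (zzd x)" unfolding W by simp
  finally show ?thesis unfolding K Qf_def by simp
qed

lemma absolutely_integrable_on_cong:
  fixes f g :: "'a::euclidean_space \<Rightarrow> 'b::euclidean_space"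
  assumes "\<And>x. x \<in> S \<Longrightarrow> f x = g x"
  shows "f absolutely_integrable_on S \<longleftrightarrow> g absolutely_integrable_on S"
  by (rule set_integrable_cong) (simp_all add: assms)

lemma hankelF_zz:
  assumes tau: "\<tau> > 0"
  shows "(\<lambda>z. exp (- \<tau> * (z ^ 3 / 6)) * Qf z) absolutely_integrable_on {0<..}"
    "hankelF (Complex (ln \<tau>) (pi / 2)) = of_real (2 / pi * integral {0<..} (\<lambda>z. exp (- \<tau> * (z ^ 3 / 6)) * Qf z))"
proof -
  let ?f = "\<lambda>z. exp (- \<tau> * (z ^ 3 / 6)) * Qf z"
  have eq: "exp (- \<tau> * height x) * Kdens x = \<bar>zzd x\<bar> * ?f (zz x)" if "x \<in> {0<..}" for x
    using that Kdens_eq_Qf[of x] zz_deriv(2)[of x] vv_zz(4)[of x] by simp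
  have "(\<lambda>x. \<bar>zzd x\<bar> * ?f (zz x)) absolutely_integrable_on {0<..} \<and>
      integral {0<..} (\<lambda>x. \<bar>zzd x\<bar> * ?f (zz x)) = integral {0<..} (\<lambda>x. exp (- \<tau> * height x) * Kdens x)"
  proof
    show "(\<lambda>x. \<bar>zzd x\<bar> * ?f (zz x)) absolutely_integrable_on {0<..}"
      by (rule iffD1[OF absolutely_integrable_on_cong[OF eq] Kdens_exp_integrable[OF tau]])
    show "integral {0<..} (\<lambda>x. \<bar>zzd x\<bar> * ?f (zz x)) = integral {0<..} (\<lambda>x. exp (- \<tau> * height x) * Kdens x)"
      by (rule integral_cong) (rule eq[symmetric])
  qed
  then have "?f absolutely_integrable_on zz ` {0<..} \<and> integral (zz ` {0<..}) ?f = integral {0<..} (\<lambda>x. exp (- \<tau> * height x) * Kdens x)"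
    using has_absolute_integral_change_of_variables_1'[of "{0<..}" zz zzd ?f "integral {0<..} (\<lambda>x. exp (- \<tau> * height x) * Kdens x)"]
      zz_inj has_field_derivative_at_within[OF zz_deriv(1)] by simp
  then show "?f absolutely_integrable_on {0<..}"
    "hankelF (Complex (ln \<tau>) (pi / 2)) = of_real (2 / pi * integral {0<..} ?f)"
    unfolding zz_image hankelF_curve[OF tau] by auto
qed

lemma cubic_exp_integral:
  assumes a: "a > (0::real)" and m: "m \<ge> 1"
  shows "(\<lambda>z. exp (- a * z ^ 3) * z ^ (m - 1)) absolutely_integrable_on {0<..}"
    "integral {0<..} (\<lambda>z. exp (- a * z ^ 3) * z ^ (m - 1)) = 1 / 3 * Gamma (real m / 3) * a powr - (real m / 3)"
proof -
  define p where "p = real m / 3"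
  have p: "p > 0" using m by (simp add: p_def)
  let ?g = "\<lambda>z::real. a * z ^ 3"
  let ?f = "\<lambda>y. exp (- y) * y powr (p - 1)"
  have img: "?g ` {0<..} = {0<..}"
  proof -
    have "y \<in> ?g ` {0<..}" if "y > 0" for y
    proof -
      have "((y / a) powr (1 / 3)) ^ 3 = y / a" using that a by (simp add: powr_powr flip: powr_realpow)
      then have "y = ?g ((y / a) powr (1 / 3))" using a by simp
      then show ?thesis by (rule image_eqI) (use that a in auto)
    qed
    then show ?thesis using a by auto
  qed
  have inj: "inj_on ?g {0<..}"
  proof (rule inj_onI)
    fix x y assume "x \<in> {0<..}" "y \<in> {0<..}" "?g x = ?g y"
    then show "x = y" using a power_eq_imp_eq_base[of x 3 y] by simp
  qed
  have fG: "?f absolutely_integrable_on {0<..}"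
    by (rule nonnegative_absolutely_integrable_1[OF integrable_exp_powr[OF p]]) simp
  have "((\<lambda>t. t powr (p - 1) / exp t) has_integral Gamma p) {0..}" by (rule Gamma_integral_real[OF p])
  then have "((\<lambda>t. t powr (p - 1) / exp t) has_integral Gamma p) {0<..}"
  proof (rule iffD1[OF has_integral_spike_set_eq, rotated 2])
    show "negligible {t \<in> {0..} - {0<..}. t powr (p - 1) / exp t \<noteq> (0::real)}"
      by (rule negligible_subset[OF negligible_sing[of 0]]) auto
    show "negligible {t \<in> {0<..} - {0..}. t powr (p - 1) / exp t \<noteq> (0::real)}"
      by (rule negligible_subset[OF negligible_sing[of 0]]) auto
  qed
  then have "integral {0<..} (\<lambda>t. t powr (p - 1) / exp t) = Gamma p" by (rule integral_unique)
  then have "integral {0<..} ?f = Gamma p" by (simp add: exp_minus divide_inverse mult.commute)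
  with fG img have "?f absolutely_integrable_on ?g ` {0<..} \<and> integral (?g ` {0<..}) ?f = Gamma p" by simp
  then have I: "(\<lambda>z. \<bar>a * (3 * z\<^sup>2)\<bar> * ?f (?g z)) absolutely_integrable_on {0<..} \<and>
      integral {0<..} (\<lambda>z. \<bar>a * (3 * z\<^sup>2)\<bar> * ?f (?g z)) = Gamma p"
    by (subst has_absolute_integral_change_of_variables_1'[of "{0<..}" ?g "\<lambda>z. a * (3 * z\<^sup>2)" ?f "Gamma p"])
       (auto intro!: derivative_eq_intros inj)
  have eq: "\<bar>a * (3 * z\<^sup>2)\<bar> * ?f (?g z) = (3 * a powr p) * (exp (- a * z ^ 3) * z ^ (m - 1))" if "z \<in> {0<..}" for z
  proof -
    have z: "z > 0" using that by simp
    have "(z ^ 3) powr (p - 1) = z powr (real m - 3)"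
      using z by (simp add: powr_powr p_def algebra_simps flip: powr_numeral)
    then have "z\<^sup>2 * (z ^ 3) powr (p - 1) = z powr 2 * z powr (real m - 3)" using z by simp
    also have "\<dots> = z powr (2 + (real m - 3))" by (rule powr_add[symmetric])
    also have "\<dots> = z powr real (m - 1)" using m by (simp add: of_nat_diff)
    finally have 1: "z\<^sup>2 * (z ^ 3) powr (p - 1) = z ^ (m - 1)" using z by (simp add: powr_realpow)
    have 2: "a * a powr (p - 1) = a powr p" using a by (simp add: powr_diff)
    have "\<bar>a * (3 * z\<^sup>2)\<bar> * ?f (?g z) = 3 * (a * a powr (p - 1)) * (exp (- a * z ^ 3) * (z\<^sup>2 * (z ^ 3) powr (p - 1)))"
      using a z by (simp add: powr_mult abs_mult)
    then show ?thesis unfolding 1 2 .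
  qed
  have 3: "(\<lambda>z. (3 * a powr p) * (exp (- a * z ^ 3) * z ^ (m - 1))) absolutely_integrable_on {0<..}"
    by (rule iffD1[OF absolutely_integrable_on_cong[OF eq] conjunct1[OF I]])
  have ap: "3 * a powr p \<noteq> 0" using a by simp
  show "(\<lambda>z. exp (- a * z ^ 3) * z ^ (m - 1)) absolutely_integrable_on {0<..}"
  proof (rule iffD1[OF absolutely_integrable_on_cong])
    show "(\<lambda>z. inverse (3 * a powr p) * ((3 * a powr p) * (exp (- a * z ^ 3) * z ^ (m - 1)))) absolutely_integrable_on {0<..}"
      by (rule set_integrable_mult_right) (rule 3)
  qed (use ap in simp)
  have "integral {0<..} (\<lambda>z. (3 * a powr p) * (exp (- a * z ^ 3) * z ^ (m - 1))) = Gamma p"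
    by (rule trans[OF integral_cong[OF eq, symmetric] conjunct2[OF I]])
  then have "(3 * a powr p) * integral {0<..} (\<lambda>z. exp (- a * z ^ 3) * z ^ (m - 1)) = Gamma p"
    by (simp only: integral_mult_right)
  then show "integral {0<..} (\<lambda>z. exp (- a * z ^ 3) * z ^ (m - 1)) = 1 / 3 * Gamma (real m / 3) * a powr - (real m / 3)"
    using a unfolding p_def by (simp add: powr_minus field_simps)
qed

section \<open>The kernel in a sector\<close>

lemma norm_quadratic_kernel:
  fixes \<zeta> :: complex
  assumes "Re \<zeta> = c * norm \<zeta>"
  shows "(norm (1 + \<zeta> + \<zeta>\<^sup>2))\<^sup>2 = 1 + 2 * c * norm \<zeta> + (4 * c\<^sup>2 - 1) * (norm \<zeta>)\<^sup>2 + 2 * c * norm \<zeta> ^ 3 + norm \<zeta> ^ 4"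
proof -
  define X Y \<rho> where "X = Re \<zeta>" and "Y = Im \<zeta>" and "\<rho> = norm \<zeta>"
  have z: "\<zeta> = Complex X Y" by (simp add: X_def Y_def)
  have Y: "Y\<^sup>2 = \<rho>\<^sup>2 - X\<^sup>2" unfolding \<rho>_def X_def Y_def cmod_power2 by simp
  have "(norm (1 + \<zeta> + \<zeta>\<^sup>2))\<^sup>2 = (1 + X + (X\<^sup>2 - Y\<^sup>2))\<^sup>2 + Y\<^sup>2 * (1 + 2 * X)\<^sup>2"
    unfolding z cmod_power2 by (simp add: power2_eq_square algebra_simps)
  also have "\<dots> = (1 + X + (X\<^sup>2 - (\<rho>\<^sup>2 - X\<^sup>2)))\<^sup>2 + (\<rho>\<^sup>2 - X\<^sup>2) * (1 + 2 * X)\<^sup>2" unfolding Y ..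
  also have "X = c * \<rho>" using assms by (simp add: X_def \<rho>_def)
  also have "(1 + c * \<rho> + ((c * \<rho>)\<^sup>2 - (\<rho>\<^sup>2 - (c * \<rho>)\<^sup>2)))\<^sup>2 + (\<rho>\<^sup>2 - (c * \<rho>)\<^sup>2) * (1 + 2 * (c * \<rho>))\<^sup>2
    = 1 + 2 * c * \<rho> + (4 * c\<^sup>2 - 1) * \<rho>\<^sup>2 + 2 * c * \<rho> ^ 3 + \<rho> ^ 4"
    by algebra
  finally show ?thesis unfolding \<rho>_def .
qed

lemma quartic_ge_one:
  assumes "c \<ge> 1 / 2" "\<rho> \<ge> (0::real)"
  shows "1 + 2 * c * \<rho> + (4 * c\<^sup>2 - 1) * \<rho>\<^sup>2 + 2 * c * \<rho> ^ 3 + \<rho> ^ 4 \<ge> 1"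
proof -
  have "(2 * c)\<^sup>2 \<ge> 1\<^sup>2" using assms(1) by (intro power_mono) auto
  then have "4 * c\<^sup>2 - 1 \<ge> 0" by (simp add: power2_eq_square)
  then have "0 \<le> 2 * c * \<rho>" "0 \<le> (4 * c\<^sup>2 - 1) * \<rho>\<^sup>2" "0 \<le> 2 * c * \<rho> ^ 3" "0 \<le> \<rho> ^ 4" using assms by simp_all
  then show ?thesis by linarith
qed

text \<open>For \<open>c = cos \<alpha>\<close> the lower bound is \<open>sin\<^sup>2 (3 \<alpha> / 2)\<close>.\<close>

lemma quartic_ge:
  fixes c \<rho> :: real
  assumes c: "- (1 / 2) \<le> c" "c \<le> 1 / 2" and r: "\<rho> \<ge> 0"
  shows "1 + 2 * c * \<rho> + (4 * c\<^sup>2 - 1) * \<rho>\<^sup>2 + 2 * c * \<rho> ^ 3 + \<rho> ^ 4 \<ge> (1 - c) * (1 + 2 * c)\<^sup>2 / 2" (is "?P \<ge> ?L")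
proof (cases "c \<ge> 0")
  case True
  have L: "?L = 1 - (1 + c) * (1 - 2 * c)\<^sup>2 / 2" by (simp add: field_simps power2_eq_square)
  show ?thesis
  proof (cases "c \<ge> 1 / 4")
    case 1: True
    \<comment> \<open>For c >= 1/4 the quartic is at least 1 while the claimed bound is at most 1:
      the odd terms combine with a square, and 4 c^2 + 4 c - 1 is already positive.\<close>
    have "0 \<le> c * (\<rho> * (1 - \<rho>)\<^sup>2)" using True r by simp
    moreover have "c * c \<ge> 1 / 4 * (1 / 4)" using 1 by (intro mult_mono) auto
    then have "0 \<le> (4 * c\<^sup>2 + 4 * c - 1) * \<rho>\<^sup>2" using 1 by (simp add: power2_eq_square)
    moreover have "?P = 1 + 2 * (c * (\<rho> * (1 - \<rho>)\<^sup>2)) + (4 * c\<^sup>2 + 4 * c - 1) * \<rho>\<^sup>2 + \<rho> ^ 4" by algebra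
    moreover have "(1 + c) * (1 - 2 * c)\<^sup>2 / 2 \<ge> 0" "\<rho> ^ 4 \<ge> 0" using True by simp_all
    ultimately show ?thesis unfolding L by linarith
  next
    case 2: False
    \<comment> \<open>Completing the square in \<rho>^2 and dropping the odd terms is enough here,
      since c < 1/4 gives (1 + 2 c)^2 <= 2 (1 + c).\<close>
    have P2: "?P = 1 + 2 * (c * \<rho>) + 2 * (c * \<rho> ^ 3) + (\<rho>\<^sup>2 - (1 - 4 * c\<^sup>2) / 2)\<^sup>2 - (1 - 2 * c)\<^sup>2 * (1 + 2 * c)\<^sup>2 / 4"
      by (simp add: field_simps power2_eq_square power3_eq_cube power4_eq_xxxx)
    have n2: "0 \<le> c * \<rho>" "0 \<le> c * \<rho> ^ 3" using True r by simp_all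
    have "c * c \<le> 1 / 4 * (1 / 4)" using 2 True by (intro mult_mono) auto
    then have "(1 + 2 * c)\<^sup>2 \<le> 2 * (1 + c)" using 2 by (simp add: power2_eq_square algebra_simps)
    then have "(1 - 2 * c)\<^sup>2 * (1 + 2 * c)\<^sup>2 \<le> (1 - 2 * c)\<^sup>2 * (2 * (1 + c))" by (intro mult_left_mono) auto
    moreover have "(1 - 2 * c)\<^sup>2 * (2 * (1 + c)) = 2 * ((1 + c) * (1 - 2 * c)\<^sup>2)" by algebra
    ultimately have "(1 - 2 * c)\<^sup>2 * (1 + 2 * c)\<^sup>2 / 4 \<le> (1 + c) * (1 - 2 * c)\<^sup>2 / 2" by linarith
    moreover have "0 \<le> (\<rho>\<^sup>2 - (1 - 4 * c\<^sup>2) / 2)\<^sup>2" by simp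
    ultimately show ?thesis unfolding L P2 using n2 by linarith
  qed
next
  case False
  define b where "b = - c"
  have b: "0 < b" "b \<le> 1 / 2" using False c by (auto simp: b_def)
  have cb: "c = - b" by (simp add: b_def)
  \<comment> \<open>The quartic minus the bound is a square of \<rho>^2 - b \<rho> + q plus a
    quadratic in \<rho>. Matching coefficients fixes \<open>q\<close> and \<open>M\<close> in terms
    of \<open>A\<close>; the choice of \<open>A\<close> makes the quantity that decides the sign of
    the quadratic factor with (1 - 2 b)^2, in \<open>d\<close>.\<close>
  define A q M where "A = b - b\<^sup>2 / 2" and "q = (3 * b\<^sup>2 - 1) / 2 - A" and "M = 1 - q\<^sup>2 - ?L"
  have bb: "b * b \<le> b * (1 / 2)" using b by (intro mult_left_mono) auto
  have A: "A > 0" unfolding A_def power2_eq_square using bb b by linarith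
  have d: "2 * A * M - (b * (1 - q))\<^sup>2 = b * (1 - 2 * b)\<^sup>2 * (1 + b - 3 * b\<^sup>2) / 2"
    unfolding M_def q_def A_def cb by (simp add: field_simps) algebra
  have "3 * (b * b) \<le> 1 + b" using bb b by linarith
  then have "b * (1 - 2 * b)\<^sup>2 * (1 + b - 3 * b\<^sup>2) / 2 \<ge> 0" using b by (simp add: power2_eq_square)
  then have "0 \<le> (2 * A * \<rho> - b * (1 - q))\<^sup>2 + (2 * A * M - (b * (1 - q))\<^sup>2)" unfolding d by simp
  also have "\<dots> = 2 * A * (2 * A * \<rho>\<^sup>2 - 2 * b * (1 - q) * \<rho> + M)" by algebra
  finally have "0 \<le> 2 * A * \<rho>\<^sup>2 - 2 * b * (1 - q) * \<rho> + M" using A by (simp add: zero_le_mult_iff)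
  moreover have "?P - ?L = (\<rho>\<^sup>2 - b * \<rho> + q)\<^sup>2 + (2 * A * \<rho>\<^sup>2 - 2 * b * (1 - q) * \<rho> + M)"
  proof -
    have "(\<rho>\<^sup>2 - b * \<rho> + q)\<^sup>2 + (2 * A * \<rho>\<^sup>2 - 2 * b * (1 - q) * \<rho> + M) = \<rho> ^ 4 - 2 * b * \<rho> ^ 3 + (b\<^sup>2 + 2 * q + 2 * A) * \<rho>\<^sup>2 - 2 * b * \<rho> + 1 - ?L"
      unfolding M_def by algebra
    moreover have "b\<^sup>2 + 2 * q + 2 * A = 4 * c\<^sup>2 - 1" unfolding q_def cb by simp
    ultimately show ?thesis unfolding cb by simp
  qed
  moreover have "0 \<le> (\<rho>\<^sup>2 - b * \<rho> + q)\<^sup>2" by simp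
  ultimately show ?thesis by linarith
qed

text \<open>The sector |arg b| < \<pi> / 3: there b^2 has argument strictly between -2 \<pi> / 3 and
  2 \<pi> / 3, so 1 + \<zeta> + \<zeta>^2 has no zero on the ray of b^2.\<close>

definition S3 :: "complex set" where "S3 = {b. 0 < Re b \<and> \<bar>Im b\<bar> < sqrt 3 * Re b}"

definition cosarg2 :: "complex \<Rightarrow> real" where "cosarg2 b = Re (b\<^sup>2) / norm (b\<^sup>2)"

lemma S3_mult_pos: "b \<in> S3 \<Longrightarrow> y > 0 \<Longrightarrow> b * of_real y \<in> S3"
  by (auto simp: S3_def abs_mult)

lemma cosarg2_gt:
  assumes "b \<in> S3"
  shows "cosarg2 b > - (1 / 2)" "norm (b\<^sup>2) > 0"
proof -
  have "(Im b)\<^sup>2 < (sqrt 3 * Re b)\<^sup>2" using assms power_strict_mono[of "\<bar>Im b\<bar>" "sqrt 3 * Re b" 2] by (simp add: S3_def)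
  then have 1: "(Im b)\<^sup>2 < 3 * (Re b)\<^sup>2" by (simp add: power_mult_distrib)
  have "b \<noteq> 0" using assms by (auto simp: S3_def)
  then show n: "norm (b\<^sup>2) > 0" by simp
  have "- (1 / 2) * norm (b\<^sup>2) < Re (b\<^sup>2)"
    unfolding norm_power cmod_power2 using 1 by (simp add: power2_eq_square field_simps)
  then show "cosarg2 b > - (1 / 2)" using n unfolding cosarg2_def by (simp add: pos_less_divide_eq)
qed

lemma cosarg2_mult_pos: "y > 0 \<Longrightarrow> cosarg2 (b * of_real y) = cosarg2 b"
  unfolding cosarg2_def power_mult_distrib by (simp add: norm_mult flip: of_real_power)

definition kbound :: "real \<Rightarrow> real" where
  "kbound c = (if c \<ge> 1 / 2 then 1 else sqrt ((1 - c) * (1 + 2 * c)\<^sup>2 / 2))"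

text \<open>A cruder bound that is positive and monotone in c; it provides constants valid on a
  whole neighbourhood.\<close>

lemma kbound_ge:
  assumes "- (1 / 2) < c0" "c0 \<le> c"
  shows "kbound c \<ge> min 1 ((1 + 2 * c0) / 2)" "min 1 ((1 + 2 * c0) / 2) > 0"
proof -
  show "min 1 ((1 + 2 * c0) / 2) > 0" using assms(1) by simp
  show "kbound c \<ge> min 1 ((1 + 2 * c0) / 2)"
  proof (cases "c \<ge> 1 / 2")
    case False
    have "1 / 2 * (1 + 2 * c)\<^sup>2 \<le> (1 - c) * (1 + 2 * c)\<^sup>2" using False by (intro mult_right_mono) auto
    then have "((1 + 2 * c) / 2)\<^sup>2 \<le> (1 - c) * (1 + 2 * c)\<^sup>2 / 2" by (simp add: power_divide)
    then have "(1 + 2 * c) / 2 \<le> sqrt ((1 - c) * (1 + 2 * c)\<^sup>2 / 2)" by (rule real_le_rsqrt)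
    then show ?thesis using False assms(2) by (simp add: kbound_def min_def)
  qed (simp add: kbound_def)
qed

lemma kernel_bound:
  assumes b: "b \<in> S3" and s: "s > 0"
  shows "norm (1 + b\<^sup>2 * of_real s + (b\<^sup>2 * of_real s)\<^sup>2) \<ge> kbound (cosarg2 b)"
proof -
  define \<zeta> c where "\<zeta> = b\<^sup>2 * of_real s" and "c = cosarg2 b"
  have "Re \<zeta> = c * norm \<zeta>"
    using cosarg2_gt(2)[OF b] s by (simp add: \<zeta>_def c_def cosarg2_def norm_mult)
  note P = norm_quadratic_kernel[OF this]
  have "kbound c ^ 2 \<le> (norm (1 + \<zeta> + \<zeta>\<^sup>2))\<^sup>2"
  proof (cases "c \<ge> 1 / 2")
    case True
    then show ?thesis unfolding P using quartic_ge_one[OF True, of "norm \<zeta>"] by (simp add: kbound_def)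
  next
    case False
    then have "(kbound c)\<^sup>2 = (1 - c) * (1 + 2 * c)\<^sup>2 / 2" by (simp add: kbound_def)
    then show ?thesis unfolding P using quartic_ge[of c "norm \<zeta>"] False cosarg2_gt(1)[OF b] by (simp add: c_def)
  qed
  then show ?thesis unfolding \<zeta>_def c_def by (rule power2_le_imp_le) simp
qed

lemma Wdom_cnj: "cnj w \<in> Wdom \<longleftrightarrow> w \<in> Wdom"
  by (simp add: Wdom_def flip: complex_cnj_power)

text \<open>Rotation by \<pi> / 6 moves the argument of b^2 into the interval from - \<pi> / 3 to
  \<pi>, which misses the negative axis. Algebraically, the square is real in the sector only for x
  = - sqrt 3 y, where its real part is 4 y^2; conjugation gives the other half.\<close>

lemma S3_Wdom:
  assumes b: "b \<in> S3"
  shows "kap * b \<in> Wdom" "cnj kap * b \<in> Wdom"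
proof -
  have main: "kap * b \<in> Wdom" if b: "b \<in> S3" for b
  proof -
    define x y where "x = Re b" and "y = Im b"
    have xy: "x > 0" "y < sqrt 3 * x" using b by (auto simp: S3_def x_def y_def)
    have bb: "b = Complex x y" by (simp add: x_def y_def)
    have I: "2 * Im ((kap * b)\<^sup>2) = sqrt 3 * x\<^sup>2 + 2 * x * y - sqrt 3 * y\<^sup>2"
      and R: "2 * Re ((kap * b)\<^sup>2) = x\<^sup>2 - y\<^sup>2 - 2 * sqrt 3 * x * y"
      unfolding power_mult_distrib kap_powers(1) bb by (simp_all add: power2_eq_square algebra_simps)
    have s3: "sqrt 3 * sqrt 3 = 3" by simp
    have "Re ((kap * b)\<^sup>2) > - 1" if "Im ((kap * b)\<^sup>2) = 0"
    proof -
      have "(y - sqrt 3 * x) * (sqrt 3 * y + x) = sqrt 3 * y\<^sup>2 - 2 * x * y - sqrt 3 * x\<^sup>2"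
      proof -
        have "(y - s * x) * (s * y + x) = s * y\<^sup>2 - 2 * x * y - s * x\<^sup>2" if "s * s = 3" for s
        proof -
          have "(y - s * x) * (s * y + x) = s * y\<^sup>2 + x * y - (s * s) * (x * y) - s * x\<^sup>2" by algebra
          then show ?thesis unfolding that by simp
        qed
        then show ?thesis using s3 by blast
      qed
      also have "\<dots> = 0" using I that by simp
      finally have "x = - sqrt 3 * y" using xy by simp
      moreover have "x\<^sup>2 - y\<^sup>2 - 2 * s * x * y = 8 * y\<^sup>2" if "s * s = 3" "x = - s * y" for s
      proof -
        have "(- s * y)\<^sup>2 - y\<^sup>2 - 2 * s * (- s * y) * y = 3 * (s * s) * y\<^sup>2 - y\<^sup>2" by algebra
        then show ?thesis unfolding that by simp
      qed
      ultimately have "2 * Re ((kap * b)\<^sup>2) = 8 * y\<^sup>2" unfolding R using s3 by blast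
      then show ?thesis using zero_le_power2[of y] by linarith
    qed
    then show ?thesis by (auto simp: Wdom_def)
  qed
  show "kap * b \<in> Wdom" by (rule main[OF b])
  have "cnj b \<in> S3" using b by (simp add: S3_def)
  then have "cnj (kap * cnj b) \<in> Wdom" unfolding Wdom_cnj by (rule main)
  then show "cnj kap * b \<in> Wdom" unfolding complex_cnj_mult complex_cnj_cnj .
qed

text \<open>Partial fractions: this is the integral of \<open>Kdens / vv\<^sup>m / (1 + \<zeta> + \<zeta>\<^sup>2)\<close> with \<open>\<zeta> = w\<^sup>2 / vv\<^sup>2\<close>, see
  \<open>kk_integral\<close>; in this form holomorphy is immediate.\<close>

definition kk :: "nat \<Rightarrow> complex \<Rightarrow> complex" where
  "kk m w = (kap\<^sup>2 * ker (m - 2) (kap * w) - (cnj kap)\<^sup>2 * ker (m - 2) (cnj kap * w)) / (\<i> * of_real (sqrt 3))"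

lemma holomorphic_kk:
  assumes m: "m \<ge> 4"
  shows "kk m holomorphic_on S3"
proof -
  have "(\<lambda>w. ker (m - 2) (k * w)) holomorphic_on S3" if "\<And>b. b \<in> S3 \<Longrightarrow> k * b \<in> Wdom" for k
  proof -
    have "(ker (m - 2) \<circ> (\<lambda>w. k * w)) holomorphic_on S3"
      using that m by (intro holomorphic_on_compose holomorphic_intros holomorphic_on_subset[OF holomorphic_ker]) auto
    then show ?thesis by (simp add: o_def)
  qed
  note this[OF S3_Wdom(1)] this[OF S3_Wdom(2)]
  then show ?thesis unfolding kk_def[abs_def] by (intro holomorphic_intros) auto
qed

lemma kk_integral:
  assumes m: "m \<ge> 4" and w: "w \<in> S3"
  shows "((\<lambda>x. of_real (Kdens x / vv x ^ m) / (1 + w\<^sup>2 * of_real (1 / (vv x)\<^sup>2) + (w\<^sup>2 * of_real (1 / (vv x)\<^sup>2))\<^sup>2)) has_integral kk m w) {0<..}"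
proof -
  define a a' where "a = kap\<^sup>2" and "a' = (cnj kap)\<^sup>2"
  \<comment> \<open>The two numbers are the primitive sixth roots of unity, so (V + a \<xi>)(V + a'
    \<xi>) = V^2 + V \<xi> + \<xi>^2 is the kernel denominator.\<close>
  have aa: "a + a' = 1" "a * a' = 1" "a - a' = \<i> * of_real (sqrt 3)"
    unfolding a_def a'_def kap_powers(1,2) by (simp_all add: complex_eq_iff)
  have s3: "\<i> * of_real (sqrt 3) \<noteq> 0" by simp
  have I: "(kerI (m - 2) (k * w) has_integral ker (m - 2) (k * w)) {0<..}" if "k * w \<in> Wdom" for k
    unfolding ker_def using that m
    by (intro integrable_integral set_lebesgue_integral_eq_integral(1) kerI_integrable) auto
  have "((\<lambda>x. (a * kerI (m - 2) (kap * w) x - a' * kerI (m - 2) (cnj kap * w) x) / (\<i> * of_real (sqrt 3))) has_integral kk m w) {0<..}"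
    unfolding kk_def a_def[symmetric] a'_def[symmetric]
    by (intro has_integral_divide has_integral_diff has_integral_mult_right I S3_Wdom w)
  then show ?thesis
  proof (rule has_integral_eq[rotated])
    fix x :: real assume "x \<in> {0<..}"
    then have x: "x > 0" by simp
    define V \<xi> where "V = complex_of_real ((vv x)\<^sup>2)" and "\<xi> = w\<^sup>2"
    have nz: "V \<noteq> 0" "V + a * \<xi> \<noteq> 0" "V + a' * \<xi> \<noteq> 0"
      using vv_zz_nz(1)[OF x] kerI_denom_nz[OF S3_Wdom(1)[OF w] x] kerI_denom_nz[OF S3_Wdom(2)[OF w] x]
      by (simp_all add: V_def \<xi>_def a_def a'_def power_mult_distrib)
    have prod: "(V + a * \<xi>) * (V + a' * \<xi>) = V\<^sup>2 + V * \<xi> + \<xi>\<^sup>2" using aa by algebra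
    have "a / (V + a * \<xi>) - a' / (V + a' * \<xi>) = (a * (V + a' * \<xi>) - a' * (V + a * \<xi>)) / ((V + a * \<xi>) * (V + a' * \<xi>))"
      using nz by (simp add: divide_simps)
    also have "a * (V + a' * \<xi>) - a' * (V + a * \<xi>) = (a - a') * V" by algebra
    finally have 1: "(a / (V + a * \<xi>) - a' / (V + a' * \<xi>)) / (\<i> * of_real (sqrt 3)) = V / (V\<^sup>2 + V * \<xi> + \<xi>\<^sup>2)"
      using s3 unfolding aa(3) prod by simp
    have "V\<^sup>2 + V * \<xi> + \<xi>\<^sup>2 \<noteq> 0" unfolding prod[symmetric] using nz by simp
    moreover have "1 + \<xi> * (1 / V) + (\<xi> * (1 / V))\<^sup>2 = (V\<^sup>2 + V * \<xi> + \<xi>\<^sup>2) / V\<^sup>2"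
      using nz(1) by (simp add: field_simps power2_eq_square)
    ultimately have 2: "V / (V\<^sup>2 + V * \<xi> + \<xi>\<^sup>2) = 1 / V / (1 + \<xi> * (1 / V) + (\<xi> * (1 / V))\<^sup>2)"
      using nz(1) by (simp add: power2_eq_square)
    have m2: "m = (m - 2) + 2" using m by simp
    have 3: "complex_of_real (Kdens x / vv x ^ m) = of_real (Kdens x / vv x ^ (m - 2)) * (1 / V)"
      unfolding V_def by (subst m2, subst power_add) simp
    have r: "complex_of_real (1 / (vv x)\<^sup>2) = 1 / V" unfolding V_def by (simp only: of_real_divide of_real_1)
    have "(a * kerI (m - 2) (kap * w) x - a' * kerI (m - 2) (cnj kap * w) x) / (\<i> * of_real (sqrt 3))
      = of_real (Kdens x / vv x ^ (m - 2)) * ((a / (V + a * \<xi>) - a' / (V + a' * \<xi>)) / (\<i> * of_real (sqrt 3)))"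
      unfolding kerI_def V_def[symmetric] power_mult_distrib a_def[symmetric] a'_def[symmetric] \<xi>_def[symmetric]
      by (simp add: right_diff_distrib diff_divide_distrib mult_ac)
    also have "\<dots> = of_real (Kdens x / vv x ^ m) / (1 + \<xi> * (1 / V) + (\<xi> * (1 / V))\<^sup>2)"
      unfolding 1 2 3 by simp
    finally show "(a * kerI (m - 2) (kap * w) x - a' * kerI (m - 2) (cnj kap * w) x) / (\<i> * of_real (sqrt 3)) =
      of_real (Kdens x / vv x ^ m) / (1 + w\<^sup>2 * of_real (1 / (vv x)\<^sup>2) + (w\<^sup>2 * of_real (1 / (vv x)\<^sup>2))\<^sup>2)"
      unfolding r \<xi>_def[symmetric] .
  qed
qed

lemma norm_kk_le:
  assumes m: "m \<ge> 4" and w: "w \<in> S3" and B: "B > 0" "B \<le> kbound (cosarg2 w)"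
  shows "norm (kk m w) \<le> Mass m / B"
proof -
  let ?f = "\<lambda>x. complex_of_real (Kdens x / vv x ^ m) / (1 + w\<^sup>2 * of_real (1 / (vv x)\<^sup>2) + (w\<^sup>2 * of_real (1 / (vv x)\<^sup>2))\<^sup>2)"
  have M: "(\<lambda>x. Kdens x / vv x ^ m) integrable_on {0<..}"
    by (rule set_lebesgue_integral_eq_integral(1)[OF Kdens_vv_integrable[OF m]])
  have "norm (integral {0<..} ?f) \<le> integral {0<..} (\<lambda>x. 1 / B * (Kdens x / vv x ^ m))"
  proof (rule integral_norm_bound_integral)
    show "?f integrable_on {0<..}" using kk_integral[OF m w] by blast
    show "(\<lambda>x. 1 / B * (Kdens x / vv x ^ m)) integrable_on {0<..}" by (rule integrable_on_mult_right[OF M])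
    fix x :: real assume "x \<in> {0<..}"
    then have x: "x > 0" by simp
    have "B \<le> norm (1 + w\<^sup>2 * of_real (1 / (vv x)\<^sup>2) + (w\<^sup>2 * of_real (1 / (vv x)\<^sup>2))\<^sup>2)"
      using B(2) kernel_bound[OF w, of "1 / (vv x)\<^sup>2"] vv_zz(1)[OF x] by simp
    moreover have nn: "0 \<le> Kdens x / vv x ^ m" using Kdens_nonneg[OF x] vv_zz(1)[OF x] by simp
    ultimately have "Kdens x / vv x ^ m / norm (1 + w\<^sup>2 * of_real (1 / (vv x)\<^sup>2) + (w\<^sup>2 * of_real (1 / (vv x)\<^sup>2))\<^sup>2) \<le> Kdens x / vv x ^ m / B"
      using B(1) by (intro divide_left_mono mult_pos_pos) auto
    then show "norm (?f x) \<le> 1 / B * (Kdens x / vv x ^ m)"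
      unfolding norm_divide norm_of_real abs_of_nonneg[OF nn] by (simp only: times_divide_eq_left mult_1)
  qed
  also have "integral {0<..} ?f = kk m w" using kk_integral[OF m w] by (rule integral_unique)
  also have "integral {0<..} (\<lambda>x. 1 / B * (Kdens x / vv x ^ m)) = Mass m / B" unfolding Mass_def by (simp only: integral_mult_right) simp
  finally show ?thesis .
qed

section \<open>Rotation of the path of integration\<close>

definition JJI :: "nat \<Rightarrow> complex \<Rightarrow> complex \<Rightarrow> real \<Rightarrow> complex" where
  "JJI m a b y = exp (- a * of_real (y ^ 3) / 6) * of_real (y ^ (m - 1)) * kk m (b * of_real y)"

text \<open>The integral of exp (- \<lambda> z^3 / 6) z^(m-1) kk m z over the ray z = b y, with a =
  \<lambda> b^3; the factor b^m comes from z^(m-1) dz. Keeping \<open>a\<close> and \<open>b\<close>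
  separate lets the ray turn while Re a stays positive.\<close>

definition JJ :: "nat \<Rightarrow> complex \<Rightarrow> complex \<Rightarrow> complex" where
  "JJ m a b = b ^ m * integral {0<..} (JJI m a b)"

lemma norm_JJI_le:
  assumes "\<alpha> \<le> Re a" "y > 0" "norm (kk m (b * of_real y)) \<le> C"
  shows "norm (JJI m a b y) \<le> C * (exp (- (\<alpha> / 6) * y ^ 3) * y ^ (m - 1))"
proof -
  have "\<alpha> * y ^ 3 \<le> Re a * y ^ 3" using assms by (intro mult_right_mono) auto
  then have "norm (exp (- a * of_real (y ^ 3) / 6)) \<le> exp (- (\<alpha> / 6) * y ^ 3)" by (simp add: Re_divide_numeral)
  moreover have "norm (complex_of_real (y ^ (m - 1))) = y ^ (m - 1)" using assms(2) by (simp only: norm_of_real) simp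
  moreover have "0 \<le> C" using assms(3) norm_ge_zero order_trans by blast
  ultimately have "norm (exp (- a * of_real (y ^ 3) / 6)) * norm (complex_of_real (y ^ (m - 1))) * norm (kk m (b * of_real y))
    \<le> exp (- (\<alpha> / 6) * y ^ 3) * y ^ (m - 1) * C"
    using assms by (intro mult_mono) auto
  then show ?thesis unfolding JJI_def norm_mult by (simp only: mult_ac)
qed

lemma continuous_on_JJI:
  assumes "m \<ge> 4" "b \<in> S3"
  shows "continuous_on {0<..} (JJI m a b)"
proof -
  have "continuous_on {0<..} (\<lambda>y. kk m (b * of_real y))"
    by (rule continuous_on_compose2[OF holomorphic_on_imp_continuous_on[OF holomorphic_kk[OF assms(1)]]])
       (auto intro!: continuous_intros S3_mult_pos assms)
  then show ?thesis unfolding JJI_def by (intro continuous_intros) auto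
qed

lemma JJ_dominating_integrable:
  fixes \<alpha> C :: real
  assumes "\<alpha> > 0" "m \<ge> 4"
  shows "(\<lambda>y. C * (exp (- (\<alpha> / 6) * y ^ 3) * y ^ (m - 1))) integrable_on {0<..}"
  by (rule integrable_on_mult_right[OF set_lebesgue_integral_eq_integral(1)[OF cubic_exp_integral(1)]]) (use assms in auto)

lemma norm_kk_ray_le:
  assumes "m \<ge> 4" "b \<in> S3" "y > 0" "B > 0" "B \<le> kbound (cosarg2 b)"
  shows "norm (kk m (b * of_real y)) \<le> Mass m / B"
  by (rule norm_kk_le) (use assms in \<open>simp_all add: S3_mult_pos cosarg2_mult_pos\<close>)

lemma JJI_integrable:
  assumes "m \<ge> 4" "b \<in> S3" "Re a > 0"
  shows "JJI m a b absolutely_integrable_on {0<..}"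
proof (rule absolutely_integrable_on_dominated)
  define B where "B = min 1 ((1 + 2 * cosarg2 b) / 2)"
  have B: "B > 0" "B \<le> kbound (cosarg2 b)" using kbound_ge[OF cosarg2_gt(1)[OF assms(2)] order_refl] by (auto simp: B_def)
  show "(\<lambda>y. Mass m / B * (exp (- (Re a / 6) * y ^ 3) * y ^ (m - 1))) integrable_on {0<..}"
    by (rule JJ_dominating_integrable) (use assms in auto)
  show "norm (JJI m a b y) \<le> Mass m / B * (exp (- (Re a / 6) * y ^ 3) * y ^ (m - 1))" if "y \<in> {0<..}" for y
    using norm_JJI_le[of "Re a" a y m b "Mass m / B"] norm_kk_ray_le[OF assms(1,2) _ B, of y] that by simp
qed (use continuous_on_JJI[OF assms(1,2)] in auto)

lemma norm_JJ_le:
  assumes m: "m \<ge> 4" and b: "b \<in> S3" and a: "Re a > 0" and B: "B > 0" "B \<le> kbound (cosarg2 b)"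
  shows "norm (JJ m a b) \<le> norm b ^ m * (Mass m / B * (1 / 3 * Gamma (real m / 3) * (Re a / 6) powr - (real m / 3)))"
proof -
  have "norm (integral {0<..} (JJI m a b)) \<le> integral {0<..} (\<lambda>y. Mass m / B * (exp (- (Re a / 6) * y ^ 3) * y ^ (m - 1)))"
  proof (rule integral_norm_bound_integral)
    show "JJI m a b integrable_on {0<..}" by (rule set_lebesgue_integral_eq_integral(1)[OF JJI_integrable[OF m b a]])
    show "(\<lambda>y. Mass m / B * (exp (- (Re a / 6) * y ^ 3) * y ^ (m - 1))) integrable_on {0<..}"
      by (rule JJ_dominating_integrable) (use m a in auto)
    show "norm (JJI m a b y) \<le> Mass m / B * (exp (- (Re a / 6) * y ^ 3) * y ^ (m - 1))" if "y \<in> {0<..}" for y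
      using norm_JJI_le[of "Re a" a y m b "Mass m / B"] norm_kk_ray_le[OF m b _ B, of y] that by simp
  qed
  also have "\<dots> = Mass m / B * (1 / 3 * Gamma (real m / 3) * (Re a / 6) powr - (real m / 3))"
  proof -
    have "integral {0<..} (\<lambda>y. exp (- (Re a / 6) * y ^ 3) * y ^ (m - 1)) = 1 / 3 * Gamma (real m / 3) * (Re a / 6) powr - (real m / 3)"
      by (rule cubic_exp_integral(2)) (use a m in auto)
    then show ?thesis unfolding integral_mult_right by (rule arg_cong)
  qed
  finally show ?thesis unfolding JJ_def norm_mult norm_power by (intro mult_left_mono) auto
qed

lemma holomorphic_JJ:
  assumes m: "m \<ge> 4" and U: "open U" and A: "A holomorphic_on U" and B: "B holomorphic_on U"
    and dom: "\<And>l. l \<in> U \<Longrightarrow> Re (A l) > 0" "\<And>l. l \<in> U \<Longrightarrow> B l \<in> S3"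
  shows "(\<lambda>l. JJ m (A l) (B l)) holomorphic_on U"
proof -
  have "(\<lambda>l. integral {0<..} (JJI m (A l) (B l))) holomorphic_on U"
  proof (rule holomorphic_on_integral_param[OF U])
    fix y :: real assume y: "y \<in> {0<..}"
    have "(kk m \<circ> (\<lambda>l. B l * of_real y)) holomorphic_on U"
      using y by (intro holomorphic_on_compose holomorphic_intros B holomorphic_on_subset[OF holomorphic_kk[OF m]]) (auto intro: S3_mult_pos dom)
    then have "(\<lambda>l. kk m (B l * of_real y)) holomorphic_on U" by (simp add: o_def)
    then show "(\<lambda>l. JJI m (A l) (B l) y) holomorphic_on U"
      unfolding JJI_def by (intro holomorphic_intros A) auto
  next
    fix l0 assume l0: "l0 \<in> U"
    \<comment> \<open>Half of Re (A l0), and the midpoint between the cosine at l0 and its critical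
      value - 1/2: both persist as strict lower bounds near l0.\<close>
    define \<alpha> c0 where "\<alpha> = Re (A l0) / 2" and "c0 = (cosarg2 (B l0) - 1 / 2) / 2"
    have \<alpha>: "\<alpha> > 0" "\<alpha> < Re (A l0)" using dom(1)[OF l0] by (auto simp: \<alpha>_def)
    have c0: "- (1 / 2) < c0" "c0 < cosarg2 (B l0)" using cosarg2_gt(1)[OF dom(2)[OF l0]] by (auto simp: c0_def)
    define V where "V = {l \<in> U. Re (A l) > \<alpha>} \<inter> {l \<in> U. cosarg2 (B l) > c0}"
    have cA: "continuous_on U A" "continuous_on U B" using A B by (auto intro: holomorphic_on_imp_continuous_on)
    have "B l \<noteq> 0" if "l \<in> U" for l using dom(2)[OF that] by (auto simp: S3_def)
    then have cc: "continuous_on U (\<lambda>l. cosarg2 (B l))" unfolding cosarg2_def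
      by (intro continuous_intros cA) auto
    have "open (U \<inter> (\<lambda>l. Re (A l)) -` {\<alpha><..})" "open (U \<inter> (\<lambda>l. cosarg2 (B l)) -` {c0<..})"
      by (auto intro!: continuous_open_preimage U cc continuous_intros cA)
    moreover have "V = (U \<inter> (\<lambda>l. Re (A l)) -` {\<alpha><..}) \<inter> (U \<inter> (\<lambda>l. cosarg2 (B l)) -` {c0<..})"
      by (auto simp: V_def)
    ultimately have "open V" using open_Int by blast
    moreover have "l0 \<in> V" using l0 \<alpha> c0 by (simp add: V_def)
    ultimately obtain e where e: "e > 0" "ball l0 e \<subseteq> V" using open_contains_ball by blast
    define M where "M = Mass m / min 1 ((1 + 2 * c0) / 2)"
    have "norm (JJI m (A l) (B l) y) \<le> M * (exp (- (\<alpha> / 6) * y ^ 3) * y ^ (m - 1))"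
      if l: "l \<in> ball l0 e \<inter> U" and y: "y \<in> {0<..}" for l y
    proof -
      have V: "Re (A l) > \<alpha>" "cosarg2 (B l) > c0" using l e by (auto simp: V_def)
      have "norm (kk m (B l * of_real y)) \<le> M"
        unfolding M_def using l y dom(2)[of l] kbound_ge[OF c0(1) less_imp_le[OF V(2)]]
        by (intro norm_kk_ray_le m) auto
      then show ?thesis using V(1) y by (intro norm_JJI_le) auto
    qed
    then show "\<exists>e>0. \<exists>g. g integrable_on {0<..} \<and> (\<forall>l\<in>ball l0 e \<inter> U. \<forall>y\<in>{0<..}. norm (JJI m (A l) (B l) y) \<le> g y)"
      using e(1) JJ_dominating_integrable[OF \<alpha>(1) m, of M] by blast
  qed (use continuous_on_JJI[OF m dom(2)] in auto)
  then show ?thesis unfolding JJ_def using B by (intro holomorphic_intros) auto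
qed

text \<open>Substitution y -> s y: for positive s the value depends only on a / b^3 and the
  direction of b.\<close>

lemma JJ_scale:
  assumes m: "m \<ge> 4" and b: "b \<in> S3" and a: "Re a > 0" and s: "s > 0"
  shows "JJ m (a * of_real (s ^ 3)) (b * of_real s) = JJ m a b"
proof -
  let ?f = "JJI m a b" and ?g = "\<lambda>y::real. s * y"
  have img: "?g ` {0<..} = {0<..}"
  proof -
    have "y \<in> ?g ` {0<..}" if "y > 0" for y using that s by (intro image_eqI[of _ _ "y / s"]) auto
    then show ?thesis using s by auto
  qed
  have "(\<lambda>y. \<bar>s\<bar> *\<^sub>R ?f (?g y)) absolutely_integrable_on {0<..} \<and> integral {0<..} (\<lambda>y. \<bar>s\<bar> *\<^sub>R ?f (?g y)) = integral {0<..} ?f"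
    by (subst has_absolute_integral_change_of_variables_real[of "{0<..}" ?g "\<lambda>_. s" ?f])
       (use s JJI_integrable[OF m b a] img in \<open>auto intro!: derivative_eq_intros inj_onI\<close>)
  then have "integral {0<..} ?f = integral {0<..} (\<lambda>y. \<bar>s\<bar> *\<^sub>R ?f (?g y))" by simp
  also have "\<dots> = integral {0<..} (\<lambda>y. of_real (s ^ m) * JJI m (a * of_real (s ^ 3)) (b * of_real s) y)"
  proof (rule integral_cong)
    fix y :: real assume "y \<in> {0<..}"
    have "s ^ m = s * s ^ (m - 1)" using m by (cases m) auto
    then have 1: "complex_of_real (s ^ m) = of_real s * of_real (s ^ (m - 1))" by simp
    have 2: "(s * y) ^ 3 = s ^ 3 * y ^ 3" "(s * y) ^ (m - 1) = s ^ (m - 1) * y ^ (m - 1)" by (rule power_mult_distrib)+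
    have 3: "- a * (complex_of_real (s ^ 3) * complex_of_real (y ^ 3)) / 6 = - (a * complex_of_real (s ^ 3)) * complex_of_real (y ^ 3) / 6"
      by (simp only: mult.assoc mult_minus_left)
    show "\<bar>s\<bar> *\<^sub>R ?f (?g y) = of_real (s ^ m) * JJI m (a * of_real (s ^ 3)) (b * of_real s) y"
      unfolding JJI_def 1 2 of_real_mult scaleR_conv_of_real 3 using s by (simp only: abs_of_pos mult_ac)
  qed
  finally have "integral {0<..} ?f = of_real (s ^ m) * integral {0<..} (JJI m (a * of_real (s ^ 3)) (b * of_real s))"
    by (simp only: integral_mult_right)
  then show ?thesis unfolding JJ_def power_mult_distrib by (simp add: mult_ac)
qed

lemma exp_mem_S3:
  assumes "\<bar>Im z\<bar> < pi / 3"
  shows "exp z \<in> S3"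
proof -
  have "cos (pi / 3) < cos \<bar>Im z\<bar>" by (rule cos_monotone_0_pi) (use assms pi_gt3 in auto)
  then have c: "cos (Im z) > 1 / 2" by (simp add: cos_60)
  then have "(1 / 2) * (1 / 2) \<le> cos (Im z) * cos (Im z)" by (intro mult_mono) auto
  then have "(sin (Im z))\<^sup>2 \<le> 3 / 4" using sin_cos_squared_add[of "Im z"] by (simp add: power2_eq_square)
  then have "\<bar>sin (Im z)\<bar> \<le> sqrt (3 / 4)" using real_le_rsqrt[of "\<bar>sin (Im z)\<bar>" "3 / 4"] by simp
  also have "sqrt (3 / 4) = sqrt 3 * (1 / 2)" by (simp add: real_sqrt_divide)
  also have "\<dots> < sqrt 3 * cos (Im z)" using c by (intro mult_strict_left_mono) auto
  finally have "\<bar>sin (Im z)\<bar> < sqrt 3 * cos (Im z)" .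
  then have "exp (Re z) * \<bar>sin (Im z)\<bar> < exp (Re z) * (sqrt 3 * cos (Im z))" by (rule mult_strict_left_mono) simp
  then show ?thesis using c by (simp add: S3_def Re_exp Im_exp abs_mult mult_ac)
qed

text \<open>Both sides are holomorphic for |Im l| < \<pi> / 2. On the line Im l = \<phi> the rotated
  ray is the positive axis and the identity is mere scaling; the identity theorem does the rest and
  replaces a contour deformation at infinity.\<close>

lemma JJ_rotate:
  assumes m: "m \<ge> 4" and \<phi>: "\<bar>\<phi>\<bar> < pi / 2" and l: "\<bar>Im l\<bar> < pi / 2"
  shows "JJ m (cis \<phi>) (exp (- (l - \<i> * of_real \<phi>) / 3)) = JJ m (exp l) 1"
proof -
  define U where "U = {l. \<bar>Im l\<bar> < pi / 2}"
  have U: "open U" unfolding U_def by (intro open_Collect_less continuous_intros)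
  have "U = {l. Im l < pi / 2} \<inter> {l. Im l > - (pi / 2)}" by (auto simp: U_def)
  then have "convex U" using convex_Int[OF convex_halfspace_Im_lt convex_halfspace_Im_gt] by (simp only:)
  then have conn: "connected U" by (rule convex_connected)
  have cpos: "cos \<phi> > 0" using \<phi> by (intro cos_gt_zero_pi) auto
  have cl: "cos (Im l) > 0" if "l \<in> U" for l using that by (intro cos_gt_zero_pi) (auto simp: U_def)
  have s1: "1 \<in> S3" by (simp add: S3_def)
  have hol: "(\<lambda>l. JJ m (cis \<phi>) (exp (- (l - \<i> * of_real \<phi>) / 3)) - JJ m (exp l) 1) holomorphic_on U"
  proof (rule holomorphic_on_diff)
    show "(\<lambda>l. JJ m (cis \<phi>) (exp (- (l - \<i> * of_real \<phi>) / 3))) holomorphic_on U"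
    proof (rule holomorphic_JJ[OF m U])
      show "exp (- (l - \<i> * of_real \<phi>) / 3) \<in> S3" if "l \<in> U" for l
      proof (rule exp_mem_S3)
        have "Im (- (l - \<i> * of_real \<phi>) / 3) = (\<phi> - Im l) / 3" by (simp add: Im_divide_numeral)
        then show "\<bar>Im (- (l - \<i> * of_real \<phi>) / 3)\<bar> < pi / 3"           using that \<phi> unfolding U_def mem_Collect_eq abs_less_iff by (auto simp: field_simps)
      qed
    qed (use cpos in \<open>auto intro!: holomorphic_intros\<close>)
    show "(\<lambda>l. JJ m (exp l) 1) holomorphic_on U"
      by (rule holomorphic_JJ[OF m U]) (use cl s1 in \<open>auto intro!: holomorphic_intros simp: Re_exp\<close>)
  qed
  have line: "JJ m (cis \<phi>) (exp (- (l - \<i> * of_real \<phi>) / 3)) - JJ m (exp l) 1 = 0" if "l \<in> {l. Im l = \<phi>}" for l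
  proof -
    define x where "x = Re l"
    have lx: "l = of_real x + \<i> * of_real \<phi>" using that by (simp add: complex_eq_iff x_def)
    have 1: "exp (- (l - \<i> * of_real \<phi>) / 3) = of_real (exp (- x / 3))"
      unfolding lx by (simp only: exp_of_real[symmetric] add_diff_cancel_right') simp
    have 2: "exp l = cis \<phi> * of_real (exp (x / 3) ^ 3)"
      unfolding lx exp_add exp_of_nat_mult[symmetric] cis_conv_exp exp_of_real by simp
    have 3: "(1::complex) = of_real (exp (- x / 3)) * of_real (exp (x / 3))"
      by (simp flip: exp_of_real exp_add)
    have s3: "complex_of_real (exp (- x / 3)) \<in> S3" by (simp add: S3_def)
    have "JJ m (exp l) 1 = JJ m (cis \<phi>) (of_real (exp (- x / 3)))"
      unfolding 2 by (subst 3, rule JJ_scale[OF m s3]) (use cpos in auto)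
    then show ?thesis unfolding 1 by simp
  qed
  have "\<i> * of_real \<phi> islimpt {l. Im l = \<phi>}"
    unfolding islimpt_approachable
  proof (intro allI impI)
    fix e :: real assume "e > 0"
    then show "\<exists>l\<in>{l. Im l = \<phi>}. l \<noteq> \<i> * of_real \<phi> \<and> dist l (\<i> * of_real \<phi>) < e"
      by (intro bexI[of _ "of_real (e / 2) + \<i> * of_real \<phi>"]) (auto simp: dist_norm norm_divide)
  qed
  note lim = this
  have sub: "{l. Im l = \<phi>} \<subseteq> U" and mem: "\<i> * of_real \<phi> \<in> U" "l \<in> U" using \<phi> l by (auto simp: U_def)
  have "JJ m (cis \<phi>) (exp (- (l - \<i> * of_real \<phi>) / 3)) - JJ m (exp l) 1 = 0"
    by (rule analytic_continuation[OF hol U conn sub mem(1) lim line mem(2)])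
  then show ?thesis by simp
qed

section \<open>The remainder\<close>

definition Dr :: "nat \<Rightarrow> real" where "Dr n = Re (coeffD (2 * n + 1))"

lemma coeffD_real: "coeffD (2 * n + 1) = of_real (Dr n)"
proof (cases "n \<ge> 1")
  case True
  show ?thesis unfolding Dr_def coeffD_eq_Mass[OF True] Re_complex_of_real ..
next
  case False
  then have "n = 0" by simp
  then show ?thesis using coeffD_1 by (simp add: Dr_def)
qed

lemma norm_coeffD_eq_Mass: "n \<ge> 1 \<Longrightarrow> norm (coeffD (2 * n + 1)) = 2 / pi * Mass (2 * n + 2)"
  unfolding coeffD_eq_Mass norm_of_real using Mass_nonneg[of "2 * n + 2"] by (simp add: abs_mult power_abs)

definition s3 :: "nat \<Rightarrow> real" where "s3 j = sin (pi * real j / 3)"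

lemma kap_even_power: "(kap\<^sup>2) ^ j = cis (pi * real j / 3)" "((cnj kap)\<^sup>2) ^ j = cis (- (pi * real j / 3))"
  unfolding kap_powers(4) cis_cnj by (simp_all add: Complex.DeMoivre mult_ac)

lemma kap_power_diff: "(kap\<^sup>2) ^ j - ((cnj kap)\<^sup>2) ^ j = 2 * \<i> * of_real (s3 j)"
  unfolding kap_even_power by (simp add: complex_eq_iff s3_def)

lemma ker_cnj: "ker k (cnj w) = cnj (ker k w)" if "w \<in> Wdom" "k \<ge> 2"
proof -
  have i: "kerI k w integrable_on {0<..}"
    by (rule set_lebesgue_integral_eq_integral(1)[OF kerI_integrable[OF that]])
  have "integral {0<..} (cnj \<circ> kerI k w) = cnj (integral {0<..} (kerI k w))"
    by (rule integral_linear[OF i bounded_linear_cnj])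
  moreover have "cnj \<circ> kerI k w = kerI k (cnj w)"
    by (rule ext) (simp add: kerI_def)
  ultimately show ?thesis unfolding ker_def by simp
qed

text \<open>For X = a^(N+1) K the product (a - a')(X - cnj X) splits, because a a' = 1, into
  multiples of a K - a' K' and K' - K. Up to i sqrt 3 the first is \<open>kk\<close> with index 2 N
  + 2, and by \<open>ker_step\<close> the second is z^2 times \<open>kk\<close> with index 2 N + 4.
  The coefficients are the sines that later vanish modulo 3.\<close>

lemma Im_kernel_eq:
  assumes N: "N \<ge> 1" and z: "z > 0"
  shows "of_real (Im (kap ^ (2 * N + 2) * ker (2 * N) (kap * of_real z)))
    = of_real (s3 (N + 1)) * kk (2 * N + 2) (of_real z) + of_real (s3 N) * (of_real z)\<^sup>2 * kk (2 * N + 4) (of_real z)"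
proof -
  define w w' where "w = kap * of_real z" and "w' = cnj kap * of_real z"
  define a a' where "a = kap\<^sup>2" and "a' = (cnj kap)\<^sup>2"
  define K K' L L' where "K = ker (2 * N) w" and "K' = ker (2 * N) w'" and "L = ker (2 * N + 2) w" and "L' = ker (2 * N + 2) w'"
  have W: "w \<in> Wdom" "w' \<in> Wdom" using kap_mult_mem_Wdom[OF z] by (simp_all only: w_def w'_def)
  have w': "w' = cnj w" by (simp add: w_def w'_def)
  have K': "K' = cnj K" unfolding K'_def K_def w' using W(1) N by (intro ker_cnj) auto
  have k: "kap ^ (2 * N + 2) = a ^ (N + 1)" unfolding a_def power_mult[symmetric] by simp
  have ck: "cnj (a ^ (N + 1)) = a' ^ (N + 1)" unfolding a_def a'_def by simp
  have aa: "a * a' = 1" "a - a' = \<i> * of_real (sqrt 3)"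
    unfolding a_def a'_def kap_powers(1,2) by (simp_all add: complex_eq_iff)
  have st: "K = of_real (Mass (2 * N + 2)) - a * (of_real z)\<^sup>2 * L" "K' = of_real (Mass (2 * N + 2)) - a' * (of_real z)\<^sup>2 * L'"
    unfolding K_def K'_def L_def L'_def using ker_step[OF W(1), of "2 * N"] ker_step[OF W(2), of "2 * N"] N
    by (simp_all add: w_def w'_def a_def a'_def power_mult_distrib)
  define X where "X = a ^ (N + 1) * K"
  have k1: "kk (2 * N + 2) (of_real z) = (a * K - a' * K') / (\<i> * of_real (sqrt 3))"
    by (simp add: kk_def a_def a'_def K_def K'_def w_def w'_def)
  have "kk (2 * N + 4) (of_real z) = (a * L - a' * L') / (\<i> * of_real (sqrt 3))"
    by (simp add: kk_def a_def a'_def L_def L'_def w_def w'_def)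
  then have "(of_real z)\<^sup>2 * kk (2 * N + 4) (of_real z) = (a * (of_real z)\<^sup>2 * L - a' * (of_real z)\<^sup>2 * L') / (\<i> * of_real (sqrt 3))"
    by (simp add: algebra_simps)
  then have k2: "(of_real z)\<^sup>2 * kk (2 * N + 4) (of_real z) = (K' - K) / (\<i> * of_real (sqrt 3))"
    unfolding st by (simp add: algebra_simps)
  have "X - cnj X = a ^ (N + 1) * K - a' ^ (N + 1) * K'" unfolding X_def complex_cnj_mult ck K' ..
  moreover have "(a - a') * (a ^ (N + 1) * K - a' ^ (N + 1) * K')
     = (a ^ (N + 1) - a' ^ (N + 1)) * (a * K - a' * K') + (a ^ N - a' ^ N) * (K' - K) * (a * a')"
    by (simp add: algebra_simps)
  ultimately have pre: "(\<i> * of_real (sqrt 3)) * (X - cnj X) = 2 * \<i> * of_real (s3 (N + 1)) * (a * K - a' * K') + 2 * \<i> * of_real (s3 N) * (K' - K)"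
    using kap_power_diff[of "N + 1"] kap_power_diff[of N] aa unfolding a_def[symmetric] a'_def[symmetric] by simp
  then have "X - cnj X = 2 * \<i> * of_real (s3 (N + 1)) * ((a * K - a' * K') / (\<i> * of_real (sqrt 3))) + 2 * \<i> * of_real (s3 N) * ((K' - K) / (\<i> * of_real (sqrt 3)))"
  proof -
    have gen: "D = u * (P / S) + v * (Q / S)" if "S * D = u * P + v * Q" "S \<noteq> 0" for D u v P Q S :: complex
    proof -
      have "D = (S * D) / S" using that(2) by simp
      then show ?thesis unfolding that(1) by (simp add: add_divide_distrib)
    qed
    show ?thesis by (rule gen[OF pre]) simp
  qed
  also have "X - cnj X = 2 * \<i> * of_real (Im X)" by (simp add: complex_eq_iff)
  finally have "2 * \<i> * of_real (Im X) = 2 * \<i> * (of_real (s3 (N + 1)) * kk (2 * N + 2) (of_real z) + of_real (s3 N) * ((of_real z)\<^sup>2 * kk (2 * N + 4) (of_real z)))"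
    unfolding k1 k2 by (simp only: distrib_left mult.assoc)
  then have "of_real (Im X) = of_real (s3 (N + 1)) * kk (2 * N + 2) (of_real z) + of_real (s3 N) * ((of_real z)\<^sup>2 * kk (2 * N + 4) (of_real z))"
    by (subst (asm) mult_left_cancel) simp
  then show ?thesis unfolding X_def k K_def w_def by (simp only: mult.assoc)
qed

lemma Qf_expansion:
  assumes N: "N \<ge> 1" and z: "z > 0"
  shows "of_real (Qf z) = (\<Sum>n<N. of_real (Dr n * s3 (n + 1)) * of_real (z ^ (2 * n + 2 - 1)))
    + (- 1) ^ (N + 1) * of_real (2 / pi) * (of_real (s3 (N + 1)) * (of_real (z ^ (2 * N + 2 - 1)) * kk (2 * N + 2) (of_real z))
       + of_real (s3 N) * (of_real (z ^ (2 * N + 4 - 1)) * kk (2 * N + 4) (of_real z)))"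
proof -
  define w where "w = kap * of_real z"
  define X where "X = kap ^ (2 * N + 2) * ker (2 * N) w"
  have W: "w \<in> Wdom" using kap_mult_mem_Wdom[OF z] by (simp only: w_def)
  have kp: "kap * w ^ (2 * n + 1) = kap ^ (2 * n + 2) * of_real (z ^ (2 * n + 1))" for n
    unfolding w_def power_mult_distrib of_real_power by simp
  have ik: "Im (kap ^ (2 * n + 2)) = s3 (n + 1)" for n
  proof -
    have "kap ^ (2 * n + 2) = (kap\<^sup>2) ^ (n + 1)" unfolding power_mult[symmetric] by simp
    then show ?thesis unfolding kap_even_power s3_def by simp
  qed
  have "kap * Ghat w = (\<Sum>n<N. of_real (Dr n) * (kap * w ^ (2 * n + 1))) + (- 1) ^ (N + 1) * of_real (2 / pi) * (kap * w ^ (2 * N + 1)) * ker (2 * N) w"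
    unfolding Ghat_expansion[OF W N] distrib_left sum_distrib_left coeffD_real by (simp only: mult_ac)
  also have "\<dots> = (\<Sum>n<N. of_real (Dr n * z ^ (2 * n + 1)) * kap ^ (2 * n + 2)) + of_real ((- 1) ^ (N + 1) * (2 / pi) * z ^ (2 * N + 1)) * X"
    unfolding kp X_def of_real_mult of_real_power of_real_minus of_real_1 by (simp only: mult_ac)
  finally have kG: "kap * Ghat w = (\<Sum>n<N. of_real (Dr n * z ^ (2 * n + 1)) * kap ^ (2 * n + 2)) + of_real ((- 1) ^ (N + 1) * (2 / pi) * z ^ (2 * N + 1)) * X" .
  have "Qf z = (\<Sum>n<N. Dr n * z ^ (2 * n + 1) * s3 (n + 1)) + (- 1) ^ (N + 1) * (2 / pi) * z ^ (2 * N + 1) * Im X"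
  proof -
    have "Im (of_real x * y) = x * Im y" for x y by simp
    then show ?thesis unfolding Qf_def w_def[symmetric] kG by (simp only: plus_complex.sel Im_sum ik)
  qed
  then have "of_real (Qf z) = (\<Sum>n<N. of_real (Dr n * s3 (n + 1)) * of_real (z ^ (2 * n + 1))) + (- 1) ^ (N + 1) * of_real (2 / pi) * of_real (z ^ (2 * N + 1)) * complex_of_real (Im X)"
    by (simp only: of_real_add of_real_sum of_real_mult of_real_power of_real_minus of_real_1 mult_ac)
  moreover have "of_real (z ^ (2 * N + 1)) * complex_of_real (Im X) = of_real (s3 (N + 1)) * (of_real (z ^ (2 * N + 1)) * kk (2 * N + 2) (of_real z))
       + of_real (s3 N) * (of_real (z ^ (2 * N + 3)) * kk (2 * N + 4) (of_real z))"
  proof -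
    have "complex_of_real (z ^ (2 * N + 3)) = of_real (z ^ (2 * N + 1)) * (of_real z)\<^sup>2"    proof -
      have "2 * N + 3 = (2 * N + 1) + 2" by simp
      then show ?thesis by (simp only: power_add of_real_mult of_real_power)
    qed
    then show ?thesis unfolding X_def w_def Im_kernel_eq[OF N z] by (simp only: distrib_left mult_ac)
  qed
  moreover have "2 * n + 2 - 1 = 2 * n + 1" "2 * n + 4 - 1 = 2 * n + 3" for n :: nat by simp_all
  ultimately show ?thesis by (simp only: mult.assoc)
qed

lemma hankelF_expansion_imaginary:
  assumes tau: "\<tau> > 0" and N: "N \<ge> 1"
  shows "hankelF (Complex (ln \<tau>) (pi / 2)) =
     (\<Sum>n<N. of_real (2 / pi * (Dr n * s3 (n + 1) * (1 / 3 * Gamma (real (2 * n + 2) / 3) * (\<tau> / 6) powr - (real (2 * n + 2) / 3)))))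
     + (- 1) ^ (N + 1) * of_real (4 / pi\<^sup>2) * (of_real (s3 (N + 1)) * JJ (2 * N + 2) (of_real \<tau>) 1 + of_real (s3 N) * JJ (2 * N + 4) (of_real \<tau>) 1)"
proof -
  define E where "E = (\<lambda>m z. complex_of_real (exp (- (\<tau> / 6) * z ^ 3) * z ^ (m - 1)))"
  define I where "I = (\<lambda>m. 1 / 3 * Gamma (real m / 3) * (\<tau> / 6) powr - (real m / 3))"
  have s1: "1 \<in> S3" by (simp add: S3_def)
  have hE: "(E m has_integral of_real (I m)) {0<..}" if "m \<ge> 1" for m
  proof -
    have "((\<lambda>z. exp (- (\<tau> / 6) * z ^ 3) * z ^ (m - 1)) has_integral I m) {0<..}"
    proof -
      have pos: "\<tau> / 6 > 0" using tau by simp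
      show ?thesis
        using integrable_integral[OF set_lebesgue_integral_eq_integral(1)[OF cubic_exp_integral(1)[OF pos that]]]
        unfolding cubic_exp_integral(2)[OF pos that] I_def .
    qed
    then show ?thesis unfolding E_def by (rule has_integral_of_real)
  qed
  have hJ: "(JJI m (of_real \<tau>) 1 has_integral JJ m (of_real \<tau>) 1) {0<..}" if "m \<ge> 4" for m
    unfolding JJ_def power_one mult_1 using tau that s1
    by (intro integrable_integral set_lebesgue_integral_eq_integral(1) JJI_integrable) auto
  have hQ: "((\<lambda>z. complex_of_real (exp (- \<tau> * (z ^ 3 / 6)) * Qf z)) has_integral of_real (integral {0<..} (\<lambda>z. exp (- \<tau> * (z ^ 3 / 6)) * Qf z))) {0<..}"
    by (rule has_integral_of_real[OF integrable_integral[OF set_lebesgue_integral_eq_integral(1)[OF hankelF_zz(1)[OF tau]]]])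
  define T where "T = (\<Sum>n<N. of_real (Dr n * s3 (n + 1)) * complex_of_real (I (2 * n + 2)))
    + (- 1) ^ (N + 1) * of_real (2 / pi) * (of_real (s3 (N + 1)) * JJ (2 * N + 2) (of_real \<tau>) 1 + of_real (s3 N) * JJ (2 * N + 4) (of_real \<tau>) 1)"
  have "((\<lambda>z. (\<Sum>n<N. of_real (Dr n * s3 (n + 1)) * E (2 * n + 2) z)
    + (- 1) ^ (N + 1) * of_real (2 / pi) * (of_real (s3 (N + 1)) * JJI (2 * N + 2) (of_real \<tau>) 1 z + of_real (s3 N) * JJI (2 * N + 4) (of_real \<tau>) 1 z))
    has_integral T) {0<..}"
    unfolding T_def using N
    by (intro has_integral_add has_integral_sum has_integral_mult_right hE hJ) auto
  then have "((\<lambda>z. of_real (exp (- \<tau> * (z ^ 3 / 6)) * Qf z)) has_integral T) {0<..}"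
  proof (rule has_integral_eq[rotated])
    fix z :: real assume "z \<in> {0<..}"
    then have z: "z > 0" by simp
    define e where "e = exp (- (\<tau> / 6) * z ^ 3)"
    have e: "exp (- \<tau> * (z ^ 3 / 6)) = e" by (simp add: e_def)
    have ce: "exp (- complex_of_real \<tau> * of_real (z ^ 3) / 6) = of_real e" unfolding e_def exp_of_real[symmetric] by simp
    show "(\<Sum>n<N. of_real (Dr n * s3 (n + 1)) * E (2 * n + 2) z)
    + (- 1) ^ (N + 1) * of_real (2 / pi) * (of_real (s3 (N + 1)) * JJI (2 * N + 2) (of_real \<tau>) 1 z + of_real (s3 N) * JJI (2 * N + 4) (of_real \<tau>) 1 z)
     = of_real (exp (- \<tau> * (z ^ 3 / 6)) * Qf z)"
      unfolding e of_real_mult[of e] Qf_expansion[OF N z] JJI_def ce E_def e_def[symmetric] mult_1 of_real_mult[of e]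
      by (simp only: distrib_left sum_distrib_left mult_ac)
  qed
  then have "of_real (integral {0<..} (\<lambda>z. exp (- \<tau> * (z ^ 3 / 6)) * Qf z)) = T" using hQ has_integral_unique by blast
  then have "hankelF (Complex (ln \<tau>) (pi / 2)) = of_real (2 / pi) * T" unfolding hankelF_zz(2)[OF tau] of_real_mult by simp
  \<comment> \<open>One factor 2 / \<pi> comes from the integral for the Hankel function, the other
    from the definition of \<open>Ghat\<close>.\<close>
  moreover have "complex_of_real (4 / pi\<^sup>2) = of_real (2 / pi) * of_real (2 / pi)" by (simp add: power2_eq_square)
  ultimately show ?thesis unfolding T_def I_def distrib_left sum_distrib_left of_real_mult[of "2 / pi"] of_real_mult[of "Dr _ * _"]
    by (simp only: mult_ac)
qed

lemma s3_bounds: "\<bar>s3 j\<bar> \<le> sqrt 3 / 2" "3 dvd j \<Longrightarrow> s3 j = 0"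
proof -
  define t where "t = pi * real j / 3"
  have "sin (3 * t) = 0" by (simp add: t_def mult.commute[of pi])
  moreover have "sin (3 * t) = sin t * (3 - 4 * (sin t)\<^sup>2)"
  proof -
    have "sin (3 * t) = sin (2 * t + t)" by simp
    also have "\<dots> = 2 * sin t * (cos t)\<^sup>2 + (1 - 2 * (sin t)\<^sup>2) * sin t"
      unfolding sin_add sin_double cos_double_sin by (simp add: power2_eq_square)
    also have "(cos t)\<^sup>2 = 1 - (sin t)\<^sup>2" by (rule cos_squared_eq)
    finally show ?thesis by (simp add: algebra_simps)
  qed
  ultimately have "(sin t)\<^sup>2 \<le> 3 / 4" by auto
  then have "\<bar>sin t\<bar> \<le> sqrt (3 / 4)" using real_le_rsqrt[of "\<bar>sin t\<bar>" "3 / 4"] by simp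
  also have "sqrt (3 / 4) = sqrt 3 / 2" by (simp add: real_sqrt_divide)
  finally show "\<bar>s3 j\<bar> \<le> sqrt 3 / 2" by (simp add: s3_def t_def)
  show "s3 j = 0" if "3 dvd j"
  proof -
    obtain k where "j = 3 * k" using \<open>3 dvd j\<close> by (rule dvdE)
    then show ?thesis by (simp add: s3_def mult.commute[of pi])
  qed
qed

text \<open>The asymptotic sum in the coordinate l = log \<nu> - i \<pi> / 2, which is real on the
  imaginary ray.\<close>

definition hsum :: "nat \<Rightarrow> complex \<Rightarrow> complex" where
  "hsum N l = (\<Sum>n<N. of_real (2 / pi * (Dr n * s3 (n + 1) * (1 / 3 * Gamma (real (2 * n + 2) / 3) * 6 powr (real (2 * n + 2) / 3))))
     * exp (- (of_real (real (2 * n + 2) / 3) * l)))"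

lemma hsum_real:
  assumes "\<tau> > 0"
  shows "hsum N (of_real (ln \<tau>)) = (\<Sum>n<N. of_real (2 / pi * (Dr n * s3 (n + 1) * (1 / 3 * Gamma (real (2 * n + 2) / 3) * (\<tau> / 6) powr - (real (2 * n + 2) / 3)))))"
  unfolding hsum_def
proof (rule sum.cong[OF refl])
  fix n
  define p where "p = real (2 * n + 2) / 3"
  have "exp (- (complex_of_real p * of_real (ln \<tau>))) = of_real (\<tau> powr - p)"
    using assms by (simp add: powr_def flip: exp_of_real)
  moreover have "(\<tau> / 6) powr - p = 6 powr p * \<tau> powr - p" using assms by (simp add: powr_divide powr_minus field_simps)
  ultimately show "of_real (2 / pi * (Dr n * s3 (n + 1) * (1 / 3 * Gamma (real (2 * n + 2) / 3) * 6 powr (real (2 * n + 2) / 3))))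
     * exp (- (of_real (real (2 * n + 2) / 3) * of_real (ln \<tau>))) =
    complex_of_real (2 / pi * (Dr n * s3 (n + 1) * (1 / 3 * Gamma (real (2 * n + 2) / 3) * (\<tau> / 6) powr - (real (2 * n + 2) / 3))))"
    unfolding p_def[symmetric] by (simp only: of_real_mult mult_ac)
qed

text \<open>Continuation to the Riemann surface. The right side is holomorphic where each rotated
  path stays within \<pi> of Im l, and for real l it is the expansion on the imaginary ray by
  \<open>JJ_rotate\<close>. The two angles are independent since each integral is optimised
  separately.\<close>

lemma hankelF_expansion:
  assumes N: "N \<ge> 1" and \<phi>: "\<bar>\<phi>1\<bar> < pi / 2" "\<bar>\<phi>2\<bar> < pi / 2"
    and l: "\<bar>Im l - \<phi>1\<bar> < pi" "\<bar>Im l - \<phi>2\<bar> < pi"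
  shows "hankelF (l + \<i> * of_real (pi / 2)) = hsum N l + (- 1) ^ (N + 1) * of_real (4 / pi\<^sup>2) *
     (of_real (s3 (N + 1)) * JJ (2 * N + 2) (cis \<phi>1) (exp (- (l - \<i> * of_real \<phi>1) / 3))
      + of_real (s3 N) * JJ (2 * N + 4) (cis \<phi>2) (exp (- (l - \<i> * of_real \<phi>2) / 3)))" (is "?H l = ?R l")
proof -
  define U where "U = {l. Im l < \<phi>1 + pi} \<inter> {l. Im l > \<phi>1 - pi} \<inter> ({l. Im l < \<phi>2 + pi} \<inter> {l. Im l > \<phi>2 - pi})"
  have U: "open U" unfolding U_def by (intro open_Int open_halfspace_Im_lt open_halfspace_Im_gt)
  have "convex U" unfolding U_def by (intro convex_Int convex_halfspace_Im_lt convex_halfspace_Im_gt)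
  then have conn: "connected U" by (rule convex_connected)
  have JJ: "(\<lambda>l. JJ m (cis \<phi>) (exp (- (l - \<i> * of_real \<phi>) / 3))) holomorphic_on U"
    if m: "m \<ge> 4" and \<phi>: "\<bar>\<phi>\<bar> < pi / 2" and UU: "\<And>l. l \<in> U \<Longrightarrow> Im l < \<phi> + pi \<and> Im l > \<phi> - pi" for m \<phi>
  proof (rule holomorphic_JJ[OF m U])
    show "exp (- (l - \<i> * of_real \<phi>) / 3) \<in> S3" if "l \<in> U" for l
    proof (rule exp_mem_S3)
      have "Im (- (l - \<i> * of_real \<phi>) / 3) = (\<phi> - Im l) / 3" by (simp add: Im_divide_numeral)
      then show "\<bar>Im (- (l - \<i> * of_real \<phi>) / 3)\<bar> < pi / 3"
        using UU[OF that] unfolding abs_less_iff by (auto simp: field_simps)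
    qed
    have "cos \<phi> > 0" using \<phi> by (intro cos_gt_zero_pi) auto
    then show "Re (cis \<phi>) > 0" if "l \<in> U" for l by simp
  qed (auto intro!: holomorphic_intros)
  have "?H holomorphic_on U"
  proof -
    have "(\<lambda>l. l + \<i> * of_real (pi / 2)) holomorphic_on U" by (intro holomorphic_intros)
    from holomorphic_on_compose_gen[OF this holomorphic_hankelF subset_UNIV] show ?thesis by (simp only: o_def)
  qed
  moreover have "?R holomorphic_on U"
  proof -
    have "hsum N holomorphic_on U" unfolding hsum_def[abs_def] by (intro holomorphic_intros)
    moreover have "(\<lambda>l. JJ (2 * N + 2) (cis \<phi>1) (exp (- (l - \<i> * of_real \<phi>1) / 3))) holomorphic_on U"
      using N by (intro JJ \<phi>) (auto simp: U_def)
    moreover have "(\<lambda>l. JJ (2 * N + 4) (cis \<phi>2) (exp (- (l - \<i> * of_real \<phi>2) / 3))) holomorphic_on U"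
      by (intro JJ \<phi>) (auto simp: U_def)
    ultimately show ?thesis by (intro holomorphic_on_add holomorphic_on_mult holomorphic_on_const)
  qed
  ultimately have hol: "(\<lambda>l. ?H l - ?R l) holomorphic_on U" by (rule holomorphic_on_diff)
  have line: "?H l - ?R l = 0" if lr: "l \<in> \<real>" for l
  proof -
    obtain x where x: "l = of_real x" using lr by (rule Reals_cases)
    define \<tau> where "\<tau> = exp x"
    have tau: "\<tau> > 0" "ln \<tau> = x" by (simp_all add: \<tau>_def)
    have 1: "l + \<i> * of_real (pi / 2) = Complex (ln \<tau>) (pi / 2)" by (simp add: x tau complex_eq_iff)
    have 2: "exp l = of_real \<tau>" by (simp add: x \<tau>_def exp_of_real)
    have 3: "hsum N l = hsum N (of_real (ln \<tau>))" by (simp add: x tau)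
    have im: "\<bar>Im l\<bar> < pi / 2" by (simp add: x)
    have m: "2 * N + 2 \<ge> 4" "2 * N + 4 \<ge> 4" using N by auto
    show ?thesis unfolding JJ_rotate[OF m(1) \<phi>(1) im] JJ_rotate[OF m(2) \<phi>(2) im] 1 2 3 hsum_real[OF tau(1)]
      using hankelF_expansion_imaginary[OF tau(1) N] by simp
  qed
  have sub: "\<real> \<subseteq> U" using \<phi> pi_gt3 by (auto simp: U_def elim!: Reals_cases)
  have mem: "0 \<in> U" "l \<in> U" using \<phi> l pi_gt3 by (auto simp: U_def)
  have lim: "0 islimpt (\<real> :: complex set)"
    unfolding islimpt_approachable
  proof (intro allI impI)
    fix e :: real assume "e > 0"
    then show "\<exists>l\<in>\<real>. l \<noteq> 0 \<and> dist l (0::complex) < e"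
      by (intro bexI[of _ "of_real (e / 2)"]) (auto simp: norm_divide)
  qed
  have "?H l - ?R l = 0" by (rule analytic_continuation[OF hol U conn sub mem(1) lim line mem(2)])
  then show ?thesis by simp
qed

text \<open>With t = \<pi> (n + 1) / 3 one has sin (3 t) = 0 and cos (3 t)^2 = 1, so exp (4 i t) sin
  (2 t) = - exp (i t) sin t. The factor exp (i t) is the shift of the argument by \<pi> / 2 in the
  power of \<nu>.\<close>

lemma hankel_remainder_eq:
  assumes r: "r > 0"
  shows "hankel_remainder N r \<theta> = hankelF (Complex (ln r) \<theta>) - hsum N (Complex (ln r) (\<theta> - pi / 2))"
proof -
  have "- (2 / (3 * of_real pi)) * (of_real (6 powr ((2 * real n + 2) / 3)) * coeffD (2 * n + 1)
           * exp (2 * (2 * of_nat n + 2) * of_real pi * \<i> / 3)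
           * of_real (sin ((2 * real n + 2) * pi / 3))
           * (of_real (Gamma ((2 * real n + 2) / 3))
              / rs_power r \<theta> ((2 * real n + 2) / 3)))
    = of_real (2 / pi * (Dr n * s3 (n + 1) * (1 / 3 * Gamma (real (2 * n + 2) / 3) * 6 powr (real (2 * n + 2) / 3))))
     * exp (- (of_real (real (2 * n + 2) / 3) * Complex (ln r) (\<theta> - pi / 2)))" (is "?L = ?R") for n
  proof -
    define p t where "p = (2 * real n + 2) / 3" and "t = pi * real (n + 1) / 3"
    have p: "real (2 * n + 2) / 3 = p" by (simp add: p_def)
    have t2: "(2 * real n + 2) * pi / 3 = 2 * t" by (simp add: t_def algebra_simps)
    have e4: "exp (2 * (2 * of_nat n + 2) * of_real pi * \<i> / 3) = cis (4 * t)"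
      unfolding cis_conv_exp by (rule arg_cong[of _ _ exp]) (simp add: t_def field_simps)
    have c3: "cos (3 * t) = (- 1) ^ (n + 1)" "sin (3 * t) = 0"
    proof -
      have "3 * t = real (n + 1) * pi" by (simp add: t_def)
      then show "cos (3 * t) = (- 1) ^ (n + 1)" "sin (3 * t) = 0" by (simp_all only: cos_npi sin_npi)
    qed
    have k1: "cis (4 * t) * of_real (sin (2 * t)) = - (of_real (sin t) * cis t)"
    proof -
      have "cis (4 * t) = cis (3 * t) * cis t" by (simp add: cis_mult)
      also have "cis (3 * t) = of_real (cos (3 * t))" using c3(2) by (simp add: complex_eq_iff)
      finally have 1: "cis (4 * t) = of_real (cos (3 * t)) * cis t" .
      have "sin (2 * t) = sin (3 * t - t)" by simp
      also have "\<dots> = - (cos (3 * t) * sin t)" unfolding sin_diff c3(2) by simp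
      finally have 2: "sin (2 * t) = - (cos (3 * t) * sin t)" .
      have "cos (3 * t) * cos (3 * t) = 1" unfolding c3(1) by (simp flip: power_mult_distrib)
      then have "complex_of_real (cos (3 * t)) * of_real (cos (3 * t)) = 1" by (simp flip: of_real_mult)
      then show ?thesis unfolding 1 2 of_real_minus of_real_mult by (simp add: algebra_simps)
    qed
    have ex: "exp (- (of_real p * Complex (ln r) (\<theta> - pi / 2))) = cis t / rs_power r \<theta> p"
    proof -
      have "- (of_real p * Complex (ln r) (\<theta> - pi / 2)) = \<i> * of_real t - (of_real (p * ln r) + \<i> * of_real (p * \<theta>))"
        by (simp add: complex_eq_iff p_def t_def field_simps)
      then have "exp (- (of_real p * Complex (ln r) (\<theta> - pi / 2))) = cis t / (exp (of_real (p * ln r)) * exp (\<i> * of_real (p * \<theta>)))"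
        by (simp only: exp_diff exp_add cis_conv_exp)
      moreover have "exp (complex_of_real (p * ln r)) = of_real (r powr p)" using r unfolding exp_of_real by (simp add: powr_def)
      ultimately show ?thesis unfolding rs_power_def by simp
    qed
    have "?L = - (2 / (3 * of_real pi)) * (of_real (6 powr p) * of_real (Dr n) * (cis (4 * t) * of_real (sin (2 * t))) * (of_real (Gamma p) / rs_power r \<theta> p))"
      unfolding e4 t2 coeffD_real p_def[symmetric] by (simp only: mult.assoc)
    also have "\<dots> = 2 / (3 * of_real pi) * (of_real (6 powr p) * of_real (Dr n) * (of_real (sin t) * cis t) * (of_real (Gamma p) / rs_power r \<theta> p))"
      unfolding k1 by simp
    also have "\<dots> = ?R" unfolding p ex s3_def t_def[symmetric] by (simp add: field_simps)
    finally show ?thesis .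
  qed
  then have "- (2 / (3 * of_real pi)) * (\<Sum>n<N. of_real (6 powr ((2 * real n + 2) / 3)) * coeffD (2 * n + 1)
           * exp (2 * (2 * of_nat n + 2) * of_real pi * \<i> / 3)
           * of_real (sin ((2 * real n + 2) * pi / 3))
           * (of_real (Gamma ((2 * real n + 2) / 3))
              / rs_power r \<theta> ((2 * real n + 2) / 3))) = hsum N (Complex (ln r) (\<theta> - pi / 2))"
    unfolding sum_distrib_left hsum_def by (rule sum.cong[OF refl])
  then show ?thesis unfolding hankel_remainder_def hankel1_deriv_diag_def hankel1_deriv_diag_log_eq by (simp only:)
qed

text \<open>The loss from rotating by \<phi>: cos \<phi> is the real part left in the exponent, and
  the angle inside \<open>kbound\<close> is, up to sign, the argument of \<zeta> on the rotated
  path.\<close>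

definition bnd :: "real \<Rightarrow> real \<Rightarrow> real \<Rightarrow> real" where
  "bnd p \<theta> \<phi> = 1 / (cos \<phi> powr p * kbound (cos (2 * (\<theta> - pi / 2 - \<phi>) / 3)))"

text \<open>The constants combine as (4 / \<pi>^2)(sqrt 3 / 2)(1 / 3) Mass = |D| / (sqrt 3 \<pi>),
  because |D| = (2 / \<pi>) Mass; sqrt 3 / 2 is the bound for the sines \<open>s3\<close>.\<close>

lemma JJ_term_bound:
  assumes n: "n \<ge> 1" and r: "r > 0" and \<phi>: "\<bar>\<phi>\<bar> < pi / 2" and \<theta>: "\<bar>\<theta> - pi / 2 - \<phi>\<bar> < pi"
  shows "4 / pi\<^sup>2 * (sqrt 3 / 2) * norm (JJ (2 * n + 2) (cis \<phi>) (exp (- (Complex (ln r) (\<theta> - pi / 2) - \<i> * of_real \<phi>) / 3)))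
     \<le> bnd ((2 * real n + 2) / 3) \<theta> \<phi> * (dterm n r / (sqrt 3 * pi))"
proof -
  define \<eta> p b where "\<eta> = \<theta> - pi / 2 - \<phi>" and "p = (2 * real n + 2) / 3" and "b = exp (- (Complex (ln r) (\<theta> - pi / 2) - \<i> * of_real \<phi>) / 3)"
  have p: "real (2 * n + 2) / 3 = p" by (simp add: p_def)
  have c: "cos \<phi> > 0" using \<phi> by (intro cos_gt_zero_pi) auto
  have arg: "- (Complex (ln r) (\<theta> - pi / 2) - \<i> * of_real \<phi>) / 3 = of_real (- (ln r / 3)) + \<i> * of_real (- \<eta> / 3)"
    by (simp add: complex_eq_iff \<eta>_def field_simps)
  have b: "b = of_real (exp (- (ln r / 3))) * cis (- \<eta> / 3)"
    unfolding b_def arg exp_add exp_of_real cis_conv_exp ..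
  have bS: "b \<in> S3" unfolding b_def arg by (rule exp_mem_S3) (use \<theta> in \<open>simp add: \<eta>_def\<close>)
  have nb: "norm b = exp (- (ln r / 3))" unfolding b norm_mult by simp
  have "norm b ^ (2 * n + 2) = r powr - p"
    unfolding nb exp_of_nat_mult[symmetric] powr_def using r by (simp add: p_def field_simps)
  note nbp = this
  define \<rho> where "\<rho> = (exp (- (ln r / 3)))\<^sup>2"
  have b2: "b\<^sup>2 = of_real \<rho> * cis (- (2 * \<eta> / 3))"
    unfolding b power_mult_distrib of_real_power[symmetric] \<rho>_def by (simp add: Complex.DeMoivre)
  have "\<rho> > 0" by (simp add: \<rho>_def)
  then have cosb: "cosarg2 b = cos (2 * \<eta> / 3)" unfolding cosarg2_def b2 by (simp add: norm_mult)
  define B where "B = kbound (cos (2 * \<eta> / 3))"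
  have B: "B > 0" using kbound_ge[OF cosarg2_gt(1)[OF bS] order_refl] unfolding B_def cosb by linarith
  have "norm (JJ (2 * n + 2) (cis \<phi>) b) \<le> norm b ^ (2 * n + 2) * (Mass (2 * n + 2) / B * (1 / 3 * Gamma (real (2 * n + 2) / 3) * (Re (cis \<phi>) / 6) powr - (real (2 * n + 2) / 3)))"
    by (rule norm_JJ_le) (use n bS c B in \<open>auto simp: B_def cosb\<close>)
  also have "\<dots> = r powr - p * (Mass (2 * n + 2) / B * (1 / 3 * Gamma p * (6 powr p / cos \<phi> powr p)))"
    unfolding nbp p using c by (simp add: powr_minus_divide powr_divide)
  finally have "4 / pi\<^sup>2 * (sqrt 3 / 2) * norm (JJ (2 * n + 2) (cis \<phi>) b)
    \<le> 4 / pi\<^sup>2 * (sqrt 3 / 2) * (r powr - p * (Mass (2 * n + 2) / B * (1 / 3 * Gamma p * (6 powr p / cos \<phi> powr p))))"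
    by (intro mult_left_mono) auto
  also have "\<dots> = bnd p \<theta> \<phi> * (dterm n r / (sqrt 3 * pi))"
  proof -
    have M: "norm (coeffD (2 * n + 1)) = 2 / pi * Mass (2 * n + 2)" by (rule norm_coeffD_eq_Mass[OF n])
    have d: "dterm n r = 6 powr p * (2 / pi * Mass (2 * n + 2)) * (Gamma p / r powr p)"
      unfolding dterm_def M p_def ..
    have bd: "bnd p \<theta> \<phi> = 1 / (cos \<phi> powr p * B)" by (simp add: bnd_def B_def \<eta>_def)
    have s: "sqrt 3 / 2 * (1 / 3) = 1 / (2 * sqrt 3)" by (simp add: field_simps)
    have "4 / pi\<^sup>2 * (sqrt 3 / 2) * (r powr - p * (Mass (2 * n + 2) / B * (1 / 3 * Gamma p * (6 powr p / cos \<phi> powr p))))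
      = (sqrt 3 / 2 * (1 / 3)) * (4 / (pi * pi)) * (1 / r powr p) * (Mass (2 * n + 2) * (Gamma p * 6 powr p) / (B * cos \<phi> powr p))"
      unfolding powr_minus_divide power2_eq_square by (simp only: times_divide_eq_left times_divide_eq_right divide_divide_eq_left mult_ac mult_1 mult_1_right)
    also have "\<dots> = bnd p \<theta> \<phi> * (dterm n r / (sqrt 3 * pi))"
      unfolding s d bd using c B r by (simp add: field_simps)
    finally show ?thesis .
  qed
  finally show ?thesis unfolding b_def p_def .
qed

text \<open>The first term disappears for N = 2 modulo 3, where \<open>s3 (N + 1)\<close> is 0, the
  second for N = 0 modulo 3, where \<open>s3 N\<close> is 0.\<close>

lemma hankel_remainder_bound:
  assumes N: "N \<ge> 1" and r: "r > 0" and \<phi>: "\<bar>\<phi>1\<bar> < pi / 2" "\<bar>\<phi>2\<bar> < pi / 2"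
    and \<theta>: "\<bar>\<theta> - pi / 2 - \<phi>1\<bar> < pi" "\<bar>\<theta> - pi / 2 - \<phi>2\<bar> < pi"
  defines "T1 \<equiv> bnd ((2 * real N + 2) / 3) \<theta> \<phi>1 * (dterm N r / (sqrt 3 * pi))"
    and "T2 \<equiv> bnd ((2 * real N + 4) / 3) \<theta> \<phi>2 * (dterm (N + 1) r / (sqrt 3 * pi))"
  shows "N mod 3 = 0 \<Longrightarrow> norm (hankel_remainder N r \<theta>) \<le> T1"
    "N mod 3 = 1 \<Longrightarrow> norm (hankel_remainder N r \<theta>) \<le> T1 + T2"
    "N mod 3 = 2 \<Longrightarrow> norm (hankel_remainder N r \<theta>) \<le> T2"
proof -
  define l where "l = Complex (ln r) (\<theta> - pi / 2)"
  define J1 J2 where "J1 = JJ (2 * N + 2) (cis \<phi>1) (exp (- (l - \<i> * of_real \<phi>1) / 3))"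
    and "J2 = JJ (2 * N + 4) (cis \<phi>2) (exp (- (l - \<i> * of_real \<phi>2) / 3))"
  have l: "l + \<i> * of_real (pi / 2) = Complex (ln r) \<theta>" by (simp add: l_def complex_eq_iff)
  have il: "\<bar>Im l - \<phi>1\<bar> < pi" "\<bar>Im l - \<phi>2\<bar> < pi" using \<theta> by (simp_all add: l_def)
  have "hankel_remainder N r \<theta> = (- 1) ^ (N + 1) * of_real (4 / pi\<^sup>2) * (of_real (s3 (N + 1)) * J1 + of_real (s3 N) * J2)"
    unfolding hankel_remainder_eq[OF r] l[symmetric] hankelF_expansion[OF N \<phi> il] l_def[symmetric] J1_def J2_def by simp
  then have "norm (hankel_remainder N r \<theta>) = 4 / pi\<^sup>2 * norm (of_real (s3 (N + 1)) * J1 + of_real (s3 N) * J2)"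
    by (simp add: norm_mult norm_power norm_divide)
  also have "\<dots> \<le> 4 / pi\<^sup>2 * (\<bar>s3 (N + 1)\<bar> * norm J1 + \<bar>s3 N\<bar> * norm J2)"
    by (intro mult_left_mono order.trans[OF norm_triangle_ineq]) (simp_all add: norm_mult)
  finally have R: "norm (hankel_remainder N r \<theta>) \<le> 4 / pi\<^sup>2 * \<bar>s3 (N + 1)\<bar> * norm J1 + 4 / pi\<^sup>2 * \<bar>s3 N\<bar> * norm J2"
    by (simp only: distrib_left mult.assoc)
  have m: "4 / pi\<^sup>2 * \<bar>s3 j\<bar> * norm J \<le> 4 / pi\<^sup>2 * (sqrt 3 / 2) * norm J" for j and J :: complex
    by (intro mult_right_mono mult_left_mono s3_bounds) auto
  have t1: "4 / pi\<^sup>2 * \<bar>s3 (N + 1)\<bar> * norm J1 \<le> T1"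
    using m[of "N + 1" J1] JJ_term_bound[OF N r \<phi>(1) \<theta>(1)] unfolding J1_def l_def T1_def by linarith
  have i: "2 * N + 4 = 2 * (N + 1) + 2" "(2 * real N + 4) / 3 = (2 * real (N + 1) + 2) / 3" by simp_all
  have t2: "4 / pi\<^sup>2 * \<bar>s3 N\<bar> * norm J2 \<le> T2"
    using m[of N J2] JJ_term_bound[of "N + 1", OF _ r \<phi>(2) \<theta>(2)] unfolding J2_def l_def T2_def i by simp
  show "norm (hankel_remainder N r \<theta>) \<le> T1 + T2" using R t1 t2 by linarith
  show "norm (hankel_remainder N r \<theta>) \<le> T1" if "N mod 3 = 0"
    using R t1 s3_bounds(2)[of N] that by (simp add: mod_eq_0_iff_dvd)
  show "norm (hankel_remainder N r \<theta>) \<le> T2" if "N mod 3 = 2"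
  proof -
    have "3 dvd N + 1" using that by presburger
    then show ?thesis using R t2 s3_bounds(2)[of "N + 1"] by simp
  qed
qed

section \<open>Choice of the angle\<close>

text \<open>For \<alpha> = 2 (\<eta> - \<pi> / 2) / 3 the quartic bound sin^2 (3 \<alpha> / 2) is
  cos^2 \<eta>; the secants of the final estimates arise here.\<close>

lemma kbound_cos_two_thirds:
  assumes "cos (2 * (\<eta> - pi / 2) / 3) \<le> 1 / 2"
  shows "kbound (cos (2 * (\<eta> - pi / 2) / 3)) = \<bar>cos \<eta>\<bar>"
proof -
  define \<alpha> c where "\<alpha> = 2 * (\<eta> - pi / 2) / 3" and "c = cos \<alpha>"
  have "cos (3 * \<alpha>) = 4 * c ^ 3 - 3 * c" unfolding c_def by (rule cos_treble_cos)
  moreover have "3 * \<alpha> = 2 * \<eta> - pi" by (simp add: \<alpha>_def)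
  then have "cos (3 * \<alpha>) = - cos (2 * \<eta>)" by (simp add: cos_diff)
  then have "cos (3 * \<alpha>) = 1 - 2 * (cos \<eta>)\<^sup>2" unfolding cos_double_cos by simp
  ultimately have "(1 - c) * (1 + 2 * c)\<^sup>2 / 2 = (cos \<eta>)\<^sup>2"
    by (simp add: power2_eq_square power3_eq_cube algebra_simps)
  then have "sqrt ((1 - c) * (1 + 2 * c)\<^sup>2 / 2) = \<bar>cos \<eta>\<bar>" by simp
  moreover have "kbound c = sqrt ((1 - c) * (1 + 2 * c)\<^sup>2 / 2)"
  proof (cases "c = 1 / 2")
    \<comment> \<open>At c = 1/2 the two branches of \<open>kbound\<close> agree, both being
      1.\<close>
    case True
    show ?thesis unfolding True by (simp add: kbound_def power2_eq_square)
  next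
    case False
    then show ?thesis using assms by (simp add: kbound_def c_def \<alpha>_def)
  qed
  ultimately show ?thesis by (simp only: c_def \<alpha>_def)
qed

lemma kbound_inner:
  assumes "0 \<le> \<eta>" "\<eta> \<le> pi"
  shows "kbound (cos (2 * (\<eta> - pi / 2) / 3)) = 1"
proof -
  have "cos (pi / 3) \<le> cos \<bar>2 * (\<eta> - pi / 2) / 3\<bar>"
    by (rule cos_monotone_0_pi_le) (use assms in \<open>auto simp: abs_le_iff field_simps\<close>)
  then show ?thesis unfolding cos_abs_real cos_60 by (simp only: kbound_def if_True)
qed

lemma kbound_outer:
  assumes "pi \<le> \<eta> \<and> \<eta> < 3 * pi / 2 \<or> - (pi / 2) < \<eta> \<and> \<eta> \<le> 0"
  shows "kbound (cos (2 * (\<eta> - pi / 2) / 3)) = \<bar>cos \<eta>\<bar>"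
proof (rule kbound_cos_two_thirds)
  have "\<bar>2 * (\<eta> - pi / 2) / 3\<bar> \<ge> pi / 3" "\<bar>2 * (\<eta> - pi / 2) / 3\<bar> \<le> pi" using assms pi_gt3 by (auto simp: abs_if field_simps)
  then have "cos \<bar>2 * (\<eta> - pi / 2) / 3\<bar> \<le> cos (pi / 3)" by (intro cos_monotone_0_pi_le) auto
  then show "cos (2 * (\<eta> - pi / 2) / 3) \<le> 1 / 2" unfolding cos_abs_real cos_60 .
qed

lemma bnd_alt: "bnd p \<theta> \<phi> = 1 / (cos \<phi> powr p * kbound (cos (2 * ((\<theta> - \<phi>) - pi / 2) / 3)))"
  unfolding bnd_def by (simp add: algebra_simps)

lemma bnd_outer:
  assumes "pi \<le> \<theta> - \<phi> \<and> \<theta> - \<phi> < 3 * pi / 2 \<or> - (pi / 2) < \<theta> - \<phi> \<and> \<theta> - \<phi> \<le> 0"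
  shows "bnd p \<theta> \<phi> = phi_factor p \<theta> \<phi>"
  unfolding bnd_alt kbound_outer[OF assms] phi_factor_def by (simp add: field_simps)

lemma bnd_zero: "- (pi / 2) < \<theta> \<Longrightarrow> \<theta> < 3 * pi / 2 \<Longrightarrow> bnd p \<theta> 0 = sfactor \<theta>"
  using kbound_inner[of \<theta>] kbound_outer[of \<theta>] unfolding bnd_alt sfactor_def by (auto simp: not_le)

text \<open>Symmetry in the imaginary ray \<theta> = \<pi> / 2; it reduces \<theta> > \<pi> to
  \<theta> < 0.\<close>

lemma bnd_reflect: "bnd p (pi - \<theta>) (- \<phi>) = bnd p \<theta> \<phi>"
proof -
  have "2 * (pi - \<theta> - pi / 2 - - \<phi>) / 3 = - (2 * (\<theta> - pi / 2 - \<phi>) / 3)" by (simp add: field_simps)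
  then show ?thesis unfolding bnd_def by (simp only: cos_minus)
qed

text \<open>The intervals are such that the rotation is admissible, |\<phi>| < \<pi> / 2, while
  \<theta> - \<phi> stays in the outer range, where \<open>kbound\<close> is the cosine and not
  1.\<close>

lemma is_phi_props:
  assumes "- pi < \<theta> \<and> \<theta> < 0 \<or> pi < \<theta> \<and> \<theta> < 2 * pi" "is_phi c \<theta> \<phi>"
  shows "\<bar>\<phi>\<bar> < pi / 2" "\<bar>\<theta> - pi / 2 - \<phi>\<bar> < pi" "bnd p \<theta> \<phi> = phi_factor p \<theta> \<phi>"
proof -
  have "\<bar>\<phi>\<bar> < pi / 2 \<and> (pi \<le> \<theta> - \<phi> \<and> \<theta> - \<phi> < 3 * pi / 2 \<or> - (pi / 2) < \<theta> - \<phi> \<and> \<theta> - \<phi> \<le> 0)"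
    using assms pi_gt3 unfolding is_phi_def phi_interval_def by (auto simp: abs_less_iff split: if_splits)
  then show "\<bar>\<phi>\<bar> < pi / 2" "\<bar>\<theta> - pi / 2 - \<phi>\<bar> < pi" "bnd p \<theta> \<phi> = phi_factor p \<theta> \<phi>"
    using pi_gt3 by (auto simp: abs_less_iff bnd_outer)
qed

lemma is_phi_reflect:
  assumes "pi < \<theta>" "\<theta> < 2 * pi"
  shows "is_phi c \<theta> \<phi> \<longleftrightarrow> is_phi c (pi - \<theta>) (- \<phi>)"
proof -
  have "sin (pi - \<theta> - 2 * - \<phi>) = sin (pi - (\<theta> - 2 * \<phi>))" by (rule arg_cong[of _ _ sin]) simp
  then have "sin (pi - \<theta> - 2 * - \<phi>) = sin (\<theta> - 2 * \<phi>)" "sin (pi - \<theta>) = sin \<theta>" by (simp_all only: sin_pi_minus)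
  moreover have "\<phi> \<in> phi_interval \<theta> \<longleftrightarrow> - \<phi> \<in> phi_interval (pi - \<theta>)"
    using assms pi_gt3 unfolding phi_interval_def by auto
  ultimately show ?thesis unfolding is_phi_def by (simp only:)
qed

text \<open>For \<theta> < 0 the interval is |\<theta> - 2 \<phi>| < h with 0 < h <= \<pi> / 2 and
  sin \<theta> = - sin h. Sine is injective there, and 0 < c < 1 puts the value strictly inside its
  range. Reflection settles \<theta> > \<pi>.\<close>

lemma ex1_is_phi:
  assumes \<theta>: "- pi < \<theta> \<and> \<theta> < 0 \<or> pi < \<theta> \<and> \<theta> < 2 * pi" and c: "0 < c" "c < 1"
  shows "\<exists>!\<phi>. is_phi c \<theta> \<phi>"
proof -
  have main: "\<exists>!\<phi>. is_phi c \<theta> \<phi>" if \<theta>: "- pi < \<theta>" "\<theta> < 0" for \<theta>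
  proof -
    define h where "h = (if \<theta> \<le> - (pi / 2) then \<theta> + pi else - \<theta>)"
    have h: "0 < h" "h \<le> pi / 2" using \<theta> by (auto simp: h_def)
    have int: "\<phi> \<in> phi_interval \<theta> \<longleftrightarrow> \<bar>\<theta> - 2 * \<phi>\<bar> < h" for \<phi>
      using \<theta> pi_gt3 unfolding phi_interval_def h_def by (auto simp: abs_less_iff)
    have sh: "sin \<theta> = - sin h" by (simp add: h_def)
    have sp: "sin h > 0" using h pi_gt3 by (intro sin_gt_zero) auto
    have b: "c * sin h < sin h" "0 < c * sin h" using c sp by auto
    define x where "x = arcsin (c * sin h)"
    have "arcsin (c * sin h) < arcsin (sin h)" using b by (intro arcsin_less_arcsin) auto
    then have x1: "x < h" using arcsin_sin[of h] h by (simp add: x_def)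
    have "arcsin 0 < x" unfolding x_def using b sin_le_one[of h] by (intro arcsin_less_arcsin) linarith+
    then have x0: "0 < x" by simp
    have sx: "sin x = c * sin h" unfolding x_def using b sin_le_one[of h] by (intro sin_arcsin) linarith+
    show ?thesis
    proof (rule ex1I[of _ "(\<theta> + x) / 2"])
      have "\<theta> - 2 * ((\<theta> + x) / 2) = - x" by (simp add: field_simps)
      then show "is_phi c \<theta> ((\<theta> + x) / 2)" unfolding is_phi_def int sh using x0 x1 sx by (simp only: sin_minus) simp
    next
      fix \<phi> assume "is_phi c \<theta> \<phi>"
      then have "\<bar>\<theta> - 2 * \<phi>\<bar> < h" "sin (\<theta> - 2 * \<phi>) = sin (- x)" unfolding is_phi_def int sh using sx by auto
      then have "\<theta> - 2 * \<phi> = - x"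
        using sin_inj_pi[of "\<theta> - 2 * \<phi>" "- x"] h x0 x1 unfolding abs_less_iff by linarith
      then show "\<phi> = (\<theta> + x) / 2" by simp
    qed
  qed
  show ?thesis
  proof (cases "\<theta> < 0")
    case True
    then show ?thesis using main[of \<theta>] \<theta> pi_gt3 by auto
  next
    case False
    then have \<theta>2: "pi < \<theta>" "\<theta> < 2 * pi" using \<theta> by auto
    have "\<exists>!\<phi>. is_phi c (pi - \<theta>) \<phi>" using \<theta>2 by (intro main) auto
    then obtain \<psi> where \<psi>: "is_phi c (pi - \<theta>) \<psi>" "\<And>\<phi>. is_phi c (pi - \<theta>) \<phi> \<Longrightarrow> \<phi> = \<psi>" by blast
    show ?thesis unfolding is_phi_reflect[OF \<theta>2]
    proof (rule ex1I[of _ "- \<psi>"])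
      show "is_phi c (pi - \<theta>) (- (- \<psi>))" using \<psi>(1) by simp
      show "\<phi> = - \<psi>" if "is_phi c (pi - \<theta>) (- \<phi>)" for \<phi> using \<psi>(2)[OF that] by simp
    qed
  qed
qed

text \<open>The difference \<open>f\<close> of the logarithms tends to 0 at infinity and decreases,
  by ln (1 + 1/q) >= 2 / (2 q + 1); so it is non-negative. The constant 1/2 is what makes the limit
  0 approached to second order.\<close>

lemma powr_one_plus_inverse_le:
  assumes p: "p > (0::real)"
  shows "(1 + 1 / p) powr p * (p + 1) \<le> exp 1 * (p + 1 / 2)"
proof -
  define f where "f = (\<lambda>p::real. 1 + ln (p + 1 / 2) - (p + 1) * ln (p + 1) + p * ln p)"
  have der: "(f has_real_derivative 1 / (q + 1 / 2) - ln (q + 1) + ln q) (at q)" if "q > 0" for q :: real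
    unfolding f_def using that by (auto intro!: derivative_eq_intros)
  have "1 / (q + 1 / 2) - ln (q + 1) + ln q \<le> 0" if "q > 0" for q :: real
  proof -
    have "2 * 1 / (2 * q + 1) \<le> ln (q + 1) - ln q" using ln_inverse_approx_ge[of q "q + 1"] that by (simp add: field_simps)
    moreover have "2 * 1 / (2 * q + 1) = 1 / (q + 1 / 2)" using that by (simp add: field_simps)
    ultimately show ?thesis by linarith
  qed
  note neg = this
  have mono: "f q \<le> f p" if "q \<ge> p" for q
  proof (rule DERIV_nonpos_imp_nonincreasing[OF that])
    fix x assume "p \<le> x"
    then have "x > 0" using p by simp
    then show "\<exists>y. (f has_real_derivative y) (at x) \<and> y \<le> 0" using der neg by blast
  qed
  have "(f \<longlongrightarrow> 0) at_top" unfolding f_def by real_asymp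
  moreover have "eventually (\<lambda>q. f q \<le> f p) at_top" using eventually_ge_at_top[of p] by eventually_elim (rule mono)
  ultimately have fp: "0 \<le> f p" by (rule tendsto_upperbound) simp
  have lq: "ln (1 + 1 / p) = ln (p + 1) - ln p"
  proof -
    have "1 + 1 / p = (p + 1) / p" using p by (simp add: field_simps)
    then show ?thesis using p by (simp add: ln_div)
  qed
  have "p * ln (1 + 1 / p) + ln (p + 1) \<le> 1 + ln (p + 1 / 2)" unfolding lq using fp by (simp add: f_def algebra_simps)
  then have "exp (p * ln (1 + 1 / p) + ln (p + 1)) \<le> exp (1 + ln (p + 1 / 2))" by simp
  then show ?thesis using p unfolding exp_add by (simp add: powr_def)
qed

text \<open>The angle \<open>arctan p\<^sup>-\<^sup>1\<^sup>/\<^sup>2\<close> maximises \<open>sin \<phi> cos\<^sup>p \<phi>\<close>.\<close>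

lemma ex_bnd_le_sqrt:
  assumes \<theta>: "pi < \<theta> \<and> \<theta> \<le> 3 * pi / 2 \<or> - (pi / 2) \<le> \<theta> \<and> \<theta> < 0" and p: "p \<ge> 1"
  obtains \<phi> where "\<bar>\<phi>\<bar> < pi / 2" "\<bar>\<theta> - pi / 2 - \<phi>\<bar> < pi" "bnd p \<theta> \<phi> \<le> sqrt (exp 1 * (p + 1 / 2))"
proof -
  have main: "\<exists>\<phi>. \<bar>\<phi>\<bar> < pi / 2 \<and> \<bar>\<theta> - pi / 2 - \<phi>\<bar> < pi \<and> bnd p \<theta> \<phi> \<le> sqrt (exp 1 * (p + 1 / 2))"
    if \<theta>: "- (pi / 2) \<le> \<theta>" "\<theta> < 0" for \<theta>
  proof -
    define \<phi>0 Q where "\<phi>0 = arctan (1 / sqrt p)" and "Q = 1 + 1 / p"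
    have Q: "Q > 0" "Q \<le> 2" using p by (auto simp: Q_def field_simps)
    have \<phi>0: "0 < \<phi>0" "\<phi>0 < pi / 2" unfolding \<phi>0_def using p arctan_ubound[of "1 / sqrt p"] by auto
    have Q2: "1 + (1 / sqrt p)\<^sup>2 = Q" using p by (simp add: Q_def power_divide)
    have c0: "cos \<phi>0 = 1 / sqrt Q" unfolding \<phi>0_def cos_arctan Q2 ..
    have "sin \<phi>0 = 1 / sqrt p / sqrt Q" unfolding \<phi>0_def sin_arctan Q2 ..
    also have "\<dots> = 1 / sqrt (p * Q)" by (simp add: real_sqrt_mult)
    also have "p * Q = p + 1" using p by (simp add: Q_def field_simps)
    finally have s0: "sin \<phi>0 = 1 / sqrt (p + 1)" .
    show ?thesis
    proof (cases "\<phi>0 < - \<theta>")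
      case True
      have \<eta>: "- (pi / 2) < \<theta> - - \<phi>0" "\<theta> - - \<phi>0 \<le> 0" using True \<theta> \<phi>0 by auto
      \<comment> \<open>As \<theta> >= - \<pi> / 2, the angle \<theta> + \<phi>0 is at most \<pi> /
        2 - \<phi>0 in modulus; this replaces its cosine by sin \<phi>0, uniformly in
        \<theta>.\<close>
      have "cos (pi / 2 - \<phi>0) \<le> cos (- (\<theta> - - \<phi>0))" by (rule cos_monotone_0_pi_le) (use \<eta> \<theta> \<phi>0 in auto)
      moreover have "cos (pi / 2 - \<phi>0) = sin \<phi>0" by (simp add: cos_diff)
      moreover have "cos (- (\<theta> - - \<phi>0)) = cos (\<theta> + \<phi>0)" unfolding cos_minus by simp
      ultimately have cs: "sin \<phi>0 \<le> cos (\<theta> + \<phi>0)" by (simp only:)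
      have sp: "sin \<phi>0 > 0" using p by (simp add: s0)
      have cp: "cos \<phi>0 powr p > 0" using Q by (simp add: c0)
      have "bnd p \<theta> (- \<phi>0) = 1 / (cos \<phi>0 powr p * cos (\<theta> + \<phi>0))"
        using bnd_outer[of \<theta> "- \<phi>0" p] \<eta> cs sp by (simp add: phi_factor_def mult.commute)
      also have "\<dots> \<le> 1 / (cos \<phi>0 powr p * sin \<phi>0)"
        using cs sp cp by (intro divide_left_mono mult_left_mono mult_pos_pos) auto
      also have "\<dots> = sqrt (Q powr p * (p + 1))"
      proof -
        have "cos \<phi>0 = Q powr (- (1 / 2))" unfolding c0 using Q by (simp add: powr_minus_divide powr_half_sqrt)
        then have "cos \<phi>0 powr p = (Q powr p) powr (- (1 / 2))" by (simp add: powr_powr)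
        also have "\<dots> = 1 / sqrt (Q powr p)" by (simp add: powr_minus_divide powr_half_sqrt)
        finally show ?thesis unfolding s0 by (simp add: real_sqrt_mult)
      qed
      also have "\<dots> \<le> sqrt (exp 1 * (p + 1 / 2))" using powr_one_plus_inverse_le[of p] p by (simp add: Q_def)
      finally show ?thesis using \<phi>0 \<eta> pi_gt3 by (intro exI[of _ "- \<phi>0"]) (auto simp: abs_less_iff)
    next
      case False
      \<comment> \<open>When \<theta> is within \<phi>0 of 0 the path is not rotated: 1 / cos
        \<theta> is at most sqrt Q <= sqrt 2, whereas the claimed bound is at least sqrt 3.\<close>
      have "cos \<phi>0 \<le> cos (- \<theta>)" by (rule cos_monotone_0_pi_le) (use False \<theta> \<phi>0 in auto)
      then have ct: "1 / sqrt Q \<le> cos \<theta>" by (simp add: c0)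
      moreover have "1 / sqrt Q > 0" using Q by simp
      ultimately have cpos: "cos \<theta> > 0" by linarith
      have "bnd p \<theta> 0 = 1 / cos \<theta>" using bnd_zero[of \<theta> p] False \<theta> \<phi>0 pi_gt3 cpos by (simp add: sfactor_def)
      also have "\<dots> \<le> 1 / (1 / sqrt Q)" by (rule divide_left_mono[OF ct]) (use Q cpos in auto)
      also have "\<dots> = sqrt Q" by simp
      also have "\<dots> \<le> sqrt (exp 1 * (p + 1 / 2))"
      proof -
        have "exp 1 * (p + 1 / 2) \<ge> 2 * (3 / 2 :: real)"
          using exp_ge_add_one_self[of "1::real"] p by (intro mult_mono) auto
        then show ?thesis using Q by simp
      qed
      finally show ?thesis using \<theta> False \<phi>0 pi_gt3 by (intro exI[of _ 0]) (auto simp: abs_less_iff)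
    qed
  qed
  show ?thesis
  proof (cases "\<theta> < 0")
    case True
    then show ?thesis using main[of \<theta>] \<theta> pi_gt3 that by auto
  next
    case False
    then have "- (pi / 2) \<le> pi - \<theta>" "pi - \<theta> < 0" using \<theta> by auto
    from main[OF this] obtain \<phi> where \<phi>: "\<bar>\<phi>\<bar> < pi / 2" "\<bar>pi - \<theta> - pi / 2 - \<phi>\<bar> < pi" "bnd p (pi - \<theta>) \<phi> \<le> sqrt (exp 1 * (p + 1 / 2))" by blast
    have "bnd p \<theta> (- \<phi>) = bnd p (pi - \<theta>) \<phi>" using bnd_reflect[of p \<theta> "- \<phi>"] by simp
    moreover have "\<bar>\<theta> - pi / 2 - - \<phi>\<bar> < pi" using \<phi>(2) by (simp add: abs_less_iff)
    ultimately show ?thesis using that[of "- \<phi>"] \<phi> by simp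
  qed
qed

lemma dterm_nonneg: "r > 0 \<Longrightarrow> dterm n r \<ge> 0"
  unfolding dterm_def by (intro mult_nonneg_nonneg divide_nonneg_nonneg less_imp_le[OF Gamma_real_pos]) auto

theorem mainTheorem8:
  fixes N :: nat and r \<theta> :: real
  assumes "1 \<le> N" and "0 < r"
  shows
    "(- (pi / 2) < \<theta> \<and> \<theta> < 3 * pi / 2 \<longrightarrow>
        (N mod 3 = 0 \<longrightarrow>
           cmod (hankel_remainder N r \<theta>) \<le> dterm N r / (sqrt 3 * pi) * sfactor \<theta>) \<and>
        (N mod 3 = 1 \<longrightarrow>
           cmod (hankel_remainder N r \<theta>)
             \<le> (dterm N r + dterm (N + 1) r) / (sqrt 3 * pi) * sfactor \<theta>) \<and>
        (N mod 3 = 2 \<longrightarrow>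
           cmod (hankel_remainder N r \<theta>) \<le> dterm (N + 1) r / (sqrt 3 * pi) * sfactor \<theta>))
     \<and>
     (- pi < \<theta> \<and> \<theta> < 0 \<or> pi < \<theta> \<and> \<theta> < 2 * pi \<longrightarrow>
        (\<exists>!\<phi>. is_phi ((2 * real N - 1) / (2 * real N + 5)) \<theta> \<phi>) \<and>
        (\<exists>!\<phi>. is_phi ((2 * real N + 1) / (2 * real N + 7)) \<theta> \<phi>) \<and>
        (\<forall>\<phi>1 \<phi>2.
           is_phi ((2 * real N - 1) / (2 * real N + 5)) \<theta> \<phi>1 \<and>
           is_phi ((2 * real N + 1) / (2 * real N + 7)) \<theta> \<phi>2 \<longrightarrow>
           (N mod 3 = 0 \<longrightarrow>
              cmod (hankel_remainder N r \<theta>)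
                \<le> phi_factor ((2 * real N + 2) / 3) \<theta> \<phi>1 * (dterm N r / (sqrt 3 * pi))) \<and>
           (N mod 3 = 1 \<longrightarrow>
              cmod (hankel_remainder N r \<theta>)
                \<le> phi_factor ((2 * real N + 2) / 3) \<theta> \<phi>1 * (dterm N r / (sqrt 3 * pi))
                  + phi_factor ((2 * real N + 4) / 3) \<theta> \<phi>2
                      * (dterm (N + 1) r / (sqrt 3 * pi))) \<and>
           (N mod 3 = 2 \<longrightarrow>
              cmod (hankel_remainder N r \<theta>)
                \<le> phi_factor ((2 * real N + 4) / 3) \<theta> \<phi>2
                    * (dterm (N + 1) r / (sqrt 3 * pi)))))
     \<and>
     (pi < \<theta> \<and> \<theta> \<le> 3 * pi / 2 \<or> - (pi / 2) \<le> \<theta> \<and> \<theta> < 0 \<longrightarrow>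
        (N mod 3 = 0 \<longrightarrow>
           cmod (hankel_remainder N r \<theta>)
             \<le> sqrt (exp 1 / 3 * (2 * real N + 7 / 2)) * (dterm N r / (sqrt 3 * pi))) \<and>
        (N mod 3 = 1 \<longrightarrow>
           cmod (hankel_remainder N r \<theta>)
             \<le> sqrt (exp 1 / 3 * (2 * real N + 7 / 2)) * (dterm N r / (sqrt 3 * pi))
               + sqrt (exp 1 / 3 * (2 * real N + 11 / 2))
                   * (dterm (N + 1) r / (sqrt 3 * pi))) \<and>
        (N mod 3 = 2 \<longrightarrow>
           cmod (hankel_remainder N r \<theta>)
             \<le> sqrt (exp 1 / 3 * (2 * real N + 11 / 2)) * (dterm (N + 1) r / (sqrt 3 * pi))))"
    (is "(?A1 \<longrightarrow> ?B1) \<and> (?A2 \<longrightarrow> ?B2) \<and> (?A3 \<longrightarrow> ?B3)")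
proof (intro conjI[of "?A1 \<longrightarrow> ?B1"] conjI[of "?A2 \<longrightarrow> ?B2"] impI[of ?A1 ?B1] impI[of ?A2 ?B2] impI[of ?A3 ?B3])
  note bound = hankel_remainder_bound[OF assms]
  assume A: ?A1
  \<comment> \<open>Without rotation the condition |\<theta> - \<pi> / 2| < \<pi> is exactly the
    range of part (i).\<close>
  have a: "\<bar>0::real\<bar> < pi / 2" "\<bar>\<theta> - pi / 2 - 0\<bar> < pi" using A pi_gt3 by (auto simp: abs_less_iff)
  have z: "bnd p \<theta> 0 = sfactor \<theta>" for p using A by (intro bnd_zero) auto
  have sum: "d / X * s + e / X * s = (d + e) / X * s" for d e X s :: real by (simp add: add_divide_distrib distrib_right)
  note b = bound[OF a(1) a(1) a(2) a(2), unfolded z mult.commute[of "sfactor \<theta>"] sum]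
  show ?B1 using b by blast
next
  note bound = hankel_remainder_bound[OF assms]
  assume A: ?A2
  have c: "0 < (2 * real N - 1) / (2 * real N + 5)" "(2 * real N - 1) / (2 * real N + 5) < 1"
    "0 < (2 * real N + 1) / (2 * real N + 7)" "(2 * real N + 1) / (2 * real N + 7) < 1"
    using assms(1) by auto
  have b: "(N mod 3 = 0 \<longrightarrow> cmod (hankel_remainder N r \<theta>) \<le> phi_factor ((2 * real N + 2) / 3) \<theta> \<phi>1 * (dterm N r / (sqrt 3 * pi))) \<and>
     (N mod 3 = 1 \<longrightarrow> cmod (hankel_remainder N r \<theta>) \<le> phi_factor ((2 * real N + 2) / 3) \<theta> \<phi>1 * (dterm N r / (sqrt 3 * pi))
        + phi_factor ((2 * real N + 4) / 3) \<theta> \<phi>2 * (dterm (N + 1) r / (sqrt 3 * pi))) \<and>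
     (N mod 3 = 2 \<longrightarrow> cmod (hankel_remainder N r \<theta>) \<le> phi_factor ((2 * real N + 4) / 3) \<theta> \<phi>2 * (dterm (N + 1) r / (sqrt 3 * pi)))"
    if "is_phi ((2 * real N - 1) / (2 * real N + 5)) \<theta> \<phi>1" "is_phi ((2 * real N + 1) / (2 * real N + 7)) \<theta> \<phi>2" for \<phi>1 \<phi>2
    using bound[OF is_phi_props(1)[OF A that(1)] is_phi_props(1)[OF A that(2)] is_phi_props(2)[OF A that(1)] is_phi_props(2)[OF A that(2)]]
    unfolding is_phi_props(3)[OF A that(1)] is_phi_props(3)[OF A that(2)] by blast
  show ?B2
  proof (rule conjI[OF ex1_is_phi[OF A c(1,2)] conjI[OF ex1_is_phi[OF A c(3,4)]]], intro allI impI, elim conjE)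
  qed (rule b)
next
  note bound = hankel_remainder_bound[OF assms]
  assume A: ?A3
  define p1 p2 where "p1 = (2 * real N + 2) / 3" and "p2 = (2 * real N + 4) / 3"
  have "p1 \<ge> 1" "p2 \<ge> 1" using assms(1) by (auto simp: p1_def p2_def)
  obtain \<phi>1 where 1: "\<bar>\<phi>1\<bar> < pi / 2" "\<bar>\<theta> - pi / 2 - \<phi>1\<bar> < pi" "bnd p1 \<theta> \<phi>1 \<le> sqrt (exp 1 * (p1 + 1 / 2))"
    using ex_bnd_le_sqrt[OF A \<open>p1 \<ge> 1\<close>] by blast
  obtain \<phi>2 where 2: "\<bar>\<phi>2\<bar> < pi / 2" "\<bar>\<theta> - pi / 2 - \<phi>2\<bar> < pi" "bnd p2 \<theta> \<phi>2 \<le> sqrt (exp 1 * (p2 + 1 / 2))"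
    using ex_bnd_le_sqrt[OF A \<open>p2 \<ge> 1\<close>] by blast
  have q: "exp 1 * (p1 + 1 / 2) = exp 1 / 3 * (2 * real N + 7 / 2)" "exp 1 * (p2 + 1 / 2) = exp 1 / 3 * (2 * real N + 11 / 2)"
    by (simp_all add: p1_def p2_def field_simps)
  have nn: "dterm N r / (sqrt 3 * pi) \<ge> 0" "dterm (N + 1) r / (sqrt 3 * pi) \<ge> 0" using dterm_nonneg[OF assms(2)] by simp_all
  have t: "bnd p1 \<theta> \<phi>1 * (dterm N r / (sqrt 3 * pi)) \<le> sqrt (exp 1 / 3 * (2 * real N + 7 / 2)) * (dterm N r / (sqrt 3 * pi))"
    "bnd p2 \<theta> \<phi>2 * (dterm (N + 1) r / (sqrt 3 * pi)) \<le> sqrt (exp 1 / 3 * (2 * real N + 11 / 2)) * (dterm (N + 1) r / (sqrt 3 * pi))"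
    using mult_right_mono[OF 1(3) nn(1)] mult_right_mono[OF 2(3) nn(2)] unfolding q by blast+
  note b = bound[OF 1(1) 2(1) 1(2) 2(2), folded p1_def p2_def]
  show ?B3 using order.trans[OF b(1) t(1)] order.trans[OF b(2) add_mono[OF t]] order.trans[OF b(3) t(2)] by blast
qed

end
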